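(* Let $(N,D)$ be a simply-connected affine manifold of dimension $n$ equipped with a development map $\iota\colon N\to\mathbb{R}^n$ and a Hessian metric $g=D^2u$ with $u\in C^\infty(N,\mathbb{R})$, such that $u$ solves the Monge–Ampère equation $$\log\det(u_{,ij})=-v_jx^j+u_{,i}\xi^i+c$$ for some $\xi\in\mathbb{R}^n$, $v\in(\mathbb{R}^n)^*$ and $c\in\mathbb{R}$. If the Riemannian manifold $(N,g)$ is complete, then $\iota\colon N\to\mathbb{R}^n$ is a diffeomorphism and $u$ is a quadratic polynomial in the coordinates $x^1,\dots,x^n$. In particular, $(N,D,g)$ is equivalent, as a Hessian manifold, to $\mathbb{R}^n$ (with its standard affine structure) equipped with a flat metric.
   Context: An affine manifold $(N,D)$ is a smooth manifold $N$ with a flat torsion-free connection $D$ on $TN$. Simply connected includes connected. A development map is an open map (local diffeomorphism) $\iota\colon N\to\mathbb{R}^n$ with $D=\iota^*D_0$, where $D_0$ is the standard flat connection of $\mathbb{R}^n$; equivalently the $1$-forms $\iota^*dx^i$ form a $D$-parallel trivialization of $T^*N$. The functions $\iota^*x^i$ are denoted $x^i$; they are local coordinates on $N$. Subscripts after a comma denote partial derivatives with respect to these coordinates, i.e. $u_{,i}=\partial u/\partial x^i$, $u_{,ij}=\partial^2u/\partial x^i\partial x^j$, and repeated indices are summed. The equality $g=D^2u$ means that the metric $g$ has components $g_{ij}=u_{,ij}$, so in particular $D^2u$ is positive definite; such a $g$ is called a Hessian metric and $(N,D,g)$ a Hessian manifold. Equivalence of Hessian manifolds means a diffeomorphism preserving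 both the connection and the metric. *)

theory Defs
  imports "HOL-Analysis.Analysis"
begin

primrec Ck_on :: "nat \<Rightarrow> 'a::euclidean_space set \<Rightarrow> ('a \<Rightarrow> 'b::euclidean_space) \<Rightarrow> bool" where
  "Ck_on 0 S f \<longleftrightarrow> continuous_on S f"
| "Ck_on (Suc k) S f \<longleftrightarrow> (\<forall>x\<in>S. f differentiable (at x)) \<and>
     (\<forall>v. Ck_on k S (\<lambda>x. frechet_derivative f (at x) v))"

text \<open>Only meaningful for open \<^term>\<open>S\<close>, the only case in which it is used below.\<close>

definition smooth_on :: "'a::euclidean_space set \<Rightarrow> ('a \<Rightarrow> 'b::euclidean_space) \<Rightarrow> bool" where
  "smooth_on S f \<longleftrightarrow> (\<forall>k. Ck_on k S f)"

text \<open>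
  The underlying space of a manifold is a whole type; the manifold is then given by an atlas on
  it. A chart is a pair \<open>(U, \<phi>)\<close>, where only the values of \<open>\<phi>\<close> on \<open>U\<close> matter.
\<close>

type_synonym ('a, 'b) chart = "'a set \<times> ('a \<Rightarrow> 'b)"

definition is_chart :: "('a::topological_space, 'b::euclidean_space) chart \<Rightarrow> bool" where
  "is_chart c \<longleftrightarrow> (case c of (U, \<phi>) \<Rightarrow>
     open U \<and> open (\<phi> ` U) \<and> (\<exists>\<psi>. homeomorphism U (\<phi> ` U) \<phi> \<psi>))"

definition smooth_manifold ::
    "('a::{t2_space,second_countable_topology}, 'b::euclidean_space) chart set \<Rightarrow> bool" where
  "smooth_manifold A \<longleftrightarrow> (\<forall>c\<in>A. is_chart c) \<and> (\<Union>c\<in>A. fst c) = UNIV \<and>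
     (\<forall>(U, \<phi>)\<in>A. \<forall>(V, \<psi>)\<in>A. smooth_on (\<phi> ` (U \<inter> V)) (\<psi> \<circ> inv_into U \<phi>))"

definition std_atlas :: "('b::euclidean_space, 'b) chart set" where
  "std_atlas = {(UNIV, \<lambda>x. x)}"

definition smooth_map_on ::
    "('a::topological_space, 'b::euclidean_space) chart set \<Rightarrow>
     ('c::topological_space, 'd::euclidean_space) chart set \<Rightarrow> 'a set \<Rightarrow> ('a \<Rightarrow> 'c) \<Rightarrow> bool" where
  "smooth_map_on A B S f \<longleftrightarrow> continuous_on S f \<and>
     (\<forall>(U, \<phi>)\<in>A. \<forall>(V, \<psi>)\<in>B. smooth_on (\<phi> ` (U \<inter> S \<inter> f -` V)) (\<psi> \<circ> f \<circ> inv_into U \<phi>))"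

definition diffeomorphism ::
    "('a::topological_space, 'b::euclidean_space) chart set \<Rightarrow>
     ('c::topological_space, 'd::euclidean_space) chart set \<Rightarrow> ('a \<Rightarrow> 'c) \<Rightarrow> bool" where
  "diffeomorphism A B F \<longleftrightarrow> bij F \<and> smooth_map_on A B UNIV F \<and> smooth_map_on B A UNIV (inv F)"

definition local_diffeomorphism ::
    "('a::topological_space, 'b::euclidean_space) chart set \<Rightarrow>
     ('c::topological_space, 'd::euclidean_space) chart set \<Rightarrow> ('a \<Rightarrow> 'c) \<Rightarrow> bool" where
  "local_diffeomorphism A B F \<longleftrightarrow>
     (\<forall>p. \<exists>U. open U \<and> p \<in> U \<and> open (F ` U) \<and> inj_on F U \<and>
        smooth_map_on A B U F \<and> smooth_map_on B A (F ` U) (inv_into U F))"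

definition smooth_functions ::
    "('a::topological_space, 'b::euclidean_space) chart set \<Rightarrow> ('a \<Rightarrow> real) set" where
  "smooth_functions A = {f. smooth_map_on A std_atlas UNIV f}"

text \<open>
  Tangent vectors are derivations of the algebra of smooth functions at a point. They are
  extended by \<open>0\<close> to non-smooth functions, so that equal derivations are equal as HOL functions.
\<close>

type_synonym 'a tangent = "('a \<Rightarrow> real) \<Rightarrow> real"

definition tangent_space ::
    "('a::topological_space, 'b::euclidean_space) chart set \<Rightarrow> 'a \<Rightarrow> 'a tangent set" where
  "tangent_space A p = {v.
     (\<forall>f\<in>smooth_functions A. \<forall>h\<in>smooth_functions A.
        v (\<lambda>q. f q + h q) = v f + v h \<and> v (\<lambda>q. f q * h q) = f p * v h + h p * v f) \<and>
     (\<forall>f\<in>smooth_functions A. \<forall>c. v (\<lambda>q. c * f q) = c * v f) \<and>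
     (\<forall>f. f \<notin> smooth_functions A \<longrightarrow> v f = 0)}"

definition pushforward ::
    "('c::topological_space, 'd::euclidean_space) chart set \<Rightarrow> ('a \<Rightarrow> 'c) \<Rightarrow>
     'a tangent \<Rightarrow> 'c tangent" where
  "pushforward B F v = (\<lambda>f. if f \<in> smooth_functions B then v (f \<circ> F) else 0)"

type_synonym 'a vfield = "'a \<Rightarrow> 'a tangent"

definition vector_fields ::
    "('a::topological_space, 'b::euclidean_space) chart set \<Rightarrow> 'a vfield set" where
  "vector_fields A = {X. (\<forall>p. X p \<in> tangent_space A p) \<and>
     (\<forall>f\<in>smooth_functions A. (\<lambda>p. X p f) \<in> smooth_functions A)}"

definition vf_add :: "'a vfield \<Rightarrow> 'a vfield \<Rightarrow> 'a vfield" where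
  "vf_add X Y = (\<lambda>p f. X p f + Y p f)"

definition vf_scale :: "('a \<Rightarrow> real) \<Rightarrow> 'a vfield \<Rightarrow> 'a vfield" where
  "vf_scale h X = (\<lambda>p f. h p * X p f)"

definition lie_bracket :: "'a vfield \<Rightarrow> 'a vfield \<Rightarrow> 'a vfield" where
  "lie_bracket X Y = (\<lambda>p f. X p (\<lambda>q. Y q f) - Y p (\<lambda>q. X q f))"

definition vf_related ::
    "('c::topological_space, 'd::euclidean_space) chart set \<Rightarrow> ('a \<Rightarrow> 'c) \<Rightarrow>
     'a vfield \<Rightarrow> 'c vfield \<Rightarrow> bool" where
  "vf_related B F X X' \<longleftrightarrow> (\<forall>p. pushforward B F (X p) = X' (F p))"

type_synonym 'a conn = "'a vfield \<Rightarrow> 'a vfield \<Rightarrow> 'a vfield"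

definition connection ::
    "('a::topological_space, 'b::euclidean_space) chart set \<Rightarrow> 'a conn \<Rightarrow> bool" where
  "connection A D \<longleftrightarrow> (\<forall>X\<in>vector_fields A. \<forall>Y\<in>vector_fields A.
     D X Y \<in> vector_fields A \<and>
     (\<forall>Z\<in>vector_fields A.
        D (vf_add X Z) Y = vf_add (D X Y) (D Z Y) \<and>
        D X (vf_add Y Z) = vf_add (D X Y) (D X Z)) \<and>
     (\<forall>h\<in>smooth_functions A.
        D (vf_scale h X) Y = vf_scale h (D X Y) \<and>
        D X (vf_scale h Y) = vf_add (vf_scale h (D X Y)) (vf_scale (\<lambda>p. X p h) Y)))"

definition torsion_free ::
    "('a::topological_space, 'b::euclidean_space) chart set \<Rightarrow> 'a conn \<Rightarrow> bool" where
  "torsion_free A D \<longleftrightarrow> (\<forall>X\<in>vector_fields A. \<forall>Y\<in>vector_fields A. \<forall>p f.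
     D X Y p f - D Y X p f = lie_bracket X Y p f)"

definition flat_connection ::
    "('a::topological_space, 'b::euclidean_space) chart set \<Rightarrow> 'a conn \<Rightarrow> bool" where
  "flat_connection A D \<longleftrightarrow>
     (\<forall>X\<in>vector_fields A. \<forall>Y\<in>vector_fields A. \<forall>Z\<in>vector_fields A. \<forall>p f.
        D X (D Y Z) p f - D Y (D X Z) p f - D (lie_bracket X Y) Z p f = 0)"

definition affine_manifold ::
    "('a::{t2_space,second_countable_topology}, 'b::euclidean_space) chart set \<Rightarrow>
     'a conn \<Rightarrow> bool" where
  "affine_manifold A D \<longleftrightarrow>
     smooth_manifold A \<and> connection A D \<and> torsion_free A D \<and> flat_connection A D"

definition std_coord_field :: "'n \<Rightarrow> (real^'n) vfield" where
  "std_coord_field i = (\<lambda>p f. if f \<in> smooth_functions std_atlas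
     then frechet_derivative f (at p) (axis i 1) else 0)"

text \<open>
  The standard flat connection \<open>D\<^sub>0\<close> of Euclidean space differentiates the components
  \<open>Y\<^sup>i = Y(x\<^sup>i)\<close> of \<open>Y\<close>.
\<close>

definition std_connection :: "(real^'n) conn" where
  "std_connection X Y =
     (\<lambda>p f. \<Sum>i\<in>UNIV. X p (\<lambda>q. Y q (\<lambda>x. x $ i)) * std_coord_field i p f)"

text \<open>
  \<open>D = F\<^sup>* D'\<close> for a local diffeomorphism \<open>F\<close>. Since every vector field \<open>X'\<close> on the target has
  exactly one \<open>F\<close>-related lift \<open>X\<close> to the source, and these lifts span every tangent space,
  this condition determines \<open>D\<close> on vector fields.
\<close>

definition is_pullback_connection ::
    "('a::topological_space, 'b::euclidean_space) chart set \<Rightarrow>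
     ('c::topological_space, 'd::euclidean_space) chart set \<Rightarrow> ('a \<Rightarrow> 'c) \<Rightarrow>
     'a conn \<Rightarrow> 'c conn \<Rightarrow> bool" where
  "is_pullback_connection A B F D D' \<longleftrightarrow>
     (\<forall>X\<in>vector_fields A. \<forall>Y\<in>vector_fields A. \<forall>X'\<in>vector_fields B. \<forall>Y'\<in>vector_fields B.
        vf_related B F X X' \<and> vf_related B F Y Y' \<longrightarrow> vf_related B F (D X Y) (D' X' Y'))"

definition development_map ::
    "('a::topological_space, real^'n) chart set \<Rightarrow> 'a conn \<Rightarrow> ('a \<Rightarrow> real^'n) \<Rightarrow> bool" where
  "development_map A D \<iota> \<longleftrightarrow> local_diffeomorphism A std_atlas \<iota> \<and>
     is_pullback_connection A std_atlas \<iota> D std_connection"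

text \<open>
  \<open>partial_deriv \<iota> i u\<close> is \<open>\<partial>u/\<partial>x\<^sup>i\<close> for the local coordinates \<open>x\<^sup>i = \<iota>\<^sup>* x\<^sup>i\<close>. Its value
  at \<open>p\<close> does not depend on the neighbourhood chosen, as the germ at \<open>\<iota> p\<close> of the local
  inverse of \<open>\<iota>\<close> sending \<open>\<iota> p\<close> to \<open>p\<close> is unique.
\<close>

definition local_inverse :: "('a::topological_space \<Rightarrow> 'b) \<Rightarrow> 'a \<Rightarrow> 'b \<Rightarrow> 'a" where
  "local_inverse \<iota> p = inv_into (SOME U. open U \<and> p \<in> U \<and> inj_on \<iota> U) \<iota>"

definition partial_deriv ::
    "('a::topological_space \<Rightarrow> real^'n) \<Rightarrow> 'n \<Rightarrow> ('a \<Rightarrow> real) \<Rightarrow> 'a \<Rightarrow> real" where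
  "partial_deriv \<iota> i u p = frechet_derivative (u \<circ> local_inverse \<iota> p) (at (\<iota> p)) (axis i 1)"

definition coord_field ::
    "('a::topological_space, real^'n) chart set \<Rightarrow> ('a \<Rightarrow> real^'n) \<Rightarrow> 'n \<Rightarrow> 'a vfield" where
  "coord_field A \<iota> i = (\<lambda>p f. if f \<in> smooth_functions A then partial_deriv \<iota> i f p else 0)"

definition hessian_matrix ::
    "('a::topological_space \<Rightarrow> real^'n) \<Rightarrow> ('a \<Rightarrow> real) \<Rightarrow> 'a \<Rightarrow> real^'n^'n" where
  "hessian_matrix \<iota> u p = (\<chi> i j. partial_deriv \<iota> j (partial_deriv \<iota> i u) p)"

type_synonym 'a metric_tensor = "'a \<Rightarrow> 'a tangent \<Rightarrow> 'a tangent \<Rightarrow> real"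

definition riemannian_metric ::
    "('a::topological_space, 'b::euclidean_space) chart set \<Rightarrow> 'a metric_tensor \<Rightarrow> bool" where
  "riemannian_metric A g \<longleftrightarrow>
     (\<forall>p. \<forall>v\<in>tangent_space A p.
        (v \<noteq> (\<lambda>_. 0) \<longrightarrow> g p v v > 0) \<and>
        (\<forall>w\<in>tangent_space A p. g p v w = g p w v \<and>
           (\<forall>z\<in>tangent_space A p. g p (\<lambda>f. v f + w f) z = g p v z + g p w z) \<and>
           (\<forall>c. g p (\<lambda>f. c * v f) w = c * g p v w))) \<and>
     (\<forall>X\<in>vector_fields A. \<forall>Y\<in>vector_fields A. (\<lambda>p. g p (X p) (Y p)) \<in> smooth_functions A)"

text \<open>\<open>g = D\<^sup>2 u\<close>, i.e. \<open>g\<^sub>i\<^sub>j = u\<^sub>,\<^sub>i\<^sub>j\<close> in the coordinates given by a development map \<open>\<iota>\<close> of \<open>D\<close>.\<close>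

definition hessian_potential ::
    "('a::topological_space, real^'n) chart set \<Rightarrow> ('a \<Rightarrow> real^'n) \<Rightarrow> 'a metric_tensor \<Rightarrow>
     ('a \<Rightarrow> real) \<Rightarrow> bool" where
  "hessian_potential A \<iota> g u \<longleftrightarrow> u \<in> smooth_functions A \<and>
     (\<forall>p i j. g p (coord_field A \<iota> i p) (coord_field A \<iota> j p) = hessian_matrix \<iota> u p $ i $ j)"

definition velocity ::
    "('a::topological_space, 'b::euclidean_space) chart set \<Rightarrow> (real \<Rightarrow> 'a) \<Rightarrow> real \<Rightarrow>
     'a tangent" where
  "velocity A \<gamma> t =
     (\<lambda>f. if f \<in> smooth_functions A then vector_derivative (f \<circ> \<gamma>) (at t) else 0)"

text \<open>
  As for \<^const>\<open>valid_path\<close>, the derivative need not be bounded near the finitely many exceptional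
  times. The length is therefore an extended nonnegative integral, so that a curve of infinite
  length does not get length \<open>0\<close>.
\<close>

definition piecewise_C1_curve ::
    "('a::topological_space, 'b::euclidean_space) chart set \<Rightarrow> (real \<Rightarrow> 'a) \<Rightarrow> bool" where
  "piecewise_C1_curve A \<gamma> \<longleftrightarrow> path \<gamma> \<and>
     (\<exists>T. finite T \<and> (\<forall>f\<in>smooth_functions A. (f \<circ> \<gamma>) C1_differentiable_on ({0..1} - T)))"

definition curve_length ::
    "('a::topological_space, 'b::euclidean_space) chart set \<Rightarrow> 'a metric_tensor \<Rightarrow> (real \<Rightarrow> 'a) \<Rightarrow>
     ennreal" where
  "curve_length A g \<gamma> =
     (\<integral>\<^sup>+t\<in>{0..1}. ennreal (sqrt (g (\<gamma> t) (velocity A \<gamma> t) (velocity A \<gamma> t))) \<partial>lborel)"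

text \<open>
  On a connected manifold the infimum is finite, so passing to a real-valued distance loses
  nothing.
\<close>

definition riemannian_dist ::
    "('a::topological_space, 'b::euclidean_space) chart set \<Rightarrow> 'a metric_tensor \<Rightarrow> 'a \<Rightarrow> 'a \<Rightarrow> real" where
  "riemannian_dist A g p q = enn2real
     (INF \<gamma>\<in>{\<gamma>. piecewise_C1_curve A \<gamma> \<and> pathstart \<gamma> = p \<and> pathfinish \<gamma> = q}. curve_length A g \<gamma>)"

definition riemannian_complete ::
    "('a::topological_space, 'b::euclidean_space) chart set \<Rightarrow> 'a metric_tensor \<Rightarrow> bool" where
  "riemannian_complete A g \<longleftrightarrow> Metric_space.mcomplete UNIV (riemannian_dist A g)"

definition levi_civita_connection ::
    "('a::topological_space, 'b::euclidean_space) chart set \<Rightarrow> 'a metric_tensor \<Rightarrow> 'a conn \<Rightarrow> bool" where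
  "levi_civita_connection A g D \<longleftrightarrow> connection A D \<and> torsion_free A D \<and>
     (\<forall>X\<in>vector_fields A. \<forall>Y\<in>vector_fields A. \<forall>Z\<in>vector_fields A. \<forall>p.
        X p (\<lambda>q. g q (Y q) (Z q)) = g p (D X Y p) (Z p) + g p (Y p) (D X Z p))"

definition flat_metric ::
    "('a::topological_space, 'b::euclidean_space) chart set \<Rightarrow> 'a metric_tensor \<Rightarrow> bool" where
  "flat_metric A g \<longleftrightarrow> (\<exists>D. levi_civita_connection A g D \<and> flat_connection A D)"

definition hessian_equivalence ::
    "('a::topological_space, 'b::euclidean_space) chart set \<Rightarrow> 'a conn \<Rightarrow> 'a metric_tensor \<Rightarrow>
     ('c::topological_space, 'd::euclidean_space) chart set \<Rightarrow> 'c conn \<Rightarrow> 'c metric_tensor \<Rightarrow>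
     ('a \<Rightarrow> 'c) \<Rightarrow> bool" where
  "hessian_equivalence A D g B D' g' F \<longleftrightarrow>
     diffeomorphism A B F \<and> is_pullback_connection A B F D D' \<and>
     (\<forall>p. \<forall>v\<in>tangent_space A p. \<forall>w\<in>tangent_space A p.
        g p v w = g' (F p) (pushforward B F v) (pushforward B F w))"

end

theory Submission
  imports Defs
begin

text \<open>
  Let \<open>\<Lambda>\<close> be the maximum of the cubic form \<open>C = D\<^sup>3 u\<close> on \<open>g\<close>-unit vectors, as a function on the manifold. If \<open>\<Lambda>\<close> is
  positive somewhere, completeness yields a point \<open>q\<close> with \<open>\<Lambda> \<le> (1 + \<epsilon>) \<Lambda>(q)\<close> on the ball of radius
  \<open>1 / \<Lambda>(q)\<close>. There the logarithm of \<open>g\<close> varies by a bounded amount along rays, so the development map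
  can be inverted on a \<open>g(q)\<close>-ball of comparable radius. On it, subtract from \<open>C\<close> a multiple of the quadratic
  function \<open>g(q)(x - q, x - q)\<close> and apply the second derivative test at an interior maximum: the twice differentiated
  Monge-Ampere equation gives \<open>\<Lambda>\<^sup>3 / 4\<close> on one side and a term of order \<open>\<epsilon> \<Lambda>\<^sup>3\<close> on the other, which
  is absurd for small \<open>\<epsilon>\<close>. Hence \<open>C = 0\<close>, \<open>g\<close> is constant in the coordinates, and completeness makes the
  development map a bijection. The quadratic cutoff replaces the comparison geometry of the classical argument, so
  that only first order bounds on \<open>g\<close> are needed.
\<close>

section \<open>Smooth functions on Euclidean space\<close>

text \<open>The obstacle is that global coordinates are part of the conclusion: a priori nothing
  controls \<open>g\<close> away from the point in hand, nor can \<open>\<iota>\<close> be inverted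
  beyond small neighbourhoods. All calculus is therefore done through continuous local right
  inverses of \<open>\<iota>\<close>, and completeness continues them: a bound for \<Lambda> near
  \<open>q\<close> bounds the speed of lifted coordinate rays, so these are Cauchy up to their ends.
  In coordinates the cutoff has a constant Hessian. It enters the maximum principle only through the
  trace of \<open>g(q)\<close> with respect to \<open>g\<close>, which a comparison of the two
  metrics bounds, and through the drift term \<open>g(q)(\<xi>, x - q)\<close>. The drift is the
  dangerous one, since the \<open>g\<close>-length of the fixed vector \<open>\<xi>\<close> may be
  large. Its bound is a multiple of \<Lambda>(q) plus a constant, and since point picking never
  lowers \<Lambda> below its starting value, the constant is absorbed as well. Every term then
  scales like \<Lambda>^3, and the factor \<epsilon> from point picking decides. Once \<Lambda> = 0,
  the same inversion works at every radius.\<close>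

lemma has_derivative_cong_open:
  assumes "open S" "x \<in> S" "\<And>y. y \<in> S \<Longrightarrow> f y = g y"
  shows "(f has_derivative f') (at x) \<longleftrightarrow> (g has_derivative f') (at x)"
  using has_derivative_transform_within_open[of f f' x UNIV S g]
    has_derivative_transform_within_open[of g f' x UNIV S f] assms by auto

lemma frechet_derivative_cong_open:
  assumes "open S" "x \<in> S" "\<And>y. y \<in> S \<Longrightarrow> f y = g y"
  shows "frechet_derivative f (at x) = frechet_derivative g (at x)"
  unfolding frechet_derivative_def using has_derivative_cong_open[OF assms] by simp

lemma differentiable_cong_open:
  assumes "open S" "x \<in> S" "\<And>y. y \<in> S \<Longrightarrow> f y = g y"
  shows "f differentiable (at x) \<longleftrightarrow> g differentiable (at x)"
  unfolding differentiable_def using has_derivative_cong_open[OF assms] by simp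

lemma Ck_on_subset: "Ck_on k S f \<Longrightarrow> T \<subseteq> S \<Longrightarrow> Ck_on k T f"
  by (induction k arbitrary: f) (auto intro: continuous_on_subset)

lemma Ck_on_cong:
  assumes "open S" "\<And>y. y \<in> S \<Longrightarrow> f y = g y" "Ck_on k S f"
  shows "Ck_on k S g"
  using assms(2,3)
proof (induction k arbitrary: f g)
  case 0
  then show ?case using continuous_on_cong by (metis Ck_on.simps(1))
next
  case (Suc k)
  have "Ck_on k S (\<lambda>x. frechet_derivative g (at x) v)" for v
    by (rule Suc.IH[of "\<lambda>x. frechet_derivative f (at x) v"])
      (use Suc.prems frechet_derivative_cong_open[OF assms(1), of _ f g] in auto)
  moreover have "g differentiable (at x)" if "x \<in> S" for x
    using Suc.prems differentiable_cong_open[OF assms(1) that, of f g] that by auto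
  ultimately show ?case by simp
qed

lemma Ck_on_lower: "Ck_on (Suc k) S f \<Longrightarrow> Ck_on k S f"
proof (induction k arbitrary: f)
  case 0
  then show ?case
    by (simp add: continuous_at_imp_continuous_on differentiable_imp_continuous_within)
next
  case (Suc k)
  then show ?case by auto
qed

lemma Ck_on_local:
  assumes "\<And>x. x \<in> S \<Longrightarrow> \<exists>T. open T \<and> x \<in> T \<and> Ck_on k T f"
  shows "Ck_on k S f"
  using assms
proof (induction k arbitrary: f)
  case 0
  have "isCont f x" if "x \<in> S" for x
    using 0[OF that] by (auto simp: continuous_on_eq_continuous_at)
  then show ?case by (simp add: continuous_at_imp_continuous_on)
next
  case (Suc k)
  then show ?case by (metis Ck_on.simps(2))
qed

lemma Ck_on_const: "Ck_on k S (\<lambda>x. c)"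
proof (induction k arbitrary: c)
  case (Suc k)
  then show ?case by (simp add: frechet_derivative_const)
qed simp

lemma Ck_on_bounded_linear:
  assumes "bounded_linear f" shows "Ck_on k S f"
proof (cases k)
  case 0
  then show ?thesis using assms by (simp add: linear_continuous_on)
next
  case (Suc m)
  have d: "(f has_derivative f) (at x)" for x
    using assms by (rule bounded_linear_imp_has_derivative)
  then have "frechet_derivative f (at x) = f" for x
    using frechet_derivative_at by metis
  then show ?thesis using d by (auto simp: Suc Ck_on_const differentiable_def)
qed

lemma Ck_on_add:
  assumes "open S" "Ck_on k S f" "Ck_on k S g"
  shows "Ck_on k S (\<lambda>x. f x + g x)"
  using assms(2,3)
proof (induction k arbitrary: f g)
  case 0
  then show ?case by (simp add: continuous_on_add)
next
  case (Suc k)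
  have d: "((\<lambda>x. f x + g x) has_derivative
     (\<lambda>v. frechet_derivative f (at x) v + frechet_derivative g (at x) v)) (at x)" if "x \<in> S" for x
    using Suc.prems that by (intro derivative_intros) (auto simp: frechet_derivative_works)
  have "Ck_on k S (\<lambda>x. frechet_derivative (\<lambda>x. f x + g x) (at x) v)" for v
    by (rule Ck_on_cong[OF assms(1) _ Suc.IH[of "\<lambda>x. frechet_derivative f (at x) v"
            "\<lambda>x. frechet_derivative g (at x) v"]])
      (use Suc.prems frechet_derivative_at[OF d] in \<open>auto simp: fun_eq_iff\<close>)
  then show ?case using d by (auto simp: differentiable_def)
qed

text \<open>One induction on the product rule serves multiplication, scaling and the inner product.
  The factor that is not differentiated keeps order \<open>Suc k\<close>, so
  \<open>Ck_on_lower\<close> brings it down to the order of the induction hypothesis.\<close>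

lemma Ck_on_bilinear:
  fixes B :: "'b::euclidean_space \<Rightarrow> 'c::euclidean_space \<Rightarrow> 'd::euclidean_space"
  assumes "bounded_bilinear B" "open S" "Ck_on k S f" "Ck_on k S g"
  shows "Ck_on k S (\<lambda>x. B (f x) (g x))"
  using assms(3,4)
proof (induction k arbitrary: f g)
  case 0
  then show ?case using bounded_bilinear.continuous_on[OF assms(1)] by simp
next
  case (Suc k)
  have *: "((\<lambda>x. B (f x) (g x)) has_derivative
      (\<lambda>v. B (f x) (frechet_derivative g (at x) v) + B (frechet_derivative f (at x) v) (g x))) (at x)"
    if "x \<in> S" for x
    using Suc.prems that
    by (intro bounded_bilinear.FDERIV[OF assms(1)]) (auto simp: frechet_derivative_works)
  have "Ck_on k S (\<lambda>x. frechet_derivative (\<lambda>x. B (f x) (g x)) (at x) v)" for v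
  proof (rule Ck_on_cong[OF assms(2)])
    show "Ck_on k S (\<lambda>x. B (f x) (frechet_derivative g (at x) v) +
        B (frechet_derivative f (at x) v) (g x))"
      by (intro Ck_on_add[OF assms(2)] Suc.IH) (use Suc.prems Ck_on_lower in auto)
  qed (use frechet_derivative_at[OF *] in \<open>auto simp: fun_eq_iff\<close>)
  then show ?case using * by (auto simp: differentiable_def)
qed

lemma Ck_on_sum:
  assumes "open S" "finite I" "\<And>i. i \<in> I \<Longrightarrow> Ck_on k S (f i)"
  shows "Ck_on k S (\<lambda>x. \<Sum>i\<in>I. f i x)"
  using assms(2,3)
  by (induction I rule: finite_induct) (auto simp: Ck_on_const intro!: Ck_on_add[OF assms(1)])

text \<open>\<open>Ck_on\<close> speaks of derivatives in fixed directions, while the chain rule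
  differentiates \<open>f\<close> in a direction that moves with the point. Expanding this direction
  over \<open>Basis\<close> leaves a sum of products, in which the induction hypothesis handles the
  directional derivatives of \<open>f\<close> composed with the same \<open>g\<close>.\<close>

lemma Ck_on_compose:
  fixes f :: "'b::euclidean_space \<Rightarrow> 'c::euclidean_space" and g :: "'a::euclidean_space \<Rightarrow> 'b"
  assumes "open S" "open T" "Ck_on k T f" "Ck_on k S g" "g ` S \<subseteq> T"
  shows "Ck_on k S (f \<circ> g)"
  using assms(3-5)
proof (induction k arbitrary: f)
  case 0
  then show ?case by (simp add: o_def continuous_on_compose2)
next
  case (Suc k)
  have d: "((f \<circ> g) has_derivative
      (\<lambda>v. frechet_derivative f (at (g x)) (frechet_derivative g (at x) v))) (at x)" if "x \<in> S" for x
    using diff_chain_at[of g "frechet_derivative g (at x)" x f "frechet_derivative f (at (g x))"]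
      Suc.prems that by (force simp: frechet_derivative_works o_def)
  have eq: "frechet_derivative (f \<circ> g) (at x) v =
      (\<Sum>b\<in>Basis. (frechet_derivative g (at x) v \<bullet> b) *\<^sub>R (frechet_derivative f (at (g x)) b))"
    if "x \<in> S" for x v
  proof -
    have "linear (frechet_derivative f (at (g x)))"
      using Suc.prems that by (intro linear_frechet_derivative) auto
    then have "frechet_derivative f (at (g x)) w =
      (\<Sum>b\<in>Basis. (w \<bullet> b) *\<^sub>R (frechet_derivative f (at (g x)) b))" for w
      by (subst euclidean_representation[of w, symmetric])
        (simp add: linear_sum linear_scale)
    then show ?thesis using frechet_derivative_at[OF d[OF that]] by metis
  qed
  have "Ck_on k S (\<lambda>x. \<Sum>b\<in>Basis. (frechet_derivative g (at x) v \<bullet> b) *\<^sub>R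
      ((\<lambda>y. frechet_derivative f (at y) b) \<circ> g) x)" for v
    using Suc.prems Ck_on_lower[OF Suc.prems(2)]
    by (intro Ck_on_sum[OF assms(1)] Ck_on_bilinear[OF bounded_bilinear_scaleR assms(1)] Suc.IH
         Ck_on_bilinear[OF bounded_bilinear_inner assms(1)] Ck_on_const) auto
  then have "Ck_on k S (\<lambda>x. frechet_derivative (f \<circ> g) (at x) v)" for v
    by (rule Ck_on_cong[OF assms(1), rotated]) (simp add: eq)
  then show ?case using d unfolding Ck_on.simps differentiable_def by blast
qed

lemma smooth_on_subset: "smooth_on S f \<Longrightarrow> T \<subseteq> S \<Longrightarrow> smooth_on T f"
  unfolding smooth_on_def using Ck_on_subset by blast

lemma smooth_on_cong: "open S \<Longrightarrow> (\<And>y. y \<in> S \<Longrightarrow> f y = g y) \<Longrightarrow> smooth_on S f \<Longrightarrow> smooth_on S g"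
  unfolding smooth_on_def using Ck_on_cong by blast

lemma smooth_on_local: "(\<And>x. x \<in> S \<Longrightarrow> \<exists>T. open T \<and> x \<in> T \<and> smooth_on T f) \<Longrightarrow> smooth_on S f"
  unfolding smooth_on_def by (meson Ck_on_local)

lemma smooth_on_const: "smooth_on S (\<lambda>x. c)"
  unfolding smooth_on_def using Ck_on_const by blast

lemma smooth_on_bounded_linear: "bounded_linear f \<Longrightarrow> smooth_on S f"
  unfolding smooth_on_def using Ck_on_bounded_linear by blast

lemma smooth_on_add: "open S \<Longrightarrow> smooth_on S f \<Longrightarrow> smooth_on S g \<Longrightarrow> smooth_on S (\<lambda>x. f x + g x)"
  unfolding smooth_on_def using Ck_on_add by blast

lemma smooth_on_mult:
  fixes f g :: "'a::euclidean_space \<Rightarrow> real"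
  shows "open S \<Longrightarrow> smooth_on S f \<Longrightarrow> smooth_on S g \<Longrightarrow> smooth_on S (\<lambda>x. f x * g x)"
  unfolding smooth_on_def using Ck_on_bilinear[OF bounded_bilinear_mult] by blast

lemma smooth_on_sum:
  "open S \<Longrightarrow> finite I \<Longrightarrow> (\<And>i. i \<in> I \<Longrightarrow> smooth_on S (f i)) \<Longrightarrow> smooth_on S (\<lambda>x. \<Sum>i\<in>I. f i x)"
  unfolding smooth_on_def using Ck_on_sum by blast

lemma smooth_on_compose:
  "open S \<Longrightarrow> open T \<Longrightarrow> smooth_on T f \<Longrightarrow> smooth_on S g \<Longrightarrow> g ` S \<subseteq> T \<Longrightarrow> smooth_on S (f \<circ> g)"
  unfolding smooth_on_def using Ck_on_compose by blast

lemma smooth_on_imp_differentiable: "smooth_on S f \<Longrightarrow> x \<in> S \<Longrightarrow> f differentiable (at x)"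
  unfolding smooth_on_def by (metis Ck_on.simps(2))

lemma smooth_on_imp_has_derivative:
  "smooth_on S f \<Longrightarrow> x \<in> S \<Longrightarrow> (f has_derivative frechet_derivative f (at x)) (at x)"
  using smooth_on_imp_differentiable frechet_derivative_works by blast

lemma smooth_on_frechet_derivative: "smooth_on S f \<Longrightarrow> smooth_on S (\<lambda>x. frechet_derivative f (at x) v)"
  unfolding smooth_on_def by (metis Ck_on.simps(2))

lemma smooth_on_imp_continuous_on: "smooth_on S f \<Longrightarrow> continuous_on S f"
  unfolding smooth_on_def by (metis Ck_on.simps(1))

lemma has_derivative_along_line:
  assumes "(f has_derivative f') (at (x + t *\<^sub>R v))"
  shows "((\<lambda>t. f (x + t *\<^sub>R v)) has_derivative (\<lambda>h. h *\<^sub>R f' v)) (at t)"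
proof -
  have "((\<lambda>t. x + t *\<^sub>R v) has_derivative (\<lambda>h. h *\<^sub>R v)) (at t)"
    by (auto intro!: derivative_eq_intros)
  from diff_chain_at[OF this assms] show ?thesis
    using linear_scale[OF has_derivative_linear[OF assms]] by (simp add: o_def)
qed

lemma has_real_derivative_along_line:
  fixes f :: "'a::euclidean_space \<Rightarrow> real"
  assumes "(f has_derivative f') (at (x + t *\<^sub>R v))"
  shows "((\<lambda>t. f (x + t *\<^sub>R v)) has_real_derivative f' v) (at t)"
  using has_derivative_along_line[OF assms] by (simp add: has_field_derivative_def mult_commute_abs)

text \<open>Both mixed derivatives are limits of the same second difference quotient.\<close>

lemma mixed_difference_mean_value:
  fixes f :: "'a::euclidean_space \<Rightarrow> real"
  assumes S: "\<And>s t. 0 \<le> s \<Longrightarrow> s \<le> h \<Longrightarrow> 0 \<le> t \<Longrightarrow> t \<le> h \<Longrightarrow> x + s *\<^sub>R v + t *\<^sub>R w \<in> S"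
    and f: "smooth_on S f" and h: "h > 0"
  obtains s t where "0 < s" "s < h" "0 < t" "t < h"
    "f (x + h *\<^sub>R v + h *\<^sub>R w) - f (x + h *\<^sub>R v) - f (x + h *\<^sub>R w) + f x =
     h\<^sup>2 * frechet_derivative (\<lambda>y. frechet_derivative f (at y) v) (at (x + s *\<^sub>R v + t *\<^sub>R w)) w"
proof -
  let ?g = "\<lambda>s. f ((x + h *\<^sub>R w) + s *\<^sub>R v) - f (x + s *\<^sub>R v)"
  let ?dv = "\<lambda>y. frechet_derivative f (at y) v"
  have f': "(f has_derivative frechet_derivative f (at (x + s *\<^sub>R v + t *\<^sub>R w))) (at (x + s *\<^sub>R v + t *\<^sub>R w))"
    if "0 \<le> s" "s \<le> h" "0 \<le> t" "t \<le> h" for s t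
    using smooth_on_imp_has_derivative[OF f S[OF that]] .
  have "(?g has_real_derivative ?dv (x + h *\<^sub>R w + s *\<^sub>R v) - ?dv (x + s *\<^sub>R v)) (at s)"
    if "0 \<le> s" "s \<le> h" for s
    using f'[of s h] f'[of s 0] that h
    by (intro DERIV_diff has_real_derivative_along_line) (auto simp: algebra_simps)
  from MVT2[OF h this] obtain s where s: "0 < s" "s < h"
    "?g h - ?g 0 = (h - 0) * (?dv (x + h *\<^sub>R w + s *\<^sub>R v) - ?dv (x + s *\<^sub>R v))"
    by blast
  have "((\<lambda>t. ?dv ((x + s *\<^sub>R v) + t *\<^sub>R w)) has_real_derivative
      frechet_derivative ?dv (at (x + s *\<^sub>R v + t *\<^sub>R w)) w) (at t)" if "0 \<le> t" "t \<le> h" for t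
    by (intro has_real_derivative_along_line
        smooth_on_imp_has_derivative[OF smooth_on_frechet_derivative[OF f]] S)
      (use that s in auto)
  from MVT2[OF h this] obtain t where t: "0 < t" "t < h"
    "?dv ((x + s *\<^sub>R v) + h *\<^sub>R w) - ?dv ((x + s *\<^sub>R v) + 0 *\<^sub>R w)
      = (h - 0) * frechet_derivative ?dv (at (x + s *\<^sub>R v + t *\<^sub>R w)) w"
    by blast
  have "f (x + h *\<^sub>R v + h *\<^sub>R w) - f (x + h *\<^sub>R v) - f (x + h *\<^sub>R w) + f x = ?g h - ?g 0"
    by (simp add: ac_simps)
  also have "\<dots> = h\<^sup>2 * frechet_derivative ?dv (at (x + s *\<^sub>R v + t *\<^sub>R w)) w"
  proof -
    have "?dv (x + h *\<^sub>R w + s *\<^sub>R v) - ?dv (x + s *\<^sub>R v) =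
      h * frechet_derivative ?dv (at (x + s *\<^sub>R v + t *\<^sub>R w)) w"
      using t(3) by (simp add: ac_simps)
    then show ?thesis using s(3) by (simp only: power2_eq_square diff_zero mult.assoc)
  qed
  finally show thesis by (rule that[OF s(1,2) t(1,2)])
qed

lemma frechet_derivative_commute:
  fixes f :: "'a::euclidean_space \<Rightarrow> real"
  assumes "open S" "smooth_on S f" "x \<in> S"
  shows "frechet_derivative (\<lambda>y. frechet_derivative f (at y) v) (at x) w =
    frechet_derivative (\<lambda>y. frechet_derivative f (at y) w) (at x) v" (is "?P x = ?Q x")
proof (rule ccontr)
  assume ne: "?P x \<noteq> ?Q x"
  define e where "e = \<bar>?P x - ?Q x\<bar> / 2"
  have e: "e > 0" using ne by (simp add: e_def)
  have "continuous_on S ?P" "continuous_on S ?Q"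
    by (intro smooth_on_imp_continuous_on smooth_on_frechet_derivative assms)+
  then have "isCont ?P x" "isCont ?Q x"
    using assms(1,3) by (simp_all add: continuous_on_eq_continuous_at)
  then obtain d1 d2 where d: "d1 > 0" "d2 > 0"
    "\<And>y. dist y x < d1 \<Longrightarrow> dist (?P y) (?P x) < e" "\<And>y. dist y x < d2 \<Longrightarrow> dist (?Q y) (?Q x) < e"
    using e unfolding continuous_at_eps_delta by blast
  obtain d3 where d3: "d3 > 0" "ball x d3 \<subseteq> S"
    using assms(1,3) open_contains_ball by blast
  define d where "d = min d1 (min d2 d3)"
  have dpos: "d > 0" using d d3 by (simp add: d_def)
  \<comment> \<open>This size keeps the parallelogram spanned by \<open>h *\<^sub>R v\<close> and
    \<open>h *\<^sub>R w\<close> within distance \<open>d\<close> of \<open>x\<close>; the summand 1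
    covers \<open>v = w = 0\<close>.\<close>
  define h where "h = d / (2 * (norm v + norm w + 1))"
  have h: "h > 0" using dpos by (simp add: h_def add_nonneg_pos)
  have near: "dist (x + s *\<^sub>R v + t *\<^sub>R w) x < d" if "0 \<le> s" "s \<le> h" "0 \<le> t" "t \<le> h" for s t
  proof -
    have "dist (x + s *\<^sub>R v + t *\<^sub>R w) x \<le> norm (s *\<^sub>R v) + norm (t *\<^sub>R w)"
      using norm_triangle_ineq[of "s *\<^sub>R v" "t *\<^sub>R w"] by (simp add: dist_norm add.assoc)
    also have "\<dots> \<le> h * norm v + h * norm w"
      using that by (simp add: add_mono mult_right_mono)
    also have "\<dots> \<le> h * (norm v + norm w + 1)" using h by (simp add: algebra_simps)
    also have "\<dots> = d / 2" 
      using add_nonneg_pos[of "norm v + norm w" 1] by (simp only: h_def) (simp add: field_simps)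
    also have "\<dots> < d" using dpos by simp
    finally show ?thesis .
  qed
  have S: "x + s *\<^sub>R v + t *\<^sub>R w \<in> S" if "0 \<le> s" "s \<le> h" "0 \<le> t" "t \<le> h" for s t
    using near[OF that] d3(2) by (auto simp: d_def dist_commute subset_iff)
  have S': "x + s *\<^sub>R w + t *\<^sub>R v \<in> S" if "0 \<le> s" "s \<le> h" "0 \<le> t" "t \<le> h" for s t
    using S[of t s] that by (simp add: add.assoc add.commute[of "s *\<^sub>R w"])
  obtain s t where 1: "0 < s" "s < h" "0 < t" "t < h"
    "f (x + h *\<^sub>R v + h *\<^sub>R w) - f (x + h *\<^sub>R v) - f (x + h *\<^sub>R w) + f x = h\<^sup>2 * ?P (x + s *\<^sub>R v + t *\<^sub>R w)"
    by (rule mixed_difference_mean_value[of h x v w S f, OF S assms(2) h])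
  obtain s' t' where 2: "0 < s'" "s' < h" "0 < t'" "t' < h"
    "f (x + h *\<^sub>R w + h *\<^sub>R v) - f (x + h *\<^sub>R w) - f (x + h *\<^sub>R v) + f x = h\<^sup>2 * ?Q (x + s' *\<^sub>R w + t' *\<^sub>R v)"
    by (rule mixed_difference_mean_value[of h x w v S f, OF S' assms(2) h])
  \<comment> \<open>The second difference is symmetric in \<open>v\<close> and \<open>w\<close>, so
    the two intermediate values are equal although they are taken at different points; both points
    are close to \<open>x\<close>.\<close>
  have eq: "x + h *\<^sub>R w + h *\<^sub>R v = x + h *\<^sub>R v + h *\<^sub>R w" by simp
  have "h\<^sup>2 * ?P (x + s *\<^sub>R v + t *\<^sub>R w) = h\<^sup>2 * ?Q (x + s' *\<^sub>R w + t' *\<^sub>R v)"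
    using 1(5) 2(5)[unfolded eq] by linarith
  then have "?P (x + s *\<^sub>R v + t *\<^sub>R w) = ?Q (x + s' *\<^sub>R w + t' *\<^sub>R v)" using h by simp
  moreover have "dist (?P (x + s *\<^sub>R v + t *\<^sub>R w)) (?P x) < e"
    using near[of s t] 1 by (intro d(3)) (auto simp: d_def)
  moreover have "dist (?Q (x + s' *\<^sub>R w + t' *\<^sub>R v)) (?Q x) < e"
    using near[of t' s'] 2 by (intro d(4)) (simp add: d_def add.assoc add.commute[of "s' *\<^sub>R w"])
  ultimately show False by (simp add: e_def dist_real_def abs_if split: if_splits)
qed

section \<open>Second derivative test, determinants and orthonormal frames\<close>

text \<open>Were \<open>h2\<close> positive, \<open>h1\<close> would be positive just to the right
  of its zero at 0, and the mean value theorem would lift \<open>h\<close> above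
  \<open>h 0\<close>.\<close>

lemma second_derivative_at_local_max:
  fixes h h1 :: "real \<Rightarrow> real"
  assumes \<delta>: "\<delta> > 0"
    and h1: "\<And>s. \<bar>s\<bar> < \<delta> \<Longrightarrow> (h has_real_derivative h1 s) (at s)"
    and h2: "(h1 has_real_derivative h2) (at 0)"
    and max: "\<And>s. \<bar>s\<bar> < \<delta> \<Longrightarrow> h s \<le> h 0"
  shows "h1 0 = 0" "h2 \<le> 0"
proof -
  show 0: "h1 0 = 0"
    by (rule DERIV_local_max[OF h1[of 0] \<delta>]) (use \<delta> max in auto)
  show "h2 \<le> 0"
  proof (rule ccontr)
    assume "\<not> h2 \<le> 0"
    then obtain d where d: "d > 0" "\<And>k. 0 < k \<Longrightarrow> k < d \<Longrightarrow> h1 0 < h1 (0 + k)"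
      using DERIV_pos_inc_right[OF h2] by auto
    define k where "k = min d \<delta> / 2"
    have k: "0 < k" "k < d" "k < \<delta>" using d \<delta> by (auto simp: k_def)
    obtain z where z: "0 < z" "z < k" "h k - h 0 = (k - 0) * h1 z"
      using MVT2[of 0 k h h1] k h1 by force
    have "h1 z > 0" using d(2)[of z] z k 0 by simp
    then have "h k > h 0" using z k by (smt (verit) mult_pos_pos)
    then show False using max[of k] k by simp
  qed
qed

lemma DERIV_det:
  fixes M :: "real \<Rightarrow> real^'n^'n"
  assumes "\<And>i j. ((\<lambda>s. M s $ i $ j) has_real_derivative M' $ i $ j) (at t)"
  shows "((\<lambda>s. det (M s)) has_real_derivative (\<Sum>p | p permutes UNIV. of_int (sign p) *
      (\<Sum>i\<in>UNIV. M' $ i $ p i * (\<Prod>j\<in>UNIV-{i}. M t $ j $ p j)))) (at t)"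
  unfolding det_def
  by (intro DERIV_sum DERIV_cmult has_field_derivative_prod assms)

text \<open>A permutation other than the identity moves at least two indices. Whichever row is
  differentiated, an off-diagonal entry of the identity matrix remains among the other factors, so
  only \<open>id\<close> contributes.\<close>

lemma DERIV_det_at_one:
  fixes M :: "real \<Rightarrow> real^'n^'n"
  assumes M': "\<And>i j. ((\<lambda>s. M s $ i $ j) has_real_derivative M' $ i $ j) (at t)" and one: "M t = mat 1"
  shows "((\<lambda>s. det (M s)) has_real_derivative trace M') (at t)"
proof -
  let ?g = "\<lambda>p. of_int (sign p) * (\<Sum>i\<in>UNIV. M' $ i $ p i * (\<Prod>j\<in>UNIV-{i}. M t $ j $ p j)) :: real"
  have "?g p = 0" if p: "p permutes UNIV" "p \<noteq> id" for p
  proof -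
    have "(\<Prod>j\<in>UNIV-{i}. M t $ j $ p j) = 0" for i
    proof -
      have "\<exists>j. j \<noteq> i \<and> p j \<noteq> j"
      proof (rule ccontr)
        assume "\<not> ?thesis"
        then have *: "\<And>j. j \<noteq> i \<Longrightarrow> p j = j" by auto
        have "p i = i"
          using *[of "p i"] permutes_inj[OF p(1)] by (metis injD)
        then have "p = id" using * by (metis eq_id_iff)
        then show False using p by simp
      qed
      then obtain j where "j \<noteq> i" "p j \<noteq> j" by blast
      then show ?thesis by (intro prod_zero) (auto simp: one mat_def intro!: bexI[of _ j])
    qed
    then show ?thesis by (simp only: mult_zero_right sum.neutral_const)
  qed
  then have "(\<Sum>p | p permutes UNIV. ?g p) = (\<Sum>p\<in>{id}. ?g p)"
    by (intro sum.mono_neutral_right) (auto simp: permutes_id)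
  also have "\<dots> = trace M'" by (simp add: trace_def one mat_def)
  finally show ?thesis using DERIV_det[OF M'] by simp
qed

section \<open>Inverse matrices and derivatives of the log-determinant\<close>

lemma matrix_inv_mult:
  fixes A :: "real^'n^'n"
  assumes "det A \<noteq> 0"
  shows "A ** matrix_inv A = mat 1" "matrix_inv A ** A = mat 1"
proof -
  have "\<exists>A'. A ** A' = mat 1 \<and> A' ** A = mat 1"
    using assms invertible_det_nz invertible_def by blast
  then have "A ** matrix_inv A = mat 1 \<and> matrix_inv A ** A = mat 1"
    unfolding matrix_inv_def by (rule someI_ex)
  then show "A ** matrix_inv A = mat 1" "matrix_inv A ** A = mat 1" by auto
qed

text \<open>Cramer's rule: as quotients of determinants the entries of the inverse are visibly
  differentiable, before any formula for their derivative is known.\<close>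

lemma matrix_inv_entry:
  fixes A :: "real^'n^'n"
  assumes "det A \<noteq> 0"
  shows "matrix_inv A $ k $ j = det (\<chi> i l. if l = k then (axis j 1 :: real^'n) $ i else A $ i $ l) / det A"
proof -
  have inv: "A ** matrix_inv A = mat 1"
    using assms by (rule matrix_inv_mult)
  have "A *v column j (matrix_inv A) = axis j 1"
    using inv by (metis matrix_vector_mul_assoc matrix_vector_mul_lid matrix_vector_mult_basis)
  then have "column j (matrix_inv A) = (\<chi> k. det (\<chi> i l. if l = k then (axis j 1 :: real^'n) $ i else A $ i $ l) / det A)"
    using cramer[OF assms] by blast
  then show ?thesis by (simp add: column_def vec_eq_iff)
qed

lemma matrix_add_rdistrib':
  fixes A B :: "real^'n^'n" shows "(A + B) ** C = A ** C + B ** C"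
  by (simp add: matrix_matrix_mult_def sum.distrib distrib_right vec_eq_iff)

text \<open>Cramer's rule yields the existence of the derivative, and differentiating
  \<open>X s ** M s = mat 1\<close> then yields its value.\<close>

lemma DERIV_matrix_inv:
  fixes M :: "real \<Rightarrow> real^'n^'n"
  assumes \<delta>: "\<delta> > 0" and nz: "\<And>s. \<bar>s - t\<bar> < \<delta> \<Longrightarrow> det (M s) \<noteq> 0"
    and M': "\<And>i j. ((\<lambda>s. M s $ i $ j) has_real_derivative M' $ i $ j) (at t)"
  defines "X \<equiv> \<lambda>s. matrix_inv (M s)"
  shows "((\<lambda>s. X s $ i $ j) has_real_derivative (- (X t ** M' ** X t)) $ i $ j) (at t)"
proof -
  have nzt: "det (M t) \<noteq> 0" using nz \<delta> by simp
  have ev: "\<forall>\<^sub>F s in nhds t. \<bar>s - t\<bar> < \<delta>"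
    using eventually_nhds_metric \<delta> by (metis dist_real_def)
  have "\<exists>D. ((\<lambda>s. X s $ k $ l) has_real_derivative D) (at t)" for k l
  proof -
    let ?A = "\<lambda>s. (\<chi> i m. if m = k then (axis l 1 :: real^'n) $ i else M s $ i $ m)"
    let ?A' = "(\<chi> i m. if m = k then 0 else M' $ i $ m)"
    have A: "((\<lambda>s. ?A s $ i $ m) has_real_derivative ?A' $ i $ m) (at t)" for i m
      using M' by simp
    have "\<exists>D. ((\<lambda>s. det (?A s) / det (M s)) has_real_derivative D) (at t)"
      using DERIV_divide[OF DERIV_det[of ?A, OF A] DERIV_det[of M, OF M'] nzt] by blast
    then obtain D where D: "((\<lambda>s. det (?A s) / det (M s)) has_real_derivative D) (at t)" ..
    have "\<forall>\<^sub>F s in nhds t. X s $ k $ l = det (?A s) / det (M s)"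
      using ev by eventually_elim (use nz in \<open>simp add: X_def matrix_inv_entry\<close>)
    then show ?thesis using D DERIV_cong_ev[of t t "\<lambda>s. X s $ k $ l" "\<lambda>s. det (?A s) / det (M s)" D D] by blast
  qed
  then obtain X' where X': "\<And>k l. ((\<lambda>s. X s $ k $ l) has_real_derivative X' k l) (at t)" by metis
  define Y where "Y = (\<chi> k l. X' k l)"
  have inv: "X s ** M s = mat 1" "M s ** X s = mat 1" if "\<bar>s - t\<bar> < \<delta>" for s
    using nz[OF that] unfolding X_def by (simp_all add: matrix_inv_mult)
  have "Y ** M t + X t ** M' = 0"
  proof -
    have "(Y ** M t + X t ** M') $ k $ l = 0" for k l
    proof -
      have "((\<lambda>s. \<Sum>m\<in>UNIV. X s $ k $ m * M s $ m $ l) has_real_derivative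
          (\<Sum>m\<in>UNIV. X' k m * M t $ m $ l + M' $ m $ l * X t $ k $ m)) (at t)"
        by (intro DERIV_sum DERIV_mult X' M')
      moreover have "\<forall>\<^sub>F s in nhds t. (\<Sum>m\<in>UNIV. X s $ k $ m * M s $ m $ l) = mat 1 $ k $ l"
        using ev
      proof eventually_elim
        case (elim s)
        have "(X s ** M s) $ k $ l = mat 1 $ k $ l" by (simp only: inv(1)[OF elim])
        then show ?case by (simp only: matrix_matrix_mult_def vec_lambda_beta)
      qed
      ultimately have "((\<lambda>s. mat 1 $ k $ l) has_real_derivative
          (\<Sum>m\<in>UNIV. X' k m * M t $ m $ l + M' $ m $ l * X t $ k $ m)) (at t)"
        by (subst (asm) DERIV_cong_ev[OF refl _ refl]) auto
      then have "(\<Sum>m\<in>UNIV. X' k m * M t $ m $ l + M' $ m $ l * X t $ k $ m) = 0"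
        using DERIV_unique DERIV_const by blast
      then show ?thesis
        by (simp add: Y_def matrix_matrix_mult_def sum.distrib mult.commute)
    qed
    then show ?thesis by (simp add: vec_eq_iff)
  qed
  then have "(Y ** M t + X t ** M') ** X t = 0" by simp
  then have "Y ** (M t ** X t) + X t ** M' ** X t = 0"
    by (simp add: matrix_add_rdistrib' matrix_mul_assoc)
  then have "Y = - (X t ** M' ** X t)"
    using inv(2)[of t] \<delta> by (simp add: eq_neg_iff_add_eq_0)
  then show ?thesis using X'[of i j] by (metis Y_def vec_lambda_beta)
qed

text \<open>Multiplying by the constant matrix \<open>matrix_inv (M t)\<close> reduces to a curve
  through the identity, where the derivative of the determinant is the trace.\<close>

lemma DERIV_ln_det:
  fixes M :: "real \<Rightarrow> real^'n^'n"
  assumes pos: "det (M t) > 0"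
    and M': "\<And>i j. ((\<lambda>s. M s $ i $ j) has_real_derivative M' $ i $ j) (at t)"
  shows "((\<lambda>s. ln (det (M s))) has_real_derivative trace (matrix_inv (M t) ** M')) (at t)"
proof -
  let ?X = "matrix_inv (M t)"
  have inv: "?X ** M t = mat 1" "M t ** ?X = mat 1"
    using pos by (simp_all add: matrix_inv_mult)
  have "((\<lambda>s. det (?X ** M s)) has_real_derivative trace (?X ** M')) (at t)"
  proof (rule DERIV_det_at_one)
    show "((\<lambda>s. (?X ** M s) $ i $ j) has_real_derivative (?X ** M') $ i $ j) (at t)" for i j
      by (auto simp: matrix_matrix_mult_def intro!: DERIV_sum DERIV_cmult M')
  qed (rule inv)
  then have "((\<lambda>s. det (M t) * det (?X ** M s)) has_real_derivative det (M t) * trace (?X ** M')) (at t)"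
    by (rule DERIV_cmult)
  moreover have "det (M t) * det (?X ** M s) = det (M s)" for s
    using inv(2) by (metis det_mul matrix_mul_assoc matrix_mul_lid)
  ultimately have "((\<lambda>s. det (M s)) has_real_derivative det (M t) * trace (?X ** M')) (at t)" by simp
  from DERIV_chain2[OF DERIV_ln_divide[OF pos] this] show ?thesis using pos by simp
qed

text \<open>All three formulas come from differentiating tr(X M') with X' = - X M' X and then
  putting X = 1. The derivatives \<open>l1\<close>, \<open>l2\<close>, \<open>l3\<close> are given
  independently because in the application they are computed from the other side of the Monge-Ampere
  equation; uniqueness of derivatives then equates the two.\<close>

lemma ln_det_derivatives:
  fixes M M1 M2 :: "real \<Rightarrow> real^'n^'n"
  assumes \<delta>: "\<delta> > 0"
    and M1: "\<And>s i j. \<bar>s\<bar> < \<delta> \<Longrightarrow> ((\<lambda>s. M s $ i $ j) has_real_derivative M1 s $ i $ j) (at s)"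
    and M2: "\<And>s i j. \<bar>s\<bar> < \<delta> \<Longrightarrow> ((\<lambda>s. M1 s $ i $ j) has_real_derivative M2 s $ i $ j) (at s)"
    and M3: "\<And>i j. ((\<lambda>s. M2 s $ i $ j) has_real_derivative M3 $ i $ j) (at 0)"
    and pos: "\<And>s. \<bar>s\<bar> < \<delta> \<Longrightarrow> det (M s) > 0" and one: "M 0 = mat 1"
    and l1: "\<And>s. \<bar>s\<bar> < \<delta> \<Longrightarrow> ((\<lambda>s. ln (det (M s))) has_real_derivative l1 s) (at s)"
    and l2: "\<And>s. \<bar>s\<bar> < \<delta> \<Longrightarrow> (l1 has_real_derivative l2 s) (at s)"
    and l3: "(l2 has_real_derivative l3) (at 0)"
  shows "l1 0 = (\<Sum>i\<in>UNIV. M1 0 $ i $ i)"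
    and "l2 0 = (\<Sum>i\<in>UNIV. M2 0 $ i $ i) - (\<Sum>i\<in>UNIV. \<Sum>j\<in>UNIV. M1 0 $ i $ j * M1 0 $ j $ i)"
    and "l3 = (\<Sum>i\<in>UNIV. M3 $ i $ i) - 3 * (\<Sum>i\<in>UNIV. \<Sum>j\<in>UNIV. M1 0 $ i $ j * M2 0 $ j $ i)
      + 2 * (\<Sum>i\<in>UNIV. \<Sum>j\<in>UNIV. \<Sum>k\<in>UNIV. M1 0 $ i $ j * M1 0 $ j $ k * M1 0 $ k $ i)"
proof -
  define X where "X s = matrix_inv (M s)" for s
  define Y where "Y s = - (X s ** M1 s ** X s)" for s
  have X0: "X 0 = mat 1"
    using matrix_inv_mult(1)[of "mat 1 :: real^'n^'n"] by (simp add: X_def one)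
  have ev: "\<forall>\<^sub>F s in nhds t. \<bar>s\<bar> < \<delta>" if "\<bar>t\<bar> < \<delta>" for t
  proof -
    have "open {s::real. \<bar>s\<bar> < \<delta>}" by (intro open_Collect_less continuous_intros)
    then show ?thesis using that eventually_nhds by blast
  qed
  have l1': "l1 s = (\<Sum>i\<in>UNIV. \<Sum>j\<in>UNIV. X s $ i $ j * M1 s $ j $ i)" if "\<bar>s\<bar> < \<delta>" for s
    using DERIV_unique[OF l1[OF that] DERIV_ln_det[of M s "M1 s", OF pos[OF that] M1[OF that]]]
    by (simp add: trace_def matrix_matrix_mult_def X_def)
  show "l1 0 = (\<Sum>i\<in>UNIV. M1 0 $ i $ i)"
    using l1'[of 0] \<delta> by (simp add: X0 mat_def if_distrib[of "\<lambda>x. x * _"] cong: if_cong)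
  have X': "((\<lambda>s. X s $ i $ j) has_real_derivative Y s $ i $ j) (at s)" if "\<bar>s\<bar> < \<delta>" for s i j
    unfolding X_def Y_def
    by (rule DERIV_matrix_inv[of "\<delta> - \<bar>s\<bar>"]) (use that in \<open>auto intro!: M1 less_imp_neq[OF pos, symmetric]\<close>)
  have l2': "l2 s = (\<Sum>i\<in>UNIV. \<Sum>j\<in>UNIV. Y s $ i $ j * M1 s $ j $ i + M2 s $ j $ i * X s $ i $ j)"
    if s: "\<bar>s\<bar> < \<delta>" for s
  proof -
    have "((\<lambda>s. \<Sum>i\<in>UNIV. \<Sum>j\<in>UNIV. X s $ i $ j * M1 s $ j $ i) has_real_derivative
       (\<Sum>i\<in>UNIV. \<Sum>j\<in>UNIV. Y s $ i $ j * M1 s $ j $ i + M2 s $ j $ i * X s $ i $ j)) (at s)"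
      by (intro DERIV_sum DERIV_mult X' M2 s)
    moreover have "\<forall>\<^sub>F s in nhds s. l1 s = (\<Sum>i\<in>UNIV. \<Sum>j\<in>UNIV. X s $ i $ j * M1 s $ j $ i)"
      using ev[OF s] by eventually_elim (rule l1')
    ultimately have "(l1 has_real_derivative
       (\<Sum>i\<in>UNIV. \<Sum>j\<in>UNIV. Y s $ i $ j * M1 s $ j $ i + M2 s $ j $ i * X s $ i $ j)) (at s)"
      by (subst DERIV_cong_ev[OF refl _ refl]) auto
    then show ?thesis using DERIV_unique l2[OF s] by blast
  qed
  have Y0: "Y 0 = - M1 0" by (simp add: Y_def X0)
  show "l2 0 = (\<Sum>i\<in>UNIV. M2 0 $ i $ i) - (\<Sum>i\<in>UNIV. \<Sum>j\<in>UNIV. M1 0 $ i $ j * M1 0 $ j $ i)"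
    using l2'[of 0] \<delta>
    by (simp add: X0 Y0 mat_def sum.distrib sum_subtractf sum_negf if_distrib[of "\<lambda>x. _ * x"] cong: if_cong)
  have Yij: "Y s $ i $ j = - (\<Sum>k\<in>UNIV. \<Sum>m\<in>UNIV. X s $ i $ m * M1 s $ m $ k * X s $ k $ j)" for s i j
    by (simp add: Y_def matrix_matrix_mult_def sum_distrib_right)
  \<comment> \<open>The derivative at 0 of \<open>Y\<close>, i.e. of - X M' X, as the product rule
    delivers it. With X = 1 it collapses to 2 M' M' - M''.\<close>
  define Z where "Z = (\<chi> i j. - (\<Sum>k\<in>UNIV. \<Sum>m\<in>UNIV. (Y 0 $ i $ m * M1 0 $ m $ k + M2 0 $ m $ k * X 0 $ i $ m) * X 0 $ k $ j
     + Y 0 $ k $ j * (X 0 $ i $ m * M1 0 $ m $ k)))"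
  have Y': "((\<lambda>s. Y s $ i $ j) has_real_derivative Z $ i $ j) (at 0)" for i j
  proof -
    have "(\<lambda>s. Y s $ i $ j) =
        (\<lambda>s. - (\<Sum>k\<in>UNIV. \<Sum>m\<in>UNIV. X s $ i $ m * M1 s $ m $ k * X s $ k $ j))"
      by (simp only: Yij)
    then show ?thesis
      unfolding Z_def vec_lambda_beta
      using X'[of 0] M2[of 0] \<delta> by (simp only:) (intro DERIV_minus DERIV_sum DERIV_mult; simp)
  qed
  have "((\<lambda>s. \<Sum>i\<in>UNIV. \<Sum>j\<in>UNIV. Y s $ i $ j * M1 s $ j $ i + M2 s $ j $ i * X s $ i $ j) has_real_derivative
      (\<Sum>i\<in>UNIV. \<Sum>j\<in>UNIV. (Z $ i $ j * M1 0 $ j $ i + M2 0 $ j $ i * Y 0 $ i $ j) +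
        (M3 $ j $ i * X 0 $ i $ j + Y 0 $ i $ j * M2 0 $ j $ i))) (at 0)"
    by (intro DERIV_sum DERIV_add DERIV_mult Y' M3) (use \<delta> in \<open>auto intro!: X' M2\<close>)
  moreover have "\<forall>\<^sub>F s in nhds 0. l2 s = (\<Sum>i\<in>UNIV. \<Sum>j\<in>UNIV. Y s $ i $ j * M1 s $ j $ i + M2 s $ j $ i * X s $ i $ j)"
    using ev[of 0] \<delta> by simp (erule eventually_mono, rule l2')
  ultimately have "(l2 has_real_derivative (\<Sum>i\<in>UNIV. \<Sum>j\<in>UNIV. (Z $ i $ j * M1 0 $ j $ i + M2 0 $ j $ i * Y 0 $ i $ j) +
        (M3 $ j $ i * X 0 $ i $ j + Y 0 $ i $ j * M2 0 $ j $ i))) (at 0)"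
    by (subst DERIV_cong_ev[OF refl _ refl]) auto
  then have l3': "l3 = (\<Sum>i\<in>UNIV. \<Sum>j\<in>UNIV. (Z $ i $ j * M1 0 $ j $ i + M2 0 $ j $ i * Y 0 $ i $ j) +
        (M3 $ j $ i * X 0 $ i $ j + Y 0 $ i $ j * M2 0 $ j $ i))"
    using DERIV_unique l3 by blast
  have Z: "Z $ i $ j = 2 * (\<Sum>k\<in>UNIV. M1 0 $ i $ k * M1 0 $ k $ j) - M2 0 $ i $ j" for i j
    by (simp add: Z_def X0 Y0 mat_def sum.distrib sum_subtractf sum_negf algebra_simps
        if_distrib[of "\<lambda>x. _ * x"] if_distrib[of "\<lambda>x. x * _"] cong: if_cong)
      (subst sum.swap, simp)
  have eq: "(\<Sum>i\<in>UNIV. \<Sum>j\<in>UNIV. M3 $ j $ i * (mat 1 :: real^'n^'n) $ i $ j) = (\<Sum>i\<in>UNIV. M3 $ i $ i)"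
    by (simp add: mat_def if_distrib[of "\<lambda>x. _ * x"] cong: if_cong)
  have sw: "(\<Sum>i\<in>UNIV. \<Sum>j\<in>UNIV. M1 0 $ j $ i * M2 0 $ i $ j) = (\<Sum>i\<in>UNIV. \<Sum>j\<in>UNIV. M1 0 $ i $ j * M2 0 $ j $ i)"
    by (rule sum.swap)
  have sw3: "(\<Sum>i\<in>UNIV. \<Sum>j\<in>UNIV. \<Sum>k\<in>UNIV. M1 0 $ i $ k * M1 0 $ k $ j * M1 0 $ j $ i) =
    (\<Sum>i\<in>UNIV. \<Sum>j\<in>UNIV. \<Sum>k\<in>UNIV. M1 0 $ i $ j * M1 0 $ j $ k * M1 0 $ k $ i)"
    by (rule sum.cong[OF refl], rule sum.swap)
  have "l3 = (\<Sum>i\<in>UNIV. \<Sum>j\<in>UNIV. 2 * (\<Sum>k\<in>UNIV. M1 0 $ i $ k * M1 0 $ k $ j * M1 0 $ j $ i)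
       - M1 0 $ j $ i * M2 0 $ i $ j - 2 * (M1 0 $ i $ j * M2 0 $ j $ i) + M3 $ j $ i * (mat 1 :: real^'n^'n) $ i $ j)"
    unfolding l3' by (simp add: Z X0 Y0 algebra_simps sum_distrib_left)
  also have "\<dots> = (\<Sum>i\<in>UNIV. M3 $ i $ i) - 3 * (\<Sum>i\<in>UNIV. \<Sum>j\<in>UNIV. M1 0 $ i $ j * M2 0 $ j $ i)
      + 2 * (\<Sum>i\<in>UNIV. \<Sum>j\<in>UNIV. \<Sum>k\<in>UNIV. M1 0 $ i $ k * M1 0 $ k $ j * M1 0 $ j $ i)"
    by (simp only: sum.distrib sum_subtractf sum_distrib_left[symmetric] eq sw)
  finally show "l3 = (\<Sum>i\<in>UNIV. M3 $ i $ i) - 3 * (\<Sum>i\<in>UNIV. \<Sum>j\<in>UNIV. M1 0 $ i $ j * M2 0 $ j $ i)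
      + 2 * (\<Sum>i\<in>UNIV. \<Sum>j\<in>UNIV. \<Sum>k\<in>UNIV. M1 0 $ i $ j * M1 0 $ j $ k * M1 0 $ k $ i)"
    unfolding sw3 .
qed

text \<open>Gram-Schmidt for the form \<open>B\<close>, one index at a time: while fewer than n
  vectors have been found they do not span, and a vector outside their span has a nonzero
  \<open>B\<close>-orthogonal part to normalise.\<close>

lemma orthonormal_frame_exists:
  fixes B :: "real^'n \<Rightarrow> real^'n \<Rightarrow> real"
  assumes bil: "bilinear B" and sym: "\<And>x y. B x y = B y x" and pos: "\<And>x. x \<noteq> 0 \<Longrightarrow> B x x > 0"
  obtains E :: "'n \<Rightarrow> real^'n" where "\<And>i j. B (E i) (E j) = (if i = j then 1 else 0)"
    and "\<And>x. x = (\<Sum>i\<in>UNIV. B x (E i) *\<^sub>R E i)"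
proof -
  note lin = bilinear_ladd[OF bil] bilinear_radd[OF bil] bilinear_lmul[OF bil] bilinear_rmul[OF bil]
    bilinear_lsub[OF bil] bilinear_rsub[OF bil]
  have lsum: "B (\<Sum>i\<in>I. f i) y = (\<Sum>i\<in>I. B (f i) y)" for f :: "'n \<Rightarrow> real^'n" and I y
    using bil linear_sum unfolding bilinear_def by blast
  have ex: "\<exists>E :: 'n \<Rightarrow> real^'n. \<forall>i\<in>I. \<forall>j\<in>I. B (E i) (E j) = (if i = j then 1 else 0)"
    if "finite I" for I :: "'n set"
    using that
  proof (induction I)
    case (insert a I)
    then obtain E where E: "\<forall>i\<in>I. \<forall>j\<in>I. B (E i) (E j) = (if i = j then 1 else 0)" by blast
    have "card (E ` I) \<le> card I" using insert(1) by (rule card_image_le)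
    also have "\<dots> < card (insert a I)" using insert by simp
    also have "\<dots> \<le> CARD('n)" by (rule card_mono) auto
    finally have "card (E ` I) < CARD('n)" .
    then have "dim (span (E ` I)) < DIM(real^'n)"
      using dim_le_card[of "E ` I" "E ` I"] insert(1) by (simp add: span_superset)
    then have "span (E ` I) \<noteq> UNIV" by (metis dim_UNIV less_irrefl)
    then obtain x where x: "x \<notin> span (E ` I)" by auto
    define y where "y = x - (\<Sum>i\<in>I. B x (E i) *\<^sub>R E i)"
    have "(\<Sum>i\<in>I. B x (E i) *\<^sub>R E i) \<in> span (E ` I)"
      by (intro span_sum span_scale span_base) auto
    then have "y \<noteq> 0" using x by (auto simp: y_def)
    then have yy: "B y y > 0" by (rule pos)
    have yE: "B y (E j) = 0" if "j \<in> I" for j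
    proof -
      have "B (\<Sum>i\<in>I. B x (E i) *\<^sub>R E i) (E j) = (\<Sum>i\<in>I. B x (E i) * (if i = j then 1 else 0))"
        using E that by (simp add: lsum lin)
      also have "\<dots> = B x (E j)"
        using insert(1) that by (simp add: if_distrib[of "\<lambda>x. _ * x"] cong: if_cong)
      finally show ?thesis by (simp add: y_def lin)
    qed
    define z where "z = (1 / sqrt (B y y)) *\<^sub>R y"
    have "B z z = 1" using yy by (simp add: z_def lin field_simps)
    moreover have "B z (E j) = 0" "B (E j) z = 0" if "j \<in> I" for j
      using yE[OF that] sym by (simp_all add: z_def lin)
    ultimately have "\<forall>i\<in>insert a I. \<forall>j\<in>insert a I. B ((E(a := z)) i) ((E(a := z)) j) = (if i = j then 1 else 0)"
      using E insert(2) by auto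
    then show ?case by blast
  qed simp
  then obtain E :: "'n \<Rightarrow> real^'n" where E: "\<And>i j. B (E i) (E j) = (if i = j then 1 else 0)"
    using ex[of UNIV] by auto
  have coef: "B (\<Sum>i\<in>UNIV. c i *\<^sub>R E i) (E j) = c j" for c j
    by (simp add: lsum lin E if_distrib[of "\<lambda>x. _ * x"] cong: if_cong)
  have inj: "inj E" using E by (metis injI zero_neq_one)
  \<comment> \<open>Pairing a linear relation with \<open>E j\<close> reads off its coefficient
    there, which gives independence; n independent vectors span, and the same pairing gives the
    coefficients of any vector.\<close>
  have "independent (range E)"
  proof (rule independent_if_scalars_zero)
    fix f x assume f: "(\<Sum>x\<in>range E. f x *\<^sub>R x) = 0" and "x \<in> range E"
    then obtain j where j: "x = E j" by blast
    have "(\<Sum>i\<in>UNIV. f (E i) *\<^sub>R E i) = 0"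
      using f by (simp add: sum.reindex[OF inj])
    then have "f (E j) = B 0 (E j)" using coef[of "\<lambda>i. f (E i)" j] by simp
    then show "f x = 0" using j bil by (simp add: bilinear_lzero)
  qed simp
  then have "span (range E) = UNIV"
    using inj by (metis card_image dim_UNIV DIM_cart DIM_real card_eq_dim dim_le_card' independent_imp_finite
        mult.right_neutral order_refl subset_UNIV top.extremum_uniqueI span_UNIV)
  then have "x \<in> span (range E)" for x by simp
  then have rep: "\<exists>c. x = (\<Sum>i\<in>UNIV. c i *\<^sub>R E i)" for x
  proof -
    have "x \<in> range (\<lambda>u. \<Sum>v\<in>range E. u v *\<^sub>R v)"
      using \<open>x \<in> span (range E)\<close> span_finite[of "range E"] by simp
    then show ?thesis by (auto simp: sum.reindex[OF inj])
  qed
  have "x = (\<Sum>i\<in>UNIV. B x (E i) *\<^sub>R E i)" for x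
    using rep[of x] coef by fastforce
  with E show thesis by (rule that)
qed

text \<open>The Gram matrix in the frame is P H P^T with the rows of P being the frame. Passing from
  the coordinate basis to an orthonormal frame thus only adds a constant to the logarithm of the
  determinant, so the differentiated equation may be read in the frame.\<close>

lemma det_change_frame:
  fixes B :: "real^'n \<Rightarrow> real^'n \<Rightarrow> real"
  assumes bil: "bilinear B"
  shows "det (\<chi> i j. B (E i) (E j)) = (det (\<chi> i. E i))\<^sup>2 * det (\<chi> i j. B (axis i 1) (axis j 1))"
proof -
  let ?P = "\<chi> i. E i" and ?H = "\<chi> i j. B (axis i 1) (axis j 1)"
  have "B (E i) (E j) = (?P ** ?H ** transpose ?P) $ i $ j" for i j
  proof -
    have "B (E i) (E j) = B (\<Sum>k\<in>UNIV. E i $ k *\<^sub>R axis k 1) (\<Sum>l\<in>UNIV. E j $ l *\<^sub>R axis l 1)"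
      using basis_expansion[of "E i"] basis_expansion[of "E j"] by (simp add: scalar_mult_eq_scaleR)
    also have "\<dots> = (\<Sum>(k,l)\<in>UNIV\<times>UNIV. B (E i $ k *\<^sub>R axis k 1) (E j $ l *\<^sub>R axis l 1))"
      by (rule bilinear_sum[OF bil])
    also have "\<dots> = (\<Sum>k\<in>UNIV. \<Sum>l\<in>UNIV. E i $ k * B (axis k 1) (axis l 1) * E j $ l)"
      by (simp add: sum.cartesian_product bilinear_lmul[OF bil] bilinear_rmul[OF bil] mult_ac split_def)
    also have "\<dots> = (\<Sum>l\<in>UNIV. \<Sum>k\<in>UNIV. E i $ k * B (axis k 1) (axis l 1) * E j $ l)"
      by (rule sum.swap)
    finally show ?thesis
      by (simp add: matrix_matrix_mult_def transpose_def sum_distrib_right)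
  qed
  then have "(\<chi> i j. B (E i) (E j)) = ?P ** ?H ** transpose ?P" by (simp add: vec_eq_iff)
  then show ?thesis by (simp add: det_mul det_transpose power2_eq_square)
qed

section \<open>Functions on a space with a development map\<close>

locale dev_map =
  fixes \<iota> :: "'a::t2_space \<Rightarrow> real^'n"
  assumes local_homeo: "\<And>p. \<exists>U. open U \<and> p \<in> U \<and> open (\<iota> ` U) \<and> inj_on \<iota> U \<and>
    continuous_on U \<iota> \<and> continuous_on (\<iota> ` U) (inv_into U \<iota>)"
begin

text \<open>Sections take the place of charts: a section is a piece of the inverse of
  \<open>\<iota>\<close>, i.e. affine coordinates on its image. No injectivity of
  \<open>\<iota>\<close> on a given set has to be assumed, which is what allows sections to be
  enlarged later.\<close>

definition is_section :: "(real^'n \<Rightarrow> 'a) \<Rightarrow> (real^'n) set \<Rightarrow> bool" where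
  "is_section \<tau> W \<longleftrightarrow> open W \<and> continuous_on W \<tau> \<and> (\<forall>x\<in>W. \<iota> (\<tau> x) = x)"

section \<open>Local sections of the development map\<close>

lemma is_section_subset: "is_section \<tau> W \<Longrightarrow> open V \<Longrightarrow> V \<subseteq> W \<Longrightarrow> is_section \<tau> V"
  by (auto simp: is_section_def intro: continuous_on_subset)

lemma section_right_inverse: "is_section \<tau> W \<Longrightarrow> x \<in> W \<Longrightarrow> \<iota> (\<tau> x) = x"
  by (simp add: is_section_def)

lemma continuous_dev: "continuous_on UNIV \<iota>"
proof -
  have "isCont \<iota> p" for p
    using local_homeo[of p] by (metis continuous_on_eq_continuous_at)
  then show ?thesis by (simp add: continuous_at_imp_continuous_on)
qed

text \<open>The uniqueness of lifts from covering theory: the set of agreement is open because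
  \<open>\<iota>\<close> is locally injective, and closed because the space is Hausdorff.\<close>

lemma dev_lift_unique:
  assumes C: "connected C" and f: "continuous_on C f" and g: "continuous_on C g"
    and eq: "\<And>x. x \<in> C \<Longrightarrow> \<iota> (f x) = \<iota> (g x)"
    and x0: "x0 \<in> C" "f x0 = g x0" and x: "x \<in> C"
  shows "f x = g x"
proof -
  let ?S = "{x\<in>C. f x = g x}"
  have "openin (top_of_set C) ?S"
  proof (subst openin_subopen, intro ballI)
    fix y assume y: "y \<in> ?S"
    obtain U where U: "open U" "f y \<in> U" "inj_on \<iota> U" using local_homeo by meson
    let ?T = "(C \<inter> f -` U) \<inter> (C \<inter> g -` U)"
    have "openin (top_of_set C) ?T"
      by (intro openin_Int continuous_openin_preimage_gen f g U)
    moreover have "y \<in> ?T" using y U by auto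
    moreover have "?T \<subseteq> ?S" using U(3) eq by (auto dest: inj_onD)
    ultimately show "\<exists>T. openin (top_of_set C) T \<and> y \<in> T \<and> T \<subseteq> ?S" by blast
  qed
  moreover have "openin (top_of_set C) (C - ?S)"
  proof (subst openin_subopen, intro ballI)
    fix y assume y: "y \<in> C - ?S"
    then obtain U V where U: "open U" "open V" "f y \<in> U" "g y \<in> V" "U \<inter> V = {}"
      using hausdorff[of "f y" "g y"] by auto
    let ?T = "(C \<inter> f -` U) \<inter> (C \<inter> g -` V)"
    have "openin (top_of_set C) ?T"
      by (intro openin_Int continuous_openin_preimage_gen f g U)
    moreover have "y \<in> ?T" using y U by auto
    moreover have "?T \<subseteq> C - ?S" using U(5) by force
    ultimately show "\<exists>T. openin (top_of_set C) T \<and> y \<in> T \<and> T \<subseteq> C - ?S" by blast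
  qed
  ultimately have "?S = {} \<or> ?S = C"
    using C unfolding connected_clopen closedin_def by force
  then show ?thesis using x0 x by blast
qed

lemma section_unique:
  assumes "is_section \<tau> W" "is_section \<sigma> V" "connected C" "C \<subseteq> W" "C \<subseteq> V"
    "x0 \<in> C" "\<tau> x0 = \<sigma> x0" "x \<in> C"
  shows "\<tau> x = \<sigma> x"
proof (rule dev_lift_unique[where C = C and f = \<tau> and g = \<sigma>, OF assms(3) _ _ _ assms(6,7,8)])
  show "continuous_on C \<tau>" "continuous_on C \<sigma>"
    using assms(1,2,4,5) continuous_on_subset by (metis is_section_def)+
  show "\<iota> (\<tau> x) = \<iota> (\<sigma> x)" if "x \<in> C" for x
    using assms(1,2,4,5) that section_right_inverse by (metis subsetD)
qed

lemma local_section: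
  assumes "open V" "p \<in> V"
  obtains r \<tau> where "r > 0" "is_section \<tau> (ball (\<iota> p) r)" "\<tau> (\<iota> p) = p" "\<tau> ` ball (\<iota> p) r \<subseteq> V"
proof -
  obtain U where U: "open U" "p \<in> U" "open (\<iota> ` U)" "inj_on \<iota> U"
    "continuous_on (\<iota> ` U) (inv_into U \<iota>)" using local_homeo by meson
  let ?\<tau> = "inv_into U \<iota>"
  have "open (\<iota> ` U \<inter> ?\<tau> -` V)"
    using U assms by (intro continuous_open_preimage)
  moreover have "\<iota> p \<in> \<iota> ` U \<inter> ?\<tau> -` V" using U assms by auto
  ultimately obtain r where r: "r > 0" "ball (\<iota> p) r \<subseteq> \<iota> ` U \<inter> ?\<tau> -` V"
    using open_contains_ball by blast
  have "is_section ?\<tau> (ball (\<iota> p) r)"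
    using r U(5) by (auto simp: is_section_def subset_iff f_inv_into_f intro: continuous_on_subset)
  then show thesis using that[of r ?\<tau>] r U by auto
qed

lemma dev_open_map: "open V \<Longrightarrow> open (\<iota> ` V)"
proof (subst open_contains_ball, intro ballI)
  fix y assume "open V" "y \<in> \<iota> ` V"
  then obtain p where p: "p \<in> V" "y = \<iota> p" by blast
  obtain r \<tau> where r: "r > 0" "is_section \<tau> (ball (\<iota> p) r)" "\<tau> ` ball (\<iota> p) r \<subseteq> V"
    by (rule local_section[OF \<open>open V\<close> p(1)])
  have "x \<in> \<iota> ` V" if "x \<in> ball y r" for x
  proof -
    have x: "x \<in> ball (\<iota> p) r" using that p(2) by simp
    have "\<tau> x \<in> V" using r(3) x by blast
    then have "\<iota> (\<tau> x) \<in> \<iota> ` V" by (rule imageI)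
    then show ?thesis using section_right_inverse[OF r(2) x] by simp
  qed
  then show "\<exists>e>0. ball y e \<subseteq> \<iota> ` V" using r(1) by blast
qed

text \<open>On a neighbourhood where \<open>\<iota>\<close> is injective, a section is a two-sided
  inverse, so points \<open>q\<close> near \<open>\<tau> x\<close> satisfy
  \<open>\<tau> (\<iota> q) = q\<close>.\<close>

lemma section_open_image:
  assumes "is_section \<tau> W" shows "open (\<tau> ` W)"
proof (subst open_subopen, intro ballI)
  fix p assume "p \<in> \<tau> ` W"
  then obtain x where x: "x \<in> W" "p = \<tau> x" by blast
  obtain U where U: "open U" "p \<in> U" "inj_on \<iota> U" using local_homeo by meson
  let ?W = "W \<inter> \<tau> -` U" and ?V = "U \<inter> \<iota> -` (W \<inter> \<tau> -` U)"
  have "open ?W"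
    using assms U by (intro continuous_open_preimage) (auto simp: is_section_def)
  then have "open ?V"
    by (rule open_Int[OF U(1) open_vimage[OF _ continuous_dev]])
  moreover have "p \<in> ?V" using U x assms by (auto simp: is_section_def)
  moreover have "?V \<subseteq> \<tau> ` W"
  proof
    fix q assume q: "q \<in> ?V"
    then have "\<tau> (\<iota> q) = q" using assms U(3) by (auto simp: is_section_def dest: inj_onD)
    then show "q \<in> \<tau> ` W" using q by force
  qed
  ultimately show "\<exists>T. open T \<and> p \<in> T \<and> T \<subseteq> \<tau> ` W" by blast
qed

lemma inv_into_section:
  assumes "open U" "inj_on \<iota> U" shows "is_section (inv_into U \<iota>) (\<iota> ` U)"
proof -
  have "continuous_on (\<iota> ` U) (inv_into U \<iota>)"
  proof (subst continuous_on_open_vimage[OF dev_open_map[OF assms(1)]], intro allI impI)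
    fix V :: "'a set" assume "open V"
    then have "open (\<iota> ` (U \<inter> V))" using assms dev_open_map by blast
    moreover have "inv_into U \<iota> -` V \<inter> \<iota> ` U = \<iota> ` (U \<inter> V)" using assms(2) by auto
    ultimately show "open (inv_into U \<iota> -` V \<inter> \<iota> ` U)" by simp
  qed
  then show ?thesis using assms dev_open_map by (auto simp: is_section_def f_inv_into_f)
qed

text \<open>The neighbourhood inside \<open>local_inverse\<close> is an arbitrary choice; all that
  is ever used of it is recorded here.\<close>

lemma local_inverse_section:
  "\<exists>W. is_section (local_inverse \<iota> p) W \<and> \<iota> p \<in> W \<and> local_inverse \<iota> p (\<iota> p) = p"
proof -
  define U where "U = (SOME U. open U \<and> p \<in> U \<and> inj_on \<iota> U)"
  have "\<exists>U. open U \<and> p \<in> U \<and> inj_on \<iota> U" using local_homeo by meson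
  then have "open U \<and> p \<in> U \<and> inj_on \<iota> U" unfolding U_def by (rule someI_ex)
  then show ?thesis
    using inv_into_section[of U] by (auto simp: local_inverse_def U_def[symmetric] intro!: exI[of _ "\<iota> ` U"])
qed

section \<open>Smooth functions and derivatives in affine coordinates\<close>

definition smooth_fun :: "('a \<Rightarrow> real) \<Rightarrow> bool" where
  "smooth_fun f \<longleftrightarrow> (\<forall>\<tau> W. is_section \<tau> W \<longrightarrow> smooth_on W (f \<circ> \<tau>))"

text \<open>The derivative along the parallel vector field with constant components
  \<open>w\<close>; for \<open>w = axis i 1\<close> it is the partial derivative of the
  problem.\<close>

definition dd :: "real^'n \<Rightarrow> ('a \<Rightarrow> real) \<Rightarrow> 'a \<Rightarrow> real" where
  "dd w f p = frechet_derivative (f \<circ> local_inverse \<iota> p) (at (\<iota> p)) w"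

lemma sections_agree_near:
  assumes "is_section \<tau> W" "x \<in> W" "is_section \<sigma> V" "x \<in> V" "\<tau> x = \<sigma> x"
  obtains r where "r > 0" "ball x r \<subseteq> W" "ball x r \<subseteq> V" "\<And>y. y \<in> ball x r \<Longrightarrow> \<tau> y = \<sigma> y"
proof -
  have "open (W \<inter> V)" using assms by (auto simp: is_section_def)
  then obtain r where r: "r > 0" "ball x r \<subseteq> W \<inter> V" using assms open_contains_ball by blast
  then show thesis
    using section_unique[OF assms(1,3) connected_ball, of x r x] assms
    by (intro that[of r]) auto
qed

text \<open>Two sections through the same point agree on a ball around it, so any section through
  the point computes the derivative.\<close>

lemma dd_section:
  assumes "is_section \<tau> W" "x \<in> W"
  shows "dd w f (\<tau> x) = frechet_derivative (f \<circ> \<tau>) (at x) w"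
proof -
  have x: "\<iota> (\<tau> x) = x" using assms by (simp add: is_section_def)
  obtain V where V: "is_section (local_inverse \<iota> (\<tau> x)) V" "x \<in> V" "local_inverse \<iota> (\<tau> x) x = \<tau> x"
    using local_inverse_section[of "\<tau> x"] x by auto
  obtain r where r: "r > 0" "\<And>y. y \<in> ball x r \<Longrightarrow> \<tau> y = local_inverse \<iota> (\<tau> x) y"
    by (rule sections_agree_near[OF assms V(1,2) V(3)[symmetric]]) blast
  have "frechet_derivative (f \<circ> local_inverse \<iota> (\<tau> x)) (at x) = frechet_derivative (f \<circ> \<tau>) (at x)"
  proof (rule frechet_derivative_cong_open[OF open_ball])
    show "x \<in> ball x r" using r(1) by simp
    show "(f \<circ> local_inverse \<iota> (\<tau> x)) y = (f \<circ> \<tau>) y" if "y \<in> ball x r" for y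
      unfolding comp_apply by (rule arg_cong[OF r(2)[OF that, symmetric]])
  qed
  then show ?thesis unfolding dd_def x by simp
qed

lemma smooth_fun_has_derivative:
  assumes "smooth_fun f" "is_section \<tau> W" "x \<in> W"
  shows "((f \<circ> \<tau>) has_derivative (\<lambda>w. dd w f (\<tau> x))) (at x)"
proof -
  have "((f \<circ> \<tau>) has_derivative frechet_derivative (f \<circ> \<tau>) (at x)) (at x)"
    using assms by (auto simp: smooth_fun_def intro!: smooth_on_imp_has_derivative)
  moreover have "frechet_derivative (f \<circ> \<tau>) (at x) = (\<lambda>w. dd w f (\<tau> x))"
    using dd_section[OF assms(2,3)] by auto
  ultimately show ?thesis by simp
qed

lemma section_through:
  obtains \<tau> W x where "is_section \<tau> W" "x \<in> W" "\<tau> x = p"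
proof -
  obtain W where "is_section (local_inverse \<iota> p) W \<and> \<iota> p \<in> W \<and> local_inverse \<iota> p (\<iota> p) = p"
    using local_inverse_section by (rule exE)
  then show thesis by (elim conjE) (rule that)
qed

lemma smooth_fun_dd: "smooth_fun f \<Longrightarrow> smooth_fun (dd w f)"
  unfolding smooth_fun_def
proof (intro allI impI)
  fix \<tau> W assume f: "\<forall>\<tau> W. is_section \<tau> W \<longrightarrow> smooth_on W (f \<circ> \<tau>)" and \<tau>: "is_section \<tau> W"
  have "smooth_on W (f \<circ> \<tau>)" using f \<tau> by blast
  then have "smooth_on W (\<lambda>x. frechet_derivative (f \<circ> \<tau>) (at x) w)"
    by (rule smooth_on_frechet_derivative)
  moreover have "open W" using \<tau> by (simp add: is_section_def)
  ultimately show "smooth_on W (dd w f \<circ> \<tau>)"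
    by (rule smooth_on_cong[rotated 2]) (simp add: dd_section[OF \<tau>])
qed

text \<open>Smoothness is tested on all sections, but germs of sections at a point are unique, so
  one section through each point decides.\<close>

lemma smooth_funI:
  assumes "\<And>p. \<exists>\<tau> W. is_section \<tau> W \<and> \<iota> p \<in> W \<and> \<tau> (\<iota> p) = p \<and> smooth_on W (f \<circ> \<tau>)"
  shows "smooth_fun f"
  unfolding smooth_fun_def
proof (intro allI impI smooth_on_local)
  fix \<sigma> V x assume \<sigma>: "is_section \<sigma> V" and x: "x \<in> V"
  obtain \<tau> W where \<tau>: "is_section \<tau> W" "x \<in> W" "\<tau> x = \<sigma> x" "smooth_on W (f \<circ> \<tau>)"
    using assms[of "\<sigma> x"] section_right_inverse[OF \<sigma> x] by auto
  obtain r where r: "r > 0" "ball x r \<subseteq> W" "\<And>y. y \<in> ball x r \<Longrightarrow> \<tau> y = \<sigma> y"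
    by (rule sections_agree_near[OF \<tau>(1,2) \<sigma> x \<tau>(3)]) blast
  have "smooth_on (ball x r) (f \<circ> \<sigma>)"
    by (rule smooth_on_cong[OF open_ball _ smooth_on_subset[OF \<tau>(4) r(2)]]) (simp add: r(3))
  then show "\<exists>T. open T \<and> x \<in> T \<and> smooth_on T (f \<circ> \<sigma>)" using r(1) by (intro exI[of _ "ball x r"]) auto
qed

lemma smooth_fun_add: "smooth_fun f \<Longrightarrow> smooth_fun g \<Longrightarrow> smooth_fun (\<lambda>p. f p + g p)"
  by (simp add: smooth_fun_def comp_def is_section_def smooth_on_add)

lemma smooth_fun_mult: "smooth_fun f \<Longrightarrow> smooth_fun g \<Longrightarrow> smooth_fun (\<lambda>p. f p * g p)"
  by (simp add: smooth_fun_def comp_def is_section_def smooth_on_mult)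

lemma smooth_fun_const: "smooth_fun (\<lambda>p. c)"
  by (simp add: smooth_fun_def comp_def smooth_on_const)

lemma smooth_fun_linear:
  assumes "bounded_linear l" shows "smooth_fun (\<lambda>p. l (\<iota> p))"
  unfolding smooth_fun_def
proof (intro allI impI)
  fix \<tau> W assume "is_section \<tau> W"
  then have "open W" "\<And>x. x \<in> W \<Longrightarrow> l x = ((\<lambda>p. l (\<iota> p)) \<circ> \<tau>) x"
    by (simp_all add: is_section_def)
  then show "smooth_on W ((\<lambda>p. l (\<iota> p)) \<circ> \<tau>)"
    by (rule smooth_on_cong[OF _ _ smooth_on_bounded_linear[OF assms]])
qed

lemma dd_unique:
  assumes "is_section \<tau> W" "x \<in> W" "((f \<circ> \<tau>) has_derivative f') (at x)"
  shows "dd w f (\<tau> x) = f' w"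
  by (simp only: dd_section[OF assms(1,2)] frechet_derivative_at[OF assms(3), symmetric])

lemma dd_add:
  assumes "smooth_fun f" "smooth_fun g"
  shows "dd w (\<lambda>p. f p + g p) p = dd w f p + dd w g p"
proof -
  obtain \<tau> W x where \<tau>: "is_section \<tau> W" "x \<in> W" "\<tau> x = p" by (rule section_through)
  have "((\<lambda>x. (f \<circ> \<tau>) x + (g \<circ> \<tau>) x) has_derivative (\<lambda>w. dd w f (\<tau> x) + dd w g (\<tau> x))) (at x)"
    by (intro has_derivative_add smooth_fun_has_derivative[OF _ \<tau>(1,2)] assms)
  then have "((\<lambda>p. f p + g p) \<circ> \<tau> has_derivative (\<lambda>w. dd w f (\<tau> x) + dd w g (\<tau> x))) (at x)"
    by (simp add: comp_def)
  from dd_unique[OF \<tau>(1,2) this] show ?thesis by (simp only: \<tau>(3))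
qed

lemma dd_mult:
  assumes "smooth_fun f" "smooth_fun g"
  shows "dd w (\<lambda>p. f p * g p) p = f p * dd w g p + dd w f p * g p"
proof -
  obtain \<tau> W x where \<tau>: "is_section \<tau> W" "x \<in> W" "\<tau> x = p" by (rule section_through)
  have "((\<lambda>x. (f \<circ> \<tau>) x * (g \<circ> \<tau>) x) has_derivative
      (\<lambda>w. (f \<circ> \<tau>) x * dd w g (\<tau> x) + dd w f (\<tau> x) * (g \<circ> \<tau>) x)) (at x)"
    by (intro has_derivative_mult smooth_fun_has_derivative[OF _ \<tau>(1,2)] assms)
  then have "((\<lambda>p. f p * g p) \<circ> \<tau> has_derivative
      (\<lambda>w. f (\<tau> x) * dd w g (\<tau> x) + dd w f (\<tau> x) * g (\<tau> x))) (at x)"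
    by (simp add: comp_def)
  from dd_unique[OF \<tau>(1,2) this] show ?thesis by (simp only: \<tau>(3))
qed

lemma dd_const: "dd w (\<lambda>p. c) p = 0"
  by (simp add: dd_def comp_def frechet_derivative_const)

lemma dd_cmult: "smooth_fun f \<Longrightarrow> dd w (\<lambda>p. c * f p) p = c * dd w f p"
  using dd_mult[OF smooth_fun_const, of f w c p] by (simp add: dd_const)

lemma dd_linear_coord:
  assumes "bounded_linear l" shows "dd w (\<lambda>p. l (\<iota> p)) p = l w"
proof -
  obtain \<tau> W x where \<tau>: "is_section \<tau> W" "x \<in> W" "\<tau> x = p" by (rule section_through)
  have "(l has_derivative l) (at x)" using assms by (rule bounded_linear_imp_has_derivative)
  then have "(((\<lambda>p. l (\<iota> p)) \<circ> \<tau>) has_derivative l) (at x)"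
    by (subst has_derivative_cong_open[of W x _ l]) (use \<tau> in \<open>auto simp: is_section_def\<close>)
  from dd_unique[OF \<tau>(1,2) this] show ?thesis by (simp only: \<tau>(3))
qed

lemma linear_dd: "smooth_fun f \<Longrightarrow> linear (\<lambda>w. dd w f p)"
proof -
  assume f: "smooth_fun f"
  obtain \<tau> W x where \<tau>: "is_section \<tau> W" "x \<in> W" "\<tau> x = p" by (rule section_through)
  show ?thesis using has_derivative_linear[OF smooth_fun_has_derivative[OF f \<tau>(1,2)]] \<tau>(3) by simp
qed

lemma dd_dir_add: "smooth_fun f \<Longrightarrow> dd (a + b) f = (\<lambda>p. dd a f p + dd b f p)"
  using linear_add[OF linear_dd] by blast

lemma dd_dir_scale: "smooth_fun f \<Longrightarrow> dd (c *\<^sub>R a) f = (\<lambda>p. c * dd a f p)"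
  using linear_scale[OF linear_dd] by fastforce

text \<open>The symmetry of second derivatives, read through a section. It makes the higher
  derivatives of \<open>u\<close> in parallel directions totally symmetric, the fact behind every
  rearrangement at the maximum point.\<close>

lemma dd_commute: "smooth_fun f \<Longrightarrow> dd a (dd b f) = dd b (dd a f)"
proof
  fix p assume f: "smooth_fun f"
  obtain \<tau> W x where \<tau>: "is_section \<tau> W" "x \<in> W" "\<tau> x = p" by (rule section_through)
  have W: "open W" using \<tau> by (simp add: is_section_def)
  have *: "dd a (dd b f) p = frechet_derivative (\<lambda>y. frechet_derivative (f \<circ> \<tau>) (at y) b) (at x) a" for a b
    unfolding \<tau>(3)[symmetric] dd_section[OF \<tau>(1,2)]
    by (subst frechet_derivative_cong_open[OF W \<tau>(2), of _ "\<lambda>y. frechet_derivative (f \<circ> \<tau>) (at y) b"])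
      (auto simp: dd_section[OF \<tau>(1)])
  show "dd a (dd b f) p = dd b (dd a f) p"
    unfolding * using f \<tau>(1,2) W by (intro frechet_derivative_commute[of W]) (auto simp: smooth_fun_def)
qed

lemma dd_along_line:
  assumes "smooth_fun f" "is_section \<tau> W" "x + s *\<^sub>R w \<in> W"
  shows "((\<lambda>s. f (\<tau> (x + s *\<^sub>R w))) has_real_derivative dd w f (\<tau> (x + s *\<^sub>R w))) (at s)"
  using has_real_derivative_along_line[OF smooth_fun_has_derivative[OF assms]] by (simp add: comp_def)

lemma smooth_fun_continuous_section:
  "smooth_fun f \<Longrightarrow> is_section \<tau> W \<Longrightarrow> continuous_on W (\<lambda>x. f (\<tau> x))"
  by (simp add: smooth_fun_def comp_def smooth_on_imp_continuous_on)

lemma partial_deriv_dd: "partial_deriv \<iota> i f = dd (axis i 1) f"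
  by (simp add: partial_deriv_def dd_def fun_eq_iff)

end

section \<open>The cubic form at a maximum\<close>

text \<open>\<open>A\<close> stands for the cubic form on a moving vector and \<open>P\<close> for
  its squared length. The exponent -3/2 makes the ratio homogeneous of degree 0, so the vector need
  not stay of unit length along the variation. The numbers 3 = 2 * 3/2 and 15/4 = 3/2 * 5/2 come
  from differentiating the power twice.\<close>

lemma weighted_ratio_local_max:
  fixes A A1 P P1 q q1 :: "real \<Rightarrow> real"
  assumes \<delta>: "\<delta> > 0"
    and A1: "\<And>s. \<bar>s\<bar> < \<delta> \<Longrightarrow> (A has_real_derivative A1 s) (at s)" and A2: "(A1 has_real_derivative A2) (at 0)"
    and P1: "\<And>s. \<bar>s\<bar> < \<delta> \<Longrightarrow> (P has_real_derivative P1 s) (at s)" and P2: "(P1 has_real_derivative P2) (at 0)"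
    and q1: "\<And>s. \<bar>s\<bar> < \<delta> \<Longrightarrow> (q has_real_derivative q1 s) (at s)" and q2: "(q1 has_real_derivative q2) (at 0)"
    and pos: "\<And>s. \<bar>s\<bar> < \<delta> \<Longrightarrow> P s > 0" and one: "P 0 = 1"
    and max: "\<And>s. \<bar>s\<bar> < \<delta> \<Longrightarrow> A s * P s powr (-3/2) - k * q s \<le> A 0 - k * q 0"
  shows "A1 0 - 3/2 * A 0 * P1 0 - k * q1 0 = 0"
    and "A2 - 3 * A1 0 * P1 0 + A 0 * (15/4 * (P1 0)\<^sup>2 - 3/2 * P2) - k * q2 \<le> 0"
proof -
  define h1 where "h1 s = A1 s * P s powr (-3/2) + (-3/2 * P s powr (-5/2) * P1 s) * A s - k * q1 s" for s
  have pw: "((\<lambda>s. P s powr r) has_real_derivative r * P s powr (r - 1) * P1 s) (at s)" if "\<bar>s\<bar> < \<delta>" for s r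
    using DERIV_fun_powr[OF P1[OF that] pos[OF that], of r] by simp
  have h1: "((\<lambda>s. A s * P s powr (-3/2) - k * q s) has_real_derivative h1 s) (at s)" if "\<bar>s\<bar> < \<delta>" for s
    unfolding h1_def using pw[OF that, of "-3/2"]
    by (intro DERIV_diff DERIV_mult DERIV_cmult A1 q1 that) simp
  have "(h1 has_real_derivative
      (A2 * P 0 powr (-3/2) + (-3/2 * P 0 powr (-5/2) * P1 0) * A1 0)
      + ((-3/2 * (-5/2 * P 0 powr (-7/2) * P1 0) * P1 0 + P2 * (-3/2 * P 0 powr (-5/2))) * A 0
         + A1 0 * (-3/2 * P 0 powr (-5/2) * P1 0)) - k * q2) (at 0)"
    unfolding h1_def using pw[of 0 "-3/2"] pw[of 0 "-5/2"] \<delta>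
    by (intro DERIV_diff DERIV_add DERIV_mult DERIV_cmult A1 A2 P2 q2) simp_all
  from second_derivative_at_local_max[OF \<delta> h1 this] max one
  have *: "h1 0 = 0" "(A2 * P 0 powr (-3/2) + (-3/2 * P 0 powr (-5/2) * P1 0) * A1 0)
      + ((-3/2 * (-5/2 * P 0 powr (-7/2) * P1 0) * P1 0 + P2 * (-3/2 * P 0 powr (-5/2))) * A 0
         + A1 0 * (-3/2 * P 0 powr (-5/2) * P1 0)) - k * q2 \<le> 0"
    by simp_all
  show "A1 0 - 3/2 * A 0 * P1 0 - k * q1 0 = 0"
    using *(1) by (simp add: h1_def one algebra_simps)
  show "A2 - 3 * A1 0 * P1 0 + A 0 * (15/4 * (P1 0)\<^sup>2 - 3/2 * P2) - k * q2 \<le> 0"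
    using *(2) by (simp add: one algebra_simps power2_eq_square)
qed

locale hessian_potential_locale = dev_map \<iota> for \<iota> :: "'a::t2_space \<Rightarrow> real^'n" +
  fixes u :: "'a \<Rightarrow> real"
  assumes smooth_u: "smooth_fun u"
    and hess_pos: "\<And>a p. a \<noteq> 0 \<Longrightarrow> dd a (dd a u) p > 0"
begin

definition G :: "'a \<Rightarrow> real^'n \<Rightarrow> real^'n \<Rightarrow> real" where
  "G p a b = dd a (dd b u) p"

text \<open>The cubic form D^3 u. It is the derivative of \<open>G\<close> in affine coordinates,
  and its half is the Christoffel symbol of the first kind of \<open>G\<close>.\<close>

definition C :: "'a \<Rightarrow> real^'n \<Rightarrow> real^'n \<Rightarrow> real^'n \<Rightarrow> real" where
  "C p a b c = dd a (dd b (dd c u)) p"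

lemmas smooths = smooth_u smooth_fun_dd

lemma G_pos: "a \<noteq> 0 \<Longrightarrow> G p a a > 0"
  by (simp add: G_def hess_pos)

lemma G_sym: "G p a b = G p b a"
  by (simp add: G_def dd_commute[OF smooth_u, of a b])

lemma linear_G: "linear (\<lambda>a. G p a b)"
  by (simp add: G_def linear_dd smooths)

lemma bilinear_G: "bilinear (G p)"
  unfolding bilinear_def using linear_G by (simp add: G_sym[of p _ ] linear_G) (metis (no_types) G_sym ext linear_G)

lemmas G_bilin = bilinear_ladd[OF bilinear_G] bilinear_radd[OF bilinear_G] bilinear_lmul[OF bilinear_G]
  bilinear_rmul[OF bilinear_G] bilinear_lsub[OF bilinear_G] bilinear_rsub[OF bilinear_G]
  bilinear_lzero[OF bilinear_G] bilinear_rzero[OF bilinear_G]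

lemma G_nonneg: "G p a a \<ge> 0"
  using G_pos[of a p] by (cases "a = 0") (auto simp: G_bilin)

lemma C_sym12: "C p a b c = C p b a c"
  by (simp add: C_def dd_commute[of "dd c u" a b] smooths)

lemma C_sym23: "C p a b c = C p a c b"
  by (simp add: C_def dd_commute[of u b c] smooths)

lemma linear_C1: "linear (\<lambda>a. C p a b c)"
  by (simp add: C_def linear_dd smooths)

lemma linear_C2: "linear (\<lambda>b. C p a b c)"
  using linear_C1[of p a c] by (simp add: C_sym12[of p a])

lemma linear_C3: "linear (\<lambda>c. C p a b c)"
  using linear_C2[of p a b] by (simp add: C_sym23[of p a b])

lemmas C_lin = linear_add[OF linear_C1] linear_add[OF linear_C2] linear_add[OF linear_C3]
  linear_diff[OF linear_C1] linear_diff[OF linear_C2] linear_diff[OF linear_C3]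
  linear_scale[OF linear_C1, simplified] linear_scale[OF linear_C2, simplified] linear_scale[OF linear_C3, simplified]
  linear_0[OF linear_C1] linear_0[OF linear_C2] linear_0[OF linear_C3]
  linear_neg[OF linear_C1] linear_neg[OF linear_C2] linear_neg[OF linear_C3]

lemma G_line:
  assumes "is_section \<tau> W" "x + s *\<^sub>R w \<in> W"
  shows "((\<lambda>s. G (\<tau> (x + s *\<^sub>R w)) a b) has_real_derivative C (\<tau> (x + s *\<^sub>R w)) w a b) (at s)"
  unfolding G_def C_def by (intro dd_along_line[OF _ assms] smooths)

section \<open>Bounds on the cubic form and their polarization\<close>

definition cubic_bound :: "'a \<Rightarrow> real \<Rightarrow> bool" where
  "cubic_bound p m \<longleftrightarrow> (\<forall>e. C p e e e \<le> m * sqrt (G p e e) ^ 3)"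

text \<open>The cubic form is odd in \<open>e\<close>, so an upper bound on all vectors is
  two-sided.\<close>

lemma cubic_bound_abs:
  assumes "cubic_bound p m" shows "\<bar>C p e e e\<bar> \<le> m * sqrt (G p e e) ^ 3"
proof -
  have "C p e e e \<le> m * sqrt (G p e e) ^ 3" "C p (- e) (- e) (- e) \<le> m * sqrt (G p (- e) (- e)) ^ 3"
    using assms unfolding cubic_bound_def by blast+
  moreover have "G p (- e) (- e) = G p e e"
    using G_bilin(3)[of p "-1" e] G_bilin(4)[of p _ "-1" e] by simp
  ultimately show ?thesis by (simp add: C_lin abs_le_iff)
qed

text \<open>With \<open>C(e)\<close> short for \<open>C p e e e\<close>, polarization gives
  \<open>C(a+b) + C(a-b) - 2 C(a) = 6 C p a b b\<close>. The vectors \<open>a + b\<close> and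
  \<open>a - b\<close> have length at most 2, so the left side is at most 8m + 8m + 2m, whence the
  factor 3.\<close>

lemma cubic_bound_polarized_unit:
  assumes "cubic_bound p m" "m \<ge> 0" "G p a a = 1" "G p b b = 1"
  shows "\<bar>C p a b b\<bar> \<le> 3 * m"
proof -
  have ab: "\<bar>G p a b\<bar> \<le> 1"
    using G_nonneg[of p "a + b"] G_nonneg[of p "a - b"] assms(3,4) G_sym[of p b a] by (simp add: G_bilin)
  have le: "\<bar>C p e e e\<bar> \<le> 8 * m" if "G p e e \<le> 4" for e
  proof -
    have "sqrt (G p e e) \<le> sqrt 4" using that by (rule real_sqrt_le_mono)
    then have "sqrt (G p e e) ^ 3 \<le> 2 ^ 3" by (intro power_mono) (auto simp: G_nonneg)
    then have "m * sqrt (G p e e) ^ 3 \<le> m * 8" using assms(2) by (intro mult_left_mono) auto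
    then show ?thesis using cubic_bound_abs[OF assms(1), of e] by simp
  qed
  have "\<bar>C p (a+b) (a+b) (a+b)\<bar> \<le> 8 * m" "\<bar>C p (a-b) (a-b) (a-b)\<bar> \<le> 8 * m"
    using ab assms(3,4) G_sym[of p b a] by (intro le; simp add: G_bilin)+
  moreover have "\<bar>C p a a a\<bar> \<le> m" using cubic_bound_abs[OF assms(1), of a] assms(3) by simp
  moreover have "C p (a+b) (a+b) (a+b) + C p (a-b) (a-b) (a-b) - 2 * C p a a a = 6 * C p a b b"
  proof -
    have "C p b a b = C p a b b" "C p b b a = C p a b b"
      using C_sym12[of p b a b] C_sym12 C_sym23 by metis+
    then show ?thesis by (simp add: C_lin)
  qed
  ultimately show ?thesis by linarith
qed

lemma cubic_bound_polarized:
  assumes "cubic_bound p m" "m \<ge> 0"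
  shows "\<bar>C p a b b\<bar> \<le> 3 * m * sqrt (G p a a) * G p b b"
proof (cases "a = 0 \<or> b = 0")
  case True
  then show ?thesis by (auto simp: C_lin G_bilin)
next
  case False
  then have pos: "G p a a > 0" "G p b b > 0" by (auto intro: G_pos)
  define \<alpha> \<beta> where "\<alpha> = sqrt (G p a a)" and "\<beta> = sqrt (G p b b)"
  have ab: "\<alpha> > 0" "\<beta> > 0" "\<alpha>\<^sup>2 = G p a a" "\<beta>\<^sup>2 = G p b b" using pos by (simp_all add: \<alpha>_def \<beta>_def)
  have "\<bar>C p ((1/\<alpha>) *\<^sub>R a) ((1/\<beta>) *\<^sub>R b) ((1/\<beta>) *\<^sub>R b)\<bar> \<le> 3 * m"
    using ab pos by (intro cubic_bound_polarized_unit assms) (simp_all add: G_bilin power2_eq_square[symmetric] field_simps)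
  then have "\<bar>C p a b b\<bar> / (\<alpha> * \<beta> * \<beta>) \<le> 3 * m"
    using ab by (simp add: C_lin abs_mult mult_ac)
  then have "\<bar>C p a b b\<bar> \<le> 3 * m * (\<alpha> * \<beta> * \<beta>)"
    using ab by (simp add: divide_le_eq)
  then show ?thesis using ab by (simp add: \<alpha>_def[symmetric] mult.assoc power2_eq_square[symmetric])
qed

lemma frame_at:
  obtains E :: "'n \<Rightarrow> real^'n" where "\<And>i j. G p (E i) (E j) = (if i = j then 1 else 0)"
    and "\<And>x. x = (\<Sum>i\<in>UNIV. G p x (E i) *\<^sub>R E i)"
proof (rule orthonormal_frame_exists[of "G p"])
  show "bilinear (G p)" by (rule bilinear_G)
qed (use that in \<open>auto simp: G_pos G_sym\<close>)

text \<open>Point and vector move together, along \<open>x0 + s *\<^sub>R w\<close> and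
  \<open>e + s *\<^sub>R a\<close>, with \<open>w\<close> and \<open>a\<close> free. Later
  \<open>w = 0\<close> gives the conditions at a fixed point, \<open>a = 0\<close> the drift
  identity, and parallel transport for \<open>a\<close> the main inequality.\<close>

lemma variation_at_max:
  assumes \<tau>: "is_section \<tau> W" and r: "r > 0" "ball x0 r \<subseteq> W" and e: "G (\<tau> x0) e e = 1"
    and Q: "bilinear Q" "\<And>x y. Q x y = Q y x"
    and max: "\<And>x e'. x \<in> ball x0 r \<Longrightarrow> e' \<noteq> 0 \<Longrightarrow>
      C (\<tau> x) e' e' e' * G (\<tau> x) e' e' powr (-3/2) - k * Q (x - xq) (x - xq)
      \<le> C (\<tau> x0) e e e - k * Q (x0 - xq) (x0 - xq)"
  defines "p \<equiv> \<tau> x0"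
  shows "(dd w (dd e (dd e (dd e u))) p + 3 * C p a e e) - 3/2 * C p e e e * (C p w e e + 2 * G p a e)
      - k * (2 * Q w (x0 - xq)) = 0" (is ?first)
    and "(dd w (dd w (dd e (dd e (dd e u)))) p + 6 * dd w (dd a (dd e (dd e u))) p + 6 * C p a a e)
      - 3 * (dd w (dd e (dd e (dd e u))) p + 3 * C p a e e) * (C p w e e + 2 * G p a e)
      + C p e e e * (15/4 * (C p w e e + 2 * G p a e)\<^sup>2
         - 3/2 * (dd w (dd w (dd e (dd e u))) p + 4 * C p w a e + 2 * G p a a))
      - k * (2 * Q w w) \<le> 0" (is ?second)
proof -
  have e0: "e \<noteq> 0" using e by (auto simp: G_bilin)
  obtain \<delta> where \<delta>: "\<delta> > 0" "\<And>s. \<bar>s\<bar> < \<delta> \<Longrightarrow> x0 + s *\<^sub>R w \<in> ball x0 r \<and> e + s *\<^sub>R a \<noteq> 0"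
  proof -
    have "isCont (\<lambda>s. x0 + s *\<^sub>R w) 0" "isCont (\<lambda>s. e + s *\<^sub>R a) 0" by (intro continuous_intros)+
    then obtain d1 d2 where d: "d1 > 0" "d2 > 0" "\<And>s. dist s 0 < d1 \<Longrightarrow> dist (x0 + s *\<^sub>R w) (x0 + 0 *\<^sub>R w) < r"
      "\<And>s. dist s 0 < d2 \<Longrightarrow> dist (e + s *\<^sub>R a) (e + 0 *\<^sub>R a) < norm e"
      using r(1) e0 unfolding continuous_at_eps_delta by (metis zero_less_norm_iff)
    show thesis
    proof (rule that[of "min d1 d2"])
      fix s :: real assume s: "\<bar>s\<bar> < min d1 d2"
      have "dist (x0 + s *\<^sub>R w) x0 < r" using d(3)[of s] s by simp
      moreover have "dist (e + s *\<^sub>R a) e < norm e" using d(4)[of s] s by simp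
      ultimately show "x0 + s *\<^sub>R w \<in> ball x0 r \<and> e + s *\<^sub>R a \<noteq> 0"
        by (auto simp: dist_commute)
    qed (use d in auto)
  qed
  define y where "y s = \<tau> (x0 + s *\<^sub>R w)" for s
  have y0: "y 0 = p" by (simp add: y_def p_def)
  have inW: "x0 + s *\<^sub>R w \<in> W" if "\<bar>s\<bar> < \<delta>" for s using \<delta>(2)[OF that] r by blast
  have der: "((\<lambda>s. f (y s)) has_real_derivative dd w f (y s)) (at s)" if "\<bar>s\<bar> < \<delta>" "smooth_fun f" for f s
    unfolding y_def by (rule dd_along_line[OF that(2) \<tau> inW[OF that(1)]])
  let ?T = "\<lambda>a b c. dd a (dd b (dd c u))" and ?H = "\<lambda>a b. dd a (dd b u)"
  define A A1 where "A s = C (y s) (e + s *\<^sub>R a) (e + s *\<^sub>R a) (e + s *\<^sub>R a)"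
    and "A1 s = dd w (?T e e e) (y s) + 3 * (?T a e e (y s) + dd w (?T a e e) (y s) * s)
      + 3 * (2 * s * ?T a a e (y s) + dd w (?T a a e) (y s) * s^2)
      + (3 * s^2 * ?T a a a (y s) + dd w (?T a a a) (y s) * s^3)" for s
  define P P1 where "P s = G (y s) (e + s *\<^sub>R a) (e + s *\<^sub>R a)"
    and "P1 s = dd w (?H e e) (y s) + 2 * (?H a e (y s) + dd w (?H a e) (y s) * s)
      + (2 * s * ?H a a (y s) + dd w (?H a a) (y s) * s^2)" for s
  define q q1 where "q s = Q (x0 + s *\<^sub>R w - xq) (x0 + s *\<^sub>R w - xq)"
    and "q1 s = 2 * Q w (x0 - xq) + 2 * s * Q w w" for s
  \<comment> \<open>Multilinearity moves the dependence on the vector into powers of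
    \<open>s\<close>. What remains are fixed derivatives of \<open>u\<close> along a line, to which
    \<open>der\<close> applies.\<close>
  have A: "A s = ?T e e e (y s) + 3 * (s * ?T a e e (y s)) + 3 * (s^2 * ?T a a e (y s)) + s^3 * ?T a a a (y s)" for s
  proof -
    have "C (y s) e a e = C (y s) a e e" "C (y s) e e a = C (y s) a e e"
        "C (y s) a e a = C (y s) a a e" "C (y s) e a a = C (y s) a a e"
      using C_sym12 C_sym23 by metis+
    then show ?thesis unfolding A_def C_def[symmetric]
      by (simp add: C_lin algebra_simps power2_eq_square power3_eq_cube)
  qed
  have P: "P s = ?H e e (y s) + 2 * (s * ?H a e (y s)) + s^2 * ?H a a (y s)" for s
    unfolding P_def G_def[symmetric] using G_sym[of "y s" e a] by (simp add: G_bilin algebra_simps power2_eq_square)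
  have q: "q s = Q (x0 - xq) (x0 - xq) + s * (2 * Q w (x0 - xq)) + s^2 * Q w w" for s
  proof -
    have "x0 + s *\<^sub>R w - xq = (x0 - xq) + s *\<^sub>R w" by simp
    then show ?thesis unfolding q_def using Q(2)[of "x0 - xq" w]
      by (simp only: bilinear_ladd[OF Q(1)] bilinear_radd[OF Q(1)] bilinear_lmul[OF Q(1)] bilinear_rmul[OF Q(1)])
        (simp add: algebra_simps power2_eq_square)
  qed
  have ds: "((\<lambda>s. s^2) has_real_derivative 2 * s) (at s)" "((\<lambda>s. s^3) has_real_derivative 3 * s^2) (at s)"
    "((\<lambda>s. s) has_real_derivative 1) (at s)" for s :: real
    by (auto intro!: derivative_eq_intros)
  have A1: "(A has_real_derivative A1 s) (at s)" if s: "\<bar>s\<bar> < \<delta>" for s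
  proof -
    have "((\<lambda>s. ?T e e e (y s) + 3 * (s * ?T a e e (y s)) + 3 * (s^2 * ?T a a e (y s)) + s^3 * ?T a a a (y s))
      has_real_derivative dd w (?T e e e) (y s) + 3 * (1 * ?T a e e (y s) + dd w (?T a e e) (y s) * s)
      + 3 * (2 * s * ?T a a e (y s) + dd w (?T a a e) (y s) * s^2)
      + (3 * s^2 * ?T a a a (y s) + dd w (?T a a a) (y s) * s^3)) (at s)"
      by (intro DERIV_add DERIV_mult DERIV_cmult ds der[OF s] smooths)
    then show ?thesis by (simp only: ext[OF A] A1_def mult_1)
  qed
  have P1: "(P has_real_derivative P1 s) (at s)" if s: "\<bar>s\<bar> < \<delta>" for s
  proof -
    have "((\<lambda>s. ?H e e (y s) + 2 * (s * ?H a e (y s)) + s^2 * ?H a a (y s))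
      has_real_derivative dd w (?H e e) (y s) + 2 * (1 * ?H a e (y s) + dd w (?H a e) (y s) * s)
      + (2 * s * ?H a a (y s) + dd w (?H a a) (y s) * s^2)) (at s)"
      by (intro DERIV_add DERIV_mult DERIV_cmult ds der[OF s] smooths)
    then show ?thesis by (simp only: ext[OF P] P1_def mult_1)
  qed
  have q1: "(q has_real_derivative q1 s) (at s)" for s
    unfolding ext[OF q] q1_def by (auto intro!: derivative_eq_intros)
  have d0: "\<bar>0\<bar> < \<delta>" using \<delta>(1) by simp
  note der0 = der[OF d0, unfolded y0]
  have A2: "(A1 has_real_derivative dd w (dd w (?T e e e)) p + 6 * dd w (?T a e e) p + 6 * ?T a a e p) (at 0)"
    unfolding A1_def by (rule derivative_eq_intros der[OF d0] smooths refl | simp add: y0)+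
  have P2: "(P1 has_real_derivative dd w (dd w (?H e e)) p + 4 * dd w (?H a e) p + 2 * ?H a a p) (at 0)"
    unfolding P1_def by (rule derivative_eq_intros der[OF d0] smooths refl | simp add: y0)+
  have q2: "(q1 has_real_derivative 2 * Q w w) (at 0)"
    unfolding q1_def by (auto intro!: derivative_eq_intros)
  have pos: "P s > 0" if "\<bar>s\<bar> < \<delta>" for s
    unfolding P_def using \<delta>(2)[OF that] by (intro G_pos) blast
  have one: "P 0 = 1" using e by (simp add: P_def y0 p_def)
  have "A s * P s powr (-3/2) - k * q s \<le> A 0 - k * q 0" if "\<bar>s\<bar> < \<delta>" for s
    using max[of "x0 + s *\<^sub>R w" "e + s *\<^sub>R a"] \<delta>(2)[OF that] by (simp add: A_def P_def q_def y_def p_def)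
  note res = weighted_ratio_local_max[of \<delta> A A1 _ P P1 _ q q1 _ k, OF \<delta>(1) A1 A2 P1 P2 q1 q2 pos one this, simplified]
  have eqs: "A1 0 = dd w (?T e e e) p + 3 * C p a e e" "P1 0 = C p w e e + 2 * G p a e"
    "q1 0 = 2 * Q w (x0 - xq)" "A 0 = C p e e e"
    by (simp_all add: A1_def P1_def q1_def A_def y0 C_def G_def)
  have com: "dd w (?H a e) p = C p w a e" by (simp add: C_def)
  have com2: "dd w (?H e e) p = C p w e e" by (simp add: C_def)
  show ?first using res(1) unfolding eqs by (simp add: algebra_simps)
  show ?second using res(2) unfolding eqs com unfolding C_def G_def by (simp add: algebra_simps add_divide_distrib)
qed

end

section \<open>The Monge-Ampere equation at a maximum of the cubic form\<close>

lemma sum_mult_delta: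
  fixes f :: "'k::finite \<Rightarrow> real"
  shows "(\<Sum>k\<in>UNIV. f k * (if k = b then 1 else 0)) = f b"
  by (simp add: mult_delta_right)

locale monge_ampere = hessian_potential_locale \<iota> u
  for \<iota> :: "'a::t2_space \<Rightarrow> real^'n" and u :: "'a \<Rightarrow> real" +
  fixes \<xi> v :: "real^'n" and c :: real
  assumes ma: "\<And>p. ln (det (\<chi> i j. G p (axis i 1) (axis j 1))) = - (v \<bullet> \<iota> p) + dd \<xi> u p + c"
begin

text \<open>The frame \<open>E\<close> is constant in affine coordinates and orthonormal at
  \<open>p\<close> only. This suffices for \<open>ln_det_derivatives\<close>, which wants the
  identity matrix at the one point where the traces are taken.\<close>

lemma ma_derivatives:
  fixes E :: "'n \<Rightarrow> real^'n"
  assumes E: "\<And>i j. G p (E i) (E j) = (if i = j then 1 else 0)"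
  shows "(\<Sum>i\<in>UNIV. C p e (E i) (E i)) = - (v \<bullet> e) + G p e \<xi>"
    and "(\<Sum>i\<in>UNIV. dd e (dd e (dd (E i) (dd (E i) u))) p)
      - (\<Sum>i\<in>UNIV. \<Sum>j\<in>UNIV. C p e (E i) (E j) * C p e (E j) (E i)) = C p e e \<xi>"
    and "(\<Sum>i\<in>UNIV. dd e (dd e (dd e (dd (E i) (dd (E i) u)))) p)
      - 3 * (\<Sum>i\<in>UNIV. \<Sum>j\<in>UNIV. C p e (E i) (E j) * dd e (dd e (dd (E j) (dd (E i) u))) p)
      + 2 * (\<Sum>i\<in>UNIV. \<Sum>j\<in>UNIV. \<Sum>k\<in>UNIV. C p e (E i) (E j) * C p e (E j) (E k) * C p e (E k) (E i))
      = dd e (dd e (dd e (dd \<xi> u))) p"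
proof -
  obtain r \<tau> where \<tau>: "r > 0" "is_section \<tau> (ball (\<iota> p) r)" "\<tau> (\<iota> p) = p"
    by (rule local_section[OF open_UNIV UNIV_I])
  let ?x = "\<iota> p" and ?W = "ball (\<iota> p) r"
  define y where "y s = \<tau> (?x + s *\<^sub>R e)" for s
  have y0: "y 0 = p" by (simp add: y_def \<tau>)
  \<comment> \<open>Within this time the line stays in the ball on which \<open>\<tau>\<close> is a
    section; adding 1 to the norm covers \<open>e = 0\<close>.\<close>
  define d1 where "d1 = r / (norm e + 1)"
  have d1: "d1 > 0" using \<tau>(1) by (simp add: d1_def add_nonneg_pos)
  have inW: "?x + s *\<^sub>R e \<in> ?W" if "\<bar>s\<bar> < d1" for s
  proof -
    have "norm (s *\<^sub>R e) \<le> \<bar>s\<bar> * (norm e + 1)" by (simp add: algebra_simps)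
    also have "\<dots> < d1 * (norm e + 1)" using that by (intro mult_strict_right_mono) (auto simp: add_nonneg_pos)
    also have "\<dots> = r" by (simp add: d1_def) (metis add_nonneg_pos less_irrefl norm_ge_zero zero_less_one)
    finally show ?thesis by (simp add: dist_norm)
  qed
  have der: "((\<lambda>s. f (y s)) has_real_derivative dd e f (y s)) (at s)" if "\<bar>s\<bar> < d1" "smooth_fun f" for f s
    unfolding y_def by (rule dd_along_line[OF that(2) \<tau>(2) inW[OF that(1)]])
  have iy: "\<iota> (y s) = ?x + s *\<^sub>R e" if "\<bar>s\<bar> < d1" for s
    unfolding y_def by (rule section_right_inverse[OF \<tau>(2) inW[OF that]])
  define M M1 M2 where "M s = (\<chi> i j. dd (E i) (dd (E j) u) (y s))"
    and "M1 s = (\<chi> i j. dd e (dd (E i) (dd (E j) u)) (y s))"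
    and "M2 s = (\<chi> i j. dd e (dd e (dd (E i) (dd (E j) u))) (y s))" for s
  define M3 where "M3 = (\<chi> i j. dd e (dd e (dd e (dd (E i) (dd (E j) u)))) p)"
  have M1: "((\<lambda>s. M s $ i $ j) has_real_derivative M1 s $ i $ j) (at s)" if "\<bar>s\<bar> < d1" for s i j
    by (simp add: M_def M1_def der[OF that] smooths)
  have M2: "((\<lambda>s. M1 s $ i $ j) has_real_derivative M2 s $ i $ j) (at s)" if "\<bar>s\<bar> < d1" for s i j
    by (simp add: M2_def M1_def der[OF that] smooths)
  have M3: "((\<lambda>s. M2 s $ i $ j) has_real_derivative M3 $ i $ j) (at 0)" for i j
    using der[of 0 "dd e (dd e (dd (E i) (dd (E j) u)))"] d1 by (simp add: M2_def M3_def y0 smooths)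
  have one: "M 0 = mat 1"
    using E by (simp add: M_def y0 G_def mat_def vec_eq_iff)
  have detM: "det (M s) = (det (\<chi> i. E i))\<^sup>2 * det (\<chi> i j. G (y s) (axis i 1) (axis j 1))" for s
    using det_change_frame[OF bilinear_G[of "y s"], of E] by (simp add: M_def G_def)
  have cont: "isCont (\<lambda>s. det (M s)) 0"
    using DERIV_isCont[OF DERIV_det[of M, OF M1[of 0]]] d1 by simp
  \<comment> \<open>Continuity from \<open>M 0 = mat 1\<close> provides a positive determinant for
    short times, which is all that the logarithm needs.\<close>
  obtain d2 where d2: "d2 > 0" "\<And>s. \<bar>s\<bar> < d2 \<Longrightarrow> det (M s) > 0"
  proof -
    have "0 < det (M 0)" by (simp add: one)
    with cont obtain d where "d > 0" "\<And>s. dist s 0 < d \<Longrightarrow> dist (det (M s)) (det (M 0)) < det (M 0)"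
      unfolding continuous_at_eps_delta by blast
    then show thesis by (intro that[of d]) (auto simp: dist_real_def abs_less_iff)
  qed
  define \<delta> where "\<delta> = min d1 d2"
  have \<delta>: "\<delta> > 0" "\<And>s. \<bar>s\<bar> < \<delta> \<Longrightarrow> \<bar>s\<bar> < d1" "\<And>s. \<bar>s\<bar> < \<delta> \<Longrightarrow> det (M s) > 0"
    using d1 d2 by (auto simp: \<delta>_def)
  \<comment> \<open>The constant by which the equation changes when read in the frame
    \<open>E\<close> instead of the coordinate basis.\<close>
  let ?k = "ln ((det (\<chi> i. E i))\<^sup>2)"
  have ln: "ln (det (M s)) = ?k - (v \<bullet> ?x + s * (v \<bullet> e)) + dd \<xi> u (y s) + c" if s: "\<bar>s\<bar> < \<delta>" for s
  proof -
    have "0 < (det (\<chi> i. E i))\<^sup>2 * det (\<chi> i j. G (y s) (axis i 1) (axis j 1))"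
      using \<delta>(3)[OF s] detM by simp
    then have "(det (\<chi> i. E i))\<^sup>2 > 0" "det (\<chi> i j. G (y s) (axis i 1) (axis j 1)) > 0"
      by (auto simp: zero_less_mult_iff)
    then show ?thesis
      unfolding detM using ma[of "y s"] iy[OF \<delta>(2)[OF s]]
      by (simp add: ln_mult inner_add_right inner_scaleR_right)
  qed
  have l1: "((\<lambda>s. ln (det (M s))) has_real_derivative - (v \<bullet> e) + dd e (dd \<xi> u) (y s)) (at s)" if s: "\<bar>s\<bar> < \<delta>" for s
  proof -
    have "((\<lambda>s. ?k - (v \<bullet> ?x + s * (v \<bullet> e)) + dd \<xi> u (y s) + c) has_real_derivative
        - (v \<bullet> e) + dd e (dd \<xi> u) (y s)) (at s)"
      using der[OF \<delta>(2)[OF s], of "dd \<xi> u"] by (auto intro!: derivative_eq_intros simp: smooths)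
    moreover have "\<forall>\<^sub>F s in nhds s. ln (det (M s)) = ?k - (v \<bullet> ?x + s * (v \<bullet> e)) + dd \<xi> u (y s) + c"
    proof -
      have "open {s. \<bar>s\<bar> < \<delta>}" by (intro open_Collect_less continuous_intros)
      then show ?thesis using s ln eventually_nhds by blast
    qed
    ultimately show ?thesis by (subst DERIV_cong_ev[OF refl _ refl]) auto
  qed
  have l2: "((\<lambda>s. - (v \<bullet> e) + dd e (dd \<xi> u) (y s)) has_real_derivative dd e (dd e (dd \<xi> u)) (y s)) (at s)"
    if s: "\<bar>s\<bar> < \<delta>" for s
    using der[OF \<delta>(2)[OF s], of "dd e (dd \<xi> u)"] by (auto intro!: derivative_eq_intros simp: smooths)
  have l3: "((\<lambda>s. dd e (dd e (dd \<xi> u)) (y s)) has_real_derivative dd e (dd e (dd e (dd \<xi> u))) p) (at 0)"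
    using der[of 0 "dd e (dd e (dd \<xi> u))"] d1 by (simp add: smooths y0)
  note res = ln_det_derivatives[OF \<delta>(1) M1[OF \<delta>(2)] M2[OF \<delta>(2)] M3 \<delta>(3) one l1 l2 l3]
  show "(\<Sum>i\<in>UNIV. C p e (E i) (E i)) = - (v \<bullet> e) + G p e \<xi>"
    using res(1) by (simp add: M1_def y0 C_def G_def)
  show "(\<Sum>i\<in>UNIV. dd e (dd e (dd (E i) (dd (E i) u))) p)
      - (\<Sum>i\<in>UNIV. \<Sum>j\<in>UNIV. C p e (E i) (E j) * C p e (E j) (E i)) = C p e e \<xi>"
    using res(2) by (simp add: M1_def M2_def y0 C_def G_def)
  show "(\<Sum>i\<in>UNIV. dd e (dd e (dd e (dd (E i) (dd (E i) u)))) p)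
      - 3 * (\<Sum>i\<in>UNIV. \<Sum>j\<in>UNIV. C p e (E i) (E j) * dd e (dd e (dd (E j) (dd (E i) u))) p)
      + 2 * (\<Sum>i\<in>UNIV. \<Sum>j\<in>UNIV. \<Sum>k\<in>UNIV. C p e (E i) (E j) * C p e (E j) (E k) * C p e (E k) (E i))
      = dd e (dd e (dd e (dd \<xi> u))) p"
    using res(3) by (simp add: M1_def M2_def M3_def y0 C_def G_def)
qed

text \<open>
  At a maximum of the cubic form on unit vectors, vary the point along \<open>E\<^sub>i\<close> and the unit vector by
  Levi-Civita parallel transport, \<open>e' = - C(E\<^sub>i, e) / 2\<close>. Summed over the frame, all fourth and fifth
  derivatives cancel against those of the Monge-Ampere equation.
\<close>

lemma max_point_inequality:
  fixes E :: "'n \<Rightarrow> real^'n"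
  assumes \<tau>: "is_section \<tau> W" and r: "r > 0" "ball x0 r \<subseteq> W" and e: "G (\<tau> x0) e e = 1"
    and Q: "bilinear Q" "\<And>x y. Q x y = Q y x"
    and max: "\<And>x e'. x \<in> ball x0 r \<Longrightarrow> e' \<noteq> 0 \<Longrightarrow>
      C (\<tau> x) e' e' e' * G (\<tau> x) e' e' powr (-3/2) - k * Q (x - xq) (x - xq)
      \<le> C (\<tau> x0) e e e - k * Q (x0 - xq) (x0 - xq)"
    and E: "\<And>i j. G (\<tau> x0) (E i) (E j) = (if i = j then 1 else 0)"
      "\<And>x. x = (\<Sum>i\<in>UNIV. G (\<tau> x0) x (E i) *\<^sub>R E i)"
    and \<mu>: "C (\<tau> x0) e e e > 0"
  shows "(C (\<tau> x0) e e e) ^ 3 / 4 \<le> 2 * k * ((\<Sum>i\<in>UNIV. Q (E i) (E i)) - Q \<xi> (x0 - xq))"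
proof -
  define p where "p = \<tau> x0"
  define \<mu> where "\<mu> = C p e e e"
  note var = variation_at_max[OF \<tau> r e Q max, folded p_def]
  note E' = E[folded p_def]
  have ee: "G p e e = 1" using e by (simp add: p_def)
  define c where "c i j = C p e (E i) (E j)" for i j
  have csym: "c i j = c j i" for i j by (simp add: c_def C_sym23[of p e "E i"])
  define D where "D i j = dd e (dd e (dd (E j) (dd (E i) u))) p" for i j
  have lin_sum: "C p (\<Sum>i\<in>UNIV. f i *\<^sub>R E i) b d = (\<Sum>i\<in>UNIV. f i * C p (E i) b d)" for f b d
    using linear_sum[OF linear_C1[of p b d], of "\<lambda>i. f i *\<^sub>R E i" UNIV] by (simp add: C_lin)
  have G_sum: "G p (\<Sum>i\<in>UNIV. f i *\<^sub>R E i) b = (\<Sum>i\<in>UNIV. f i * G p (E i) b)" for f b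
    using linear_sum[OF linear_G[of p b], of "\<lambda>i. f i *\<^sub>R E i" UNIV] by (simp add: G_bilin)
  \<comment> \<open>Here only the vector varies. The first variation gives
    \<open>C p w e e = \<mu> * G p w e\<close> and the second a bound on \<open>C p w w e\<close>;
    together they bound the quadratic form \<open>C p e\<close> by \<mu> times the metric, as at a
    maximum of a cubic form on the unit sphere.\<close>
  have op: "C p e w w \<le> \<mu> * G p w w" for w
  proof -
    note v1 = var(1)[of 0 w, unfolded ee] and v2 = var(2)[of 0 w, unfolded ee]
    have z: "dd 0 f p = 0" if "smooth_fun f" for f using linear_0[OF linear_dd[OF that]] .
    have Q0: "Q 0 y = 0" for y using Q(1) by (rule bilinear_lzero)
    have 1: "C p w e e = \<mu> * G p w e"
      using v1 by (simp add: z smooths C_lin Q0 \<mu>_def)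
    have 2: "6 * C p w w e - 3 * (3 * C p w e e) * (2 * G p w e) + \<mu> * (15/4 * (2 * G p w e)\<^sup>2 - 3/2 * (2 * G p w w)) \<le> 0"
      using v2 by (simp add: z smooths C_lin Q0 \<mu>_def)
    have "6 * C p w w e \<le> 3 * \<mu> * ((G p w e)\<^sup>2 + G p w w)"
      using 2 unfolding 1 by (simp add: algebra_simps power2_eq_square)
    moreover have "(G p w e)\<^sup>2 \<le> G p w w"
    proof -
      have "0 \<le> G p (w - G p w e *\<^sub>R e) (w - G p w e *\<^sub>R e)" by (rule G_nonneg)
      then show ?thesis using ee G_sym[of p e w] by (simp add: G_bilin algebra_simps power2_eq_square)
    qed
    then have "3 * \<mu> * ((G p w e)\<^sup>2 + G p w w) \<le> 3 * \<mu> * (2 * G p w w)"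
      using \<mu> by (intro mult_left_mono) (auto simp: \<mu>_def p_def)
    moreover have "C p w w e = C p e w w" using C_sym12 C_sym23 by metis
    ultimately show ?thesis by simp
  qed
  \<comment> \<open>The right side of the three times differentiated equation is the derivative of
    the cubic form along \<open>\<xi>\<close>. Moving the point along \<open>\<xi>\<close> with
    \<open>e\<close> fixed, the first variation expresses it through lower order terms and the
    cutoff.\<close>
  have drift: "dd e (dd e (dd e (dd \<xi> u))) p - 3/2 * \<mu> * C p e e \<xi> = 2 * k * Q \<xi> (x0 - xq)"
  proof -
    have "dd \<xi> (dd e (dd e (dd e u))) p = dd e (dd e (dd e (dd \<xi> u))) p"
      by (simp add: dd_commute[of _ \<xi> e] smooths)
    moreover have "C p \<xi> e e = C p e e \<xi>" using C_sym12 C_sym23 by metis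
    ultimately show ?thesis using var(1)[of \<xi> 0] by (simp add: C_lin G_bilin \<mu>_def)
  qed
  define a where "a i = (\<Sum>b\<in>UNIV. (- c i b / 2) *\<^sub>R E b)" for i
  have var2: "dd e (dd e (dd e (dd (E i) (dd (E i) u)))) p - 3 * (\<Sum>b\<in>UNIV. c i b * D i b)
      + 3/2 * (\<Sum>b\<in>UNIV. \<Sum>d\<in>UNIV. c i b * c b d * c d i)
      - 3/2 * \<mu> * (dd e (dd e (dd (E i) (dd (E i) u))) p - 3/2 * (\<Sum>b\<in>UNIV. c i b * c b i))
      - 2 * k * Q (E i) (E i) \<le> 0" for i
  proof -
    have Gae: "G p (a i) e = - C p e e (E i) / 2"
    proof -
      have "G p (a i) e = (\<Sum>b\<in>UNIV. G p e (E b) * c i b) * (-1/2)"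
        unfolding a_def G_sum sum_distrib_right by (intro sum.cong) (simp_all add: G_sym[of p e])
      also have "(\<Sum>b\<in>UNIV. G p e (E b) * c i b) = (\<Sum>b\<in>UNIV. G p e (E b) * C p (E b) e (E i))"
        unfolding c_def using C_sym12 C_sym23 by (intro sum.cong refl arg_cong[where f = "\<lambda>x. _ * x"]) metis
      also have "\<dots> = C p e e (E i)" using lin_sum[of "\<lambda>b. G p e (E b)" e "E i"] unfolding E'(2)[of e, symmetric] by simp
      finally show ?thesis by simp
    qed
    have sym: "C p (E i) e e = C p e e (E i)" using C_sym12 C_sym23 by metis
    \<comment> \<open>With this choice of \<open>a i\<close> the squared length of the moving vector
      is stationary, so the cross terms of the second variation drop out.\<close>
    have P': "C p (E i) e e + 2 * G p (a i) e = 0" by (simp add: Gae sym)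
    have Gaa: "G p (a i) (a i) = (\<Sum>b\<in>UNIV. c i b * c b i) / 4"
    proof -
      have "G p (E b) (a i) = - c i b / 2" for b
        unfolding G_sym[of p "E b"] a_def G_sum by (simp only: E'(1) sum_mult_delta)
      then have "G p (a i) (a i) = (\<Sum>b\<in>UNIV. (- c i b / 2) * (- c i b / 2))"
        by (subst (1) a_def) (simp only: G_sum)
      then show ?thesis by (simp add: sum_divide_distrib csym[of _ i])
    qed
    have Cwa: "C p (E i) (a i) e = - (\<Sum>b\<in>UNIV. c i b * c b i) / 2"
    proof -
      have "C p (E i) (a i) e = C p (a i) (E i) e" by (rule C_sym12)
      also have "\<dots> = (\<Sum>b\<in>UNIV. (- c i b / 2) * C p (E b) (E i) e)" unfolding a_def lin_sum ..
      also have "\<dots> = (\<Sum>b\<in>UNIV. (- c i b / 2) * c b i)"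
        unfolding c_def using C_sym12 C_sym23 by (intro sum.cong refl arg_cong[where f = "\<lambda>x. _ * x"]) metis
      finally show ?thesis by (simp add: sum_divide_distrib sum_negf)
    qed
    have Caa: "C p (a i) (a i) e = (\<Sum>b\<in>UNIV. \<Sum>d\<in>UNIV. c i b * c b d * c d i) / 4"
    proof -
      have "C p (E b) (a i) e = (\<Sum>d\<in>UNIV. (- c i d / 2) * c b d)" for b
      proof -
        have "C p (E b) (a i) e = C p (a i) (E b) e" by (rule C_sym12)
        also have "\<dots> = (\<Sum>d\<in>UNIV. (- c i d / 2) * C p (E d) (E b) e)" unfolding a_def lin_sum ..
        also have "\<dots> = (\<Sum>d\<in>UNIV. (- c i d / 2) * c b d)"
          unfolding c_def using C_sym12 C_sym23 by (intro sum.cong refl arg_cong[where f = "\<lambda>x. _ * x"]) metis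
        finally show ?thesis .
      qed
      then have "C p (a i) (a i) e = (\<Sum>b\<in>UNIV. (- c i b / 2) * (\<Sum>d\<in>UNIV. (- c i d / 2) * c b d))"
        by (subst (1) a_def) (simp only: lin_sum)
      then show ?thesis
        by (simp add: sum_divide_distrib sum_distrib_left sum_negf csym[of _ i] mult_ac)
    qed
    have Dwa: "dd (E i) (dd (a i) (dd e (dd e u))) p = - (\<Sum>b\<in>UNIV. c i b * D i b) / 2"
    proof -
      have "dd (E i) (dd (a i) (dd e (dd e u))) p = dd (a i) (dd (E i) (dd e (dd e u))) p"
        by (simp add: dd_commute[of _ "E i" "a i"] smooths)
      also have "\<dots> = (\<Sum>b\<in>UNIV. (- c i b / 2) * dd (E b) (dd (E i) (dd e (dd e u))) p)"
      proof -
        have sm: "smooth_fun (dd (E i) (dd e (dd e u)))" by (intro smooths)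
        show ?thesis
          unfolding a_def linear_sum[OF linear_dd[OF sm]] linear_scale[OF linear_dd[OF sm]] real_scaleR_def ..
      qed
      also have "\<dots> = (\<Sum>b\<in>UNIV. (- c i b / 2) * D i b)"
        by (simp add: D_def dd_commute[of _ "E _" e] smooths)
      finally show ?thesis by (simp add: sum_divide_distrib sum_negf)
    qed
    have c1: "dd (E i) (dd (E i) (dd e (dd e (dd e u)))) p = dd e (dd e (dd e (dd (E i) (dd (E i) u)))) p"
      "dd (E i) (dd (E i) (dd e (dd e u))) p = dd e (dd e (dd (E i) (dd (E i) u))) p"
      by (simp_all add: dd_commute[of _ "E _" e] smooths)
    show ?thesis
      using var(2)[of "E i" "a i"] unfolding P' Gaa Cwa Caa Dwa c1 \<mu>_def[symmetric] by (simp add: algebra_simps)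
  qed
  \<comment> \<open>For the symmetric matrix \<open>c\<close> of \<open>C p e\<close> in the frame,
    \<open>S2\<close> and \<open>S3\<close> are the traces of its square and cube, and
    \<open>SD\<close> pairs it with the fourth derivatives \<open>D\<close>; \<open>D4\<close> and
    \<open>D5\<close> are traces of fourth and fifth derivatives.\<close>
  define S2 S3 SD D4 D5 SQ where "S2 = (\<Sum>i\<in>UNIV. \<Sum>b\<in>UNIV. c i b * c b i)"
    and "S3 = (\<Sum>i\<in>UNIV. \<Sum>b\<in>UNIV. \<Sum>d\<in>UNIV. c i b * c b d * c d i)"
    and "SD = (\<Sum>i\<in>UNIV. \<Sum>b\<in>UNIV. c i b * D i b)"
    and "D4 = (\<Sum>i\<in>UNIV. dd e (dd e (dd (E i) (dd (E i) u))) p)"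
    and "D5 = (\<Sum>i\<in>UNIV. dd e (dd e (dd e (dd (E i) (dd (E i) u)))) p)"
    and "SQ = (\<Sum>i\<in>UNIV. Q (E i) (E i))"
  have sum2: "D5 - 3 * SD + 3/2 * S3 - 3/2 * \<mu> * (D4 - 3/2 * S2) - 2 * k * SQ \<le> 0"
  proof -
    have "(\<Sum>i\<in>UNIV. dd e (dd e (dd e (dd (E i) (dd (E i) u)))) p - 3 * (\<Sum>b\<in>UNIV. c i b * D i b)
      + 3/2 * (\<Sum>b\<in>UNIV. \<Sum>d\<in>UNIV. c i b * c b d * c d i)
      - 3/2 * \<mu> * (dd e (dd e (dd (E i) (dd (E i) u))) p - 3/2 * (\<Sum>b\<in>UNIV. c i b * c b i))
      - 2 * k * Q (E i) (E i)) \<le> 0" by (intro sum_nonpos var2)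
    then show ?thesis
      by (simp only: sum.distrib sum_subtractf sum_distrib_left[symmetric]
          S2_def S3_def SD_def D4_def D5_def SQ_def)
  qed
  have ma2: "D4 - S2 = C p e e \<xi>"
    using ma_derivatives(2)[OF E'(1), of e] by (simp add: D4_def S2_def c_def)
  have ma3: "D5 - 3 * SD + 2 * S3 = dd e (dd e (dd e (dd \<xi> u))) p"
    using ma_derivatives(3)[OF E'(1), of e] by (simp add: D5_def SD_def S3_def c_def D_def)
  \<comment> \<open>Each summand is the quadratic form \<open>C p e\<close> on the vector
    \<open>w i\<close> dual to the i-th row of \<open>c\<close>, so \<open>op\<close> applies row by
    row.\<close>
  have S3: "S3 \<le> \<mu> * S2"
  proof -
    define w where "w i = (\<Sum>b\<in>UNIV. c i b *\<^sub>R E b)" for i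
    have Gw: "G p (w i) (w i) = (\<Sum>b\<in>UNIV. c i b * c b i)" for i
    proof -
      have "G p (E b) (w i) = c i b" for b
        unfolding G_sym[of p "E b"] w_def G_sum by (simp only: E'(1) sum_mult_delta)
      then have "G p (w i) (w i) = (\<Sum>b\<in>UNIV. c i b * c i b)"
        by (subst (1) w_def) (simp only: G_sum)
      then show ?thesis by (simp add: csym[of _ i])
    qed
    have Cw: "C p e (w i) (w i) = (\<Sum>b\<in>UNIV. \<Sum>d\<in>UNIV. c i b * c b d * c d i)" for i
    proof -
      have "C p (E b) (w i) e = (\<Sum>d\<in>UNIV. c i d * c b d)" for b
      proof -
        have "C p (E b) (w i) e = C p (w i) (E b) e" by (rule C_sym12)
        also have "\<dots> = (\<Sum>d\<in>UNIV. c i d * C p (E d) (E b) e)" unfolding w_def lin_sum ..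
        also have "\<dots> = (\<Sum>d\<in>UNIV. c i d * c b d)"
          unfolding c_def using C_sym12 C_sym23 by (intro sum.cong refl arg_cong[where f = "\<lambda>x. _ * x"]) metis
        finally show ?thesis .
      qed
      then have "C p (w i) (w i) e = (\<Sum>b\<in>UNIV. c i b * (\<Sum>d\<in>UNIV. c i d * c b d))"
        by (subst (1) w_def) (simp only: lin_sum)
      moreover have "C p e (w i) (w i) = C p (w i) (w i) e" using C_sym12 C_sym23 by metis
      ultimately show ?thesis by (simp add: sum_distrib_left csym[of _ i] mult_ac)
    qed
    have "S3 = (\<Sum>i\<in>UNIV. C p e (w i) (w i))" by (simp add: S3_def Cw)
    also have "\<dots> \<le> (\<Sum>i\<in>UNIV. \<mu> * G p (w i) (w i))" by (intro sum_mono op)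
    also have "\<dots> = \<mu> * S2" by (simp add: S2_def Gw sum_distrib_left)
    finally show ?thesis .
  qed
  \<comment> \<open>Since \<mu> is the matrix \<open>c\<close> evaluated twice on the unit
    coordinate vector \<open>g\<close> of \<open>e\<close>, two Cauchy-Schwarz inequalities bound it
    by the Hilbert-Schmidt norm of \<open>c\<close>.\<close>
  have S2: "\<mu>\<^sup>2 \<le> S2"
  proof -
    define g where "g i = G p e (E i)" for i
    have ex: "(\<Sum>i\<in>UNIV. g i *\<^sub>R E i) = e" unfolding g_def by (rule E'(2)[symmetric])
    have gi: "G p (E i) e = g i" for i unfolding g_def by (rule G_sym)
    have "G p e e = (\<Sum>i\<in>UNIV. g i * g i)"
      using G_sum[of g e] unfolding ex gi .
    then have g1: "(\<Sum>i\<in>UNIV. (g i)\<^sup>2) = 1" by (simp add: ee power2_eq_square)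
    have "\<mu> = (\<Sum>i\<in>UNIV. g i * C p (E i) e e)"
      using lin_sum[of g e e] unfolding ex by (simp add: \<mu>_def)
    also have "\<dots> = (\<Sum>i\<in>UNIV. g i * (\<Sum>j\<in>UNIV. g j * c i j))"
    proof (intro sum.cong refl arg_cong[where f = "\<lambda>x. _ * x"])
      fix i
      have "C p (E i) e e = C p e (E i) e" by (rule C_sym12)
      also have "\<dots> = C p (\<Sum>j\<in>UNIV. g j *\<^sub>R E j) (E i) e" by (simp only: ex)
      also have "\<dots> = (\<Sum>j\<in>UNIV. g j * C p (E j) (E i) e)" by (rule lin_sum)
      also have "\<dots> = (\<Sum>j\<in>UNIV. g j * c i j)"
        unfolding c_def using C_sym12 C_sym23 by (intro sum.cong refl arg_cong[where f = "\<lambda>x. _ * x"]) metis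
      finally show "C p (E i) e e = (\<Sum>j\<in>UNIV. g j * c i j)" .
    qed
    finally have "\<mu>\<^sup>2 = (\<Sum>i\<in>UNIV. g i * (\<Sum>j\<in>UNIV. g j * c i j))\<^sup>2" by simp
    also have "\<dots> \<le> (\<Sum>i\<in>UNIV. (g i)\<^sup>2) * (\<Sum>i\<in>UNIV. (\<Sum>j\<in>UNIV. g j * c i j)\<^sup>2)"
      by (rule Cauchy_Schwarz_ineq_sum)
    also have "\<dots> \<le> (\<Sum>i\<in>UNIV. (\<Sum>j\<in>UNIV. (g j)\<^sup>2) * (\<Sum>j\<in>UNIV. (c i j)\<^sup>2))"
      unfolding g1 mult_1 by (intro sum_mono order_trans[OF Cauchy_Schwarz_ineq_sum]) (simp add: g1)
    also have "\<dots> = S2" unfolding g1 mult_1 S2_def by (simp add: power2_eq_square csym)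
    finally show ?thesis .
  qed
  have \<mu>0: "\<mu> > 0" using \<mu> by (simp add: \<mu>_def p_def)
  have "\<mu> ^ 3 / 4 = \<mu> * \<mu>\<^sup>2 / 4" by (simp add: power3_eq_cube power2_eq_square)
  also have "\<dots> \<le> \<mu> * S2 / 4" using S2 \<mu>0 by simp
  also have "\<dots> \<le> 2 * k * (SQ - Q \<xi> (x0 - xq))"
  proof -
    \<comment> \<open>Eliminating \<open>D5\<close> by the equation and \<open>drift\<close> also
      cancels \<open>SD\<close> and \<open>D4\<close>. What is left is 3/4 \<mu> \<open>S2\<close> -
      1/2 \<open>S3\<close>, and \<open>S3 \<le> \<mu> * S2\<close> turns it into the factor
      1/4.\<close>
    have D5: "D5 = 2 * k * Q \<xi> (x0 - xq) + 3/2 * \<mu> * (D4 - S2) + 3 * SD - 2 * S3"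
      unfolding ma2 using ma3 drift by simp
    have arith: "X / 4 \<le> 2 * z - 2 * y"
      if "2 * y + (3/2 * Y - 3/2 * X) + 3 * d - 2 * t - 3 * d + 3/2 * t - (3/2 * Y - 9/4 * X) - 2 * z \<le> 0" "t \<le> X"
      for X Y y z d t :: real
      using that by (simp add: field_simps)
    have "2 * (k * Q \<xi> (x0 - xq)) + (3/2 * (\<mu> * D4) - 3/2 * (\<mu> * S2)) + 3 * SD - 2 * S3 - 3 * SD + 3/2 * S3
        - (3/2 * (\<mu> * D4) - 9/4 * (\<mu> * S2)) - 2 * (k * SQ) \<le> 0"
      using sum2 unfolding D5 by (simp add: field_simps)
    from arith[OF this S3] show ?thesis by (simp add: algebra_simps)
  qed
  finally show ?thesis by (simp add: \<mu>_def p_def SQ_def)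
qed

end

section \<open>Metric balls and point picking\<close>

text \<open>In finite dimensions a linear map varies continuously as soon as its values on the basis
  do. Applied one slot at a time, this gives joint continuity of tensors in point and
  arguments.\<close>

lemma continuous_on_linear_arg:
  fixes f :: "'x::topological_space \<Rightarrow> real^'n \<Rightarrow> real"
  assumes lin: "\<And>x. linear (f x)" and f: "\<And>i. continuous_on S (\<lambda>x. f x (axis i 1))"
    and g: "continuous_on S g"
  shows "continuous_on S (\<lambda>x. f x (g x))"
proof -
  have "f x (g x) = (\<Sum>i\<in>UNIV. g x $ i * f x (axis i 1))" for x
  proof -
    have "f x (g x) = f x (\<Sum>i\<in>UNIV. g x $ i *\<^sub>R axis i 1)"
      using basis_expansion[of "g x"] by (simp add: scalar_mult_eq_scaleR)
    also have "\<dots> = (\<Sum>i\<in>UNIV. g x $ i * f x (axis i 1))"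
      by (simp add: linear_sum[OF lin] linear_scale[OF lin])
    finally show ?thesis .
  qed
  moreover have "continuous_on S (\<lambda>x. \<Sum>i\<in>UNIV. g x $ i * f x (axis i 1))"
    by (intro continuous_intros f g)
  ultimately show ?thesis by simp
qed

context dev_map
begin

lemma glue_sections:
  assumes sec: "\<And>i. i \<in> I \<Longrightarrow> is_section (t i) (W i)"
    and agree: "\<And>i j x. i \<in> I \<Longrightarrow> j \<in> I \<Longrightarrow> x \<in> W i \<Longrightarrow> x \<in> W j \<Longrightarrow> t i x = t j x"
  obtains \<tau> where "is_section \<tau> (\<Union>i\<in>I. W i)" "\<And>i x. i \<in> I \<Longrightarrow> x \<in> W i \<Longrightarrow> \<tau> x = t i x"
proof -
  define \<tau> where "\<tau> x = t (SOME i. i \<in> I \<and> x \<in> W i) x" for x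
  have eq: "\<tau> x = t i x" if "i \<in> I" "x \<in> W i" for i x
  proof -
    have "(SOME i. i \<in> I \<and> x \<in> W i) \<in> I \<and> x \<in> W (SOME i. i \<in> I \<and> x \<in> W i)"
      using that by (intro someI[of "\<lambda>i. i \<in> I \<and> x \<in> W i" i]) simp
    then show ?thesis unfolding \<tau>_def using agree that by blast
  qed
  have "continuous_on (\<Union>i\<in>I. W i) \<tau>"
  proof (rule continuous_on_open_UN)
    fix i assume i: "i \<in> I"
    show "open (W i)" using sec[OF i] by (simp add: is_section_def)
    have "continuous_on (W i) (t i)" using sec[OF i] by (simp add: is_section_def)
    then show "continuous_on (W i) \<tau>"
      by (rule continuous_on_eq) (simp add: eq[OF i])
  qed
  then have "is_section \<tau> (\<Union>i\<in>I. W i)"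
    using sec eq unfolding is_section_def by auto
  with eq show thesis by (intro that) auto
qed

end

context hessian_potential_locale
begin

definition cubic_ratio :: "'a \<Rightarrow> real^'n \<Rightarrow> real" where
  "cubic_ratio p e = C p e e e * G p e e powr (-3/2)"

section \<open>The normalised cubic form and its maximum\<close>

lemma linear_G2: "linear (\<lambda>b. G p a b)"
  using bilinear_G[of p] by (simp add: bilinear_def)

lemma G_scale_square: "G p (t *\<^sub>R a) (t *\<^sub>R a) = t\<^sup>2 * G p a a"
  by (simp add: G_bilin power2_eq_square)

lemma cubic_ratio_scale:
  assumes "t > 0" shows "cubic_ratio p (t *\<^sub>R e) = cubic_ratio p e"
proof -
  have "(t * (t * G p e e)) powr (-3/2) = (t * t) powr (-3/2) * G p e e powr (-3/2)"
    using assms by (simp add: powr_mult G_nonneg mult.assoc[symmetric])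
  moreover have "(t * t) powr (-3/2) = 1 / (t * (t * t))"
  proof -
    have "(t * t) powr (-3/2) = (t powr 2) powr (-3/2)" using assms by (simp add: power2_eq_square)
    also have "\<dots> = t powr (-3)" unfolding powr_powr by simp
    also have "\<dots> = 1 / (t * (t * t))"
      using assms by (simp add: powr_minus_divide power3_eq_cube mult.assoc)
    finally show ?thesis .
  qed
  ultimately show ?thesis using assms by (simp add: cubic_ratio_def C_lin G_bilin)
qed

lemma sqrt_cube_powr: "x > 0 \<Longrightarrow> sqrt x ^ 3 * x powr (-3/2) = 1"
proof -
  assume x: "x > 0"
  have "sqrt x ^ 3 = x powr (3/2)"
    using x by (simp add: powr_half_sqrt[symmetric] powr_powr powr_realpow[symmetric])
  then show ?thesis using x by (simp add: powr_add[symmetric])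
qed

lemma cubic_bound_iff: "cubic_bound p m \<longleftrightarrow> (\<forall>e. e \<noteq> 0 \<longrightarrow> cubic_ratio p e \<le> m)"
proof -
  have eq: "C p e e e \<le> m * sqrt (G p e e) ^ 3 \<longleftrightarrow> cubic_ratio p e \<le> m" if "e \<noteq> 0" for e
  proof -
    have pos: "G p e e powr (-3/2) > 0" "G p e e > 0" using G_pos[OF that, of p] by simp_all
    have "C p e e e \<le> m * sqrt (G p e e) ^ 3 \<longleftrightarrow>
        C p e e e * G p e e powr (-3/2) \<le> m * sqrt (G p e e) ^ 3 * G p e e powr (-3/2)"
      using pos by simp
    then show ?thesis
      using sqrt_cube_powr[OF pos(2)] by (simp add: cubic_ratio_def mult.assoc)
  qed
  have zero: "C p 0 0 0 \<le> m * sqrt (G p 0 0) ^ 3" by (simp add: C_lin G_bilin)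
  show ?thesis
    unfolding cubic_bound_def
  proof (rule iff_allI)
    show "(C p e e e \<le> m * sqrt (G p e e) ^ 3) = (e \<noteq> 0 \<longrightarrow> cubic_ratio p e \<le> m)" for e
      using eq[of e] zero by (cases "e = 0") simp_all
  qed
qed

lemma continuous_C_section:
  assumes "is_section \<tau> W"
  shows "continuous_on (W \<times> UNIV) (\<lambda>z. C (\<tau> (fst z)) (snd z) (snd z) (snd z))"
proof -
  have 0: "continuous_on (W \<times> UNIV) (\<lambda>z. C (\<tau> (fst z)) a b c)" for a b c
  proof -
    have "continuous_on W (\<lambda>x. C (\<tau> x) a b c)"
      unfolding C_def by (intro smooth_fun_continuous_section[OF _ assms] smooths)
    then show ?thesis by (rule continuous_on_compose2) (auto intro!: continuous_intros)
  qed
  have sc: "continuous_on (W \<times> UNIV) (snd :: _ \<Rightarrow> real^'n)" by (rule continuous_on_snd[OF continuous_on_id])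
  have 1: "continuous_on (W \<times> UNIV) (\<lambda>z. C (\<tau> (fst z)) a b (snd z))" for a b
    by (rule continuous_on_linear_arg[of "\<lambda>z c. C (\<tau> (fst z)) a b c"]) (rule linear_C3 0 sc)+
  have 2: "continuous_on (W \<times> UNIV) (\<lambda>z. C (\<tau> (fst z)) a (snd z) (snd z))" for a
    by (rule continuous_on_linear_arg[of "\<lambda>z b. C (\<tau> (fst z)) a b (snd z)"]) (rule linear_C2 1 sc)+
  show ?thesis
    by (rule continuous_on_linear_arg[of "\<lambda>z a. C (\<tau> (fst z)) a (snd z) (snd z)"]) (rule linear_C1 2 sc)+
qed

lemma continuous_G_section:
  assumes "is_section \<tau> W"
  shows "continuous_on (W \<times> UNIV) (\<lambda>z. G (\<tau> (fst z)) (snd z) (snd z))"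
proof -
  have 0: "continuous_on (W \<times> UNIV) (\<lambda>z. G (\<tau> (fst z)) a b)" for a b
  proof -
    have "continuous_on W (\<lambda>x. G (\<tau> x) a b)"
      unfolding G_def by (intro smooth_fun_continuous_section[OF _ assms] smooths)
    then show ?thesis by (rule continuous_on_compose2) (auto intro!: continuous_intros)
  qed
  have sc: "continuous_on (W \<times> UNIV) (snd :: _ \<Rightarrow> real^'n)" by (rule continuous_on_snd[OF continuous_on_id])
  have 1: "continuous_on (W \<times> UNIV) (\<lambda>z. G (\<tau> (fst z)) a (snd z))" for a
    by (rule continuous_on_linear_arg[of "\<lambda>z b. G (\<tau> (fst z)) a b"]) (rule linear_G2 0 sc)+
  show ?thesis
    by (rule continuous_on_linear_arg[of "\<lambda>z a. G (\<tau> (fst z)) a (snd z)"]) (rule linear_G 1 sc)+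
qed

text \<open>The \<open>G\<close>-unit sphere moves with the point, so compactness is applied to
  \<open>K\<close> times the Euclidean sphere; homogeneity of degree 0 allows the maximising vector
  to be rescaled to \<open>G\<close>-length 1 afterwards. The function \<open>q\<close> is zero or
  the quadratic cutoff.\<close>

lemma cubic_ratio_max:
  assumes \<tau>: "is_section \<tau> W" and K: "compact K" "K \<noteq> {}" "K \<subseteq> W" and q: "continuous_on K q"
  obtains x0 e0 where "x0 \<in> K" "G (\<tau> x0) e0 e0 = 1"
    "\<And>x e. x \<in> K \<Longrightarrow> e \<noteq> 0 \<Longrightarrow> cubic_ratio (\<tau> x) e - q x \<le> C (\<tau> x0) e0 e0 e0 - q x0"
proof -
  let ?S = "K \<times> sphere (0::real^'n) 1"
  let ?F = "\<lambda>z. cubic_ratio (\<tau> (fst z)) (snd z) - q (fst z)"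
  have "continuous_on ?S ?F"
    unfolding cubic_ratio_def
  proof (intro continuous_intros)
    show "continuous_on ?S (\<lambda>z. C (\<tau> (fst z)) (snd z) (snd z) (snd z))"
      using K(3) by (intro continuous_on_subset[OF continuous_C_section[OF \<tau>]]) auto
    show "continuous_on ?S (\<lambda>z. G (\<tau> (fst z)) (snd z) (snd z))"
      using K(3) by (intro continuous_on_subset[OF continuous_G_section[OF \<tau>]]) auto
    show "\<forall>z\<in>?S. G (\<tau> (fst z)) (snd z) (snd z) \<noteq> 0"
    proof
      fix z assume "z \<in> ?S"
      then have "snd z \<noteq> 0" by auto
      then show "G (\<tau> (fst z)) (snd z) (snd z) \<noteq> 0" using G_pos[of "snd z"] by (simp add: less_le)
    qed
    show "continuous_on ?S (\<lambda>z. q (fst z))"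
      by (rule continuous_on_compose2[OF q]) (auto intro!: continuous_intros)
  qed
  moreover have "compact ?S" using K(1) by (intro compact_Times) auto
  moreover have "?S \<noteq> {}" using K(2) by simp
  ultimately obtain z where z: "z \<in> ?S" "\<forall>y\<in>?S. ?F y \<le> ?F z"
    using continuous_attains_sup[of ?S ?F] by blast
  define x0 e1 where "x0 = fst z" and "e1 = snd z"
  have x0: "x0 \<in> K" "norm e1 = 1" using z(1) by (auto simp: x0_def e1_def)
  then have e1: "e1 \<noteq> 0" by auto
  then have g: "G (\<tau> x0) e1 e1 > 0" by (rule G_pos)
  define t where "t = 1 / sqrt (G (\<tau> x0) e1 e1)"
  have t: "t > 0" "t * (t * G (\<tau> x0) e1 e1) = 1" using g by (simp_all add: t_def field_simps)
  define e0 where "e0 = t *\<^sub>R e1"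
  have e0: "G (\<tau> x0) e0 e0 = 1" using t by (simp add: e0_def G_bilin)
  have r0: "cubic_ratio (\<tau> x0) e0 = C (\<tau> x0) e0 e0 e0" by (simp add: cubic_ratio_def e0)
  have "cubic_ratio (\<tau> x) e - q x \<le> C (\<tau> x0) e0 e0 e0 - q x0" if "x \<in> K" "e \<noteq> 0" for x e
  proof -
    have "?F (x, (1 / norm e) *\<^sub>R e) \<le> ?F z"
      using z(2) that by auto
    then show ?thesis
      using that cubic_ratio_scale[of "1 / norm e" "\<tau> x" e] cubic_ratio_scale[OF t(1), of "\<tau> x0" e1] r0
      by (simp add: x0_def[symmetric] e1_def[symmetric] e0_def)
  qed
  with x0(1) e0 show thesis by (rule that)
qed

lemma cubic_max_exists:
  "\<exists>m\<ge>0. cubic_bound p m \<and> (\<exists>e. G p e e = 1 \<and> C p e e e = m)"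
proof -
  obtain \<tau> W x where \<tau>: "is_section \<tau> W" "x \<in> W" "\<tau> x = p" by (rule section_through)
  obtain x0 e0 where e0: "x0 \<in> {x}" "G (\<tau> x0) e0 e0 = 1"
    "\<And>y e. y \<in> {x} \<Longrightarrow> e \<noteq> 0 \<Longrightarrow> cubic_ratio (\<tau> y) e - 0 \<le> C (\<tau> x0) e0 e0 e0 - 0"
    by (rule cubic_ratio_max[OF \<tau>(1), of "{x}" "\<lambda>_. 0"]) (use \<tau>(2) in auto)
  then have p: "G p e0 e0 = 1" "\<And>e. e \<noteq> 0 \<Longrightarrow> cubic_ratio p e \<le> C p e0 e0 e0" using \<tau>(3) by auto
  have "e0 \<noteq> 0" using p(1) by (auto simp: G_bilin)
  moreover have "cubic_ratio p (- e0) = - C p e0 e0 e0"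
    using p(1) bilinear_lneg[OF bilinear_G[of p], of e0] bilinear_rneg[OF bilinear_G[of p], of _ e0]
    by (simp add: cubic_ratio_def C_lin)
  ultimately have "C p e0 e0 e0 \<ge> 0" using p(2)[of "- e0"] by simp
  then show ?thesis using p cubic_bound_iff by blast
qed

text \<open>The function \<Lambda> of the overview. The choice determines a single number: the value
  is attained on a unit vector and is the least \<open>cubic_bound\<close>.\<close>

definition lam :: "'a \<Rightarrow> real" where
  "lam p = (SOME m. m \<ge> 0 \<and> cubic_bound p m \<and> (\<exists>e. G p e e = 1 \<and> C p e e e = m))"

lemma lam_props: "lam p \<ge> 0" "cubic_bound p (lam p)" "\<exists>e. G p e e = 1 \<and> C p e e e = lam p"
  using someI_ex[OF cubic_max_exists[of p]] unfolding lam_def by blast+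

lemma lam_le: "cubic_bound p m \<Longrightarrow> lam p \<le> m"
  using lam_props(3)[of p] unfolding cubic_bound_def by (metis mult.right_neutral power_one real_sqrt_one)

text \<open>Local boundedness of \<open>lam\<close> takes the role of its continuity in the point
  picking.\<close>

lemma lam_bounded_on_compact:
  assumes \<tau>: "is_section \<tau> W" and K: "compact K" "K \<noteq> {}" "K \<subseteq> W"
  obtains B where "\<And>x. x \<in> K \<Longrightarrow> lam (\<tau> x) \<le> B"
proof -
  obtain x0 e0 where e0: "x0 \<in> K" "G (\<tau> x0) e0 e0 = 1"
    "\<And>x e. x \<in> K \<Longrightarrow> e \<noteq> 0 \<Longrightarrow> cubic_ratio (\<tau> x) e - 0 \<le> C (\<tau> x0) e0 e0 e0 - 0"
    by (rule cubic_ratio_max[OF assms, of "\<lambda>_. 0"]) (rule continuous_on_const, blast)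
  then have "lam (\<tau> x) \<le> C (\<tau> x0) e0 e0 e0" if "x \<in> K" for x
    using that by (intro lam_le) (auto simp: cubic_bound_iff)
  then show thesis by (rule that)
qed

text \<open>An ellipsoid in the coordinate space, the ball of the constant metric frozen at
  \<open>q\<close>; it is not a ball of the Riemannian distance. Its convexity makes intersections
  connected, as the uniqueness of sections requires.\<close>

abbreviation gball :: "'a \<Rightarrow> real \<Rightarrow> (real^'n) set" where
  "gball q r \<equiv> {x. G q (x - \<iota> q) (x - \<iota> q) < r\<^sup>2}"

lemma continuous_G_quadratic: "continuous_on S (\<lambda>x. G q (x - a) (x - a))"
proof -
  have sc: "continuous_on S (\<lambda>x. x - a)" by (intro continuous_intros)
  have 1: "continuous_on S (\<lambda>x. G q b (x - a))" for b
    by (rule continuous_on_linear_arg[of "\<lambda>x. G q b"]) (rule linear_G2 continuous_on_const sc)+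
  show ?thesis
    by (rule continuous_on_linear_arg[of "\<lambda>x b. G q b (x - a)"]) (rule linear_G 1 sc)+
qed

lemma open_gball: "open (gball q r)"
  by (intro open_Collect_less continuous_G_quadratic continuous_on_const)

lemma G_convex_combination:
  assumes "s + t = 1"
  shows "G p (s *\<^sub>R x + t *\<^sub>R y) (s *\<^sub>R x + t *\<^sub>R y) = s * G p x x + t * G p y y - s * t * G p (x - y) (x - y)"
proof -
  have t: "t = 1 - s" using assms by simp
  show ?thesis unfolding t by (simp add: G_bilin G_sym[of p y x] algebra_simps)
qed

lemma convex_gball: "convex (gball q r)"
proof (rule convexI)
  fix x y and s t :: real
  assume xy: "x \<in> gball q r" "y \<in> gball q r" and st: "0 \<le> s" "0 \<le> t" "s + t = 1"
  have eq: "s *\<^sub>R x + t *\<^sub>R y - \<iota> q = s *\<^sub>R (x - \<iota> q) + t *\<^sub>R (y - \<iota> q)"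
    using st(3) by (simp add: algebra_simps flip: scaleR_add_left)
  have "G q (s *\<^sub>R x + t *\<^sub>R y - \<iota> q) (s *\<^sub>R x + t *\<^sub>R y - \<iota> q)
      \<le> s * G q (x - \<iota> q) (x - \<iota> q) + t * G q (y - \<iota> q) (y - \<iota> q)"
    unfolding eq G_convex_combination[OF st(3)] using st G_nonneg by simp
  also have "\<dots> < r\<^sup>2"
  proof (cases "s = 0")
    case True
    then show ?thesis using xy st by simp
  next
    case False
    have "s * G q (x - \<iota> q) (x - \<iota> q) < s * r\<^sup>2" using xy False st by simp
    moreover have "t * G q (y - \<iota> q) (y - \<iota> q) \<le> t * r\<^sup>2" using xy st by (intro mult_left_mono) auto
    moreover have "s * r\<^sup>2 + t * r\<^sup>2 = r\<^sup>2" using st(3) by (metis distrib_right mult_1)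
    ultimately show ?thesis by linarith
  qed
  finally show "s *\<^sub>R x + t *\<^sub>R y \<in> gball q r" by simp
qed

lemma G_coercive:
  obtains m where "m > 0" "\<And>w. m\<^sup>2 * (norm w)\<^sup>2 \<le> G q w w"
proof -
  have "continuous_on (sphere 0 1) (\<lambda>w. G q w w)" using continuous_G_quadratic[of _ q 0] by simp
  moreover have "axis undefined 1 \<in> sphere (0::real^'n) 1" by simp
  ultimately obtain w0 where w0: "w0 \<in> sphere 0 1" "\<And>w. w \<in> sphere 0 1 \<Longrightarrow> G q w0 w0 \<le> G q w w"
    using continuous_attains_inf[of "sphere (0::real^'n) 1" "\<lambda>w. G q w w"] compact_sphere by blast
  have pos: "G q w0 w0 > 0" using w0(1) by (intro G_pos) auto
  have "(sqrt (G q w0 w0))\<^sup>2 * (norm w)\<^sup>2 \<le> G q w w" for w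
  proof (cases "w = 0")
    case False
    have "G q w0 w0 \<le> G q ((1 / norm w) *\<^sub>R w) ((1 / norm w) *\<^sub>R w)" using False by (intro w0) auto
    then show ?thesis using False pos by (simp add: G_bilin field_simps power2_eq_square)
  qed (simp add: G_bilin)
  then show thesis using pos by (intro that[of "sqrt (G q w0 w0)"]) auto
qed

lemma compact_gcball: "compact {x. G q (x - \<iota> q) (x - \<iota> q) \<le> r\<^sup>2}"
proof -
  obtain m where m: "m > 0" "\<And>w. m\<^sup>2 * (norm w)\<^sup>2 \<le> G q w w" by (rule G_coercive[of q]) blast
  have "{x. G q (x - \<iota> q) (x - \<iota> q) \<le> r\<^sup>2} \<subseteq> cball (\<iota> q) (\<bar>r\<bar> / m)"
  proof
    fix x assume "x \<in> {x. G q (x - \<iota> q) (x - \<iota> q) \<le> r\<^sup>2}"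
    then have "(m * norm (x - \<iota> q))\<^sup>2 \<le> r\<^sup>2"
      using m(2)[of "x - \<iota> q"] by (simp add: power_mult_distrib)
    then have "m * norm (x - \<iota> q) \<le> \<bar>r\<bar>" using m(1) by (metis abs_le_square_iff abs_of_nonneg mult_nonneg_nonneg less_imp_le norm_ge_zero)
    then show "x \<in> cball (\<iota> q) (\<bar>r\<bar> / m)" using m(1) by (simp add: dist_norm norm_minus_commute field_simps)
  qed
  then have "bounded {x. G q (x - \<iota> q) (x - \<iota> q) \<le> r\<^sup>2}" using bounded_cball bounded_subset by blast
  moreover have "closed {x. G q (x - \<iota> q) (x - \<iota> q) \<le> r\<^sup>2}"
    by (intro closed_Collect_le continuous_G_quadratic continuous_on_const)
  ultimately show ?thesis by (simp add: compact_eq_bounded_closed)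
qed

text \<open>Compactness of the closed ellipsoid provides a Euclidean margin \<open>e\<close> inside
  \<open>V\<close>. A point of \<open>G q\<close>-radius \<open>t > r\<close> is moved by at most
  \<open>(t - r) / m\<close> when projected radially, so radii up to \<open>r + e * m\<close> stay
  in the margin.\<close>

lemma gball_superset:
  assumes r: "r > 0" and V: "open V" "{x. G q (x - \<iota> q) (x - \<iota> q) \<le> r\<^sup>2} \<subseteq> V"
  obtains r' where "r' > r" "gball q r' \<subseteq> V"
proof -
  obtain m where m: "m > 0" "\<And>w. m\<^sup>2 * (norm w)\<^sup>2 \<le> G q w w" by (rule G_coercive[of q]) blast
  obtain e where e: "e > 0" "(\<Union>x\<in>{x. G q (x - \<iota> q) (x - \<iota> q) \<le> r\<^sup>2}. ball x e) \<subseteq> V"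
    using compact_subset_open_imp_ball_epsilon_subset[OF compact_gcball V] by blast
  have "y \<in> V" if y: "y \<in> gball q (r + e * m)" for y
  proof (cases "G q (y - \<iota> q) (y - \<iota> q) \<le> r\<^sup>2")
    case True
    then show ?thesis using V by blast
  next
    case False
    let ?w = "y - \<iota> q"
    define t where "t = sqrt (G q ?w ?w)"
    have t2: "t\<^sup>2 = G q ?w ?w" "t \<ge> 0" by (simp_all add: t_def G_nonneg)
    have tr: "r < t" using False t2 r by (metis linorder_not_less power_mono)
    have te: "t < r + e * m" using y t2 r e m by (intro power_less_imp_less_base[of t 2]) auto
    have w: "m * norm ?w \<le> t"
    proof (rule power2_le_imp_le)
      show "(m * norm ?w)\<^sup>2 \<le> t\<^sup>2" using m(2)[of ?w] t2 by (simp add: power_mult_distrib)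
    qed (rule t2)
    let ?x = "\<iota> q + (r / t) *\<^sub>R ?w"
    have "?x - \<iota> q = (r / t) *\<^sub>R ?w" by simp
    then have "G q (?x - \<iota> q) (?x - \<iota> q) = (r / t)\<^sup>2 * t\<^sup>2" by (simp only: G_scale_square t2)
    also have "\<dots> = r\<^sup>2" using tr r by (simp add: power_divide)
    finally have "G q (?x - \<iota> q) (?x - \<iota> q) \<le> r\<^sup>2" by simp
    moreover have "dist ?x y < e"
    proof -
      have "?x - y = ((r - t) / t) *\<^sub>R ?w"
      proof -
        have "((r - t) / t) *\<^sub>R ?w = (r / t) *\<^sub>R ?w - ?w" using tr r by (simp add: diff_divide_distrib scaleR_left_diff_distrib)
        then show ?thesis by simp
      qed
      then have "dist ?x y = ((t - r) / t) * norm ?w" using tr r by (simp add: dist_norm)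
      also have "\<dots> \<le> ((t - r) / t) * (t / m)"
        using w m tr r by (intro mult_left_mono) (auto simp: field_simps)
      also have "\<dots> = (t - r) / m" using tr r by simp
      also have "\<dots> < e" using te m by (simp add: field_simps)
      finally show ?thesis .
    qed
    ultimately show ?thesis using e(2) by (force simp: subset_iff)
  qed
  then show thesis using e m by (intro that[of "r + e * m"]) auto
qed

end

text \<open>All that the analysis takes from the Riemannian distance: an upper bound through lifted
  coordinate segments, and the fact that small balls are small in the topology, so that convergence
  for \<open>d\<close> is convergence in the manifold.\<close>

locale complete_hessian = hessian_potential_locale \<iota> u
  for \<iota> :: "'a::t2_space \<Rightarrow> real^'n" and u :: "'a \<Rightarrow> real" +
  fixes d :: "'a \<Rightarrow> 'a \<Rightarrow> real"
  assumes metric: "Metric_space UNIV d" and complete: "Metric_space.mcomplete UNIV d"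
    and segment_length: "\<And>\<tau> W x y M. is_section \<tau> W \<Longrightarrow> closed_segment x y \<subseteq> W \<Longrightarrow>
      (\<And>z. z \<in> closed_segment x y \<Longrightarrow> sqrt (G (\<tau> z) (y - x) (y - x)) \<le> M) \<Longrightarrow> d (\<tau> x) (\<tau> y) \<le> M"
    and small_balls: "\<And>p V. open V \<Longrightarrow> p \<in> V \<Longrightarrow> \<exists>\<delta>>0. \<forall>q. d p q < \<delta> \<longrightarrow> q \<in> V"
begin

interpretation Metric_space UNIV d by (rule metric)

lemma cauchy_limit:
  assumes "\<And>\<epsilon>. \<epsilon> > 0 \<Longrightarrow> \<exists>N. \<forall>n n'. N \<le> n \<longrightarrow> N \<le> n' \<longrightarrow> d (s n) (s n') < \<epsilon>"
  obtains l where "\<And>\<epsilon>. \<epsilon> > 0 \<Longrightarrow> \<forall>\<^sub>F n in sequentially. d (s n) l < \<epsilon>"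
    "\<And>V. open V \<Longrightarrow> l \<in> V \<Longrightarrow> \<forall>\<^sub>F n in sequentially. s n \<in> V"
proof -
  have "MCauchy s" using assms by (simp add: MCauchy_def)
  then obtain l where "limitin mtopology s l sequentially"
    using complete unfolding mcomplete_def by blast
  then have l: "\<forall>\<^sub>F n in sequentially. d (s n) l < \<epsilon>" if "\<epsilon> > 0" for \<epsilon>
    using that by (simp add: limitin_metric)
  moreover have "\<forall>\<^sub>F n in sequentially. s n \<in> V" if V: "open V" "l \<in> V" for V
  proof -
    obtain \<delta> where "\<delta> > 0" "\<And>q. d l q < \<delta> \<Longrightarrow> q \<in> V" using small_balls[OF V] by blast
    then show ?thesis using l[of \<delta>] by (auto simp: commute elim: eventually_mono)
  qed
  ultimately show thesis by (rule that)
qed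

text \<open>Otherwise every point has a successor within \<open>1 / lam\<close> of it at which
  \<open>lam\<close> is larger by the factor \<open>1 + \<epsilon>\<close>. The jumps then shrink
  geometrically and the chain converges by completeness, while \<open>lam\<close> tends to infinity
  along it.\<close>

lemma point_picking:
  assumes p0: "lam p0 > 0" and \<epsilon>: "\<epsilon> > 0"
  shows "\<exists>q. lam q \<ge> lam p0 \<and> (\<forall>p. d q p \<le> 1 / lam q \<longrightarrow> lam p \<le> (1 + \<epsilon>) * lam q)"
proof (rule ccontr)
  assume neg: "\<not> ?thesis"
  have "\<exists>p. d q p \<le> 1 / lam q \<and> lam p > (1 + \<epsilon>) * lam q" if "lam q \<ge> lam p0" for q
    using that neg by (meson not_le_imp_less)
  then obtain f where f: "\<And>q. lam q \<ge> lam p0 \<Longrightarrow> d q (f q) \<le> 1 / lam q \<and> lam (f q) > (1 + \<epsilon>) * lam q"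
    by metis
  define s where "s n = (f ^^ n) p0" for n
  have s: "lam (s n) \<ge> (1 + \<epsilon>) ^ n * lam p0" for n
  proof (induction n)
    case (Suc n)
    have "(1 + \<epsilon>) ^ n \<ge> 1" using \<epsilon> by (intro one_le_power) simp
    then have "lam (s n) \<ge> lam p0" using Suc p0 by (smt (verit) mult_le_cancel_right1)
    then have "lam (s (Suc n)) > (1 + \<epsilon>) * lam (s n)" using f by (simp add: s_def)
    moreover have "(1 + \<epsilon>) * lam (s n) \<ge> (1 + \<epsilon>) * ((1 + \<epsilon>) ^ n * lam p0)"
      using Suc \<epsilon> by (intro mult_left_mono) auto
    ultimately show ?case by (simp add: mult.assoc)
  qed (simp add: s_def)
  have ge: "lam (s n) \<ge> lam p0" for n
  proof -
    have "(1 + \<epsilon>) ^ n \<ge> 1" using \<epsilon> by (intro one_le_power) simp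
    then show ?thesis using s[of n] p0 by (smt (verit) mult_le_cancel_right1)
  qed
  define \<rho> where "\<rho> = 1 / (1 + \<epsilon>)"
  have \<rho>: "0 < \<rho>" "\<rho> < 1" using \<epsilon> by (auto simp: \<rho>_def)
  \<comment> \<open>Chosen so that the n-th jump is bounded by the telescoping difference
    \<open>b * (\<rho> ^ n - \<rho> ^ Suc n)\<close>.\<close>
  define b where "b = 1 / (lam p0 * (1 - \<rho>))"
  have b: "b > 0" using p0 \<rho> by (simp add: b_def)
  have step: "d (s n) (s (Suc n)) \<le> b * (\<rho> ^ n - \<rho> ^ Suc n)" for n
  proof -
    have "d (s n) (s (Suc n)) \<le> 1 / lam (s n)" using f[OF ge[of n]] by (simp add: s_def)
    also have "\<dots> \<le> 1 / ((1 + \<epsilon>) ^ n * lam p0)"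
      using s[of n] ge[of n] p0 \<epsilon> by (intro divide_left_mono mult_pos_pos) auto
    also have "\<dots> = \<rho> ^ n / lam p0" by (simp add: \<rho>_def power_divide)
    also have "\<dots> = b * (\<rho> ^ n - \<rho> ^ Suc n)"
    proof -
      have "\<rho> ^ n - \<rho> ^ Suc n = \<rho> ^ n * (1 - \<rho>)" by (simp add: algebra_simps)
      then show ?thesis using \<rho> p0 by (simp add: b_def field_simps)
    qed
    finally show ?thesis .
  qed
  have far: "d (s n) (s (n + k)) \<le> b * (\<rho> ^ n - \<rho> ^ (n + k))" for n k
  proof (induction k)
    case (Suc k)
    have "d (s n) (s (n + Suc k)) \<le> d (s n) (s (n + k)) + d (s (n + k)) (s (n + Suc k))"
      by (rule triangle) auto
    then show ?case using Suc step[of "n + k"] by (simp add: algebra_simps)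
  qed simp
  have far': "d (s n) (s m) \<le> b * \<rho> ^ n" if "n \<le> m" for n m
  proof -
    have "b * (\<rho> ^ n - \<rho> ^ m) \<le> b * \<rho> ^ n" using b \<rho> by (intro mult_left_mono) auto
    then show ?thesis using far[of n "m - n"] that by simp
  qed
  have "\<exists>N. \<forall>n n'. N \<le> n \<longrightarrow> N \<le> n' \<longrightarrow> d (s n) (s n') < e" if e: "e > 0" for e
  proof -
    obtain N where N: "\<rho> ^ N < e / b" using real_arch_pow_inv[of "e / b" \<rho>] e b \<rho> by auto
    have "d (s n) (s n') < e" if "N \<le> n" "N \<le> n'" for n n'
    proof -
      have "d (s n) (s n') \<le> b * \<rho> ^ min n n'"
        using far'[of n n'] far'[of n' n] by (cases "n \<le> n'") (auto simp: commute min_def)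
      also have "\<dots> \<le> b * \<rho> ^ N" using b \<rho> that by (intro mult_left_mono power_decreasing) auto
      also have "\<dots> < e" using N b by (simp add: field_simps)
      finally show ?thesis .
    qed
    then show ?thesis by blast
  qed
  then obtain l where l: "\<And>V. open V \<Longrightarrow> l \<in> V \<Longrightarrow> \<forall>\<^sub>F n in sequentially. s n \<in> V"
    using cauchy_limit[of s] by metis
  obtain r \<tau> where r: "r > 0" "is_section \<tau> (ball (\<iota> l) r)" "\<tau> (\<iota> l) = l"
    by (rule local_section[OF open_UNIV UNIV_I])
  \<comment> \<open>A compact coordinate ball about the limit contains the tail of the chain in its
    lift, and there \<open>lam\<close> has a bound.\<close>
  obtain B where B: "\<And>x. x \<in> cball (\<iota> l) (r / 2) \<Longrightarrow> lam (\<tau> x) \<le> B"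
    by (rule lam_bounded_on_compact[OF r(2), of "cball (\<iota> l) (r / 2)"]) (use r(1) in auto)
  have "is_section \<tau> (ball (\<iota> l) (r / 2))" using r(1) by (intro is_section_subset[OF r(2)]) auto
  then have "open (\<tau> ` ball (\<iota> l) (r / 2))" by (rule section_open_image)
  moreover have "l \<in> \<tau> ` ball (\<iota> l) (r / 2)" using r by (intro image_eqI[of _ _ "\<iota> l"]) auto
  ultimately have "\<forall>\<^sub>F n in sequentially. s n \<in> \<tau> ` ball (\<iota> l) (r / 2)" by (rule l)
  then have "\<forall>\<^sub>F n in sequentially. (1 + \<epsilon>) ^ n * lam p0 \<le> B"
  proof eventually_elim
    case (elim n)
    then obtain x where "x \<in> ball (\<iota> l) (r / 2)" "s n = \<tau> x" by blast
    then show ?case using s[of n] B[of x] by auto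
  qed
  moreover have "\<forall>\<^sub>F n in sequentially. (1 + \<epsilon>) ^ n > B / lam p0"
  proof -
    obtain N where "B / lam p0 < (1 + \<epsilon>) ^ N" using real_arch_pow[of "1 + \<epsilon>"] \<epsilon> by auto
    then have "B / lam p0 < (1 + \<epsilon>) ^ n" if "n \<ge> N" for n
    proof -
      have "(1 + \<epsilon>) ^ N \<le> (1 + \<epsilon>) ^ n" using that \<epsilon> by (intro power_increasing) auto
      with \<open>B / lam p0 < (1 + \<epsilon>) ^ N\<close> show ?thesis by linarith
    qed
    then show ?thesis by (auto simp: eventually_sequentially)
  qed
  ultimately have "\<forall>\<^sub>F n in sequentially. False"
    by eventually_elim (use p0 in \<open>simp add: field_simps\<close>)
  then show False by simp
qed

end

section \<open>Local inverses of the development map on metric balls\<close>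

context complete_hessian
begin

lemma gball_zero: "r > 0 \<Longrightarrow> \<iota> q \<in> gball q r"
  by (simp add: G_bilin)

lemma gball_mono: "0 \<le> r \<Longrightarrow> r \<le> r' \<Longrightarrow> gball q r \<subseteq> gball q r'"
  by (auto intro: less_le_trans power_mono)

text \<open>Radial speeds at most double, whence 4 = 2^2 for squared lengths. The condition ranges
  over every radius up to \<open>R\<close> and every section through \<open>q\<close> because it is
  applied to sections that are still being enlarged.\<close>

definition radially_bounded :: "'a \<Rightarrow> real \<Rightarrow> bool" where
  "radially_bounded q R \<longleftrightarrow> (\<forall>\<rho> \<tau>. 0 < \<rho> \<longrightarrow> \<rho> \<le> R \<longrightarrow> is_section \<tau> (gball q \<rho>) \<longrightarrow> \<tau> (\<iota> q) = q \<longrightarrow>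
     (\<forall>x\<in>gball q \<rho>. G (\<tau> x) (x - \<iota> q) (x - \<iota> q) \<le> 4 * G q (x - \<iota> q) (x - \<iota> q)))"

lemma radial_direction_bound:
  assumes rb: "radially_bounded q R" and \<rho>: "0 < \<rho>" "\<rho> \<le> R" and \<tau>: "is_section \<tau> (gball q \<rho>)" "\<tau> (\<iota> q) = q"
    and z: "\<iota> q + s *\<^sub>R w \<in> gball q \<rho>"
  shows "G (\<tau> (\<iota> q + s *\<^sub>R w)) w w \<le> 4 * G q w w"
proof (cases "s = 0")
  case True
  then show ?thesis using \<tau>(2) G_nonneg[of q w] by simp
next
  case False
  have "G (\<tau> (\<iota> q + s *\<^sub>R w)) (s *\<^sub>R w) (s *\<^sub>R w) \<le> 4 * G q (s *\<^sub>R w) (s *\<^sub>R w)"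
    using rb[unfolded radially_bounded_def, rule_format, OF \<rho> \<tau> z] by (simp only: add_diff_cancel_left')
  then show ?thesis using False unfolding G_scale_square by simp
qed

lemma radial_distance:
  assumes rb: "radially_bounded q R" and \<rho>: "0 < \<rho>" "\<rho> \<le> R" and \<tau>: "is_section \<tau> (gball q \<rho>)" "\<tau> (\<iota> q) = q"
    and s: "\<And>s. s \<in> closed_segment s1 s2 \<Longrightarrow> \<iota> q + s *\<^sub>R w \<in> gball q \<rho>"
  shows "d (\<tau> (\<iota> q + s1 *\<^sub>R w)) (\<tau> (\<iota> q + s2 *\<^sub>R w)) \<le> 2 * \<bar>s2 - s1\<bar> * sqrt (G q w w)"
proof (rule segment_length[OF \<tau>(1)])
  have seg: "\<exists>s\<in>closed_segment s1 s2. z = \<iota> q + s *\<^sub>R w"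
    if z: "z \<in> closed_segment (\<iota> q + s1 *\<^sub>R w) (\<iota> q + s2 *\<^sub>R w)" for z
  proof -
    obtain t where t: "0 \<le> t" "t \<le> 1" "z = (1 - t) *\<^sub>R (\<iota> q + s1 *\<^sub>R w) + t *\<^sub>R (\<iota> q + s2 *\<^sub>R w)"
      using z unfolding closed_segment_def by blast
    have "(1 - t) * s1 + t * s2 \<in> closed_segment s1 s2"
      using t(1,2) unfolding closed_segment_def by (intro CollectI exI[of _ t]) simp
    moreover have "z = \<iota> q + ((1 - t) * s1 + t * s2) *\<^sub>R w" using t(3) by (simp add: algebra_simps)
    ultimately show ?thesis by blast
  qed
  show "closed_segment (\<iota> q + s1 *\<^sub>R w) (\<iota> q + s2 *\<^sub>R w) \<subseteq> gball q \<rho>"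
    using seg s by blast
  fix z assume "z \<in> closed_segment (\<iota> q + s1 *\<^sub>R w) (\<iota> q + s2 *\<^sub>R w)"
  then obtain s' where s': "s' \<in> closed_segment s1 s2" "z = \<iota> q + s' *\<^sub>R w" using seg by blast
  have "G (\<tau> z) w w \<le> 4 * G q w w"
    unfolding s'(2) by (rule radial_direction_bound[OF rb \<rho> \<tau> s[OF s'(1)]])
  then have "(s2 - s1)\<^sup>2 * G (\<tau> z) w w \<le> (s2 - s1)\<^sup>2 * (4 * G q w w)" by (intro mult_left_mono) auto
  then have "sqrt ((s2 - s1)\<^sup>2 * G (\<tau> z) w w) \<le> sqrt ((s2 - s1)\<^sup>2 * (4 * G q w w))"
    by (rule real_sqrt_le_mono)
  moreover have "\<iota> q + s2 *\<^sub>R w - (\<iota> q + s1 *\<^sub>R w) = (s2 - s1) *\<^sub>R w" by (simp add: algebra_simps)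
  ultimately show "sqrt (G (\<tau> z) (\<iota> q + s2 *\<^sub>R w - (\<iota> q + s1 *\<^sub>R w)) (\<iota> q + s2 *\<^sub>R w - (\<iota> q + s1 *\<^sub>R w)))
      \<le> 2 * \<bar>s2 - s1\<bar> * sqrt (G q w w)"
    by (simp add: G_scale_square real_sqrt_mult)
qed

text \<open>The lift of the ray towards \<open>x\<close> has bounded speed, so it is Cauchy and
  completeness gives a point \<open>l\<close> over \<open>x\<close>. A section through
  \<open>l\<close> meets the lifted ray, hence agrees with \<open>\<tau>\<close> on the convex set
  where both are defined.\<close>

lemma boundary_section:
  assumes rb: "radially_bounded q R" and \<rho>: "0 < \<rho>" "\<rho> \<le> R" and \<tau>: "is_section \<tau> (gball q \<rho>)" "\<tau> (\<iota> q) = q"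
    and x: "G q (x - \<iota> q) (x - \<iota> q) \<le> \<rho>\<^sup>2"
  shows "\<exists>r \<sigma>. r > 0 \<and> is_section \<sigma> (ball x r) \<and> (\<forall>y\<in>ball x r \<inter> gball q \<rho>. \<sigma> y = \<tau> y)"
proof -
  interpret Metric_space UNIV d by (rule metric)
  define w where "w = x - \<iota> q"
  have ray: "\<iota> q + s *\<^sub>R w \<in> gball q \<rho>" if "0 \<le> s" "s < 1" for s
  proof -
    have "s\<^sup>2 * G q w w \<le> s\<^sup>2 * \<rho>\<^sup>2" using x by (intro mult_left_mono) (auto simp: w_def)
    also have "\<dots> < 1 * \<rho>\<^sup>2" using that \<rho>(1) by (intro mult_strict_right_mono) (auto simp: power_less_one_iff)
    finally show ?thesis by (simp add: G_scale_square)
  qed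
  \<comment> \<open>These times stay below 1, so the lift is evaluated only inside the open
    ellipsoid even when \<open>x\<close> lies on its boundary.\<close>
  define s where "s n = 1 - 1 / real (Suc n)" for n
  have s01: "0 \<le> s n" "s n < 1" for n by (simp_all add: s_def)
  define y where "y n = \<tau> (\<iota> q + s n *\<^sub>R w)" for n
  \<comment> \<open>The summand 1 keeps this Lipschitz constant positive when
    \<open>w = 0\<close>.\<close>
  define L where "L = 2 * sqrt (G q w w) + 1"
  have L: "L > 0" by (simp add: L_def add_nonneg_pos G_nonneg)
  have dy: "d (y n) (y m) \<le> \<bar>s m - s n\<bar> * L" for n m
  proof -
    have "\<iota> q + t *\<^sub>R w \<in> gball q \<rho>" if "t \<in> closed_segment (s n) (s m)" for t
      using that s01[of n] s01[of m] by (intro ray) (auto simp: closed_segment_eq_real_ivl split: if_splits)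
    then have "d (y n) (y m) \<le> 2 * \<bar>s m - s n\<bar> * sqrt (G q w w)"
      unfolding y_def by (rule radial_distance[OF rb \<rho> \<tau>])
    also have "\<dots> \<le> \<bar>s m - s n\<bar> * L" by (simp add: L_def algebra_simps)
    finally show ?thesis .
  qed
  have s_lim: "s \<longlonglongrightarrow> 1"
    unfolding s_def using tendsto_diff[OF tendsto_const LIMSEQ_inverse_real_of_nat, of 1] by (simp add: inverse_eq_divide)
  have "\<exists>N. \<forall>n n'. N \<le> n \<longrightarrow> N \<le> n' \<longrightarrow> d (y n) (y n') < e" if e: "e > 0" for e
  proof -
    have "Cauchy s" using s_lim by (intro LIMSEQ_imp_Cauchy)
    then obtain N where N: "\<And>m n. m \<ge> N \<Longrightarrow> n \<ge> N \<Longrightarrow> dist (s m) (s n) < e / L"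
      using e L unfolding Cauchy_def by (meson divide_pos_pos)
    have "d (y n) (y n') < e" if "N \<le> n" "N \<le> n'" for n n'
    proof -
      have "\<bar>s n' - s n\<bar> * L < e / L * L" using N[OF that(2,1)] L by (intro mult_strict_right_mono) (auto simp: dist_real_def)
      then show ?thesis using dy[of n n'] L by simp
    qed
    then show ?thesis by blast
  qed
  then obtain l where "\<And>\<epsilon>. \<epsilon> > 0 \<Longrightarrow> \<forall>\<^sub>F n in sequentially. d (y n) l < \<epsilon>"
    and l: "\<And>V. open V \<Longrightarrow> l \<in> V \<Longrightarrow> \<forall>\<^sub>F n in sequentially. y n \<in> V"
    using cauchy_limit[of y] by blast
  have iy: "\<iota> (y n) = \<iota> q + s n *\<^sub>R w" for n
    unfolding y_def by (rule section_right_inverse[OF \<tau>(1) ray[OF s01]])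
  have "(\<lambda>n. \<iota> (y n)) \<longlonglongrightarrow> \<iota> l"
  proof (rule topological_tendstoI)
    fix S assume "open S" "\<iota> l \<in> S"
    then show "\<forall>\<^sub>F n in sequentially. \<iota> (y n) \<in> S"
      using l[OF open_vimage[OF _ continuous_dev]] by (auto elim: eventually_mono)
  qed
  moreover have "(\<lambda>n. \<iota> (y n)) \<longlonglongrightarrow> \<iota> q + 1 *\<^sub>R w"
    unfolding iy by (intro tendsto_intros s_lim)
  ultimately have "\<iota> l = \<iota> q + 1 *\<^sub>R w" by (rule LIMSEQ_unique)
  then have il: "\<iota> l = x" by (simp add: w_def)
  obtain r \<sigma> where \<sigma>: "r > 0" "is_section \<sigma> (ball x r)" "\<sigma> x = l"
    by (rule local_section[OF open_UNIV UNIV_I, of l]) (simp only: il)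
  have "open (\<sigma> ` ball x r)" "l \<in> \<sigma> ` ball x r"
    using section_open_image[OF \<sigma>(2)] \<sigma> by auto
  from l[OF this] obtain n where n: "y n \<in> \<sigma> ` ball x r"
    using eventually_happens'[OF sequentially_bot] by blast
  then obtain z where z: "z \<in> ball x r" "y n = \<sigma> z" by blast
  then have zn: "z = \<iota> q + s n *\<^sub>R w" using section_right_inverse[OF \<sigma>(2)] iy by metis
  have "\<sigma> t = \<tau> t" if t: "t \<in> ball x r \<inter> gball q \<rho>" for t
  proof (rule section_unique[OF \<sigma>(2) \<tau>(1), of "ball x r \<inter> gball q \<rho>" z])
    show "connected (ball x r \<inter> gball q \<rho>)"
      by (intro convex_connected convex_Int convex_ball convex_gball)
    show "z \<in> ball x r \<inter> gball q \<rho>" using z(1) ray[OF s01, of n] zn by blast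
    show "\<sigma> z = \<tau> z" using z(2) zn by (simp add: y_def)
  qed (use t in auto)
  then show ?thesis using \<sigma>(1,2) by blast
qed

text \<open>Local sections over the closed ellipsoid are glued. They are known to agree only through
  \<open>\<tau>\<close>, so the point is that two of the balls which meet at all meet already inside
  the open ellipsoid.\<close>

lemma extend_section_beyond:
  assumes rb: "radially_bounded q R" and \<rho>: "0 < \<rho>" "\<rho> \<le> R" and \<tau>: "is_section \<tau> (gball q \<rho>)" "\<tau> (\<iota> q) = q"
  shows "\<exists>\<rho>' \<tau>'. \<rho>' > \<rho> \<and> is_section \<tau>' (gball q \<rho>') \<and> \<tau>' (\<iota> q) = q"
proof -
  let ?K = "{x. G q (x - \<iota> q) (x - \<iota> q) \<le> \<rho>\<^sup>2}"
  obtain r \<sigma> where \<sigma>: "\<And>x. x \<in> ?K \<Longrightarrow> r x > 0" "\<And>x. x \<in> ?K \<Longrightarrow> is_section (\<sigma> x) (ball x (r x))"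
    "\<And>x y. x \<in> ?K \<Longrightarrow> y \<in> ball x (r x) \<Longrightarrow> y \<in> gball q \<rho> \<Longrightarrow> \<sigma> x y = \<tau> y"
  proof -
    have "\<forall>x\<in>?K. \<exists>r \<sigma>. r > 0 \<and> is_section \<sigma> (ball x r) \<and> (\<forall>y\<in>ball x r \<inter> gball q \<rho>. \<sigma> y = \<tau> y)"
      using boundary_section[OF assms] by blast
    from bchoice[OF this] obtain r where
      "\<forall>x\<in>?K. \<exists>\<sigma>. r x > 0 \<and> is_section \<sigma> (ball x (r x)) \<and> (\<forall>y\<in>ball x (r x) \<inter> gball q \<rho>. \<sigma> y = \<tau> y)"
      by (rule exE)
    from bchoice[OF this] obtain \<sigma> where "\<forall>x\<in>?K. r x > 0 \<and> is_section (\<sigma> x) (ball x (r x)) \<and>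
        (\<forall>y\<in>ball x (r x) \<inter> gball q \<rho>. \<sigma> x y = \<tau> y)"
      by (rule exE)
    then show thesis by (intro that[of r \<sigma>]) auto
  qed
  have near: "\<exists>y. y \<in> ball a ra \<inter> ball b rb \<and> y \<in> gball q \<rho>"
    if ab: "a \<in> ?K" "b \<in> ?K" and ne: "z \<in> ball a ra" "z \<in> ball b rb" for a b ra rb z
  proof -
    have rab: "ra > 0" "rb > 0" "dist a b < ra + rb"
      using ne dist_triangle_less_add[of a z ra b rb] zero_le_dist[of a z] zero_le_dist[of b z]
      by (auto simp: dist_commute simp del: zero_le_dist)
    \<comment> \<open>Dividing the segment between the centres in the ratio of the radii gives a
      point in both balls, and convexity keeps it in the closed ellipsoid.\<close>
    define t where "t = ra / (ra + rb)"
    have t: "0 < t" "t < 1" using rab by (auto simp: t_def)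
    define m where "m = (1 - t) *\<^sub>R a + t *\<^sub>R b"
    have "dist a m = t * dist a b"
    proof -
      have "a - m = t *\<^sub>R (a - b)" by (simp add: m_def algebra_simps)
      then show ?thesis using t by (simp add: dist_norm)
    qed
    also have "\<dots> < t * (ra + rb)" using t rab by simp
    also have "\<dots> = ra" using rab by (simp add: t_def)
    finally have ma: "m \<in> ball a ra" by simp
    have "dist b m = (1 - t) * dist a b"
    proof -
      have "b - m = (1 - t) *\<^sub>R (b - a)" by (simp add: m_def algebra_simps)
      then show ?thesis using t by (simp add: dist_norm norm_minus_commute)
    qed
    also have "\<dots> < (1 - t) * (ra + rb)" using t rab by simp
    also have "\<dots> = rb" using rab by (simp add: t_def field_simps)
    finally have mb: "m \<in> ball b rb" by simp
    have mK: "m \<in> ?K"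
    proof -
      have eq: "m - \<iota> q = (1 - t) *\<^sub>R (a - \<iota> q) + t *\<^sub>R (b - \<iota> q)" by (simp add: m_def algebra_simps)
      have "G q (m - \<iota> q) (m - \<iota> q) \<le> (1 - t) * G q (a - \<iota> q) (a - \<iota> q) + t * G q (b - \<iota> q) (b - \<iota> q)"
        unfolding eq using G_convex_combination[of "1 - t" t q "a - \<iota> q" "b - \<iota> q"] t G_nonneg by simp
      also have "\<dots> \<le> (1 - t) * \<rho>\<^sup>2 + t * \<rho>\<^sup>2"
        using ab t by (intro add_mono mult_left_mono) auto
      finally show ?thesis by (simp add: algebra_simps)
    qed
    have "open (ball a ra \<inter> ball b rb)" by auto
    then obtain e where e: "e > 0" "ball m e \<subseteq> ball a ra \<inter> ball b rb"
      using ma mb open_contains_ball by (metis IntI)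
    \<comment> \<open>A shift towards the centre that is short enough to stay in both balls and long
      enough to enter the open ellipsoid.\<close>
    define k where "k = min (1/2) (e / (2 * (norm (m - \<iota> q) + 1)))"
    have np: "norm (m - \<iota> q) + 1 > 0" by (simp add: add_nonneg_pos)
    have k: "0 < k" "k \<le> 1/2" "k * (norm (m - \<iota> q) + 1) < e"
    proof -
      show "0 < k" using e np by (simp add: k_def)
      show "k \<le> 1/2" unfolding k_def by (rule min.cobounded1)
      have "k * (norm (m - \<iota> q) + 1) \<le> e / (2 * (norm (m - \<iota> q) + 1)) * (norm (m - \<iota> q) + 1)"
        using np by (intro mult_right_mono) (auto simp: k_def)
      also have "\<dots> = e / 2" using np by (simp add: field_simps)
      finally show "k * (norm (m - \<iota> q) + 1) < e" using e by simp
    qed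
    let ?y = "m - k *\<^sub>R (m - \<iota> q)"
    have "dist m ?y = k * norm (m - \<iota> q)" using k(1) by (simp add: dist_norm)
    also have "\<dots> < e" using k by (simp add: algebra_simps)
    finally have "?y \<in> ball m e" by simp
    moreover have "?y \<in> gball q \<rho>"
    proof -
      have "?y - \<iota> q = (1 - k) *\<^sub>R (m - \<iota> q)" by (simp add: algebra_simps)
      then have "G q (?y - \<iota> q) (?y - \<iota> q) = (1 - k)\<^sup>2 * G q (m - \<iota> q) (m - \<iota> q)" by (simp only: G_scale_square)
      also have "\<dots> \<le> (1 - k)\<^sup>2 * \<rho>\<^sup>2" using mK by (intro mult_left_mono) auto
      also have "\<dots> < 1 * \<rho>\<^sup>2" using k \<rho>(1) by (intro mult_strict_right_mono) (auto simp: power_less_one_iff)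
      finally show ?thesis by simp
    qed
    ultimately show ?thesis using e(2) by blast
  qed
  have agree: "\<sigma> a z = \<sigma> b z" if ab: "a \<in> ?K" "b \<in> ?K" and z: "z \<in> ball a (r a)" "z \<in> ball b (r b)" for a b z
  proof -
    obtain y where y: "y \<in> ball a (r a) \<inter> ball b (r b)" "y \<in> gball q \<rho>" using near[OF ab z] by blast
    have "\<sigma> a y = \<sigma> b y" using \<sigma>(3) ab y by auto
    then show ?thesis
      using section_unique[OF \<sigma>(2)[OF ab(1)] \<sigma>(2)[OF ab(2)], of "ball a (r a) \<inter> ball b (r b)" y z] y(1) z
      by (simp add: convex_connected convex_Int)
  qed
  obtain \<tau>' where \<tau>': "is_section \<tau>' (\<Union>x\<in>?K. ball x (r x))"
    "\<And>x z. x \<in> ?K \<Longrightarrow> z \<in> ball x (r x) \<Longrightarrow> \<tau>' z = \<sigma> x z"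
    by (rule glue_sections[of ?K \<sigma> "\<lambda>x. ball x (r x)", OF \<sigma>(2) agree]) blast+
  have open_U: "open (\<Union>x\<in>?K. ball x (r x))" by blast
  have "?K \<subseteq> (\<Union>x\<in>?K. ball x (r x))" using \<sigma>(1) by force
  then obtain \<rho>' where \<rho>': "\<rho>' > \<rho>" "gball q \<rho>' \<subseteq> (\<Union>x\<in>?K. ball x (r x))"
    using gball_superset[OF \<rho>(1) open_U] by blast
  have qK: "\<iota> q \<in> ?K" by (simp add: G_bilin)
  have "\<tau>' (\<iota> q) = q"
    using \<tau>'(2)[OF qK, of "\<iota> q"] \<sigma>(1,3)[OF qK] gball_zero[OF \<rho>(1), of q] \<tau>(2) by simp
  then show ?thesis using \<rho>' is_section_subset[OF \<tau>'(1) open_gball] by blast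
qed

text \<open>A supremum argument on the radius: sections of smaller radius agree by uniqueness and
  glue to one at the supremum, and \<open>extend_section_beyond\<close> would enlarge it if the
  supremum were below \<open>R\<close>.\<close>

lemma extend_section:
  assumes rb: "radially_bounded q R" and R: "R > 0"
  shows "\<exists>\<tau>. is_section \<tau> (gball q R) \<and> \<tau> (\<iota> q) = q"
proof -
  define S where "S = {\<rho>. 0 < \<rho> \<and> \<rho> \<le> R \<and> (\<exists>\<tau>. is_section \<tau> (gball q \<rho>) \<and> \<tau> (\<iota> q) = q)}"
  obtain r0 \<tau>0 where \<tau>0: "r0 > 0" "is_section \<tau>0 (ball (\<iota> q) r0)" "\<tau>0 (\<iota> q) = q"
    by (rule local_section[OF open_UNIV UNIV_I])
  have "\<exists>\<rho>. \<rho> \<in> S"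
  proof -
    obtain m where m: "m > 0" "\<And>w. m\<^sup>2 * (norm w)\<^sup>2 \<le> G q w w" by (rule G_coercive[of q]) blast
    let ?\<rho> = "min R (m * r0)"
    have "gball q ?\<rho> \<subseteq> ball (\<iota> q) r0"
    proof
      fix x assume x: "x \<in> gball q ?\<rho>"
      have "(m * norm (x - \<iota> q))\<^sup>2 < (m * r0)\<^sup>2"
      proof -
        have "(m * norm (x - \<iota> q))\<^sup>2 \<le> G q (x - \<iota> q) (x - \<iota> q)" using m(2) by (simp add: power_mult_distrib)
        also have "\<dots> < ?\<rho>\<^sup>2" using x by simp
        also have "\<dots> \<le> (m * r0)\<^sup>2" using R m(1) \<tau>0(1) by (intro power_mono) simp_all
        finally show ?thesis .
      qed
      then have "m * norm (x - \<iota> q) < m * r0"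
        by (rule power_less_imp_less_base) (use m(1) \<tau>0(1) in simp)
      then show "x \<in> ball (\<iota> q) r0" using m(1) by (simp add: dist_norm norm_minus_commute)
    qed
    then have "is_section \<tau>0 (gball q ?\<rho>)" by (rule is_section_subset[OF \<tau>0(2) open_gball])
    moreover have "0 < ?\<rho>" using R m \<tau>0 by simp
    ultimately have "?\<rho> \<in> S" using \<tau>0(3) by (auto simp: S_def)
    then show ?thesis ..
  qed
  then obtain \<rho>1 where \<rho>1: "\<rho>1 \<in> S" ..
  have bdd: "bdd_above S" by (rule bdd_aboveI[of _ R]) (simp add: S_def)
  define \<sigma> where "\<sigma> = Sup S"
  have up: "\<rho> \<le> \<sigma>" if "\<rho> \<in> S" for \<rho> unfolding \<sigma>_def using that bdd by (rule cSup_upper)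
  have \<sigma>R: "\<sigma> \<le> R" unfolding \<sigma>_def using \<rho>1 by (intro cSup_least) (auto simp: S_def)
  have \<sigma>0: "\<sigma> > 0" using up[OF \<rho>1] \<rho>1 by (simp add: S_def)
  obtain t where t: "\<And>\<rho>. \<rho> \<in> S \<Longrightarrow> is_section (t \<rho>) (gball q \<rho>)" "\<And>\<rho>. \<rho> \<in> S \<Longrightarrow> t \<rho> (\<iota> q) = q"
  proof -
    have "\<forall>\<rho>\<in>S. \<exists>\<tau>. is_section \<tau> (gball q \<rho>) \<and> \<tau> (\<iota> q) = q" by (simp add: S_def)
    from bchoice[OF this] obtain t where "\<forall>\<rho>\<in>S. is_section (t \<rho>) (gball q \<rho>) \<and> t \<rho> (\<iota> q) = q"
      by (rule exE)
    then show thesis by (intro that[of t]) simp_all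
  qed
  have agree: "t i x = t j x" if ij: "i \<in> S" "j \<in> S" and x: "x \<in> gball q i" "x \<in> gball q j" for i j x
  proof (rule section_unique[OF t(1)[OF ij(1)] t(1)[OF ij(2)], of "gball q i \<inter> gball q j" "\<iota> q"])
    show "connected (gball q i \<inter> gball q j)" by (intro convex_connected convex_Int convex_gball)
    show "\<iota> q \<in> gball q i \<inter> gball q j" using ij by (simp add: S_def G_bilin)
    show "t i (\<iota> q) = t j (\<iota> q)" using t(2) ij by simp
  qed (use x in auto)
  obtain \<tau> where \<tau>: "is_section \<tau> (\<Union>\<rho>\<in>S. gball q \<rho>)" "\<And>\<rho> x. \<rho> \<in> S \<Longrightarrow> x \<in> gball q \<rho> \<Longrightarrow> \<tau> x = t \<rho> x"
    by (rule glue_sections[of S t "gball q", OF t(1) agree]) blast+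
  have sub: "gball q \<sigma> \<subseteq> (\<Union>\<rho>\<in>S. gball q \<rho>)"
  proof
    fix x assume x: "x \<in> gball q \<sigma>"
    let ?n = "sqrt (G q (x - \<iota> q) (x - \<iota> q))"
    have "?n < \<sigma>" using x \<sigma>0 by (intro real_less_lsqrt) auto
    then obtain \<rho> where \<rho>: "\<rho> \<in> S" "?n < \<rho>" using less_cSup_iff[OF _ bdd] \<rho>1 unfolding \<sigma>_def by blast
    have "?n\<^sup>2 < \<rho>\<^sup>2" using \<rho> G_nonneg by (intro power_strict_mono) auto
    then have "x \<in> gball q \<rho>" using G_nonneg by simp
    then show "x \<in> (\<Union>\<rho>\<in>S. gball q \<rho>)" using \<rho>(1) by blast
  qed
  have \<tau>\<sigma>: "is_section \<tau> (gball q \<sigma>)" by (rule is_section_subset[OF \<tau>(1) open_gball sub])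
  have \<tau>q: "\<tau> (\<iota> q) = q"
    using \<tau>(2)[OF \<rho>1, of "\<iota> q"] t(2)[OF \<rho>1] \<rho>1 by (simp add: S_def G_bilin)
  have "\<sigma> = R"
  proof (rule ccontr)
    assume "\<sigma> \<noteq> R"
    obtain \<rho>' \<tau>' where \<rho>': "\<rho>' > \<sigma>" "is_section \<tau>' (gball q \<rho>')" "\<tau>' (\<iota> q) = q"
      using extend_section_beyond[OF rb \<sigma>0 \<sigma>R \<tau>\<sigma> \<tau>q] by blast
    have "gball q (min R \<rho>') \<subseteq> gball q \<rho>'" using R \<sigma>0 \<rho>' by (intro gball_mono) auto
    then have "is_section \<tau>' (gball q (min R \<rho>'))" by (rule is_section_subset[OF \<rho>'(2) open_gball])
    then have "min R \<rho>' \<in> S" using R \<sigma>0 \<rho>' by (auto simp: S_def)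
    then show False using up \<rho>'(1) \<sigma>R \<open>\<sigma> \<noteq> R\<close> by fastforce
  qed
  then show ?thesis using \<tau>\<sigma> \<tau>q by blast
qed

end

section \<open>Vanishing of the cubic form\<close>

context complete_hessian
begin

lemma unit_radius:
  assumes "x \<noteq> \<iota> q" "x \<in> gball q \<rho>" "\<rho> > 0"
  obtains t w where "0 < t" "t < \<rho>" "G q w w = 1" "x = \<iota> q + t *\<^sub>R w"
proof -
  define t where "t = sqrt (G q (x - \<iota> q) (x - \<iota> q))"
  have g: "G q (x - \<iota> q) (x - \<iota> q) > 0" using assms(1) by (intro G_pos) simp
  have t: "t > 0" "t\<^sup>2 = G q (x - \<iota> q) (x - \<iota> q)" using g by (simp_all add: t_def)
  have "t\<^sup>2 < \<rho>\<^sup>2" using assms(2) t(2) by simp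
  then have "t < \<rho>" by (rule power_less_imp_less_base) (use assms(3) in simp)
  moreover have "G q ((1 / t) *\<^sub>R (x - \<iota> q)) ((1 / t) *\<^sub>R (x - \<iota> q)) = 1"
    unfolding G_scale_square t(2)[symmetric] using t(1) by (simp add: power_divide)
  moreover have "x = \<iota> q + t *\<^sub>R ((1 / t) *\<^sub>R (x - \<iota> q))" using t(1) by simp
  ultimately show thesis using t(1) by (intro that[of t "(1 / t) *\<^sub>R (x - \<iota> q)"])
qed

lemma unit_ray_in_gball:
  assumes "G q w w = 1" "0 \<le> s" "s < \<rho>"
  shows "\<iota> q + s *\<^sub>R w \<in> gball q \<rho>"
  using assms by (simp add: G_scale_square power_strict_mono)

text \<open>A continuity argument. Before the first time \<open>s1\<close> at which the squared
  speed reaches 4, the ray has length at most \<open>2 * s \<le> 1 / \<Lambda>\<close>, so the bound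
  on \<open>lam\<close> is available there; it then forces
  \<open>s1 \<ge> 1 / (2 * \<Lambda>)\<close>, beyond the radius considered.\<close>

lemma unit_ray_bound:
  assumes \<Lambda>: "\<Lambda> > 0" "\<And>p. d q p \<le> 1 / \<Lambda> \<Longrightarrow> lam p \<le> 2 * \<Lambda>"
    and \<rho>: "0 < \<rho>" "\<rho> \<le> 1 / (2 * \<Lambda>)" and \<tau>: "is_section \<tau> (gball q \<rho>)" "\<tau> (\<iota> q) = q"
    and w: "G q w w = 1" and t: "0 \<le> t" "t < \<rho>"
  shows "G (\<tau> (\<iota> q + t *\<^sub>R w)) w w \<le> 4"
proof (rule ccontr)
  assume neg: "\<not> ?thesis"
  define y where "y s = \<tau> (\<iota> q + s *\<^sub>R w)" for s
  define \<phi> where "\<phi> s = G (y s) w w" for s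
  have w0: "w \<noteq> 0" using w by (auto simp: G_bilin)
  have pos: "\<phi> s > 0" for s unfolding \<phi>_def by (rule G_pos[OF w0])
  have inB: "\<iota> q + s *\<^sub>R w \<in> gball q \<rho>" if "0 \<le> s" "s \<le> t" for s
    using that t by (intro unit_ray_in_gball w) auto
  have der: "(\<phi> has_real_derivative C (y s) w w w) (at s)" if "0 \<le> s" "s \<le> t" for s
    unfolding \<phi>_def y_def by (rule G_line[OF \<tau>(1) inB[OF that]])
  have cont: "continuous_on {0..t} \<phi>"
    by (rule DERIV_continuous_on[where D = "\<lambda>s. C (y s) w w w"])
      (use der in \<open>auto intro: has_field_derivative_at_within\<close>)
  let ?S = "{0..t} \<inter> \<phi> -` {4..}"
  have "compact ?S"
    using continuous_closed_preimage[OF cont closed_atLeastAtMost closed_atLeast] bounded_subset[of "{0..t}" ?S]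
    by (auto simp: compact_eq_bounded_closed)
  moreover have "t \<in> ?S" using neg t by (auto simp: \<phi>_def y_def)
  ultimately obtain s1 where s1: "s1 \<in> ?S" "\<And>s. s \<in> ?S \<Longrightarrow> s1 \<le> s"
    using compact_attains_inf[of ?S] by blast
  have \<phi>0: "\<phi> 0 = 1" using \<tau>(2) w by (simp add: \<phi>_def y_def)
  have s1t: "0 \<le> s1" "s1 \<le> t" "4 \<le> \<phi> s1" using s1(1) by auto
  have s1pos: "0 < s1" using s1t \<phi>0 by (cases "s1 = 0") auto
  have below: "\<phi> s \<le> 4" if "0 \<le> s" "s < s1" for s
    using s1(2)[of s] that s1t by force
  have lam: "lam (y s) \<le> 2 * \<Lambda>" if s: "0 \<le> s" "s < s1" for s
  proof (rule \<Lambda>(2))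
    have "d (\<tau> (\<iota> q)) (\<tau> (\<iota> q + s *\<^sub>R w)) \<le> 2 * s"
    proof (rule segment_length[OF \<tau>(1)])
      have seg: "\<exists>s'. 0 \<le> s' \<and> s' \<le> s \<and> z = \<iota> q + s' *\<^sub>R w"
        if z: "z \<in> closed_segment (\<iota> q) (\<iota> q + s *\<^sub>R w)" for z
      proof -
        obtain t where t: "0 \<le> t" "t \<le> 1" "z = (1 - t) *\<^sub>R \<iota> q + t *\<^sub>R (\<iota> q + s *\<^sub>R w)"
          using z unfolding closed_segment_def by blast
        then have "z = \<iota> q + (t * s) *\<^sub>R w" by (simp add: algebra_simps)
        moreover have "t * s \<le> s" using t s by (simp add: mult_left_le_one_le)
        ultimately show ?thesis using t s by (intro exI[of _ "t * s"]) simp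
      qed
      show "closed_segment (\<iota> q) (\<iota> q + s *\<^sub>R w) \<subseteq> gball q \<rho>"
      proof
        fix z assume "z \<in> closed_segment (\<iota> q) (\<iota> q + s *\<^sub>R w)"
        from seg[OF this] obtain s' where "0 \<le> s'" "s' \<le> s" "z = \<iota> q + s' *\<^sub>R w" by blast
        then show "z \<in> gball q \<rho>" using inB[of s'] s s1t by simp
      qed
      fix z assume "z \<in> closed_segment (\<iota> q) (\<iota> q + s *\<^sub>R w)"
      from seg[OF this] obtain s' where s': "0 \<le> s'" "s' \<le> s" "z = \<iota> q + s' *\<^sub>R w" by blast
      have "G (\<tau> z) w w \<le> 4" using below[of s'] s s' by (simp add: \<phi>_def y_def)
      then have "s\<^sup>2 * G (\<tau> z) w w \<le> s\<^sup>2 * 4" by (intro mult_left_mono) auto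
      then have "sqrt (s\<^sup>2 * G (\<tau> z) w w) \<le> 2 * s"
        using s by (intro real_le_lsqrt) (auto simp: power_mult_distrib)
      then show "sqrt (G (\<tau> z) (\<iota> q + s *\<^sub>R w - \<iota> q) (\<iota> q + s *\<^sub>R w - \<iota> q)) \<le> 2 * s"
        by (simp add: G_scale_square)
    qed
    then have "d q (y s) \<le> 2 * s" using \<tau>(2) by (simp add: y_def)
    also have "\<dots> \<le> 2 * \<rho>" using s s1t t by simp
    also have "\<dots> \<le> 1 / \<Lambda>" using \<rho>(2) by simp
    finally show "d q (y s) \<le> 1 / \<Lambda>" .
  qed
  \<comment> \<open>The derivative of \<phi> is at most \<open>lam\<close> times \<phi>^(3/2), and
    the power -1/2 turns this into a slope of at least -\<Lambda>. Starting from 1, \<psi> cannot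
    reach 1/2, its value at \<phi> = 4, before time \<open>1 / (2 * \<Lambda>)\<close>.\<close>
  define \<psi> where "\<psi> s = \<phi> s powr (-1/2)" for s
  have d\<psi>: "(\<psi> has_real_derivative -1/2 * \<phi> s powr (-3/2) * C (y s) w w w) (at s)" if "0 \<le> s" "s \<le> t" for s
    using DERIV_fun_powr[OF der[OF that] pos, of "-1/2"] unfolding \<psi>_def by simp
  obtain z where z: "0 < z" "z < s1"
    "\<psi> s1 - \<psi> 0 = (s1 - 0) * (-1/2 * \<phi> z powr (-3/2) * C (y z) w w w)"
    using MVT2[OF s1pos, of \<psi> "\<lambda>s. -1/2 * \<phi> s powr (-3/2) * C (y s) w w w"] d\<psi> s1t by auto
  have "\<phi> z powr (-3/2) * C (y z) w w w \<le> 2 * \<Lambda>"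
  proof -
    have "cubic_ratio (y z) w \<le> lam (y z)" using lam_props(2)[of "y z"] w0 cubic_bound_iff by blast
    then show ?thesis using lam[of z] z by (simp add: cubic_ratio_def \<phi>_def mult.commute)
  qed
  then have "s1 * (\<phi> z powr (-3/2) * C (y z) w w w) \<le> s1 * (2 * \<Lambda>)" using s1pos by (intro mult_left_mono) auto
  moreover have "\<psi> s1 - \<psi> 0 = - (s1 * (\<phi> z powr (-3/2) * C (y z) w w w)) / 2" using z(3) by simp
  ultimately have "\<psi> s1 \<ge> \<psi> 0 - s1 * \<Lambda>" by simp
  moreover have "\<psi> 0 = 1" by (simp add: \<psi>_def \<phi>0)
  moreover have "\<psi> s1 \<le> 1 / 2"
  proof -
    have "\<psi> s1 \<le> 4 powr (-1/2)" unfolding \<psi>_def using s1t by (intro powr_mono2') auto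
    also have "(4::real) powr (-1/2) = 1 / 2" by (simp add: powr_minus_divide powr_half_sqrt)
    finally show ?thesis .
  qed
  ultimately have "1 / 2 \<le> s1 * \<Lambda>" by simp
  moreover have "s1 * \<Lambda> < \<rho> * \<Lambda>" using s1t t \<Lambda>(1) by simp
  moreover have "\<rho> * \<Lambda> \<le> 1 / 2" using \<rho>(2) \<Lambda>(1) by (simp add: field_simps)
  ultimately show False by simp
qed

lemma radially_bounded_of_lam:
  assumes \<Lambda>: "\<Lambda> > 0" "\<And>p. d q p \<le> 1 / \<Lambda> \<Longrightarrow> lam p \<le> 2 * \<Lambda>"
  shows "radially_bounded q (1 / (2 * \<Lambda>))"
  unfolding radially_bounded_def
proof (intro allI impI ballI)
  fix \<rho> \<tau> x
  assume \<rho>: "0 < \<rho>" "\<rho> \<le> 1 / (2 * \<Lambda>)" and \<tau>: "is_section \<tau> (gball q \<rho>)" "\<tau> (\<iota> q) = q" and x: "x \<in> gball q \<rho>"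
  show "G (\<tau> x) (x - \<iota> q) (x - \<iota> q) \<le> 4 * G q (x - \<iota> q) (x - \<iota> q)"
  proof (cases "x = \<iota> q")
    case True
    then show ?thesis by (simp add: G_bilin)
  next
    case False
    obtain t w where w: "0 < t" "t < \<rho>" "G q w w = 1" "x = \<iota> q + t *\<^sub>R w"
      by (rule unit_radius[OF False x \<rho>(1)])
    have "G (\<tau> x) w w \<le> 4"
      unfolding w(4) using w by (intro unit_ray_bound[OF \<Lambda> \<rho> \<tau>]) auto
    then have "t\<^sup>2 * G (\<tau> x) w w \<le> t\<^sup>2 * 4" by (intro mult_left_mono) auto
    moreover have "x - \<iota> q = t *\<^sub>R w" using w(4) by simp
    ultimately show ?thesis using w(3) by (simp only: G_scale_square)
  qed
qed

text \<open>Along a ray the polarized cubic bound gives ln \<open>G\<close> a slope of at least -3 *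
  2\<Lambda> * 2 = -12\<Lambda>. Over a time of at most \<open>1 / (2 * \<Lambda>)\<close> this
  loses at most 6, whence \<open>exp 6\<close>.\<close>

lemma section_metric_comparison:
  assumes \<Lambda>: "\<Lambda> > 0" "\<And>p. d q p \<le> 1 / \<Lambda> \<Longrightarrow> lam p \<le> 2 * \<Lambda>"
    and \<tau>: "is_section \<tau> (gball q (1 / (2 * \<Lambda>)))" "\<tau> (\<iota> q) = q" and x: "x \<in> gball q (1 / (2 * \<Lambda>))"
  shows "d q (\<tau> x) \<le> 1 / \<Lambda>" and "G q a a \<le> exp 6 * G (\<tau> x) a a"
proof -
  interpret Metric_space UNIV d by (rule metric)
  let ?R = "1 / (2 * \<Lambda>)"
  have R: "0 < ?R" "?R \<le> ?R" using \<Lambda>(1) by simp_all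
  have "d q (\<tau> x) \<le> 1 / \<Lambda> \<and> G q a a \<le> exp 6 * G (\<tau> x) a a"
  proof (cases "x = \<iota> q")
    case True
    have "1 * G q a a \<le> exp 6 * G q a a" by (intro mult_right_mono G_nonneg) simp
    then show ?thesis using True \<tau>(2) \<Lambda>(1) by simp
  next
    case False
    obtain t w where w: "0 < t" "t < ?R" "G q w w = 1" "x = \<iota> q + t *\<^sub>R w"
      by (rule unit_radius[OF False x R(1)])
    define y where "y s = \<tau> (\<iota> q + s *\<^sub>R w)" for s
    have inB: "\<iota> q + s *\<^sub>R w \<in> gball q ?R" if "0 \<le> s" "s \<le> t" for s
      using that w by (intro unit_ray_in_gball) auto
    have y0: "y 0 = q" using \<tau>(2) by (simp add: y_def)
    have dist: "d q (y s) \<le> 1 / \<Lambda>" if s: "0 \<le> s" "s \<le> t" for s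
    proof -
      have "d (\<tau> (\<iota> q + 0 *\<^sub>R w)) (\<tau> (\<iota> q + s *\<^sub>R w)) \<le> 2 * \<bar>s - 0\<bar> * sqrt (G q w w)"
      proof (rule radial_distance[OF radially_bounded_of_lam[OF \<Lambda>] R \<tau>])
        fix s' assume "s' \<in> closed_segment 0 s"
        then show "\<iota> q + s' *\<^sub>R w \<in> gball q ?R" using s by (intro inB) (auto simp: closed_segment_eq_real_ivl)
      qed
      then have "d q (y s) \<le> 2 * s" using s w(3) \<tau>(2) by (simp add: y_def)
      also have "\<dots> \<le> 2 * ?R" using s w(2) by simp
      finally show ?thesis by simp
    qed
    have first: "d q (\<tau> x) \<le> 1 / \<Lambda>" using dist[of t] w by (simp add: y_def)
    have second: "G q a a \<le> exp 6 * G (\<tau> x) a a"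
    proof (cases "a = 0")
      case True
      then show ?thesis by (simp add: G_bilin)
    next
      case a0: False
      define \<eta> where "\<eta> s = G (y s) a a" for s
      have pos: "\<eta> s > 0" for s unfolding \<eta>_def by (rule G_pos[OF a0])
      have der: "((\<lambda>s. ln (\<eta> s)) has_real_derivative C (y s) w a a / \<eta> s) (at s)" if "0 \<le> s" "s \<le> t" for s
      proof -
        have "(\<eta> has_real_derivative C (y s) w a a) (at s)"
          unfolding \<eta>_def y_def by (rule G_line[OF \<tau>(1) inB[OF that]])
        from DERIV_chain2[OF DERIV_ln_divide[OF pos[of s]] this] show ?thesis by simp
      qed
      obtain z where z: "0 < z" "z < t" "ln (\<eta> t) - ln (\<eta> 0) = (t - 0) * (C (y z) w a a / \<eta> z)"
        using MVT2[OF w(1), of "\<lambda>s. ln (\<eta> s)" "\<lambda>s. C (y s) w a a / \<eta> s"] der by auto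
      have "\<bar>C (y z) w a a\<bar> \<le> 3 * lam (y z) * sqrt (G (y z) w w) * \<eta> z"
        unfolding \<eta>_def by (intro cubic_bound_polarized lam_props)
      also have "\<dots> \<le> 3 * (2 * \<Lambda>) * 2 * \<eta> z"
      proof (intro mult_right_mono mult_mono)
        show "lam (y z) \<le> 2 * \<Lambda>" using dist[of z] z by (intro \<Lambda>(2)) auto
        have "G (y z) w w \<le> 4"
          unfolding y_def using z w by (intro unit_ray_bound[OF \<Lambda> R \<tau>]) auto
        then have "sqrt (G (y z) w w) \<le> sqrt 4" by (rule real_sqrt_le_mono)
        then show "sqrt (G (y z) w w) \<le> 2" by simp
      qed (use \<Lambda>(1) pos[of z] lam_props(1) G_nonneg in auto)
      finally have "C (y z) w a a \<ge> - (12 * \<Lambda> * \<eta> z)" by (simp add: abs_le_iff)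
      then have "C (y z) w a a / \<eta> z \<ge> - (12 * \<Lambda>)" using pos[of z] by (simp add: field_simps)
      then have "t * (C (y z) w a a / \<eta> z) \<ge> t * (- (12 * \<Lambda>))" using w(1) by (intro mult_left_mono) auto
      moreover have "t * (12 * \<Lambda>) \<le> 6"
      proof -
        have "t * (12 * \<Lambda>) \<le> ?R * (12 * \<Lambda>)" using w(2) \<Lambda>(1) by (intro mult_right_mono) auto
        then show ?thesis using \<Lambda>(1) by simp
      qed
      moreover have "ln (\<eta> t) - ln (\<eta> 0) = t * (C (y z) w a a / \<eta> z)" using z(3) by (simp only: diff_zero)
      moreover have "b \<le> 6 + a" if "x \<ge> t * (- e)" "t * e \<le> 6" "a - b = x" for x e a b :: real
        using that by simp
      ultimately have "ln (\<eta> 0) \<le> 6 + ln (\<eta> t)" by blast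
      then have "exp (ln (\<eta> 0)) \<le> exp (6 + ln (\<eta> t))" by simp
      then have "\<eta> 0 \<le> exp 6 * \<eta> t" using pos by (simp add: exp_add)
      then show ?thesis using w(4) by (simp add: \<eta>_def y0) (simp add: y_def)
    qed
    show ?thesis using first second by blast
  qed
  then show "d q (\<tau> x) \<le> 1 / \<Lambda>" "G q a a \<le> exp 6 * G (\<tau> x) a a" by blast+
qed

end

locale complete_monge_ampere = monge_ampere \<iota> u \<xi> v c + complete_hessian \<iota> u d
  for \<iota> :: "'a::t2_space \<Rightarrow> real^'n" and u :: "'a \<Rightarrow> real" and \<xi> v :: "real^'n" and c :: real
    and d :: "'a \<Rightarrow> 'a \<Rightarrow> real"
begin

text \<open>
  By the first derivative of the equation, \<open>|\<xi>|\<^sup>2 - v(\<xi>)\<close> is the trace of \<open>C(\<xi>, -, -)\<close>. As \<open>v(\<xi>)\<close> is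
  constant, this bounds the otherwise uncontrolled drift by the cubic form.
\<close>

lemma drift_bound: "sqrt (G q \<xi> \<xi>) \<le> 3 * CARD('n) * lam q + sqrt \<bar>v \<bullet> \<xi>\<bar>"
proof -
  obtain E :: "'n \<Rightarrow> real^'n" where E: "\<And>i j. G q (E i) (E j) = (if i = j then 1 else 0)"
    by (rule frame_at[of q]) blast
  let ?X = "sqrt (G q \<xi> \<xi>)"
  have X: "?X \<ge> 0" "?X\<^sup>2 = G q \<xi> \<xi>" by (simp_all add: G_nonneg)
  have "(\<Sum>i\<in>UNIV. C q \<xi> (E i) (E i)) \<le> (\<Sum>i\<in>(UNIV::'n set). 3 * lam q * ?X)"
  proof (rule sum_mono)
    fix i :: 'n
    have "\<bar>C q \<xi> (E i) (E i)\<bar> \<le> 3 * lam q * ?X * G q (E i) (E i)"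
      by (intro cubic_bound_polarized lam_props)
    then show "C q \<xi> (E i) (E i) \<le> 3 * lam q * ?X" using E by simp
  qed
  then have "?X\<^sup>2 \<le> \<bar>v \<bullet> \<xi>\<bar> + (3 * CARD('n) * lam q) * ?X"
    using ma_derivatives(1)[OF E, of \<xi>] X(2) by (simp add: mult_ac)
  \<comment> \<open>With X the length of \<open>\<xi>\<close>, the trace inequality reads X^2 \<le>
    b^2 + a X, and this quadratic inequality forces X \<le> a + b.\<close>
  define a b where "a = 3 * CARD('n) * lam q" and "b = sqrt \<bar>v \<bullet> \<xi>\<bar>"
  have ab: "a \<ge> 0" "b \<ge> 0" "b\<^sup>2 = \<bar>v \<bullet> \<xi>\<bar>" by (simp_all add: a_def b_def lam_props)
  have le: "?X\<^sup>2 \<le> b\<^sup>2 + a * ?X" using \<open>?X\<^sup>2 \<le> _\<close> by (simp add: ab(3) a_def)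
  have "?X \<le> a + b"
  proof (rule ccontr)
    assume "\<not> ?X \<le> a + b"
    then have gt: "?X > a + b" by simp
    have "b * b \<le> b * ?X" using gt ab by (intro mult_left_mono) auto
    moreover have "(a + b) * ?X < ?X * ?X"
      by (rule mult_strict_right_mono[OF gt]) (use gt ab in linarith)
    ultimately show False using le by (simp add: power2_eq_square algebra_simps)
  qed
  then show ?thesis by (simp add: a_def b_def)
qed

theorem lam_zero: "lam p0 = 0"
proof (rule ccontr)
  assume "lam p0 \<noteq> 0"
  then have l0: "lam p0 > 0" using lam_props(1)[of p0] by simp
  \<comment> \<open>A bound for the trace of \<open>G q\<close> minus the drift, uniform in the
    picked point. Dividing by \<open>lam p0\<close> instead of \<open>lam q\<close> makes it
    available before \<open>q\<close> is chosen, so that \<epsilon> can depend on it.\<close>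
  define K1 where "K1 = CARD('n) * exp 6 + (3 * CARD('n) + sqrt \<bar>v \<bullet> \<xi>\<bar> / lam p0) / 4"
  have K1: "K1 > 0" unfolding K1_def using l0 by (intro add_pos_nonneg mult_pos_pos) auto
  \<comment> \<open>The final estimate compares 1 with \<open>\<epsilon> * (256 * K1)\<close>; the
    number 512 makes this at most 1/2, and \<epsilon> \<le> 1 turns the picked bound into
    \<open>lam p \<le> 2 * \<Lambda>\<close>.\<close>
  define \<epsilon> where "\<epsilon> = min 1 (1 / (512 * K1))"
  have \<epsilon>: "0 < \<epsilon>" "\<epsilon> \<le> 1" "\<epsilon> * (256 * K1) < 1"
  proof -
    show "0 < \<epsilon>" "\<epsilon> \<le> 1" using K1 by (simp_all add: \<epsilon>_def)
    have "\<epsilon> * (256 * K1) \<le> 1 / (512 * K1) * (256 * K1)" using K1 by (intro mult_right_mono) (auto simp: \<epsilon>_def)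
    also have "\<dots> < 1" using K1 by simp
    finally show "\<epsilon> * (256 * K1) < 1" .
  qed
  obtain q where q: "lam q \<ge> lam p0" "\<And>p. d q p \<le> 1 / lam q \<Longrightarrow> lam p \<le> (1 + \<epsilon>) * lam q"
    using point_picking[OF l0 \<epsilon>(1)] by blast
  define \<Lambda> where "\<Lambda> = lam q"
  have \<Lambda>0: "\<Lambda> > 0" using q(1) l0 by (simp add: \<Lambda>_def)
  have pick: "lam p \<le> (1 + \<epsilon>) * \<Lambda>" if "d q p \<le> 1 / \<Lambda>" for p using q(2) that by (simp add: \<Lambda>_def)
  have \<Lambda>2: "lam p \<le> 2 * \<Lambda>" if "d q p \<le> 1 / \<Lambda>" for p
  proof -
    have "(1 + \<epsilon>) * \<Lambda> \<le> 2 * \<Lambda>" using \<epsilon> \<Lambda>0 by (intro mult_right_mono) auto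
    then show ?thesis using pick[OF that] by simp
  qed
  let ?R = "1 / (2 * \<Lambda>)"
  have R: "?R > 0" using \<Lambda>0 by simp
  obtain \<tau> where \<tau>: "is_section \<tau> (gball q ?R)" "\<tau> (\<iota> q) = q"
    using extend_section[OF radially_bounded_of_lam[OF \<Lambda>0 \<Lambda>2] R] by blast
  have comp: "d q (\<tau> x) \<le> 1 / \<Lambda>" "G q a a \<le> exp 6 * G (\<tau> x) a a" if "x \<in> gball q ?R" for x a
    by (rule section_metric_comparison[OF \<Lambda>0 _ \<tau> that], erule \<Lambda>2)+
  \<comment> \<open>At the rim of the ellipsoid of radius
    \<open>?R / 2 = 1 / (4 * \<Lambda>)\<close> the cutoff takes the value 2 \<epsilon> \<Lambda>,
    twice the excess of the cubic form that point picking permits.\<close>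
  define k where "k = 32 * \<epsilon> * \<Lambda> ^ 3"
  have k: "k > 0" using \<epsilon> \<Lambda>0 by (simp add: k_def)
  let ?Q = "\<lambda>x. G q (x - \<iota> q) (x - \<iota> q)"
  let ?K = "{x. ?Q x \<le> (?R / 2)\<^sup>2}"
  have half: "x / 2 < x" if "x > 0" for x :: real using that by simp
  from half[OF R] have RR: "(?R / 2)\<^sup>2 < ?R\<^sup>2" by (rule power_strict_mono) (use R in simp_all)
  have KW: "?K \<subseteq> gball q ?R" using RR by auto
  have qK: "\<iota> q \<in> ?K" by (simp add: G_bilin)
  obtain x0 e0 where x0: "x0 \<in> ?K" "G (\<tau> x0) e0 e0 = 1"
    "\<And>x e. x \<in> ?K \<Longrightarrow> e \<noteq> 0 \<Longrightarrow> cubic_ratio (\<tau> x) e - k * ?Q x \<le> C (\<tau> x0) e0 e0 e0 - k * ?Q x0"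
  proof (rule cubic_ratio_max[OF \<tau>(1) compact_gcball _ KW, of "\<lambda>x. k * ?Q x"])
    show "?K \<noteq> {}" using qK by blast
    show "continuous_on ?K (\<lambda>x. k * ?Q x)" by (intro continuous_on_mult continuous_on_const continuous_G_quadratic)
  qed blast
  define \<mu> where "\<mu> = C (\<tau> x0) e0 e0 e0"
  have e0: "e0 \<noteq> 0" using x0(2) by (auto simp: G_bilin)
  \<comment> \<open>Compares the maximum with the centre, where the cutoff vanishes and the cubic
    form attains \<Lambda>.\<close>
  have \<mu>ge: "\<Lambda> \<le> \<mu> - k * ?Q x0"
  proof -
    obtain e where e: "G q e e = 1" "C q e e e = \<Lambda>" using lam_props(3)[of q] by (auto simp: \<Lambda>_def)
    have "e \<noteq> 0" using e by (auto simp: G_bilin)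
    then have "cubic_ratio (\<tau> (\<iota> q)) e - k * ?Q (\<iota> q) \<le> \<mu> - k * ?Q x0"
      unfolding \<mu>_def by (intro x0(3) qK)
    then show ?thesis using e by (simp add: \<tau>(2) cubic_ratio_def G_bilin)
  qed
  have x0W: "x0 \<in> gball q ?R" using x0(1) KW by blast
  have \<mu>le: "\<mu> \<le> (1 + \<epsilon>) * \<Lambda>"
  proof -
    have "cubic_ratio (\<tau> x0) e0 \<le> lam (\<tau> x0)" using lam_props(2)[of "\<tau> x0"] e0 cubic_bound_iff by blast
    then have "\<mu> \<le> lam (\<tau> x0)" by (simp add: cubic_ratio_def x0(2) \<mu>_def)
    also have "\<dots> \<le> (1 + \<epsilon>) * \<Lambda>" by (intro pick comp(1) x0W)
    finally show ?thesis .
  qed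
  \<comment> \<open>The cubic form exceeds \<Lambda> by at most \<epsilon> \<Lambda>, so a maximum
    point pays at most \<epsilon> \<Lambda> for the cutoff and cannot lie on the rim.\<close>
  have interior: "?Q x0 < (?R / 2)\<^sup>2"
  proof -
    have "k * ?Q x0 \<le> \<epsilon> * \<Lambda>" using \<mu>ge \<mu>le by (simp add: algebra_simps)
    also have "\<dots> < k * (?R / 2)\<^sup>2"
    proof -
      have "k * (?R / 2)\<^sup>2 = 2 * (\<epsilon> * \<Lambda>)"
        using \<Lambda>0 by (simp add: k_def power_divide power2_eq_square power3_eq_cube)
      then show ?thesis using \<epsilon> \<Lambda>0 by simp
    qed
    finally show ?thesis using k by simp
  qed
  then have "x0 \<in> gball q (?R / 2)" by simp
  then obtain r where r: "r > 0" "ball x0 r \<subseteq> gball q (?R / 2)"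
    using open_gball open_contains_ball by blast
  have rK: "ball x0 r \<subseteq> ?K" using r(2) by auto
  obtain E :: "'n \<Rightarrow> real^'n" where E: "\<And>i j. G (\<tau> x0) (E i) (E j) = (if i = j then 1 else 0)"
    "\<And>x. x = (\<Sum>i\<in>UNIV. G (\<tau> x0) x (E i) *\<^sub>R E i)"
    by (rule frame_at[of "\<tau> x0"]) blast
  have \<mu>\<Lambda>: "\<mu> \<ge> \<Lambda>" using \<mu>ge k G_nonneg[of q "x0 - \<iota> q"] by (smt (verit) mult_nonneg_nonneg)
  have main: "\<mu> ^ 3 / 4 \<le> 2 * k * ((\<Sum>i\<in>UNIV. G q (E i) (E i)) - G q \<xi> (x0 - \<iota> q))"
    unfolding \<mu>_def
  proof (rule max_point_inequality[OF \<tau>(1) r(1) order_trans[OF rK KW] x0(2) bilinear_G G_sym _ E])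
    fix x e' assume "x \<in> ball x0 r" "e' \<noteq> (0::real^'n)"
    then show "C (\<tau> x) e' e' e' * G (\<tau> x) e' e' powr (-3/2) - k * ?Q x \<le> C (\<tau> x0) e0 e0 e0 - k * ?Q x0"
      using x0(3)[of x e'] rK unfolding cubic_ratio_def by blast
  qed (use \<mu>\<Lambda> \<Lambda>0 in \<open>simp add: \<mu>_def\<close>)
  \<comment> \<open>The frame is orthonormal at the maximum point, while \<open>Q\<close> is the
    metric at the centre: each term is bounded by comparing the two.\<close>
  have tr: "(\<Sum>i\<in>UNIV. G q (E i) (E i)) \<le> CARD('n) * exp 6"
  proof -
    have "(\<Sum>i\<in>UNIV. G q (E i) (E i)) \<le> (\<Sum>i\<in>(UNIV::'n set). exp 6)"
    proof (rule sum_mono)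
      fix i show "G q (E i) (E i) \<le> exp 6" using comp(2)[OF x0W, of "E i"] E(1)[of i i] by simp
    qed
    then show ?thesis by simp
  qed
  have dr: "- G q \<xi> (x0 - \<iota> q) \<le> (3 * CARD('n) + sqrt \<bar>v \<bullet> \<xi>\<bar> / lam p0) / 4"
  proof -
    have cs: "\<bar>G q a b\<bar> \<le> sqrt (G q a a) * sqrt (G q b b)" for a b
    proof (cases "b = 0")
      case False
      then have gb: "G q b b > 0" by (rule G_pos)
      let ?t = "G q a b / G q b b"
      have "0 \<le> G q (a - ?t *\<^sub>R b) (a - ?t *\<^sub>R b)" by (rule G_nonneg)
      also have "\<dots> = G q a a - (G q a b)\<^sup>2 / G q b b"
        using gb by (simp add: G_bilin G_sym[of q b a] power2_eq_square field_simps)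
      finally have "(G q a b)\<^sup>2 \<le> G q a a * G q b b" using gb by (simp add: field_simps)
      then have "sqrt ((G q a b)\<^sup>2) \<le> sqrt (G q a a * G q b b)" by (rule real_sqrt_le_mono)
      then show ?thesis by (simp add: real_sqrt_mult)
    qed (simp add: G_bilin)
    have "- G q \<xi> (x0 - \<iota> q) \<le> sqrt (G q \<xi> \<xi>) * sqrt (?Q x0)" using cs[of \<xi> "x0 - \<iota> q"] by (simp add: abs_le_iff)
    also have "\<dots> \<le> (3 * CARD('n) * \<Lambda> + sqrt \<bar>v \<bullet> \<xi>\<bar>) * (?R / 2)"
    proof (rule mult_mono)
      show "sqrt (G q \<xi> \<xi>) \<le> 3 * CARD('n) * \<Lambda> + sqrt \<bar>v \<bullet> \<xi>\<bar>" using drift_bound[of q] by (simp add: \<Lambda>_def)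
      show "sqrt (?Q x0) \<le> ?R / 2" using interior R by (intro real_le_lsqrt) auto
    qed (use \<Lambda>0 G_nonneg in auto)
    also have "\<dots> = (3 * CARD('n) + sqrt \<bar>v \<bullet> \<xi>\<bar> / \<Lambda>) / 4" using \<Lambda>0 by (simp add: field_simps)
    also have "\<dots> \<le> (3 * CARD('n) + sqrt \<bar>v \<bullet> \<xi>\<bar> / lam p0) / 4"
    proof -
      have "sqrt \<bar>v \<bullet> \<xi>\<bar> / \<Lambda> \<le> sqrt \<bar>v \<bullet> \<xi>\<bar> / lam p0"
        using l0 q(1) \<Lambda>0 by (intro divide_left_mono) (auto simp: \<Lambda>_def)
      then show ?thesis by (intro divide_right_mono add_left_mono) (assumption, simp)
    qed
    finally show ?thesis .
  qed
  have "\<Lambda> ^ 3 / 4 \<le> \<mu> ^ 3 / 4" using \<mu>\<Lambda> \<Lambda>0 by (simp add: power_mono)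
  also have "\<dots> \<le> 2 * k * ((\<Sum>i\<in>UNIV. G q (E i) (E i)) - G q \<xi> (x0 - \<iota> q))" by (rule main)
  also have "\<dots> \<le> 2 * k * K1"
  proof (rule mult_left_mono)
    show "(\<Sum>i\<in>UNIV. G q (E i) (E i)) - G q \<xi> (x0 - \<iota> q) \<le> K1" using add_mono[OF tr dr] by (simp only: K1_def diff_conv_add_uminus)
  qed (use k in simp)
  also have "\<dots> = \<Lambda> ^ 3 / 4 * (\<epsilon> * (256 * K1))" by (simp add: k_def)
  also have "\<dots> < \<Lambda> ^ 3 / 4 * 1" using \<epsilon>(3) \<Lambda>0 by (intro mult_strict_left_mono) auto
  finally show False by simp
qed

end

section \<open>Global coordinates\<close>

lemma DERIV_zero_constant:
  fixes f :: "real \<Rightarrow> real"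
  assumes "\<And>s. (f has_real_derivative 0) (at s)" shows "f x = f y"
  by (rule DERIV_isconst_all) (use assms in blast)

context complete_hessian
begin

text \<open>The sections over all ellipsoids about one point glue to a section over the whole
  coordinate space. Its image is open, closed and nonempty, so by connectedness it is everything and
  \<open>\<iota>\<close> is injective.\<close>

lemma global_section_of_lam_zero:
  assumes lam0: "\<And>p. lam p = 0" and conn: "connected (UNIV :: 'a set)"
  shows "\<exists>\<tau>. is_section \<tau> UNIV \<and> (\<forall>p. \<tau> (\<iota> p) = p)"
proof -
  fix q :: 'a
  have ex: "\<exists>\<tau>. is_section \<tau> (gball q R) \<and> \<tau> (\<iota> q) = q" if R: "R > 0" for R
  proof -
    have L: "1 / (2 * R) > 0" using R by simp
    \<comment> \<open>As \<open>lam\<close> vanishes, every positive \<Lambda> is admissible, and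
      \<Lambda> = 1 / (2R) turns the radius 1 / (2\<Lambda>) into R.\<close>
    have "radially_bounded q (1 / (2 * (1 / (2 * R))))"
      by (rule radially_bounded_of_lam[OF L]) (use R in \<open>simp add: lam0\<close>)
    then have "radially_bounded q R" using R by simp
    then show ?thesis using R by (rule extend_section)
  qed
  then have "\<forall>R\<in>{0<..}. \<exists>\<tau>. is_section \<tau> (gball q R) \<and> \<tau> (\<iota> q) = q" by simp
  from bchoice[OF this] obtain t where t0: "\<forall>R\<in>{0<..}. is_section (t R) (gball q R) \<and> t R (\<iota> q) = q"
    by (rule exE)
  then have t: "is_section (t R) (gball q R)" "t R (\<iota> q) = q" if "R \<in> {0<..}" for R using that by simp_all
  have agree: "t i x = t j x" if ij: "i \<in> {0<..}" "j \<in> {0<..}" and x: "x \<in> gball q i" "x \<in> gball q j" for i j x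
  proof (rule section_unique[OF t(1)[OF ij(1)] t(1)[OF ij(2)], of "gball q i \<inter> gball q j" "\<iota> q"])
    show "connected (gball q i \<inter> gball q j)" by (intro convex_connected convex_Int convex_gball)
    show "\<iota> q \<in> gball q i \<inter> gball q j" using ij by (simp add: G_bilin)
    show "t i (\<iota> q) = t j (\<iota> q)" using t(2) ij by simp
  qed (use x in auto)
  obtain \<tau> where \<tau>: "is_section \<tau> (\<Union>R\<in>{0<..}. gball q R)" "\<And>R x. R \<in> {0<..} \<Longrightarrow> x \<in> gball q R \<Longrightarrow> \<tau> x = t R x"
    by (rule glue_sections[of "{0<..}" t "gball q", OF t(1) agree]) blast+
  have "x \<in> (\<Union>R\<in>{0<..}. gball q R)" for x
  proof (rule UN_I)
    let ?R = "sqrt (G q (x - \<iota> q) (x - \<iota> q)) + 1"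
    have g: "G q (x - \<iota> q) (x - \<iota> q) \<ge> 0" by (rule G_nonneg)
    then have s: "sqrt (G q (x - \<iota> q) (x - \<iota> q)) \<ge> 0" by simp
    then have "?R > 0" by linarith
    then show "?R \<in> {0<..}" by (simp only: greaterThan_iff)
    have "G q (x - \<iota> q) (x - \<iota> q) = (sqrt (G q (x - \<iota> q) (x - \<iota> q)))\<^sup>2" using g by simp
    also have "\<dots> < ?R\<^sup>2" by (rule power_strict_mono) (use s in simp_all)
    finally show "x \<in> gball q ?R" by simp
  qed
  then have U: "(\<Union>R\<in>{0<..}. gball q R) = UNIV" by blast
  have sec: "is_section \<tau> UNIV" using \<tau>(1) unfolding U .
  have \<tau>q: "\<tau> (\<iota> q) = q" using \<tau>(2)[of 1 "\<iota> q"] t(2)[of 1] by (simp add: G_bilin)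
  have "open (range \<tau>)" by (rule section_open_image[OF sec])
  moreover have "closed (range \<tau>)"
  proof -
    \<comment> \<open>Written as the set where two continuous maps into a Hausdorff space agree, the
      image is closed.\<close>
    have eq: "range \<tau> = {p. \<tau> (\<iota> p) = p}"
    proof (intro set_eqI iffI)
      fix p assume "p \<in> range \<tau>"
      then show "p \<in> {p. \<tau> (\<iota> p) = p}" using section_right_inverse[OF sec] by auto
    next
      fix p assume "p \<in> {p. \<tau> (\<iota> p) = p}"
      then have "p = \<tau> (\<iota> p)" by simp
      then show "p \<in> range \<tau>" by (rule image_eqI) simp
    qed
    have "continuous_on UNIV (\<lambda>p. \<tau> (\<iota> p))"
      by (rule continuous_on_compose2[OF _ continuous_dev]) (use sec in \<open>auto simp: is_section_def\<close>)
    then show ?thesis unfolding eq by (intro closed_Collect_eq continuous_on_id)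
  qed
  moreover have "range \<tau> \<noteq> {}" by simp
  ultimately have surj: "range \<tau> = UNIV" using conn connected_clopen by (metis closed_closedin open_openin subtopology_UNIV)
  have "\<tau> (\<iota> p) = p" for p
  proof -
    obtain x where "p = \<tau> x" using surj by (metis rangeE UNIV_I)
    then show ?thesis using section_right_inverse[OF sec, of x] by simp
  qed
  then show ?thesis using sec by blast
qed

text \<open>The polarized bound with constant 0 kills \<open>C p a b b\<close>, and symmetry in the
  last two slots polarizes once more.\<close>

lemma cubic_zero_of_lam_zero:
  assumes "\<And>p. lam p = 0" shows "C p a b b' = 0"
proof -
  have 0: "C p a b b = 0" for b
    using cubic_bound_polarized[OF lam_props(2) lam_props(1), of p a b] by (simp add: assms)
  have "C p a (b + b') (b + b') = C p a b b + C p a b' b' + 2 * C p a b b'"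
    using C_sym23[of p a b' b] by (simp add: C_lin)
  then show ?thesis by (simp add: 0)
qed

text \<open>Without a cubic form \<open>G\<close> is constant along coordinate lines from the
  origin, so \<open>u\<close> has a constant second derivative along each of them and two
  integrations recover it.\<close>

lemma quadratic_of_lam_zero:
  assumes lam0: "\<And>p. lam p = 0" and sec: "is_section \<tau> UNIV" "\<And>p. \<tau> (\<iota> p) = p"
  defines "b0 \<equiv> \<tau> 0"
  shows "G p a b = G b0 a b"
    and "u p = G b0 (\<iota> p) (\<iota> p) / 2 + dd (\<iota> p) u b0 + u b0"
proof -
  have const: "G (\<tau> x) a b = G b0 a b" for x a b
  proof -
    have "((\<lambda>s. G (\<tau> (0 + s *\<^sub>R x)) a b) has_real_derivative 0) (at s)" for s
      using G_line[OF sec(1), of 0 s x a b] by (simp add: cubic_zero_of_lam_zero[OF lam0])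
    from DERIV_zero_constant[OF this, of 1 0] show ?thesis by (simp add: b0_def)
  qed
  show "G p a b = G b0 a b" using const[of "\<iota> p"] by (simp add: sec(2))
  let ?x = "\<iota> p"
  define y where "y s = \<tau> (0 + s *\<^sub>R ?x)" for s
  have y: "y 0 = b0" "y 1 = p" by (simp_all add: y_def b0_def sec(2))
  have d1: "((\<lambda>s. u (y s)) has_real_derivative dd ?x u (y s)) (at s)" for s
    unfolding y_def by (rule dd_along_line[OF smooth_u sec(1) UNIV_I])
  have d2: "((\<lambda>s. dd ?x u (y s)) has_real_derivative G b0 ?x ?x) (at s)" for s
    using dd_along_line[where f = "dd ?x u" and x = 0 and s = s and w = ?x, OF smooth_fun_dd[OF smooth_u] sec(1) UNIV_I]
    by (simp add: y_def G_def[symmetric] const)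
  have "((\<lambda>s. dd ?x u (y s) - s * G b0 ?x ?x) has_real_derivative G b0 ?x ?x - 1 * G b0 ?x ?x) (at s)" for s
    by (intro DERIV_diff d2 DERIV_cmult_right DERIV_ident)
  then have d3: "((\<lambda>s. dd ?x u (y s) - s * G b0 ?x ?x) has_real_derivative 0) (at s)" for s by simp
  have 1: "dd ?x u (y s) = dd ?x u b0 + s * G b0 ?x ?x" for s
    using DERIV_zero_constant[OF d3, of s 0] y(1) by simp
  have "((\<lambda>s. u (y s) - (s * dd ?x u b0 + s\<^sup>2 * (G b0 ?x ?x / 2))) has_real_derivative
      dd ?x u (y s) - (1 * dd ?x u b0 + 2 * s * (G b0 ?x ?x / 2))) (at s)" for s
  proof (intro DERIV_diff d1 DERIV_add DERIV_cmult_right DERIV_ident)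
    show "((\<lambda>s. s\<^sup>2) has_real_derivative 2 * s) (at s)" by (auto intro!: derivative_eq_intros)
  qed
  then have "((\<lambda>s. u (y s) - (s * dd ?x u b0 + s\<^sup>2 * (G b0 ?x ?x / 2))) has_real_derivative 0) (at s)" for s
    unfolding 1 by simp
  from DERIV_zero_constant[OF this, of 1 0]
  show "u p = G b0 ?x ?x / 2 + dd ?x u b0 + u b0" by (simp add: y)
qed

end

section \<open>Lengths of curves and the Riemannian distance\<close>

context dev_map
begin

lemma smooth_fun_continuous:
  assumes f: "smooth_fun f" shows "continuous_on UNIV f"
proof -
  have "isCont f p" for p
  proof -
    obtain r \<sigma> where \<sigma>: "r > 0" "is_section \<sigma> (ball (\<iota> p) r)" "\<sigma> (\<iota> p) = p"
      by (rule local_section[OF open_UNIV UNIV_I])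
    let ?O = "\<sigma> ` ball (\<iota> p) r"
    have O: "open ?O" by (rule section_open_image[OF \<sigma>(2)])
    have "continuous_on ?O (\<lambda>q. f (\<sigma> (\<iota> q)))"
      by (rule continuous_on_compose2[OF smooth_fun_continuous_section[OF f \<sigma>(2)]
            continuous_on_subset[OF continuous_dev]])
        (auto simp: section_right_inverse[OF \<sigma>(2)])
    then have "continuous_on ?O f"
      by (rule continuous_on_eq) (auto simp: section_right_inverse[OF \<sigma>(2)])
    moreover have "p \<in> ?O" using \<sigma>(1,3) by (intro image_eqI[of _ _ "\<iota> p"]) simp_all
    ultimately show ?thesis using O continuous_on_eq_continuous_at by blast
  qed
  then show ?thesis by (simp add: continuous_at_imp_continuous_on)
qed

text \<open>Near time \<open>t\<close> the curve lies in the image of one section, so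
  \<open>f\<close> along the curve factors through \<open>\<iota> \<circ> \<gamma>\<close> and the
  chain rule applies.\<close>

lemma smooth_fun_along_curve:
  assumes \<gamma>: "isCont \<gamma> t" and V: "((\<iota> \<circ> \<gamma>) has_vector_derivative V) (at t)" and f: "smooth_fun f"
  shows "((f \<circ> \<gamma>) has_vector_derivative dd V f (\<gamma> t)) (at t)"
proof -
  let ?p = "\<gamma> t"
  obtain r \<sigma> where \<sigma>: "r > 0" "is_section \<sigma> (ball (\<iota> ?p) r)" "\<sigma> (\<iota> ?p) = ?p"
    by (rule local_section[OF open_UNIV UNIV_I])
  let ?O = "\<sigma> ` ball (\<iota> ?p) r"
  have O: "open ?O" by (rule section_open_image[OF \<sigma>(2)])
  have pO: "?p \<in> ?O" using \<sigma>(1,3) by (intro image_eqI[of _ _ "\<iota> ?p"]) simp_all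
  have "\<forall>\<^sub>F s in at t. \<gamma> s \<in> ?O" using \<gamma> O pO unfolding isCont_def by (rule topological_tendstoD)
  then have "\<forall>\<^sub>F s in nhds t. \<gamma> s \<in> ?O" using pO by (simp add: eventually_nhds_conv_at)
  then obtain S where S: "open S" "t \<in> S" "\<And>s. s \<in> S \<Longrightarrow> \<gamma> s \<in> ?O" unfolding eventually_nhds by blast
  have eq: "((f \<circ> \<sigma>) \<circ> (\<iota> \<circ> \<gamma>)) s = (f \<circ> \<gamma>) s" if s: "s \<in> S" for s
  proof -
    obtain x where x: "x \<in> ball (\<iota> ?p) r" "\<gamma> s = \<sigma> x" using S(3)[OF s] by blast
    then show ?thesis using section_right_inverse[OF \<sigma>(2) x(1)] by simp
  qed
  have "((f \<circ> \<sigma>) has_derivative (\<lambda>w. dd w f (\<sigma> (\<iota> ?p)))) (at ((\<iota> \<circ> \<gamma>) t))"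
    using smooth_fun_has_derivative[OF f \<sigma>(2), of "\<iota> ?p"] \<sigma>(1) by simp
  from diff_chain_at[OF V[unfolded has_vector_derivative_def] this]
  have "(((f \<circ> \<sigma>) \<circ> (\<iota> \<circ> \<gamma>)) has_derivative ((\<lambda>w. dd w f (\<sigma> (\<iota> ?p))) \<circ> (\<lambda>x. x *\<^sub>R V))) (at t)" .
  then have "((f \<circ> \<gamma>) has_derivative ((\<lambda>w. dd w f (\<sigma> (\<iota> ?p))) \<circ> (\<lambda>x. x *\<^sub>R V))) (at t)"
    by (subst (asm) has_derivative_cong_open[of S t _ "f \<circ> \<gamma>", OF S(1,2) eq])
  moreover have "(\<lambda>w. dd w f (\<sigma> (\<iota> ?p))) \<circ> (\<lambda>x. x *\<^sub>R V) = (\<lambda>x. x *\<^sub>R dd V f ?p)"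
    unfolding \<sigma>(3) by (auto simp: fun_eq_iff dd_dir_scale[OF f])
  ultimately show ?thesis by (simp add: has_vector_derivative_def)
qed

text \<open>\<open>V\<close> is the velocity in affine coordinates. The endpoints are left out since
  a two-sided derivative there would involve values of the curve outside the unit interval; for
  lengths they are a null set.\<close>

definition regular :: "(real \<Rightarrow> 'a) \<Rightarrow> real set \<Rightarrow> (real \<Rightarrow> real^'n) \<Rightarrow> bool" where
  "regular \<gamma> T V \<longleftrightarrow> finite T \<and> (\<forall>t\<in>{0<..<1}-T. ((\<iota> \<circ> \<gamma>) has_vector_derivative V t) (at t)) \<and>
     continuous_on ({0<..<1}-T) V"

lemma regular_exists:
  assumes "valid_path (\<iota> \<circ> \<gamma>)" obtains T V where "regular \<gamma> T V"
proof -
  obtain S where S: "finite S" "(\<iota> \<circ> \<gamma>) C1_differentiable_on ({0..1} - S)"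
    using assms unfolding valid_path_def piecewise_C1_differentiable_on_def by blast
  then obtain D where D: "\<And>t. t \<in> {0..1} - S \<Longrightarrow> ((\<iota> \<circ> \<gamma>) has_vector_derivative D t) (at t)"
    "continuous_on ({0..1} - S) D" unfolding C1_differentiable_on_def by blast
  then have "regular \<gamma> S D"
    using S(1) by (auto simp: regular_def intro: continuous_on_subset)
  then show thesis by (rule that)
qed

lemma path_isCont:
  fixes \<gamma> :: "real \<Rightarrow> 'a"
  assumes "path \<gamma>" "t \<in> {0<..<1}" shows "isCont \<gamma> t"
proof -
  have "continuous_on {0<..<1} \<gamma>" using assms(1) by (auto simp: path_def intro: continuous_on_subset)
  then show ?thesis using assms(2) by (simp add: continuous_on_eq_continuous_at[OF open_greaterThanLessThan])
qed

end

text \<open>The interface between the manifold structure and the calculus along sections: what the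
  comparison of lengths needs to know about the atlas and the metric tensor.\<close>

locale hessian_manifold = hessian_potential_locale \<iota> u
  for \<iota> :: "'a::t2_space \<Rightarrow> real^'n" and u :: "'a \<Rightarrow> real" +
  fixes A :: "('a, real^'n) chart set" and g :: "'a metric_tensor"
  assumes smooth_A: "\<And>f. f \<in> smooth_functions A \<Longrightarrow> smooth_fun f"
    and coord_A: "\<And>i. (\<lambda>p. \<iota> p $ i) \<in> smooth_functions A"
    and metric_A: "\<And>p w. g p (\<lambda>f. if f \<in> smooth_functions A then dd w f p else 0)
      (\<lambda>f. if f \<in> smooth_functions A then dd w f p else 0) = G p w w"
    and connected_A: "connected (UNIV :: 'a set)"
begin

text \<open>The coordinates are themselves smooth functions, which gives one direction; the chain
  rule gives the other, with 0 and 1 added to the exceptional times. Reversal and concatenation are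
  then inherited from \<open>valid_path\<close>.\<close>

lemma piecewise_C1_curve_iff: "piecewise_C1_curve A \<gamma> \<longleftrightarrow> path \<gamma> \<and> valid_path (\<iota> \<circ> \<gamma>)"
proof
  assume c: "piecewise_C1_curve A \<gamma>"
  then obtain T where T: "path \<gamma>" "finite T"
    "\<And>f. f \<in> smooth_functions A \<Longrightarrow> (f \<circ> \<gamma>) C1_differentiable_on ({0..1} - T)"
    unfolding piecewise_C1_curve_def by blast
  have "\<forall>i. \<exists>D. (\<forall>t\<in>{0..1} - T. (((\<lambda>p. \<iota> p $ i) \<circ> \<gamma>) has_vector_derivative D t) (at t)) \<and> continuous_on ({0..1} - T) D"
    using T(3)[OF coord_A] unfolding C1_differentiable_on_def by blast
  then obtain D where D: "\<And>i t. t \<in> {0..1} - T \<Longrightarrow> (((\<lambda>p. \<iota> p $ i) \<circ> \<gamma>) has_vector_derivative D i t) (at t)"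
    "\<And>i. continuous_on ({0..1} - T) (D i)" by metis
  have "((\<iota> \<circ> \<gamma>) has_vector_derivative (\<chi> i. D i t)) (at t)" if t: "t \<in> {0..1} - T" for t
    unfolding has_vector_derivative_def
    by (subst has_derivative_componentwise_within)
      (use D(1)[OF t] in \<open>auto simp: Basis_vec_def inner_axis has_vector_derivative_def comp_def\<close>)
  moreover have "continuous_on ({0..1} - T) (\<lambda>t. \<chi> i. D i t)" by (intro continuous_on_vec_lambda D)
  ultimately have "(\<iota> \<circ> \<gamma>) C1_differentiable_on ({0..1} - T)"
    unfolding C1_differentiable_on_def by (intro exI[of _ "\<lambda>t. \<chi> i. D i t"] conjI ballI)
  moreover have "continuous_on {0..1} (\<iota> \<circ> \<gamma>)"
    using T(1) unfolding path_def by (intro continuous_on_compose continuous_on_subset[OF continuous_dev]) auto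
  ultimately show "path \<gamma> \<and> valid_path (\<iota> \<circ> \<gamma>)"
    using T(1,2) unfolding valid_path_def piecewise_C1_differentiable_on_def by blast
next
  assume c: "path \<gamma> \<and> valid_path (\<iota> \<circ> \<gamma>)"
  obtain T V where "regular \<gamma> T V" by (rule regular_exists[OF c[THEN conjunct2]])
  then have r: "finite T" "\<And>t. t \<in> {0<..<1} - T \<Longrightarrow> ((\<iota> \<circ> \<gamma>) has_vector_derivative V t) (at t)"
    "continuous_on ({0<..<1} - T) V" by (auto simp: regular_def)
  have "(f \<circ> \<gamma>) C1_differentiable_on ({0..1} - (T \<union> {0,1}))" if f: "f \<in> smooth_functions A" for f
    unfolding C1_differentiable_on_def
  proof (intro exI[of _ "\<lambda>t. dd (V t) f (\<gamma> t)"] conjI ballI)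
    note sf = smooth_A[OF f]
    fix t assume "t \<in> {0..1} - (T \<union> {0,1})"
    then have t: "t \<in> {0<..<1} - T" by auto
    show "((f \<circ> \<gamma>) has_vector_derivative dd (V t) f (\<gamma> t)) (at t)"
      by (rule smooth_fun_along_curve[OF _ r(2)[OF t] sf]) (use t c path_isCont in auto)
  next
    note sf = smooth_A[OF f]
    have eq: "{0..1} - (T \<union> {0,1}) = {0<..<1} - T" by auto
    have cg: "continuous_on ({0<..<1} - T) \<gamma>"
      using c by (auto simp: path_def intro: continuous_on_subset)
    show "continuous_on ({0..1} - (T \<union> {0,1})) (\<lambda>t. dd (V t) f (\<gamma> t))"
      unfolding eq
    proof (rule continuous_on_linear_arg[of "\<lambda>t w. dd w f (\<gamma> t)"])
      show "linear (\<lambda>w. dd w f (\<gamma> t))" for t by (rule linear_dd[OF sf])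
      show "continuous_on ({0<..<1} - T) (\<lambda>t. dd (axis i 1) f (\<gamma> t))" for i
        by (rule continuous_on_compose2[OF smooth_fun_continuous[OF smooth_fun_dd[OF sf]] cg]) simp
    qed (rule r(3))
  qed
  then show "piecewise_C1_curve A \<gamma>"
    using c r(1) unfolding piecewise_C1_curve_def by (intro conjI exI[of _ "T \<union> {0,1}"] ballI) simp_all
qed

section \<open>Lengths of curves in affine coordinates\<close>

definition speed :: "(real \<Rightarrow> 'a) \<Rightarrow> real set \<Rightarrow> (real \<Rightarrow> real^'n) \<Rightarrow> real \<Rightarrow> real" where
  "speed \<gamma> T V t = indicator ({0<..<1} - T) t *\<^sub>R sqrt (G (\<gamma> t) (V t) (V t))"

lemma speed_nonneg: "speed \<gamma> T V t \<ge> 0"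
  by (simp add: speed_def G_nonneg)

lemma speed_measurable:
  assumes "path \<gamma>" "regular \<gamma> T V" shows "speed \<gamma> T V \<in> borel_measurable borel"
proof -
  have cg: "continuous_on ({0<..<1} - T) \<gamma>"
    using assms(1) by (auto simp: path_def intro: continuous_on_subset)
  have V: "continuous_on ({0<..<1} - T) V" using assms(2) by (simp add: regular_def)
  have 0: "continuous_on ({0<..<1} - T) (\<lambda>t. G (\<gamma> t) a b)" for a b
    unfolding G_def by (rule continuous_on_compose2[OF smooth_fun_continuous cg]) (intro smooths, simp)
  have 1: "continuous_on ({0<..<1} - T) (\<lambda>t. G (\<gamma> t) a (V t))" for a
    by (rule continuous_on_linear_arg[of "\<lambda>t b. G (\<gamma> t) a b"]) (rule linear_G2 0 V)+
  have "continuous_on ({0<..<1} - T) (\<lambda>t. G (\<gamma> t) (V t) (V t))"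
    by (rule continuous_on_linear_arg[of "\<lambda>t b. G (\<gamma> t) b (V t)"]) (rule linear_G 1 V)+
  then have "continuous_on ({0<..<1} - T) (\<lambda>t. sqrt (G (\<gamma> t) (V t) (V t)))" by (intro continuous_intros)
  moreover have "{0<..<1} - T \<in> sets borel"
    using assms(2) by (intro sets.Diff) (auto simp: regular_def intro: borel_closed finite_imp_closed)
  ultimately show ?thesis unfolding speed_def[abs_def] by (intro borel_measurable_continuous_on_indicator)
qed

lemma AE_not_finite: "finite S \<Longrightarrow> AE t in lborel. (t::real) \<notin> S"
  by (intro AE_not_in finite_imp_null_set_lborel)

lemma curve_length_regular:
  assumes p: "path \<gamma>" and r: "regular \<gamma> T V"
  shows "curve_length A g \<gamma> = (\<integral>\<^sup>+t. ennreal (speed \<gamma> T V t) \<partial>lborel)"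
  unfolding curve_length_def
proof (rule nn_integral_cong_AE)
  have "finite (T \<union> {0,1})" using r by (simp add: regular_def)
  from AE_not_finite[OF this]
  show "AE t in lborel. ennreal (sqrt (g (\<gamma> t) (velocity A \<gamma> t) (velocity A \<gamma> t))) * indicator {0..1} t
      = ennreal (speed \<gamma> T V t)"
  proof eventually_elim
    case (elim t)
    show ?case
    proof (cases "t \<in> {0<..<1}")
      case False
      then have "t \<notin> {0..1}" using elim by auto
      then show ?thesis using False by (auto simp: speed_def indicator_def)
    next
      case True
      then have t: "t \<in> {0<..<1} - T" using elim by auto
      then have V: "((\<iota> \<circ> \<gamma>) has_vector_derivative V t) (at t)" using r by (simp add: regular_def)
      have "velocity A \<gamma> t = (\<lambda>f. if f \<in> smooth_functions A then dd (V t) f (\<gamma> t) else 0)"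
        unfolding velocity_def
        using vector_derivative_at[OF smooth_fun_along_curve[OF path_isCont[OF p True] V smooth_A]] by auto
      then have "g (\<gamma> t) (velocity A \<gamma> t) (velocity A \<gamma> t) = G (\<gamma> t) (V t) (V t)"
        using metric_A[of "\<gamma> t" "V t"] by simp
      then show ?thesis using t True by (simp add: speed_def)
    qed
  qed
qed

text \<open>On \<open>I\<close> the speed of the new curve is \<bar>c\<bar> times the old one, and
  the affine substitution in the integral absorbs the factor. An inequality suffices: for a reversed
  path and for the halves of a concatenation it yields symmetry and the triangle inequality.\<close>

lemma speed_reparametrize:
  assumes p: "path \<gamma>" and r: "regular \<gamma> T V" and r': "regular \<gamma>' T' V'" and c: "c \<noteq> 0"
    and I: "open I" "\<And>t. t \<in> I \<Longrightarrow> e + c * t \<in> {0<..<1} \<and> \<gamma>' t = \<gamma> (e + c * t)"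
  shows "(\<integral>\<^sup>+t. ennreal (speed \<gamma>' T' V' t) * indicator I t \<partial>lborel) \<le> curve_length A g \<gamma>"
proof -
  have m[measurable]: "speed \<gamma> T V \<in> borel_measurable borel" by (rule speed_measurable[OF p r])
  have fin: "finite (T' \<union> (\<lambda>t. e + c * t) -` T)"
    using r r' c by (auto simp: regular_def inj_def intro!: finite_vimageI)
  have "AE t in lborel. ennreal (speed \<gamma>' T' V' t) * indicator I t \<le> ennreal \<bar>c\<bar> * ennreal (speed \<gamma> T V (e + c * t))"
    using AE_not_finite[OF fin]
  proof eventually_elim
    case (elim t)
    show ?case
    proof (cases "t \<in> I \<and> t \<in> {0<..<1}")
      case True
      then have t: "t \<in> I" "t \<in> {0<..<1} - T'" "e + c * t \<in> {0<..<1} - T" "\<gamma>' t = \<gamma> (e + c * t)"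
        using elim I(2)[of t] by auto
      have V: "((\<iota> \<circ> \<gamma>) has_vector_derivative V (e + c * t)) (at (e + c * t))" using r t by (simp add: regular_def)
      have "((\<lambda>t. e + c * t) has_vector_derivative c) (at t)"
        by (auto intro!: derivative_eq_intros simp: has_real_derivative_iff_has_vector_derivative[symmetric])
      from vector_diff_chain_at[OF this V]
      have "(((\<iota> \<circ> \<gamma>) \<circ> (\<lambda>t. e + c * t)) has_vector_derivative c *\<^sub>R V (e + c * t)) (at t)" .
      then have "((\<iota> \<circ> \<gamma>') has_vector_derivative c *\<^sub>R V (e + c * t)) (at t)"
        unfolding has_vector_derivative_def
        by (subst (asm) has_derivative_cong_open[OF I(1) t(1), of _ "\<iota> \<circ> \<gamma>'"]) (use I(2) in auto)
      moreover have "((\<iota> \<circ> \<gamma>') has_vector_derivative V' t) (at t)" using r' t by (simp add: regular_def)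
      ultimately have "V' t = c *\<^sub>R V (e + c * t)" by (rule vector_derivative_unique_at[symmetric])
      then have "speed \<gamma>' T' V' t = \<bar>c\<bar> * speed \<gamma> T V (e + c * t)"
        using t by (simp add: speed_def G_scale_square real_sqrt_mult)
      then show ?thesis using t(1) by (simp add: ennreal_mult speed_nonneg)
    next
      case False
      then show ?thesis by (auto simp: speed_def)
    qed
  qed
  then have "(\<integral>\<^sup>+t. ennreal (speed \<gamma>' T' V' t) * indicator I t \<partial>lborel)
      \<le> (\<integral>\<^sup>+t. ennreal \<bar>c\<bar> * ennreal (speed \<gamma> T V (e + c * t)) \<partial>lborel)"
    by (rule nn_integral_mono_AE)
  also have "\<dots> = ennreal \<bar>c\<bar> * (\<integral>\<^sup>+t. ennreal (speed \<gamma> T V (e + c * t)) \<partial>lborel)"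
    by (rule nn_integral_cmult) measurable
  also have "\<dots> = (\<integral>\<^sup>+t. ennreal (speed \<gamma> T V t) \<partial>lborel)"
    by (rule nn_integral_real_affine[symmetric, OF _ c]) measurable
  also have "\<dots> = curve_length A g \<gamma>" by (rule curve_length_regular[OF p r, symmetric])
  finally show ?thesis .
qed

lemma curve_reversepath:
  assumes "piecewise_C1_curve A \<gamma>"
  shows "piecewise_C1_curve A (reversepath \<gamma>)" "curve_length A g (reversepath \<gamma>) \<le> curve_length A g \<gamma>"
proof -
  have \<gamma>: "path \<gamma>" "valid_path (\<iota> \<circ> \<gamma>)" using assms by (auto simp: piecewise_C1_curve_iff)
  have "\<iota> \<circ> reversepath \<gamma> = reversepath (\<iota> \<circ> \<gamma>)" by (auto simp: reversepath_def)
  then have r\<gamma>: "path (reversepath \<gamma>)" "valid_path (\<iota> \<circ> reversepath \<gamma>)" using \<gamma> by (simp_all add: valid_path_imp_reverse)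
  then show "piecewise_C1_curve A (reversepath \<gamma>)" by (simp add: piecewise_C1_curve_iff)
  obtain T V T' V' where r: "regular \<gamma> T V" and r': "regular (reversepath \<gamma>) T' V'"
    using regular_exists[OF \<gamma>(2)] regular_exists[OF r\<gamma>(2)] by metis
  have "curve_length A g (reversepath \<gamma>) = (\<integral>\<^sup>+t. ennreal (speed (reversepath \<gamma>) T' V' t) \<partial>lborel)"
    by (rule curve_length_regular[OF r\<gamma>(1) r'])
  also have "\<dots> = (\<integral>\<^sup>+t. ennreal (speed (reversepath \<gamma>) T' V' t) * indicator {0<..<1} t \<partial>lborel)"
    by (intro nn_integral_cong) (auto simp: speed_def indicator_def)
  also have "\<dots> \<le> curve_length A g \<gamma>"
    by (rule speed_reparametrize[OF \<gamma>(1) r r', of "-1" _ 1]) (auto simp: reversepath_def)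
  finally show "curve_length A g (reversepath \<gamma>) \<le> curve_length A g \<gamma>" .
qed

lemma curve_joinpaths:
  assumes "piecewise_C1_curve A \<gamma>1" "piecewise_C1_curve A \<gamma>2" "pathfinish \<gamma>1 = pathstart \<gamma>2"
  shows "piecewise_C1_curve A (\<gamma>1 +++ \<gamma>2)"
    "curve_length A g (\<gamma>1 +++ \<gamma>2) \<le> curve_length A g \<gamma>1 + curve_length A g \<gamma>2"
proof -
  let ?\<gamma> = "\<gamma>1 +++ \<gamma>2"
  have \<gamma>: "path \<gamma>1" "valid_path (\<iota> \<circ> \<gamma>1)" "path \<gamma>2" "valid_path (\<iota> \<circ> \<gamma>2)"
    using assms by (auto simp: piecewise_C1_curve_iff)
  have "\<iota> \<circ> ?\<gamma> = (\<iota> \<circ> \<gamma>1) +++ (\<iota> \<circ> \<gamma>2)" by (auto simp: joinpaths_def)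
  moreover have "valid_path ((\<iota> \<circ> \<gamma>1) +++ (\<iota> \<circ> \<gamma>2))"
    by (rule valid_path_join[OF \<gamma>(2,4)]) (use assms(3) in \<open>simp add: pathfinish_def pathstart_def\<close>)
  ultimately have j: "path ?\<gamma>" "valid_path (\<iota> \<circ> ?\<gamma>)" using \<gamma> assms(3) by simp_all
  then show "piecewise_C1_curve A ?\<gamma>" by (simp add: piecewise_C1_curve_iff)
  obtain T V where r: "regular ?\<gamma> T V" by (rule regular_exists[OF j(2)])
  obtain T1 V1 where r1: "regular \<gamma>1 T1 V1" by (rule regular_exists[OF \<gamma>(2)])
  obtain T2 V2 where r2: "regular \<gamma>2 T2 V2" by (rule regular_exists[OF \<gamma>(4)])
  note [measurable] = speed_measurable[OF j(1) r]
  have "curve_length A g ?\<gamma> = (\<integral>\<^sup>+t. ennreal (speed ?\<gamma> T V t) \<partial>lborel)"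
    by (rule curve_length_regular[OF j(1) r])
  also have "\<dots> \<le> (\<integral>\<^sup>+t. ennreal (speed ?\<gamma> T V t) * indicator {0<..<1/2} t
       + ennreal (speed ?\<gamma> T V t) * indicator {1/2<..<1} t \<partial>lborel)"
  proof (rule nn_integral_mono_AE)
    have fin: "finite {1/2::real}" by simp
    from AE_not_finite[OF fin]
    show "AE t in lborel. ennreal (speed ?\<gamma> T V t) \<le> ennreal (speed ?\<gamma> T V t) * indicator {0<..<1/2} t
       + ennreal (speed ?\<gamma> T V t) * indicator {1/2<..<1} t"
      by eventually_elim (auto simp: speed_def indicator_def)
  qed
  also have "\<dots> = (\<integral>\<^sup>+t. ennreal (speed ?\<gamma> T V t) * indicator {0<..<1/2} t \<partial>lborel)
       + (\<integral>\<^sup>+t. ennreal (speed ?\<gamma> T V t) * indicator {1/2<..<1} t \<partial>lborel)"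
    by (rule nn_integral_add) measurable
  also have "\<dots> \<le> curve_length A g \<gamma>1 + curve_length A g \<gamma>2"
  proof (rule add_mono)
    show "(\<integral>\<^sup>+t. ennreal (speed ?\<gamma> T V t) * indicator {0<..<1/2} t \<partial>lborel) \<le> curve_length A g \<gamma>1"
      by (rule speed_reparametrize[OF \<gamma>(1) r1 r, of 2 _ 0]) (auto simp: joinpaths_def)
    show "(\<integral>\<^sup>+t. ennreal (speed ?\<gamma> T V t) * indicator {1/2<..<1} t \<partial>lborel) \<le> curve_length A g \<gamma>2"
      by (rule speed_reparametrize[OF \<gamma>(3) r2 r, of 2 _ "-1"]) (auto simp: joinpaths_def)
  qed
  finally show "curve_length A g ?\<gamma> \<le> curve_length A g \<gamma>1 + curve_length A g \<gamma>2" .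
qed

lemma segment_curve:
  assumes \<tau>: "is_section \<tau> W" and xy: "closed_segment x y \<subseteq> W"
    and M: "\<And>z. z \<in> closed_segment x y \<Longrightarrow> sqrt (G (\<tau> z) (y - x) (y - x)) \<le> M"
  shows "piecewise_C1_curve A (\<tau> \<circ> linepath x y)" "curve_length A g (\<tau> \<circ> linepath x y) \<le> ennreal M"
proof -
  let ?\<gamma> = "\<tau> \<circ> linepath x y"
  have inW: "linepath x y t \<in> W" if "t \<in> {0..1}" for t
    using xy that by (auto simp: path_image_linepath[symmetric] path_image_def)
  have p: "path ?\<gamma>"
    unfolding path_def comp_def
    by (rule continuous_on_compose2[of W \<tau>, OF _ continuous_on_linepath])
      (use \<tau> inW in \<open>auto simp: is_section_def\<close>)
  have r: "regular ?\<gamma> {} (\<lambda>_. y - x)"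
    unfolding regular_def
  proof (intro conjI ballI finite.emptyI continuous_on_const)
    fix t :: real assume t: "t \<in> {0<..<1} - {}"
    have "(linepath x y has_derivative (\<lambda>h. h *\<^sub>R (y - x))) (at t)"
      using has_vector_derivative_linepath_within[of x y t UNIV] by (simp add: has_vector_derivative_def)
    then have "((\<iota> \<circ> ?\<gamma>) has_derivative (\<lambda>h. h *\<^sub>R (y - x))) (at t)"
      by (subst has_derivative_cong_open[of "{0<..<1}" t _ "linepath x y"])
        (use t inW section_right_inverse[OF \<tau>] in auto)
    then show "((\<iota> \<circ> ?\<gamma>) has_vector_derivative y - x) (at t)" by (simp add: has_vector_derivative_def)
  qed
  have "valid_path (\<iota> \<circ> ?\<gamma>)"
  proof -
    have "(\<iota> \<circ> ?\<gamma>) C1_differentiable_on ({0..1} - {0,1})"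
      using r unfolding C1_differentiable_on_def regular_def
      by (intro exI[of _ "\<lambda>_. y - x"]) (auto simp: less_le)
    moreover have "continuous_on {0..1} (\<iota> \<circ> ?\<gamma>)"
      using p continuous_on_compose2[OF continuous_dev, of "{0..1}" ?\<gamma>] by (simp add: path_def comp_def)
    ultimately show ?thesis unfolding valid_path_def piecewise_C1_differentiable_on_def
      by (intro conjI exI[of _ "{0,1}"]) auto
  qed
  then show "piecewise_C1_curve A ?\<gamma>" using p by (simp add: piecewise_C1_curve_iff)
  have "curve_length A g ?\<gamma> = (\<integral>\<^sup>+t. ennreal (speed ?\<gamma> {} (\<lambda>_. y - x) t) \<partial>lborel)"
    by (rule curve_length_regular[OF p r])
  also have "\<dots> \<le> (\<integral>\<^sup>+t. ennreal M * indicator {0<..<1::real} t \<partial>lborel)"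
  proof (rule nn_integral_mono)
    fix t :: real
    have "linepath x y t \<in> closed_segment x y" if "t \<in> {0<..<1}"
      using that by (auto simp: path_image_linepath[symmetric] path_image_def)
    then show "ennreal (speed ?\<gamma> {} (\<lambda>_. y - x) t) \<le> ennreal M * indicator {0<..<1} t"
      using M by (auto simp: speed_def indicator_def ennreal_leI)
  qed
  also have "\<dots> = ennreal M" by (simp add: nn_integral_cmult)
  finally show "curve_length A g ?\<gamma> \<le> ennreal M" .
qed

end

section \<open>Short curves stay near their start, and the distance is a metric\<close>

context hessian_manifold
begin

text \<open>Up to the first exit from the coordinate ball of radius \<open>r'\<close> the Riemannian
  speed is at least \<open>m\<close> times the Euclidean speed, and the Euclidean displacement at
  the exit is \<open>r'\<close>.\<close>

lemma curve_leaving_ball: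
  assumes \<sigma>: "is_section \<sigma> (ball (\<iota> p) r)" "\<sigma> (\<iota> p) = p"
    and m: "m > 0" "\<And>x w. x \<in> ball (\<iota> p) r \<Longrightarrow> m\<^sup>2 * (norm w)\<^sup>2 \<le> G (\<sigma> x) w w"
    and r': "0 < r'" "r' < r"
    and \<gamma>: "piecewise_C1_curve A \<gamma>" "pathstart \<gamma> = p" "pathfinish \<gamma> \<notin> \<sigma> ` ball (\<iota> p) r'"
  shows "ennreal (m * r') \<le> curve_length A g \<gamma>"
proof -
  have p: "path \<gamma>" "valid_path (\<iota> \<circ> \<gamma>)" using \<gamma>(1) by (auto simp: piecewise_C1_curve_iff)
  obtain T V where reg: "regular \<gamma> T V" by (rule regular_exists[OF p(2)])
  have T: "finite T" "\<And>t. t \<in> {0<..<1} - T \<Longrightarrow> ((\<iota> \<circ> \<gamma>) has_vector_derivative V t) (at t)"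
    using reg by (auto simp: regular_def)
  let ?O = "\<sigma> ` ball (\<iota> p) r'"
  have O: "open ?O"
    by (rule section_open_image[OF is_section_subset[OF \<sigma>(1) open_ball]]) (use r' in auto)
  have c\<gamma>: "continuous_on {0..1} \<gamma>" using p(1) by (simp add: path_def)
  let ?S = "{0..1} \<inter> \<gamma> -` (- ?O)"
  have "closed ?S" using O by (intro continuous_closed_preimage[OF c\<gamma>]) auto
  then have "compact ?S" by (intro compact_Int_closed[of "{0..1}" ?S, simplified]) auto
  moreover have "1 \<in> ?S" using \<gamma>(3) by (simp add: pathfinish_def)
  ultimately obtain t1 where t1: "t1 \<in> ?S" "\<And>t. t \<in> ?S \<Longrightarrow> t1 \<le> t"
    using compact_attains_inf[of ?S] by blast
  have t01: "0 \<le> t1" "t1 \<le> 1" "\<gamma> t1 \<notin> ?O" using t1(1) by auto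
  have before: "\<gamma> t \<in> ?O" if "0 \<le> t" "t < t1" for t
  proof (rule ccontr)
    assume "\<gamma> t \<notin> ?O"
    then have "t \<in> ?S" using that t01 by simp
    then show False using t1(2)[of t] that by simp
  qed
  have \<gamma>0: "\<gamma> 0 = p" using \<gamma>(2) by (simp add: pathstart_def)
  have "p \<in> ?O" using \<sigma>(2) r' by (intro image_eqI[of _ _ "\<iota> p"]) simp_all
  then have t1pos: "0 < t1" using t01 \<gamma>0 by (cases "t1 = 0") auto
  have inball: "\<iota> (\<gamma> t) \<in> ball (\<iota> p) r' \<and> \<gamma> t = \<sigma> (\<iota> (\<gamma> t))" if "0 \<le> t" "t < t1" for t
  proof -
    obtain x where x: "x \<in> ball (\<iota> p) r'" "\<gamma> t = \<sigma> x" using before[OF \<open>0 \<le> t\<close> \<open>t < t1\<close>] by blast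
    then have "x \<in> ball (\<iota> p) r" using r' by simp
    then have "\<iota> (\<gamma> t) = x" using section_right_inverse[OF \<sigma>(1)] x(2) by simp
    then show ?thesis using x by simp
  qed
  \<comment> \<open>The exit point is a limit of points of the lifted ball. The lifted closed ball
    is compact, hence closed, so it contains the exit point and the exit happens over the sphere of
    radius \<open>r'\<close>.\<close>
  let ?K = "\<sigma> ` cball (\<iota> p) r'"
  have cK: "closed ?K"
  proof (intro compact_imp_closed compact_continuous_image compact_cball)
    show "continuous_on (cball (\<iota> p) r') \<sigma>"
      using \<sigma>(1) r' unfolding is_section_def by (auto intro: continuous_on_subset)
  qed
  have "\<gamma> t1 \<in> ?K"
  proof (rule ccontr)
    assume "\<gamma> t1 \<notin> ?K"
    have "closed ({0..t1} \<inter> \<gamma> -` ?K)"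
      using t01 by (intro continuous_closed_preimage[OF continuous_on_subset[OF c\<gamma>]] cK) auto
    moreover have "{0..<t1} \<subseteq> {0..t1} \<inter> \<gamma> -` ?K"
    proof
      fix t assume "t \<in> {0..<t1}"
      then show "t \<in> {0..t1} \<inter> \<gamma> -` ?K" using before[of t] by (auto simp: less_imp_le)
    qed
    ultimately have "closure {0..<t1} \<subseteq> {0..t1} \<inter> \<gamma> -` ?K" by (rule closure_minimal[rotated])
    moreover have "t1 \<in> closure {0..<t1}" using t1pos by simp
    ultimately show False using \<open>\<gamma> t1 \<notin> ?K\<close> by blast
  qed
  then obtain x1 where x1: "x1 \<in> cball (\<iota> p) r'" "\<gamma> t1 = \<sigma> x1" by blast
  have ix1: "\<iota> (\<gamma> t1) = x1" using section_right_inverse[OF \<sigma>(1), of x1] x1 r' by simp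
  have "x1 \<notin> ball (\<iota> p) r'" using t01(3) x1(2) by blast
  then have norm1: "norm (x1 - \<iota> p) = r'" using x1(1) by (simp add: dist_norm norm_minus_commute)
  \<comment> \<open>The unit vector towards the exit point: the component of the velocity along it
    integrates to exactly \<open>r'\<close>.\<close>
  define b where "b = (1 / r') *\<^sub>R (x1 - \<iota> p)"
  have b: "norm b = 1" "(x1 - \<iota> p) \<bullet> b = r'"
    using norm1 r' by (simp_all add: b_def dot_square_norm power2_eq_square)
  have "(V has_integral (\<iota> \<circ> \<gamma>) t1 - (\<iota> \<circ> \<gamma>) 0) {0..t1}"
  proof (rule fundamental_theorem_of_calculus_interior_strong[OF T(1) t01(1)])
    show "continuous_on {0..t1} (\<iota> \<circ> \<gamma>)"
      using t01 continuous_on_compose2[OF continuous_dev continuous_on_subset[OF c\<gamma>], of "{0..t1}"]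
      by (simp add: comp_def)
  next
    fix t assume "t \<in> {0<..<t1} - T"
    then show "((\<iota> \<circ> \<gamma>) has_vector_derivative V t) (at t)" using t01 by (intro T(2)) auto
  qed
  from has_integral_linear[OF this bounded_linear_inner_left[of b]]
  have "((\<lambda>t. V t \<bullet> b) has_integral r') {0..t1}" by (simp add: comp_def ix1 \<gamma>0 b(2))
  then have int1: "((\<lambda>t. indicator ({0<..<t1} - T) t * (V t \<bullet> b)) has_integral r') {0..t1}"
    by (rule has_integral_spike_finite[of "T \<union> {0,t1}", rotated 2]) (use T(1) in \<open>auto simp: indicator_def\<close>)
  \<comment> \<open>Infinite length is immediate. Finite length makes the speed integrable, so that
    its Lebesgue integral can be compared with the gauge integral that the fundamental theorem
    delivers for a possibly unbounded velocity.\<close>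
  show ?thesis
  proof (cases "curve_length A g \<gamma> = \<infinity>")
    case False
    let ?F = "speed \<gamma> T V"
    have meas: "?F \<in> borel_measurable lborel" using speed_measurable[OF p(1) reg] by simp
    have len: "curve_length A g \<gamma> = (\<integral>\<^sup>+t. ennreal (?F t) \<partial>lborel)" by (rule curve_length_regular[OF p(1) reg])
    have integ: "integrable lborel ?F"
      using False len by (intro integrableI_nonneg meas) (auto simp: speed_nonneg less_top)
    have lenI: "curve_length A g \<gamma> = ennreal (integral\<^sup>L lborel ?F)"
      unfolding len by (rule nn_integral_eq_integral[OF integ]) (simp add: speed_nonneg)
    have hi: "(?F has_integral integral\<^sup>L lborel ?F) UNIV" by (rule has_integral_integral_lborel[OF integ])
    have on: "?F integrable_on {0..t1}" using hi by (intro integrable_on_subinterval[of ?F UNIV]) auto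
    have le1: "integral {0..t1} ?F \<le> integral\<^sup>L lborel ?F"
      using integral_subset_le[of "{0..t1}" UNIV ?F] on hi by (auto simp: speed_nonneg integral_unique)
    have "((\<lambda>t. m * (indicator ({0<..<t1} - T) t * (V t \<bullet> b))) has_integral m * r') {0..t1}"
      using has_integral_mult_right[OF int1] .
    then have "m * r' \<le> integral {0..t1} ?F"
    proof (rule has_integral_le[OF _ integrable_integral[OF on]])
      fix t assume "t \<in> {0..t1}"
      show "m * (indicator ({0<..<t1} - T) t * (V t \<bullet> b)) \<le> ?F t"
      proof (cases "t \<in> {0<..<t1} - T")
        case True
        then have t: "t \<in> {0<..<1} - T" "0 \<le> t" "t < t1" using t01 by auto
        have "V t \<bullet> b \<le> norm (V t)" using norm_cauchy_schwarz[of "V t" b] b(1) by simp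
        then have "m * (V t \<bullet> b) \<le> m * norm (V t)" using m(1) by simp
        also have "\<dots> = sqrt (m\<^sup>2 * (norm (V t))\<^sup>2)" using m(1) by (simp add: real_sqrt_mult)
        also have "\<dots> \<le> sqrt (G (\<gamma> t) (V t) (V t))"
        proof (rule real_sqrt_le_mono)
          have "\<iota> (\<gamma> t) \<in> ball (\<iota> p) r" using inball[OF t(2,3)] r' by auto
          from m(2)[OF this] show "m\<^sup>2 * (norm (V t))\<^sup>2 \<le> G (\<gamma> t) (V t) (V t)" using inball[OF t(2,3)] by simp
        qed
        finally show ?thesis using True t(1) by (simp add: speed_def)
      qed (simp add: speed_nonneg)
    qed
    then show ?thesis unfolding lenI using le1 by (intro ennreal_leI) simp
  qed simp
qed

text \<open>The constant \<open>m\<close> is the square root of the minimum of the metric over a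
  compact coordinate ball times the unit sphere; a curve shorter than \<open>m * (r / 2)\<close>
  cannot leave the half-size ball.\<close>

lemma neighbourhood_contains_short_curves:
  assumes V: "open V" "p \<in> V"
  obtains \<delta> where "\<delta> > 0"
    "\<And>\<gamma>. piecewise_C1_curve A \<gamma> \<Longrightarrow> pathstart \<gamma> = p \<Longrightarrow> curve_length A g \<gamma> < ennreal \<delta> \<Longrightarrow> pathfinish \<gamma> \<in> V"
proof -
  obtain r0 \<sigma> where \<sigma>: "r0 > 0" "is_section \<sigma> (ball (\<iota> p) r0)" "\<sigma> (\<iota> p) = p" "\<sigma> ` ball (\<iota> p) r0 \<subseteq> V"
    by (rule local_section[OF V])
  define r where "r = r0 / 2"
  have r: "r > 0" "cball (\<iota> p) r \<subseteq> ball (\<iota> p) r0" using \<sigma>(1) by (auto simp: r_def)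
  let ?S = "cball (\<iota> p) r \<times> sphere (0::real^'n) 1"
  have "continuous_on ?S (\<lambda>z. G (\<sigma> (fst z)) (snd z) (snd z))"
    using r(2) by (intro continuous_on_subset[OF continuous_G_section[OF \<sigma>(2)]]) auto
  moreover have "compact ?S" by (intro compact_Times compact_cball compact_sphere)
  moreover have "(\<iota> p, axis undefined 1) \<in> ?S" using r(1) by simp
  ultimately obtain z where z: "z \<in> ?S" "\<forall>y\<in>?S. G (\<sigma> (fst z)) (snd z) (snd z) \<le> G (\<sigma> (fst y)) (snd y) (snd y)"
    using continuous_attains_inf[of ?S "\<lambda>z. G (\<sigma> (fst z)) (snd z) (snd z)"] by blast
  define m where "m = sqrt (G (\<sigma> (fst z)) (snd z) (snd z))"
  have "snd z \<noteq> 0" using z(1) by auto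
  then have gz: "G (\<sigma> (fst z)) (snd z) (snd z) > 0" by (rule G_pos)
  have m: "m > 0" "m\<^sup>2 = G (\<sigma> (fst z)) (snd z) (snd z)" using gz by (simp_all add: m_def)
  have bound: "m\<^sup>2 * (norm w)\<^sup>2 \<le> G (\<sigma> x) w w" if x: "x \<in> ball (\<iota> p) r" for x w
  proof (cases "w = 0")
    case False
    have "(x, (1 / norm w) *\<^sub>R w) \<in> ?S" using x False by simp
    then have "m\<^sup>2 \<le> G (\<sigma> x) ((1 / norm w) *\<^sub>R w) ((1 / norm w) *\<^sub>R w)" using z(2) unfolding m(2) by force
    also have "\<dots> = G (\<sigma> x) w w / (norm w)\<^sup>2" by (simp add: G_scale_square power_divide)
    finally show ?thesis using False by (simp add: field_simps)
  qed (simp add: G_bilin)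
  have sub: "is_section \<sigma> (ball (\<iota> p) r)" using r by (intro is_section_subset[OF \<sigma>(2)]) auto
  show thesis
  proof (rule that[of "m * (r / 2)"])
    show "m * (r / 2) > 0" using m r by simp
    fix \<gamma> assume \<gamma>: "piecewise_C1_curve A \<gamma>" "pathstart \<gamma> = p" "curve_length A g \<gamma> < ennreal (m * (r / 2))"
    have "pathfinish \<gamma> \<in> \<sigma> ` ball (\<iota> p) (r / 2)"
    proof (rule ccontr)
      assume n: "pathfinish \<gamma> \<notin> \<sigma> ` ball (\<iota> p) (r / 2)"
      have "ennreal (m * (r / 2)) \<le> curve_length A g \<gamma>"
        by (rule curve_leaving_ball[OF sub \<sigma>(3) m(1) bound _ _ \<gamma>(1,2) n]) (use r(1) in simp_all)
      then show False using \<gamma>(3) by simp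
    qed
    moreover have "\<sigma> ` ball (\<iota> p) (r / 2) \<subseteq> V" using \<sigma>(1,4) by (force simp: r_def)
    ultimately show "pathfinish \<gamma> \<in> V" by blast
  qed
qed

abbreviation curves :: "'a \<Rightarrow> 'a \<Rightarrow> (real \<Rightarrow> 'a) set" where
  "curves p q \<equiv> {\<gamma>. piecewise_C1_curve A \<gamma> \<and> pathstart \<gamma> = p \<and> pathfinish \<gamma> = q}"

abbreviation inf_length :: "'a \<Rightarrow> 'a \<Rightarrow> ennreal" where
  "inf_length p q \<equiv> (INF \<gamma>\<in>curves p q. curve_length A g \<gamma>)"

lemma inf_length_sym_le: "inf_length q p \<le> inf_length p q"
proof (rule INF_greatest)
  fix \<gamma> assume "\<gamma> \<in> curves p q"
  then show "inf_length q p \<le> curve_length A g \<gamma>"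
    using curve_reversepath[of \<gamma>] by (intro INF_lower2[of "reversepath \<gamma>"]) auto
qed

lemma inf_length_triangle: "inf_length p s \<le> inf_length p q + inf_length q s"
proof (rule ennreal_le_epsilon)
  fix e :: real assume fin: "inf_length p q + inf_length q s < top" and e: "0 < e"
  have ex: "\<exists>\<gamma>\<in>curves a b. curve_length A g \<gamma> < inf_length a b + ennreal (e / 2)" if "inf_length a b < top" for a b
  proof -
    have lt: "x < x + ennreal (e / 2)" if "x < top" for x :: ennreal
      using that e ennreal_add_left_cancel_less[of x 0 "ennreal (e / 2)"] by (simp add: less_top)
    have "inf_length a b < inf_length a b + ennreal (e / 2)" by (rule lt[OF that])
    then show ?thesis by (rule INF_less_iff[THEN iffD1])
  qed
  have "inf_length p q < top" "inf_length q s < top" using fin by simp_all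
  then obtain \<gamma>1 \<gamma>2 where \<gamma>: "\<gamma>1 \<in> curves p q" "curve_length A g \<gamma>1 < inf_length p q + ennreal (e / 2)"
    "\<gamma>2 \<in> curves q s" "curve_length A g \<gamma>2 < inf_length q s + ennreal (e / 2)"
    using ex by blast
  have j: "piecewise_C1_curve A (\<gamma>1 +++ \<gamma>2)"
    "curve_length A g (\<gamma>1 +++ \<gamma>2) \<le> curve_length A g \<gamma>1 + curve_length A g \<gamma>2"
    using \<gamma> by (auto intro!: curve_joinpaths)
  have "inf_length p s \<le> curve_length A g \<gamma>1 + curve_length A g \<gamma>2"
    using j \<gamma> by (intro INF_lower2[of "\<gamma>1 +++ \<gamma>2"]) auto
  also have "\<dots> \<le> (inf_length p q + ennreal (e / 2)) + (inf_length q s + ennreal (e / 2))"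
    using \<gamma> by (intro add_mono less_imp_le)
  also have "\<dots> = inf_length p q + inf_length q s + ennreal e"
    using e by (simp add: ac_simps ennreal_plus[symmetric] del: ennreal_plus)
  finally show "inf_length p s \<le> inf_length p q + inf_length q s + ennreal e" .
qed

lemma section_segment_inf_length:
  assumes "is_section \<tau> W" "closed_segment x y \<subseteq> W"
    "\<And>z. z \<in> closed_segment x y \<Longrightarrow> sqrt (G (\<tau> z) (y - x) (y - x)) \<le> M"
  shows "inf_length (\<tau> x) (\<tau> y) \<le> ennreal M"
  using segment_curve[OF assms]
  by (intro INF_lower2[of "\<tau> \<circ> linepath x y"]) (auto simp: pathstart_def pathfinish_def linepath_def)

text \<open>Being joined by curves of finite length is an equivalence relation. Its classes are open
  because coordinate segments near a point have bounded speed, so connectedness leaves one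
  class.\<close>

lemma inf_length_finite: "inf_length p q < top"
proof (rule connected_equivalence_relation[OF connected_A UNIV_I UNIV_I, of "\<lambda>p q. inf_length p q < top"])
  show "inf_length y x < top" if "inf_length x y < top" for x y using inf_length_sym_le that by (rule le_less_trans)
  show "inf_length x z < top" if "inf_length x y < top" "inf_length y z < top" for x y z
    using inf_length_triangle by (rule le_less_trans) (use that in simp)
  fix a :: 'a
  obtain r0 \<sigma> where \<sigma>: "r0 > 0" "is_section \<sigma> (ball (\<iota> a) r0)" "\<sigma> (\<iota> a) = a"
    by (rule local_section[OF open_UNIV UNIV_I])
  have "inf_length a (\<sigma> y) < top" if y: "y \<in> ball (\<iota> a) r0" for y
  proof -
    have seg: "closed_segment (\<iota> a) y \<subseteq> ball (\<iota> a) r0"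
      using y \<sigma>(1) by (intro closed_segment_subset convex_ball) auto
    have "continuous_on (closed_segment (\<iota> a) y) (\<lambda>z. sqrt (G (\<sigma> z) (y - \<iota> a) (y - \<iota> a)))"
      unfolding G_def using seg
      by (intro continuous_intros continuous_on_subset[OF smooth_fun_continuous_section[OF _ \<sigma>(2)]] smooths)
    then obtain M where M: "\<And>z. z \<in> closed_segment (\<iota> a) y \<Longrightarrow> sqrt (G (\<sigma> z) (y - \<iota> a) (y - \<iota> a)) \<le> M"
      using continuous_attains_sup[OF compact_segment, of "\<iota> a" y] by (metis ends_in_segment(1) empty_iff)
    have "inf_length (\<sigma> (\<iota> a)) (\<sigma> y) \<le> ennreal M" by (rule section_segment_inf_length[OF \<sigma>(2) seg M])
    then show ?thesis unfolding \<sigma>(3) by (rule le_less_trans) simp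
  qed
  then show "\<exists>T. openin (top_of_set UNIV) T \<and> a \<in> T \<and> (\<forall>x\<in>T. inf_length a x < top)"
    using section_open_image[OF \<sigma>(2)] \<sigma>(1,3)
    by (intro exI[of _ "\<sigma> ` ball (\<iota> a) r0"] conjI image_eqI[of _ _ "\<iota> a"]) auto
qed

lemma riemannian_dist_eq: "ennreal (riemannian_dist A g p q) = inf_length p q"
  unfolding riemannian_dist_def using inf_length_finite[of p q] by simp

lemma riemannian_dist_small_balls:
  assumes "open V" "p \<in> V" shows "\<exists>\<delta>>0. \<forall>q. riemannian_dist A g p q < \<delta> \<longrightarrow> q \<in> V"
proof -
  obtain \<delta> where \<delta>: "\<delta> > 0"
    "\<And>\<gamma>. piecewise_C1_curve A \<gamma> \<Longrightarrow> pathstart \<gamma> = p \<Longrightarrow> curve_length A g \<gamma> < ennreal \<delta> \<Longrightarrow> pathfinish \<gamma> \<in> V"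
    by (rule neighbourhood_contains_short_curves[OF assms]) blast
  have "q \<in> V" if "riemannian_dist A g p q < \<delta>" for q
  proof -
    have "inf_length p q < ennreal \<delta>"
      unfolding riemannian_dist_eq[symmetric] using that \<delta>(1) by (simp add: ennreal_less_iff riemannian_dist_def)
    then obtain \<gamma> where "\<gamma> \<in> curves p q" "curve_length A g \<gamma> < ennreal \<delta>" by (auto simp: INF_less_iff)
    then show ?thesis using \<delta>(2)[of \<gamma>] by auto
  qed
  then show ?thesis using \<delta>(1) by blast
qed

lemma riemannian_dist_segment:
  assumes "is_section \<tau> W" "closed_segment x y \<subseteq> W"
    "\<And>z. z \<in> closed_segment x y \<Longrightarrow> sqrt (G (\<tau> z) (y - x) (y - x)) \<le> M"
  shows "riemannian_dist A g (\<tau> x) (\<tau> y) \<le> M"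
proof -
  have "0 \<le> sqrt (G (\<tau> x) (y - x) (y - x))" by (simp add: G_nonneg)
  also have "\<dots> \<le> M" by (rule assms(3)) simp
  finally have "0 \<le> M" .
  moreover have "ennreal (riemannian_dist A g (\<tau> x) (\<tau> y)) \<le> ennreal M"
    unfolding riemannian_dist_eq by (rule section_segment_inf_length[OF assms])
  ultimately show ?thesis by (simp add: ennreal_le_iff)
qed

text \<open>Finiteness transfers the axioms from \<open>inf_length\<close> to real numbers.
  Definiteness is \<open>riemannian_dist_small_balls\<close> for the complement of a point.\<close>

lemma riemannian_metric_space: "Metric_space UNIV (riemannian_dist A g)"
proof
  show nn: "0 \<le> riemannian_dist A g x y" for x y by (simp add: riemannian_dist_def)
  show "riemannian_dist A g x y = riemannian_dist A g y x" for x y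
    unfolding riemannian_dist_def by (rule arg_cong[where f = enn2real], rule order_antisym; rule inf_length_sym_le)
  show "riemannian_dist A g x z \<le> riemannian_dist A g x y + riemannian_dist A g y z" for x y z
  proof -
    have "ennreal (riemannian_dist A g x z) \<le> ennreal (riemannian_dist A g x y + riemannian_dist A g y z)"
      using inf_length_triangle[of x z y] by (simp add: riemannian_dist_eq nn)
    then show ?thesis by (rule ennreal_le_iff[THEN iffD1, rotated]) (intro add_nonneg_nonneg nn)
  qed
  show "(riemannian_dist A g x y = 0) = (x = y)" for x y
  proof
    assume 0: "riemannian_dist A g x y = 0"
    show "x = y"
    proof (rule ccontr)
      assume "x \<noteq> y"
      then have "\<exists>\<delta>>0. \<forall>q. riemannian_dist A g x q < \<delta> \<longrightarrow> q \<in> - {y}"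
        by (intro riemannian_dist_small_balls) auto
      then obtain \<delta> where \<delta>: "\<delta> > 0" "\<forall>q. riemannian_dist A g x q < \<delta> \<longrightarrow> q \<in> - {y}" by blast
      from \<delta>(2)[rule_format, of y] show False using 0 \<delta>(1) by simp
    qed
  next
    assume "x = y"
    obtain \<tau> W a where \<tau>: "is_section \<tau> W" "a \<in> W" "\<tau> a = x" by (rule section_through)
    have "riemannian_dist A g (\<tau> a) (\<tau> a) \<le> 0"
      by (rule riemannian_dist_segment[OF \<tau>(1)]) (use \<tau>(2) in \<open>auto simp: G_bilin\<close>)
    then show "riemannian_dist A g x y = 0" using \<tau>(3) \<open>x = y\<close> nn[of x x] by simp
  qed
qed

lemma complete_hessian_riemannian_dist:
  assumes "riemannian_complete A g"
  shows "complete_hessian \<iota> u (riemannian_dist A g)"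
proof (intro complete_hessian.intro complete_hessian_axioms.intro)
  show "hessian_potential_locale \<iota> u" by (rule hessian_potential_locale_axioms)
  show "Metric_space UNIV (riemannian_dist A g)" by (rule riemannian_metric_space)
  show "Metric_space.mcomplete UNIV (riemannian_dist A g)"
    using assms by (simp add: riemannian_complete_def)
qed (fact riemannian_dist_segment, fact riemannian_dist_small_balls)

end

section \<open>Constant metrics on Euclidean space\<close>

text \<open>Differentiating \<open>f (p + t *\<^sub>R (x - p))\<close> in \<open>x\<close> brings
  out a factor \<open>t\<close>. Carrying the weight \<open>t ^ j\<close> keeps the derivative in
  the same family, so smoothness follows by induction on the order.\<close>

lemma differentiable_parameter_integral:
  fixes f :: "real^'n \<Rightarrow> real"
  assumes f: "smooth_on UNIV f"
  shows "((\<lambda>x. integral {0..1} (\<lambda>t. t ^ j * f (p + t *\<^sub>R (x - p)))) has_derivative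
     (\<lambda>v. integral {0..1} (\<lambda>t. t ^ Suc j * frechet_derivative f (at (p + t *\<^sub>R (x - p))) v))) (at x)"
proof -
  define c where "c i y = frechet_derivative f (at y) (axis i 1)" for i y
  define F where "F x t = (\<Sum>i\<in>UNIV. (t ^ Suc j * c i (p + t *\<^sub>R (x - p))) *\<^sub>R blinfun_inner_left (axis i 1 :: real^'n))" for x t
  have cc: "continuous_on UNIV (c i)" for i
    unfolding c_def by (intro smooth_on_imp_continuous_on smooth_on_frechet_derivative f)
  have cf: "continuous_on UNIV f" by (intro smooth_on_imp_continuous_on f)
  have Fapp: "blinfun_apply (F x t) v = t ^ Suc j * frechet_derivative f (at (p + t *\<^sub>R (x - p))) v" for x t v
  proof -
    have lin: "linear (frechet_derivative f (at y))" for y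
      using smooth_on_imp_differentiable[OF f UNIV_I] by (rule linear_frechet_derivative)
    have "frechet_derivative f (at y) v = (\<Sum>i\<in>UNIV. v $ i * c i y)" for y
    proof -
      have "frechet_derivative f (at y) v = frechet_derivative f (at y) (\<Sum>i\<in>UNIV. v $ i *\<^sub>R axis i 1)"
        using basis_expansion[of v] by (simp add: scalar_mult_eq_scaleR)
      also have "\<dots> = (\<Sum>i\<in>UNIV. v $ i * c i y)"
        by (simp add: linear_sum[OF lin] linear_scale[OF lin] c_def)
      finally show ?thesis .
    qed
    then show ?thesis
      by (simp add: F_def blinfun.sum_left blinfun.scaleR_left inner_axis' inner_commute[of v] sum_distrib_left mult_ac)
  qed
  have "((\<lambda>x. integral (cbox 0 1) (\<lambda>t. t ^ j * f (p + t *\<^sub>R (x - p)))) has_derivative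
      blinfun_apply (integral (cbox 0 1) (F x))) (at x within UNIV)"
  proof (rule leibniz_rule)
    fix x :: "real^'n" and t :: real
    have "((\<lambda>x. p + t *\<^sub>R (x - p)) has_derivative (\<lambda>v. t *\<^sub>R v)) (at x)"
      by (auto intro!: derivative_eq_intros)
    from diff_chain_at[OF this smooth_on_imp_has_derivative[OF f UNIV_I]]
    have "((\<lambda>x. f (p + t *\<^sub>R (x - p))) has_derivative
        (\<lambda>v. frechet_derivative f (at (p + t *\<^sub>R (x - p))) (t *\<^sub>R v))) (at x)" by (simp add: comp_def)
    from has_derivative_mult_right[OF this, of "t ^ j"]
    show "((\<lambda>x. t ^ j * f (p + t *\<^sub>R (x - p))) has_derivative blinfun_apply (F x t)) (at x within UNIV)"
      using linear_scale[OF linear_frechet_derivative[OF smooth_on_imp_differentiable[OF f UNIV_I]]]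
      by (simp add: Fapp[abs_def] mult_ac)
  next
    fix x :: "real^'n"
    show "(\<lambda>t. t ^ j * f (p + t *\<^sub>R (x - p))) integrable_on cbox 0 1"
      by (intro integrable_continuous continuous_intros continuous_on_compose2[OF cf]) auto
  next
    show "continuous_on (UNIV \<times> cbox 0 1) (\<lambda>(x, t). F x t)"
      unfolding F_def split_beta
      by (intro continuous_intros continuous_on_compose2[OF cc]) auto
  qed auto
  moreover have "blinfun_apply (integral (cbox 0 1) (F x)) =
      (\<lambda>v. integral {0..1} (\<lambda>t. t ^ Suc j * frechet_derivative f (at (p + t *\<^sub>R (x - p))) v))"
  proof
    fix v
    have "F x integrable_on cbox 0 1"
      unfolding F_def by (intro integrable_continuous continuous_intros continuous_on_compose2[OF cc]) auto
    then show "blinfun_apply (integral (cbox 0 1) (F x)) v =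
        integral {0..1} (\<lambda>t. t ^ Suc j * frechet_derivative f (at (p + t *\<^sub>R (x - p))) v)"
      using blinfun_apply_integral[of "F x" "cbox 0 1" v] by (simp add: Fapp)
  qed
  ultimately show ?thesis by (simp only: cbox_interval)
qed

lemma smooth_parameter_integral:
  fixes f :: "real^'n \<Rightarrow> real"
  assumes "smooth_on UNIV f"
  shows "smooth_on UNIV (\<lambda>x. integral {0..1} (\<lambda>t. t ^ j * f (p + t *\<^sub>R (x - p))))"
proof -
  have "Ck_on k UNIV (\<lambda>x. integral {0..1} (\<lambda>t. t ^ j * f (p + t *\<^sub>R (x - p))))" for k
    using assms
  proof (induction k arbitrary: f j)
    case 0
    have "isCont (\<lambda>x. integral {0..1} (\<lambda>t. t ^ j * f (p + t *\<^sub>R (x - p)))) x" for x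
      using has_derivative_continuous[OF differentiable_parameter_integral[OF 0]] .
    then show ?case by (simp add: continuous_at_imp_continuous_on)
  next
    case (Suc k)
    have d: "((\<lambda>x. integral {0..1} (\<lambda>t. t ^ j * f (p + t *\<^sub>R (x - p)))) has_derivative
     (\<lambda>v. integral {0..1} (\<lambda>t. t ^ Suc j * frechet_derivative f (at (p + t *\<^sub>R (x - p))) v))) (at x)" for x
      by (rule differentiable_parameter_integral[OF Suc.prems])
    have "Ck_on k UNIV (\<lambda>x. integral {0..1} (\<lambda>t. t ^ Suc j * frechet_derivative f (at (p + t *\<^sub>R (x - p))) v))" for v
      by (rule Suc.IH[OF smooth_on_frechet_derivative[OF Suc.prems]])
    then show ?case
      using d unfolding Ck_on.simps differentiable_def frechet_derivative_at[OF d, symmetric] by blast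
  qed
  then show ?thesis by (simp add: smooth_on_def)
qed

text \<open>The coefficient \<open>h i\<close> is the mean of the i-th partial derivative over the
  segment from \<open>p\<close> to \<open>x\<close>, by the fundamental theorem along that
  segment.\<close>

lemma hadamard:
  fixes f :: "real^'n \<Rightarrow> real"
  assumes f: "smooth_on UNIV f"
  obtains h where "\<And>i. smooth_on UNIV (h i)" "\<And>i. h i p = frechet_derivative f (at p) (axis i 1)"
    "\<And>x. f x = f p + (\<Sum>i\<in>UNIV. (x $ i - p $ i) * h i x)"
proof -
  define h where "h i x = integral {0..1} (\<lambda>t. t ^ 0 * frechet_derivative f (at (p + t *\<^sub>R (x - p))) (axis i 1))" for i x
  have sm: "smooth_on UNIV (h i)" for i
    unfolding h_def by (rule smooth_parameter_integral[OF smooth_on_frechet_derivative[OF f]])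
  have "h i p = frechet_derivative f (at p) (axis i 1)" for i by (simp add: h_def)
  moreover have "f x = f p + (\<Sum>i\<in>UNIV. (x $ i - p $ i) * h i x)" for x
  proof -
    have cc: "continuous_on UNIV (\<lambda>y. frechet_derivative f (at y) w)" for w
      by (intro smooth_on_imp_continuous_on smooth_on_frechet_derivative f)
    have "((\<lambda>t. frechet_derivative f (at (p + t *\<^sub>R (x - p))) (x - p)) has_integral
        f (p + 1 *\<^sub>R (x - p)) - f (p + 0 *\<^sub>R (x - p))) {0..1}"
    proof (rule fundamental_theorem_of_calculus)
      fix t :: real
      show "((\<lambda>t. f (p + t *\<^sub>R (x - p))) has_vector_derivative
          frechet_derivative f (at (p + t *\<^sub>R (x - p))) (x - p)) (at t within {0..1})"
        using has_real_derivative_along_line[OF smooth_on_imp_has_derivative[OF f UNIV_I]]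
        by (simp add: has_real_derivative_iff_has_vector_derivative has_vector_derivative_at_within)
    qed simp
    then have 1: "f x - f p = integral {0..1} (\<lambda>t. frechet_derivative f (at (p + t *\<^sub>R (x - p))) (x - p))"
      by (simp add: integral_unique)
    have lin: "linear (frechet_derivative f (at y))" for y
      using smooth_on_imp_differentiable[OF f UNIV_I] by (rule linear_frechet_derivative)
    have "frechet_derivative f (at y) (x - p) = (\<Sum>i\<in>UNIV. (x $ i - p $ i) * frechet_derivative f (at y) (axis i 1))" for y
    proof -
      have "frechet_derivative f (at y) (x - p) = frechet_derivative f (at y) (\<Sum>i\<in>UNIV. (x - p) $ i *\<^sub>R axis i 1)"
        using basis_expansion[of "x - p"] by (simp add: scalar_mult_eq_scaleR)
      also have "\<dots> = (\<Sum>i\<in>UNIV. (x $ i - p $ i) * frechet_derivative f (at y) (axis i 1))"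
        by (simp add: linear_sum[OF lin] linear_scale[OF lin])
      finally show ?thesis .
    qed
    then have "f x - f p = integral {0..1} (\<lambda>t. \<Sum>i\<in>UNIV. (x $ i - p $ i) * frechet_derivative f (at (p + t *\<^sub>R (x - p))) (axis i 1))"
      using 1 by simp
    also have "\<dots> = (\<Sum>i\<in>UNIV. (x $ i - p $ i) * h i x)"
      unfolding h_def
      by (subst integral_sum) (auto intro!: integrable_continuous_interval continuous_intros continuous_on_compose2[OF cc])
    finally show ?thesis by simp
  qed
  ultimately show thesis by (rule that[OF sm])
qed

section \<open>Tangent vectors of Euclidean space as derivations\<close>

lemma smooth_functions_std: "smooth_functions (std_atlas :: (real^'n, real^'n) chart set) = {f. smooth_on UNIV f}"
proof -
  have inv: "inv_into UNIV (\<lambda>x. x) = (\<lambda>x :: 'b :: euclidean_space. x)" by (simp add: fun_eq_iff inv_into_f_eq)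
  show ?thesis
    by (auto simp: smooth_functions_def smooth_map_on_def std_atlas_def inv comp_def smooth_on_imp_continuous_on)
qed

abbreviation std_tangent :: "real^'n \<Rightarrow> (real^'n) tangent set" where
  "std_tangent \<equiv> tangent_space std_atlas"

abbreviation std_fields :: "(real^'n) vfield set" where
  "std_fields \<equiv> vector_fields std_atlas"

lemma std_tangentD:
  assumes "v \<in> std_tangent p"
  shows "\<And>f h. smooth_on UNIV f \<Longrightarrow> smooth_on UNIV h \<Longrightarrow> v (\<lambda>q. f q + h q) = v f + v h"
    "\<And>f h. smooth_on UNIV f \<Longrightarrow> smooth_on UNIV h \<Longrightarrow> v (\<lambda>q. f q * h q) = f p * v h + h p * v f"
    "\<And>f c. smooth_on UNIV f \<Longrightarrow> v (\<lambda>q. c * f q) = c * v f"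
    "\<And>f. \<not> smooth_on UNIV f \<Longrightarrow> v f = 0"
  using assms unfolding tangent_space_def smooth_functions_std by blast+

lemma std_tangent_const:
  assumes v: "v \<in> std_tangent p" shows "v (\<lambda>q. c) = 0"
proof -
  have "v (\<lambda>q. 1 * 1) = 1 * v (\<lambda>q. 1) + 1 * v (\<lambda>q. 1)"
    by (rule std_tangentD(2)[OF v, of "\<lambda>q. 1" "\<lambda>q. 1"]) (rule smooth_on_const)+
  then have "v (\<lambda>q. 1) = 0" by simp
  then show ?thesis using std_tangentD(3)[OF v smooth_on_const, of c 1] by simp
qed

lemma std_tangent_sum:
  assumes v: "v \<in> std_tangent p" and "finite I" "\<And>i. i \<in> I \<Longrightarrow> smooth_on UNIV (f i)"
  shows "v (\<lambda>q. \<Sum>i\<in>I. f i q) = (\<Sum>i\<in>I. v (f i))"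
  using assms(2,3)
proof (induction I rule: finite_induct)
  case empty
  then show ?case using std_tangent_const[OF v, of 0] by simp
next
  case (insert i I)
  have "v (\<lambda>q. f i q + (\<Sum>i\<in>I. f i q)) = v (f i) + v (\<lambda>q. \<Sum>i\<in>I. f i q)"
    using insert by (intro std_tangentD(1)[OF v] smooth_on_sum) auto
  then show ?case using insert by simp
qed

lemma smooth_coord: "smooth_on S (\<lambda>x :: real^'n. x $ i)"
  by (intro smooth_on_bounded_linear bounded_linear_vec_nth)

text \<open>Apply the derivation to Hadamard's expansion: constants are killed, and in each product
  the term with the factor vanishing at \<open>p\<close> disappears.\<close>

lemma std_tangent_rep:
  assumes v: "v \<in> std_tangent p" and f: "smooth_on UNIV f"
  shows "v f = (\<Sum>i\<in>UNIV. v (\<lambda>x. x $ i) * frechet_derivative f (at p) (axis i 1))"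
proof -
  obtain h where h: "\<And>i. smooth_on UNIV (h i)" "\<And>i. h i p = frechet_derivative f (at p) (axis i 1)"
    "\<And>x. f x = f p + (\<Sum>i\<in>UNIV. (x $ i - p $ i) * h i x)"
    by (rule hadamard[OF f, of p]) blast
  have sc: "smooth_on UNIV (\<lambda>x. x $ i + (- p $ i))" for i
    by (intro smooth_on_add smooth_coord smooth_on_const open_UNIV)
  have sm: "smooth_on UNIV (\<lambda>x. (x $ i + (- p $ i)) * h i x)" for i
    by (intro smooth_on_mult sc h open_UNIV)
  have "v f = v (\<lambda>x. f p + (\<Sum>i\<in>UNIV. (x $ i + (- p $ i)) * h i x))"
  proof (intro arg_cong[where f = v] ext)
    fix x show "f x = f p + (\<Sum>i\<in>UNIV. (x $ i + (- p $ i)) * h i x)"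
      using h(3)[of x] by (simp only: diff_conv_add_uminus)
  qed
  also have "\<dots> = v (\<lambda>x. f p) + v (\<lambda>x. \<Sum>i\<in>UNIV. (x $ i + (- p $ i)) * h i x)"
    by (intro std_tangentD(1)[OF v] smooth_on_const smooth_on_sum sm open_UNIV) simp
  also have "\<dots> = (\<Sum>i\<in>UNIV. v (\<lambda>x. (x $ i + (- p $ i)) * h i x))"
    unfolding std_tangent_const[OF v] add_0 by (rule std_tangent_sum[OF v finite sm])
  also have "\<dots> = (\<Sum>i\<in>UNIV. v (\<lambda>x. x $ i) * frechet_derivative f (at p) (axis i 1))"
  proof (rule sum.cong[OF refl])
    fix i
    have "v (\<lambda>x. (x $ i + (- p $ i)) * h i x) = (p $ i + (- p $ i)) * v (h i) + h i p * v (\<lambda>x. x $ i + (- p $ i))"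
      by (rule std_tangentD(2)[OF v sc h(1)])
    moreover have "v (\<lambda>x. x $ i + (- p $ i)) = v (\<lambda>x. x $ i) + v (\<lambda>x. - p $ i)"
      by (intro std_tangentD(1)[OF v] smooth_coord smooth_on_const)
    ultimately show "v (\<lambda>x. (x $ i + (- p $ i)) * h i x) = v (\<lambda>x. x $ i) * frechet_derivative f (at p) (axis i 1)"
      unfolding std_tangent_const[OF v] h(2) by (simp only: right_minus mult_zero_left add_0 add_0_right mult.commute)
  qed
  finally show ?thesis .
qed

text \<open>Identities between vector fields can hence be checked on coordinate functions alone; the
  proofs about the standard connection rely on this.\<close>

lemma std_tangent_ext:
  assumes v: "v \<in> std_tangent p" and w: "w \<in> std_tangent p" and eq: "\<And>i. v (\<lambda>x. x $ i) = w (\<lambda>x. x $ i)"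
  shows "v = w"
proof
  fix f show "v f = w f"
    using std_tangent_rep[OF v, of f] std_tangent_rep[OF w, of f] std_tangentD(4)[OF v, of f] std_tangentD(4)[OF w, of f] eq
    by (cases "smooth_on UNIV f") auto
qed

lemma std_tangentI:
  fixes v :: "(real^'n) tangent"
  assumes "\<And>f h. smooth_on UNIV f \<Longrightarrow> smooth_on UNIV h \<Longrightarrow> v (\<lambda>q. f q + h q) = v f + v h"
    "\<And>f h. smooth_on UNIV f \<Longrightarrow> smooth_on UNIV h \<Longrightarrow> v (\<lambda>q. f q * h q) = f p * v h + h p * v f"
    "\<And>f c. smooth_on UNIV f \<Longrightarrow> v (\<lambda>q. c * f q) = c * v f"
    "\<And>f. \<not> smooth_on UNIV f \<Longrightarrow> v f = 0"
  shows "v \<in> std_tangent p"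
  unfolding tangent_space_def smooth_functions_std using assms by simp

lemma std_coord_tangent_sum:
  fixes p :: "real^'n"
  shows "(\<lambda>f. \<Sum>i\<in>UNIV. c i * std_coord_field i p f) \<in> std_tangent p"
proof (rule std_tangentI)
  fix f h :: "real^'n \<Rightarrow> real" and k :: real
  show "(\<Sum>i\<in>UNIV. c i * std_coord_field i p f) = 0" if "\<not> smooth_on UNIV f"
    using that by (simp add: std_coord_field_def smooth_functions_std)
  assume f: "smooth_on UNIV f"
  note df = smooth_on_imp_has_derivative[OF f UNIV_I, of p]
  have "((\<lambda>q. k * f q) has_derivative (\<lambda>w. k * frechet_derivative f (at p) w)) (at p)"
    by (rule has_derivative_mult_right[OF df])
  from frechet_derivative_at[OF this, symmetric]
  show "(\<Sum>i\<in>UNIV. c i * std_coord_field i p (\<lambda>q. k * f q)) = k * (\<Sum>i\<in>UNIV. c i * std_coord_field i p f)"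
    using f smooth_on_mult[OF open_UNIV smooth_on_const f, of k]
    by (simp add: std_coord_field_def smooth_functions_std sum_distrib_left mult_ac)
  assume h: "smooth_on UNIV h"
  note dh = smooth_on_imp_has_derivative[OF h UNIV_I, of p]
  show "(\<Sum>i\<in>UNIV. c i * std_coord_field i p (\<lambda>q. f q + h q)) =
      (\<Sum>i\<in>UNIV. c i * std_coord_field i p f) + (\<Sum>i\<in>UNIV. c i * std_coord_field i p h)"
    using f h smooth_on_add[OF open_UNIV f h] frechet_derivative_at[OF has_derivative_add[OF df dh], symmetric]
    by (simp add: std_coord_field_def smooth_functions_std sum.distrib distrib_left)
  show "(\<Sum>i\<in>UNIV. c i * std_coord_field i p (\<lambda>q. f q * h q)) =
      f p * (\<Sum>i\<in>UNIV. c i * std_coord_field i p h) + h p * (\<Sum>i\<in>UNIV. c i * std_coord_field i p f)"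
    using f h smooth_on_mult[OF open_UNIV f h] frechet_derivative_at[OF has_derivative_mult[OF df dh], symmetric]
    by (simp add: std_coord_field_def smooth_functions_std sum.distrib distrib_left sum_distrib_left mult_ac)
qed

lemma std_coord_field_coord: "std_coord_field i p (\<lambda>x. x $ j) = (if i = j then 1 else 0)"
proof -
  have "((\<lambda>x. x $ j) has_derivative (\<lambda>x. x $ j)) (at p)"
    by (rule bounded_linear_imp_has_derivative[OF bounded_linear_vec_nth])
  from frechet_derivative_at[OF this, symmetric] show ?thesis
    by (simp add: std_coord_field_def smooth_functions_std smooth_coord axis_def)
qed

section \<open>The standard connection and its curvature and torsion\<close>

lemma std_fieldsD:
  assumes "X \<in> std_fields"
  shows "\<And>p. X p \<in> std_tangent p" "\<And>f. smooth_on UNIV f \<Longrightarrow> smooth_on UNIV (\<lambda>p. X p f)"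
  using assms unfolding vector_fields_def smooth_functions_std by blast+

lemma std_connection_tangent: "std_connection X Y p \<in> std_tangent p"
  unfolding std_connection_def by (rule std_coord_tangent_sum)

lemma std_connection_coord: "std_connection X Y p (\<lambda>x. x $ i) = X p (\<lambda>q. Y q (\<lambda>x. x $ i))"
  by (simp add: std_connection_def std_coord_field_coord sum_mult_delta)

lemma std_connection_field:
  fixes X Y :: "(real^'n) vfield"
  assumes X: "X \<in> std_fields" and Y: "Y \<in> std_fields"
  shows "std_connection X Y \<in> std_fields"
  unfolding vector_fields_def mem_Collect_eq smooth_functions_std
proof (intro conjI allI ballI)
  fix p show "std_connection X Y p \<in> std_tangent p" by (rule std_connection_tangent)
next
  fix f :: "real^'n \<Rightarrow> real" assume "f \<in> Collect (smooth_on UNIV)"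
  then have f: "smooth_on UNIV f" by simp
  have "smooth_on UNIV (\<lambda>p. \<Sum>i\<in>UNIV. X p (\<lambda>q. Y q (\<lambda>x. x $ i)) * frechet_derivative f (at p) (axis i 1))"
    by (intro smooth_on_sum smooth_on_mult open_UNIV smooth_on_frechet_derivative f
        std_fieldsD(2)[OF X] std_fieldsD(2)[OF Y] smooth_coord) simp
  then show "smooth_on UNIV (\<lambda>p. std_connection X Y p f)"
    using f by (simp add: std_connection_def std_coord_field_def smooth_functions_std)
qed

lemma std_tangent_add: "v \<in> std_tangent p \<Longrightarrow> w \<in> std_tangent p \<Longrightarrow> (\<lambda>f. v f + w f) \<in> std_tangent p"
  by (rule std_tangentI) (simp_all add: std_tangentD algebra_simps)

lemma std_tangent_scale: "v \<in> std_tangent p \<Longrightarrow> (\<lambda>f. c * v f) \<in> std_tangent p"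
  by (rule std_tangentI) (simp_all add: std_tangentD algebra_simps)

lemma std_connection_connection: "connection (std_atlas :: (real^'n, real^'n) chart set) std_connection"
  unfolding connection_def
proof (intro ballI conjI)
  fix X Y :: "(real^'n) vfield" assume X: "X \<in> std_fields" and Y: "Y \<in> std_fields"
  show "std_connection X Y \<in> std_fields" by (rule std_connection_field[OF X Y])
  {
    fix Z :: "(real^'n) vfield" assume Z: "Z \<in> std_fields"
    show "std_connection (vf_add X Z) Y = vf_add (std_connection X Y) (std_connection Z Y)"
      by (simp add: std_connection_def vf_add_def fun_eq_iff distrib_right sum.distrib)
    have "X p (\<lambda>q. Y q (\<lambda>x. x $ i) + Z q (\<lambda>x. x $ i)) = X p (\<lambda>q. Y q (\<lambda>x. x $ i)) + X p (\<lambda>q. Z q (\<lambda>x. x $ i))" for p i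
      by (intro std_tangentD(1)[OF std_fieldsD(1)[OF X]] std_fieldsD(2)[OF Y] std_fieldsD(2)[OF Z] smooth_coord)
    then show "std_connection X (vf_add Y Z) = vf_add (std_connection X Y) (std_connection X Z)"
      by (simp add: std_connection_def vf_add_def fun_eq_iff distrib_right sum.distrib)
  }
  fix h :: "real^'n \<Rightarrow> real" assume "h \<in> smooth_functions std_atlas"
  then have h: "smooth_on UNIV h" by (simp add: smooth_functions_std)
  show "std_connection (vf_scale h X) Y = vf_scale h (std_connection X Y)"
    by (simp add: std_connection_def vf_scale_def fun_eq_iff sum_distrib_left mult_ac)
  show "std_connection X (vf_scale h Y) = vf_add (vf_scale h (std_connection X Y)) (vf_scale (\<lambda>p. X p h) Y)"
  proof
    fix p
    show "std_connection X (vf_scale h Y) p = vf_add (vf_scale h (std_connection X Y)) (vf_scale (\<lambda>p. X p h) Y) p"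
    proof (rule std_tangent_ext)
      show "vf_add (vf_scale h (std_connection X Y)) (vf_scale (\<lambda>p. X p h) Y) p \<in> std_tangent p"
        unfolding vf_add_def vf_scale_def
        by (intro std_tangent_add std_tangent_scale std_connection_tangent std_fieldsD(1)[OF Y])
      fix i
      have "X p (\<lambda>q. h q * Y q (\<lambda>x. x $ i)) = h p * X p (\<lambda>q. Y q (\<lambda>x. x $ i)) + Y p (\<lambda>x. x $ i) * X p h"
        by (intro std_tangentD(2)[OF std_fieldsD(1)[OF X]] h std_fieldsD(2)[OF Y] smooth_coord)
      then show "std_connection X (vf_scale h Y) p (\<lambda>x. x $ i) =
          vf_add (vf_scale h (std_connection X Y)) (vf_scale (\<lambda>p. X p h) Y) p (\<lambda>x. x $ i)"
        by (simp add: std_connection_coord vf_add_def vf_scale_def)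
    qed (rule std_connection_tangent)
  qed
qed

lemma std_lie_bracket_tangent:
  fixes X Y :: "(real^'n) vfield"
  assumes X: "X \<in> std_fields" and Y: "Y \<in> std_fields"
  shows "lie_bracket X Y p \<in> std_tangent p"
proof (rule std_tangentI)
  note XT = std_fieldsD(1)[OF X] and YT = std_fieldsD(1)[OF Y]
  fix f h :: "real^'n \<Rightarrow> real" and k :: real
  \<comment> \<open>By the convention for non-smooth functions both inner derivatives are the zero
    function, which a derivation sends to 0.\<close>
  show "lie_bracket X Y p f = 0" if "\<not> smooth_on UNIV f"
    using that std_tangent_const[OF XT] std_tangent_const[OF YT]
    by (simp add: lie_bracket_def std_tangentD(4)[OF XT] std_tangentD(4)[OF YT])
  assume f: "smooth_on UNIV f"
  note Xf = std_fieldsD(2)[OF X f] and Yf = std_fieldsD(2)[OF Y f]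
  show "lie_bracket X Y p (\<lambda>q. k * f q) = k * lie_bracket X Y p f"
    by (simp add: lie_bracket_def std_tangentD(3)[OF XT] std_tangentD(3)[OF YT] f Xf Yf algebra_simps)
  assume h: "smooth_on UNIV h"
  note Xh = std_fieldsD(2)[OF X h] and Yh = std_fieldsD(2)[OF Y h]
  show "lie_bracket X Y p (\<lambda>q. f q + h q) = lie_bracket X Y p f + lie_bracket X Y p h"
    by (simp add: lie_bracket_def std_tangentD(1)[OF XT] std_tangentD(1)[OF YT] f h Xf Yf Xh Yh)
  show "lie_bracket X Y p (\<lambda>q. f q * h q) = f p * lie_bracket X Y p h + h p * lie_bracket X Y p f"
    by (simp add: lie_bracket_def std_tangentD(1,2)[OF XT] std_tangentD(1,2)[OF YT] f h Xf Yf Xh Yh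
        smooth_on_mult algebra_simps)
qed

text \<open>Both sides are derivations with the same values on coordinates. The difference is
  written as a sum with factor -1 so that closure of tangent spaces under sums and multiples
  applies.\<close>

lemma std_connection_torsion_free: "torsion_free (std_atlas :: (real^'n, real^'n) chart set) std_connection"
  unfolding torsion_free_def
proof (intro ballI allI)
  fix X Y :: "(real^'n) vfield" and p f assume X: "X \<in> std_fields" and Y: "Y \<in> std_fields"
  have "(\<lambda>f. std_connection X Y p f + (- 1) * std_connection Y X p f) = lie_bracket X Y p"
  proof (rule std_tangent_ext)
    show "(\<lambda>f. std_connection X Y p f + (- 1) * std_connection Y X p f) \<in> std_tangent p"
      by (intro std_tangent_add std_tangent_scale std_connection_tangent)
    show "lie_bracket X Y p \<in> std_tangent p" by (rule std_lie_bracket_tangent[OF X Y])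
  qed (simp add: std_connection_coord lie_bracket_def)
  from fun_cong[OF this, of f]
  show "std_connection X Y p f - std_connection Y X p f = lie_bracket X Y p f" by simp
qed

text \<open>The connection differentiates components, so the commutator of two covariant derivatives
  applies the commutator of the fields to each component, which is the Lie bracket term.\<close>

lemma std_connection_flat: "flat_connection (std_atlas :: (real^'n, real^'n) chart set) std_connection"
  unfolding flat_connection_def
proof (intro ballI allI)
  fix X Y Z :: "(real^'n) vfield" and p f
  have "std_connection X V p f = (\<Sum>i\<in>UNIV. X p (\<lambda>q. V q (\<lambda>x. x $ i)) * std_coord_field i p f)" for X V :: "(real^'n) vfield"
    by (simp add: std_connection_def)
  then have cc: "std_connection X (std_connection Y Z) p f =
      (\<Sum>i\<in>UNIV. X p (\<lambda>q. Y q (\<lambda>r. Z r (\<lambda>x. x $ i))) * std_coord_field i p f)" for X Y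
    by (simp only: std_connection_coord)
  have "std_connection X (std_connection Y Z) p f - std_connection Y (std_connection X Z) p f =
      std_connection (lie_bracket X Y) Z p f"
    unfolding cc by (simp add: std_connection_def lie_bracket_def left_diff_distrib sum_subtractf)
  then show "std_connection X (std_connection Y Z) p f - std_connection Y (std_connection X Z) p f
      - std_connection (lie_bracket X Y) Z p f = 0" by simp
qed

section \<open>Metrics with constant coefficients\<close>

definition const_metric :: "real^'n^'n \<Rightarrow> (real^'n) metric_tensor" where
  "const_metric a = (\<lambda>p v w. \<Sum>i\<in>UNIV. \<Sum>j\<in>UNIV. a $ i $ j * (v (\<lambda>x. x $ i) * w (\<lambda>x. x $ j)))"

lemma const_metric_riemannian:
  fixes a :: "real^'n^'n"
  assumes sym: "\<And>i j. a $ i $ j = a $ j $ i"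
    and pos: "\<And>x :: real^'n. x \<noteq> 0 \<Longrightarrow> (\<Sum>i\<in>UNIV. \<Sum>j\<in>UNIV. a $ i $ j * (x $ i * x $ j)) > 0"
  shows "riemannian_metric std_atlas (const_metric a)"
  unfolding riemannian_metric_def
proof (intro conjI allI ballI impI)
  fix p :: "real^'n" and v w z :: "(real^'n) tangent" and c :: real
  assume v: "v \<in> std_tangent p"
  show "const_metric a p v v > 0" if "v \<noteq> (\<lambda>_. 0)"
  proof -
    have zero: "(\<lambda>_. 0) \<in> std_tangent p" by (rule std_tangentI) simp_all
    have "\<exists>i. v (\<lambda>x. x $ i) \<noteq> 0" using std_tangent_ext[OF v zero] that by auto
    then have "(\<chi> i. v (\<lambda>x. x $ i)) \<noteq> (0 :: real^'n)" by (auto simp: vec_eq_iff)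
    from pos[OF this] show ?thesis by (simp add: const_metric_def)
  qed
  show "const_metric a p v w = const_metric a p w v"
    unfolding const_metric_def by (subst sum.swap) (simp add: sym mult.commute[of "v _"])
  show "const_metric a p (\<lambda>f. v f + w f) z = const_metric a p v z + const_metric a p w z"
    by (simp add: const_metric_def sum.distrib algebra_simps)
  show "const_metric a p (\<lambda>f. c * v f) w = c * const_metric a p v w"
    by (simp add: const_metric_def sum_distrib_left mult_ac)
next
  fix X Y :: "(real^'n) vfield" assume X: "X \<in> std_fields" and Y: "Y \<in> std_fields"
  show "(\<lambda>p. const_metric a p (X p) (Y p)) \<in> smooth_functions std_atlas"
    unfolding const_metric_def smooth_functions_std mem_Collect_eq
    by (intro smooth_on_sum smooth_on_mult smooth_on_const open_UNIV std_fieldsD(2)[OF X] std_fieldsD(2)[OF Y] smooth_coord)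
      simp_all
qed

text \<open>The Levi-Civita connection is the standard one: with constant coefficients, metric
  compatibility is the product rule on components.\<close>

lemma const_metric_flat:
  fixes a :: "real^'n^'n"
  shows "flat_metric std_atlas (const_metric a)"
  unfolding flat_metric_def levi_civita_connection_def
proof (intro exI[of _ std_connection] conjI ballI allI std_connection_connection std_connection_torsion_free std_connection_flat)
  fix X Y Z :: "(real^'n) vfield" and p
  assume X: "X \<in> std_fields" and Y: "Y \<in> std_fields" and Z: "Z \<in> std_fields"
  note XT = std_fieldsD(1)[OF X, of p] and Ys = std_fieldsD(2)[OF Y smooth_coord] and Zs = std_fieldsD(2)[OF Z smooth_coord]
  have YZ: "smooth_on UNIV (\<lambda>q. Y q (\<lambda>x. x $ i) * Z q (\<lambda>x. x $ j))" for i j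
    by (intro smooth_on_mult open_UNIV Ys Zs)
  have "X p (\<lambda>q. const_metric a q (Y q) (Z q)) =
      (\<Sum>i\<in>UNIV. \<Sum>j\<in>UNIV. X p (\<lambda>q. a $ i $ j * (Y q (\<lambda>x. x $ i) * Z q (\<lambda>x. x $ j))))"
    unfolding const_metric_def
    by (subst std_tangent_sum[OF XT] | intro sum.cong refl smooth_on_sum smooth_on_mult[OF open_UNIV smooth_on_const YZ] open_UNIV finite)+
  also have "\<dots> = (\<Sum>i\<in>UNIV. \<Sum>j\<in>UNIV. a $ i $ j *
      (Y p (\<lambda>x. x $ i) * X p (\<lambda>q. Z q (\<lambda>x. x $ j)) + Z p (\<lambda>x. x $ j) * X p (\<lambda>q. Y q (\<lambda>x. x $ i))))"
    by (simp add: std_tangentD(3)[OF XT YZ] std_tangentD(2)[OF XT Ys Zs])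
  also have "\<dots> = const_metric a p (std_connection X Y p) (Z p) + const_metric a p (Y p) (std_connection X Z p)"
    by (simp add: const_metric_def std_connection_coord sum.distrib algebra_simps)
  finally show "X p (\<lambda>q. const_metric a q (Y q) (Z q)) =
      const_metric a p (std_connection X Y p) (Z p) + const_metric a p (Y p) (std_connection X Z p)" .
qed

section \<open>Hessian manifolds with a development map\<close>

lemma chart_open_image:
  assumes "is_chart (U, \<phi>)" "open V" shows "open (\<phi> ` (U \<inter> V))"
proof -
  obtain \<psi> where op: "open (\<phi> ` U)" and h: "homeomorphism U (\<phi> ` U) \<phi> \<psi>"
    using assms(1) unfolding is_chart_def by auto
  have "openin (top_of_set (\<phi> ` U)) (\<phi> ` (U \<inter> V))"
    using homeomorphism_imp_open_map[OF h] assms(2) by blast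
  then show ?thesis by (rule openin_open_trans[OF _ op])
qed

lemma chart_inv_into:
  assumes "is_chart (U, \<phi>)" shows "inj_on \<phi> U" "continuous_on U \<phi>" "continuous_on (\<phi> ` U) (inv_into U \<phi>)"
proof -
  obtain \<psi> where h: "homeomorphism U (\<phi> ` U) \<phi> \<psi>" using assms unfolding is_chart_def by auto
  show inj: "inj_on \<phi> U" by (rule inj_on_inverseI[of _ \<psi>]) (rule homeomorphism_apply1[OF h])
  show "continuous_on U \<phi>" by (rule homeomorphism_cont1[OF h])
  show "continuous_on (\<phi> ` U) (inv_into U \<phi>)"
    by (rule continuous_on_eq[OF homeomorphism_cont2[OF h]])
      (auto simp: homeomorphism_apply1[OF h] inv_into_f_f[OF inj])
qed

locale developed_atlas =
  fixes A :: "('a::{t2_space,second_countable_topology}, real^'n) chart set" and \<iota> :: "'a \<Rightarrow> real^'n"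
  assumes manifold: "smooth_manifold A" and local_diffeo: "local_diffeomorphism A std_atlas \<iota>"

lemma local_diffeomorphism_std:
  assumes "local_diffeomorphism A (std_atlas :: (real^'n, real^'n) chart set) \<iota>"
  obtains V where "open V" "p \<in> V" "open (\<iota> ` V)" "inj_on \<iota> V" "continuous_on V \<iota>" "continuous_on (\<iota> ` V) (inv_into V \<iota>)"
    "\<And>U \<phi>. (U, \<phi>) \<in> A \<Longrightarrow> smooth_on (\<phi> ` (U \<inter> V)) (\<iota> \<circ> inv_into U \<phi>)"
    "\<And>U \<phi>. (U, \<phi>) \<in> A \<Longrightarrow> smooth_on (\<iota> ` V \<inter> inv_into V \<iota> -` U) (\<phi> \<circ> inv_into V \<iota>)"
proof -
  obtain V where V: "open V" "p \<in> V" "open (\<iota> ` V)" "inj_on \<iota> V"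
    and s: "smooth_map_on A std_atlas V \<iota>" and t: "smooth_map_on std_atlas A (\<iota> ` V) (inv_into V \<iota>)"
    using assms unfolding local_diffeomorphism_def by blast
  have 1: "smooth_on (\<phi> ` (U \<inter> V)) (\<iota> \<circ> inv_into U \<phi>)" if "(U, \<phi>) \<in> A" for U \<phi>
    using s that unfolding smooth_map_on_def std_atlas_def by (fastforce simp: comp_def)
  have 2: "smooth_on (\<iota> ` V \<inter> inv_into V \<iota> -` U) (\<phi> \<circ> inv_into V \<iota>)" if "(U, \<phi>) \<in> A" for U \<phi>
    using t that unfolding smooth_map_on_def std_atlas_def by (fastforce simp: comp_def)
  show thesis
    by (rule that[OF V _ _ 1 2]) (use s t in \<open>simp_all add: smooth_map_on_def\<close>)
qed

lemma local_diffeomorphism_imp_dev_map: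
  assumes "local_diffeomorphism A (std_atlas :: (real^'n, real^'n) chart set) (\<iota> :: 'a::t2_space \<Rightarrow> real^'n)"
  shows "dev_map \<iota>"
proof
  fix p
  show "\<exists>U. open U \<and> p \<in> U \<and> open (\<iota> ` U) \<and> inj_on \<iota> U \<and> continuous_on U \<iota> \<and> continuous_on (\<iota> ` U) (inv_into U \<iota>)"
    by (rule local_diffeomorphism_std[OF assms, of p]) blast
qed

sublocale developed_atlas \<subseteq> dev_map \<iota>
  by (rule local_diffeomorphism_imp_dev_map[OF local_diffeo])

context developed_atlas
begin

section \<open>Charts compared with sections of the development map\<close>

lemma chart: "(U, \<phi>) \<in> A \<Longrightarrow> is_chart (U, \<phi>)"
  using manifold unfolding smooth_manifold_def by blast

lemma chart_through:
  obtains U \<phi> where "(U, \<phi>) \<in> A" "p \<in> U" "open U"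
proof -
  have "p \<in> (\<Union>c\<in>A. fst c)" using manifold unfolding smooth_manifold_def by simp
  then obtain U \<phi> where U: "(U, \<phi>) \<in> A" "p \<in> U" by auto
  then show thesis using that chart[OF U(1)] unfolding is_chart_def by auto
qed

lemma smooth_dev_in_chart:
  assumes c: "(U, \<phi>) \<in> A" shows "smooth_on (\<phi> ` U) (\<iota> \<circ> inv_into U \<phi>)"
proof (rule smooth_on_local)
  fix x assume "x \<in> \<phi> ` U"
  then obtain p where p: "p \<in> U" "x = \<phi> p" by blast
  obtain V where V: "open V" "p \<in> V" and s: "\<And>U \<phi>. (U, \<phi>) \<in> A \<Longrightarrow> smooth_on (\<phi> ` (U \<inter> V)) (\<iota> \<circ> inv_into U \<phi>)"
    by (rule local_diffeomorphism_std[OF local_diffeo, of p]) blast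
  show "\<exists>T. open T \<and> x \<in> T \<and> smooth_on T (\<iota> \<circ> inv_into U \<phi>)"
    using chart_open_image[OF chart[OF c] V(1)] p V(2) s[OF c] by blast
qed

text \<open>Near each point a section coincides with the local inverse that the local diffeomorphism
  supplies, and smoothness of the latter in charts is given.\<close>

lemma smooth_section_in_chart:
  assumes c: "(U, \<phi>) \<in> A" and \<tau>: "is_section \<tau> W" and im: "\<tau> ` W \<subseteq> U"
  shows "smooth_on W (\<phi> \<circ> \<tau>)"
proof (rule smooth_on_local)
  fix x assume x: "x \<in> W"
  obtain V where V: "open V" "\<tau> x \<in> V" "inj_on \<iota> V"
    and s: "\<And>U \<phi>. (U, \<phi>) \<in> A \<Longrightarrow> smooth_on (\<iota> ` V \<inter> inv_into V \<iota> -` U) (\<phi> \<circ> inv_into V \<iota>)"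
    by (rule local_diffeomorphism_std[OF local_diffeo, of "\<tau> x"]) blast
  let ?T = "W \<inter> \<tau> -` V"
  have W: "open W" "continuous_on W \<tau>" using \<tau> by (auto simp: is_section_def)
  have T: "open ?T" by (rule continuous_open_preimage[OF W(2,1) V(1)])
  have eq: "inv_into V \<iota> y = \<tau> y" if "y \<in> ?T" for y
    by (rule inv_into_f_eq[OF V(3)]) (use that section_right_inverse[OF \<tau>] in auto)
  have sub: "?T \<subseteq> \<iota> ` V \<inter> inv_into V \<iota> -` U"
  proof
    fix y assume y: "y \<in> ?T"
    then have "y = \<iota> (\<tau> y)" using section_right_inverse[OF \<tau>, of y] by simp
    then have "y \<in> \<iota> ` V" using y by (intro image_eqI[of _ _ "\<tau> y"]) auto
    moreover have "inv_into V \<iota> y \<in> U" unfolding eq[OF y] using im y by auto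
    ultimately show "y \<in> \<iota> ` V \<inter> inv_into V \<iota> -` U" by simp
  qed
  have "smooth_on ?T (\<phi> \<circ> \<tau>)"
    by (rule smooth_on_cong[OF T _ smooth_on_subset[OF s[OF c] sub]]) (simp only: comp_def eq)
  then show "\<exists>T. open T \<and> x \<in> T \<and> smooth_on T (\<phi> \<circ> \<tau>)" using T x V(2) by blast
qed

text \<open>Both transitions, from a section to a chart and from a chart through
  \<open>\<iota>\<close> to a section, are smooth, so the atlas and the sections define the same
  smooth functions.\<close>

lemma smooth_functions_iff: "f \<in> smooth_functions A \<longleftrightarrow> smooth_fun f"
proof
  assume "f \<in> smooth_functions A"
  then have fs: "smooth_on (\<phi> ` U) (f \<circ> inv_into U \<phi>)" if "(U, \<phi>) \<in> A" for U \<phi>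
    using that unfolding smooth_functions_def smooth_map_on_def std_atlas_def by (fastforce simp: comp_def)
  show "smooth_fun f"
  proof (rule smooth_funI)
    fix p
    obtain U \<phi> where c: "(U, \<phi>) \<in> A" "p \<in> U" "open U" by (rule chart_through)
    obtain r \<tau> where r: "r > 0" and \<tau>: "is_section \<tau> (ball (\<iota> p) r)" "\<tau> (\<iota> p) = p" "\<tau> ` ball (\<iota> p) r \<subseteq> U"
      by (rule local_section[OF c(3,2)])
    have opU: "open (\<phi> ` U)" using chart_open_image[OF chart[OF c(1)] open_UNIV] by simp
    have "smooth_on (ball (\<iota> p) r) ((f \<circ> inv_into U \<phi>) \<circ> (\<phi> \<circ> \<tau>))"
      by (rule smooth_on_compose[OF open_ball opU fs[OF c(1)] smooth_section_in_chart[OF c(1) \<tau>(1,3)]]) (use \<tau>(3) in auto)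
    then have "smooth_on (ball (\<iota> p) r) (f \<circ> \<tau>)"
      by (rule smooth_on_cong[OF open_ball, rotated])
        (use \<tau>(3) inv_into_f_f[OF chart_inv_into(1)[OF chart[OF c(1)]]] in \<open>auto simp: image_subset_iff\<close>)
    then show "\<exists>\<tau> W. is_section \<tau> W \<and> \<iota> p \<in> W \<and> \<tau> (\<iota> p) = p \<and> smooth_on W (f \<circ> \<tau>)"
      using \<tau>(1,2) r by (intro exI[of _ \<tau>] exI[of _ "ball (\<iota> p) r"]) simp
  qed
next
  assume f: "smooth_fun f"
  have "smooth_on (\<phi> ` U) (f \<circ> inv_into U \<phi>)" if c: "(U, \<phi>) \<in> A" for U \<phi>
  proof (rule smooth_on_local)
    fix x assume "x \<in> \<phi> ` U"
    then obtain p where p: "p \<in> U" "x = \<phi> p" by blast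
    obtain r \<sigma> where \<sigma>: "r > 0" "is_section \<sigma> (ball (\<iota> p) r)" "\<sigma> (\<iota> p) = p"
      by (rule local_section[OF open_UNIV UNIV_I])
    let ?O = "\<sigma> ` ball (\<iota> p) r"
    have T: "open (\<phi> ` (U \<inter> ?O))" by (rule chart_open_image[OF chart[OF c] section_open_image[OF \<sigma>(2)]])
    have "p \<in> ?O" using \<sigma>(1,3) by (intro image_eqI[of _ _ "\<iota> p"]) simp_all
    then have x: "x \<in> \<phi> ` (U \<inter> ?O)" using p by blast
    note inj = inv_into_f_f[OF chart_inv_into(1)[OF chart[OF c]]]
    have "smooth_on (\<phi> ` (U \<inter> ?O)) ((f \<circ> \<sigma>) \<circ> (\<iota> \<circ> inv_into U \<phi>))"
    proof (rule smooth_on_compose[OF T open_ball])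
      show "smooth_on (ball (\<iota> p) r) (f \<circ> \<sigma>)" using f \<sigma>(2) unfolding smooth_fun_def by blast
      show "smooth_on (\<phi> ` (U \<inter> ?O)) (\<iota> \<circ> inv_into U \<phi>)"
        by (rule smooth_on_subset[OF smooth_dev_in_chart[OF c]]) blast
      show "(\<iota> \<circ> inv_into U \<phi>) ` \<phi> ` (U \<inter> ?O) \<subseteq> ball (\<iota> p) r"
      proof (rule image_subsetI)
        fix y assume "y \<in> \<phi> ` (U \<inter> ?O)"
        then obtain z where z: "z \<in> ball (\<iota> p) r" "\<sigma> z \<in> U" "y = \<phi> (\<sigma> z)" by blast
        show "(\<iota> \<circ> inv_into U \<phi>) y \<in> ball (\<iota> p) r"
          using z(1) unfolding z(3) comp_def inj[OF z(2)] by (simp only: section_right_inverse[OF \<sigma>(2)])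
      qed
    qed
    then have "smooth_on (\<phi> ` (U \<inter> ?O)) (f \<circ> inv_into U \<phi>)"
    proof (rule smooth_on_cong[OF T, rotated])
      fix y assume "y \<in> \<phi> ` (U \<inter> ?O)"
      then obtain z where z: "z \<in> ball (\<iota> p) r" "\<sigma> z \<in> U" "y = \<phi> (\<sigma> z)" by blast
      show "((f \<circ> \<sigma>) \<circ> (\<iota> \<circ> inv_into U \<phi>)) y = (f \<circ> inv_into U \<phi>) y"
        using z(1) unfolding z(3) comp_def inj[OF z(2)] by (simp only: section_right_inverse[OF \<sigma>(2)])
    qed
    then show "\<exists>T. open T \<and> x \<in> T \<and> smooth_on T (f \<circ> inv_into U \<phi>)" using T x by blast
  qed
  then show "f \<in> smooth_functions A"
    using smooth_fun_continuous[OF f]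
    unfolding smooth_functions_def smooth_map_on_def std_atlas_def by (auto simp: comp_def)
qed

lemma bijective_dev_diffeomorphism:
  assumes \<tau>: "is_section \<tau> UNIV" "\<And>p. \<tau> (\<iota> p) = p"
  shows "diffeomorphism A std_atlas \<iota>"
  unfolding diffeomorphism_def
proof (intro conjI)
  note inv = section_right_inverse[OF \<tau>(1) UNIV_I]
  show "bij \<iota>" by (rule bij_betw_byWitness[of _ \<tau>]) (simp_all add: \<tau>(2) inv)
  have eq: "inv \<iota> = \<tau>" by (rule inv_unique_comp) (simp_all add: fun_eq_iff \<tau>(2) inv)
  show "smooth_map_on A std_atlas UNIV \<iota>"
    unfolding smooth_map_on_def std_atlas_def using continuous_dev smooth_dev_in_chart by (auto simp: comp_def)
  have "smooth_on (\<tau> -` U) (\<phi> \<circ> \<tau>)" if c: "(U, \<phi>) \<in> A" for U \<phi>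
  proof (rule smooth_section_in_chart[OF c])
    have "open U" using chart[OF c] by (simp add: is_chart_def)
    moreover have "continuous_on UNIV \<tau>" using \<tau>(1) by (simp add: is_section_def)
    ultimately have "open (\<tau> -` U)" using continuous_on_open_vimage[OF open_UNIV, of \<tau>] by simp
    then show "is_section \<tau> (\<tau> -` U)" by (rule is_section_subset[OF \<tau>(1)]) simp
  qed auto
  then show "smooth_map_on std_atlas A UNIV (inv \<iota>)"
    using \<tau>(1) unfolding smooth_map_on_def std_atlas_def eq by (auto simp: comp_def is_section_def)
qed

section \<open>Tangent vectors and the metric in affine coordinates\<close>

lemma dd_expand:
  assumes "smooth_fun f" shows "dd w f p = (\<Sum>i\<in>UNIV. w $ i * dd (axis i 1) f p)"
proof -
  have "dd w f p = dd (\<Sum>i\<in>UNIV. w $ i *\<^sub>R axis i 1) f p"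
    using basis_expansion[of w] by (simp add: scalar_mult_eq_scaleR)
  also have "\<dots> = (\<Sum>i\<in>UNIV. w $ i * dd (axis i 1) f p)"
    by (simp add: linear_sum[OF linear_dd[OF assms]] linear_scale[OF linear_dd[OF assms]])
  finally show ?thesis .
qed

lemma bilinear_hessian:
  assumes "smooth_fun f" shows "bilinear (\<lambda>a b. dd a (dd b f) p)"
  unfolding bilinear_def
proof (intro conjI allI)
  fix a b
  show "linear (\<lambda>a. dd a (dd b f) p)" by (rule linear_dd[OF smooth_fun_dd[OF assms]])
  show "linear (\<lambda>b. dd a (dd b f) p)"
    unfolding dd_commute[OF assms, of a] by (rule linear_dd[OF smooth_fun_dd[OF assms]])
qed

text \<open>The tangent vector with affine components \<open>w\<close>, set to 0 off smooth
  functions to match the convention of \<open>tangent_space\<close>.\<close>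

definition tvec :: "real^'n \<Rightarrow> 'a \<Rightarrow> 'a tangent" where
  "tvec w p = (\<lambda>f. if f \<in> smooth_functions A then dd w f p else 0)"

lemma coord_field_tvec: "coord_field A \<iota> i p = tvec (axis i 1) p"
  unfolding coord_field_def tvec_def partial_deriv_dd ..

lemma tvec_tangent: "tvec w p \<in> tangent_space A p"
  unfolding tangent_space_def tvec_def smooth_functions_iff mem_Collect_eq
proof (intro conjI ballI allI impI)
  fix f h and c :: real
  assume "f \<in> smooth_functions A" then have f: "smooth_fun f" by (simp add: smooth_functions_iff)
  have "smooth_fun (\<lambda>q. c * f q)" by (intro smooth_fun_mult smooth_fun_const f)
  then show "(if smooth_fun (\<lambda>q. c * f q) then dd w (\<lambda>q. c * f q) p else 0) = c * (if smooth_fun f then dd w f p else 0)"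
    using f by (simp add: dd_cmult)
  assume "h \<in> smooth_functions A" then have h: "smooth_fun h" by (simp add: smooth_functions_iff)
  show "(if smooth_fun (\<lambda>q. f q + h q) then dd w (\<lambda>q. f q + h q) p else 0) =
      (if smooth_fun f then dd w f p else 0) + (if smooth_fun h then dd w h p else 0)"
    using f h by (simp add: smooth_fun_add dd_add)
  show "(if smooth_fun (\<lambda>q. f q * h q) then dd w (\<lambda>q. f q * h q) p else 0) =
      f p * (if smooth_fun h then dd w h p else 0) + h p * (if smooth_fun f then dd w f p else 0)"
    using f h by (simp add: smooth_fun_mult dd_mult)
qed simp

lemma tvec_add: "tvec (a + b) p = (\<lambda>f. tvec a p f + tvec b p f)"
  by (auto simp: tvec_def fun_eq_iff smooth_functions_iff dd_dir_add)

lemma tvec_scale: "tvec (c *\<^sub>R a) p = (\<lambda>f. c * tvec a p f)"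
  by (auto simp: tvec_def fun_eq_iff smooth_functions_iff dd_dir_scale)

lemma coord_smooth: "(\<lambda>p. \<iota> p $ i) \<in> smooth_functions A"
  unfolding smooth_functions_iff by (rule smooth_fun_linear[OF bounded_linear_vec_nth])

lemma tvec_coord: "tvec w p (\<lambda>p. \<iota> p $ i) = w $ i"
  using dd_linear_coord[OF bounded_linear_vec_nth] by (simp add: tvec_def coord_smooth)

text \<open>The potential determines the metric on coordinate fields, and bilinearity of both sides
  extends this to all parallel directions; the order of the two derivatives is adjusted by
  \<open>dd_commute\<close>.\<close>

lemma metric_is_hessian:
  assumes g: "riemannian_metric A g" and pot: "hessian_potential A \<iota> g u"
  shows "g p (tvec a p) (tvec b p) = dd a (dd b u) p"
proof -
  have u: "smooth_fun u" using pot by (simp add: hessian_potential_def smooth_functions_iff)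
  have g': "\<forall>v\<in>tangent_space A p. (v \<noteq> (\<lambda>_. 0) \<longrightarrow> g p v v > 0) \<and>
        (\<forall>w\<in>tangent_space A p. g p v w = g p w v \<and>
           (\<forall>z\<in>tangent_space A p. g p (\<lambda>f. v f + w f) z = g p v z + g p w z) \<and>
           (\<forall>c. g p (\<lambda>f. c * v f) w = c * g p v w))"
    using g unfolding riemannian_metric_def by simp
  have sym: "g p v w = g p w v" and scale: "g p (\<lambda>f. c * v f) w = c * g p v w"
    if "v \<in> tangent_space A p" "w \<in> tangent_space A p" for v w c
    using g' that by blast+
  have add: "g p (\<lambda>f. v f + w f) z = g p v z + g p w z"
    if "v \<in> tangent_space A p" "w \<in> tangent_space A p" "z \<in> tangent_space A p" for v w z
    using g' that by blast
  have l: "linear (\<lambda>a. g p (tvec a p) (tvec b p))" for b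
    by (rule linearI) (simp_all add: tvec_add tvec_scale add scale tvec_tangent)
  moreover have "linear (\<lambda>b. g p (tvec a p) (tvec b p))" for a
    using l[of a] by (simp only: sym[OF tvec_tangent[of a] tvec_tangent])
  ultimately have b: "bilinear (\<lambda>a b. g p (tvec a p) (tvec b p))" unfolding bilinear_def by blast
  have "(\<lambda>a b. g p (tvec a p) (tvec b p)) = (\<lambda>a b. dd a (dd b u) p)"
  proof (rule bilinear_eq_stdbasis[OF b bilinear_hessian[OF u]])
    fix a b :: "real^'n" assume "a \<in> Basis" "b \<in> Basis"
    then obtain i j where ij: "a = axis i 1" "b = axis j 1" by (auto simp: Basis_vec_def)
    have "g p (coord_field A \<iota> i p) (coord_field A \<iota> j p) = hessian_matrix \<iota> u p $ i $ j"
      using pot by (simp add: hessian_potential_def)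
    then have "g p (tvec a p) (tvec b p) = dd b (dd a u) p"
      unfolding coord_field_tvec hessian_matrix_def partial_deriv_dd ij by simp
    then show "g p (tvec a p) (tvec b p) = dd a (dd b u) p" unfolding dd_commute[OF u, of a] .
  qed
  then show ?thesis by (rule fun_cong[THEN fun_cong])
qed

text \<open>Positivity of the Hessian is inherited from the metric, because \<open>tvec a p\<close>
  is nonzero for \<open>a \<noteq> 0\<close>: the coordinates recover its components.\<close>

lemma hessian_manifold_of_metric:
  assumes g: "riemannian_metric A g" and pot: "hessian_potential A \<iota> g u" and conn: "connected (UNIV :: 'a set)"
  shows "hessian_manifold \<iota> u A g"
proof -
  have u: "smooth_fun u" using pot by (simp add: hessian_potential_def smooth_functions_iff)
  note gh = metric_is_hessian[OF g pot]
  have pos: "dd a (dd a u) p > 0" if a: "a \<noteq> 0" for a p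
  proof -
    obtain i where "a $ i \<noteq> 0" using a by (auto simp: vec_eq_iff)
    then have "tvec a p \<noteq> (\<lambda>_. 0)" using fun_cong[of "tvec a p" "\<lambda>_. 0" "\<lambda>p. \<iota> p $ i"] tvec_coord[of a p i] by force
    with g[unfolded riemannian_metric_def, THEN conjunct1, rule_format, OF tvec_tangent[of a p], THEN conjunct1]
    have "g p (tvec a p) (tvec a p) > 0" by simp
    then show ?thesis by (simp add: gh)
  qed
  interpret h: hessian_potential_locale \<iota> u
    by (intro hessian_potential_locale.intro hessian_potential_locale_axioms.intro dev_map_axioms u pos)
  show ?thesis
  proof (intro hessian_manifold.intro hessian_manifold_axioms.intro)
    show "hessian_potential_locale \<iota> u" by (rule h.hessian_potential_locale_axioms)
    show "smooth_fun f" if "f \<in> smooth_functions A" for f using that by (simp add: smooth_functions_iff)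
    show "(\<lambda>p. \<iota> p $ i) \<in> smooth_functions A" for i by (rule coord_smooth)
    show "g p (\<lambda>f. if f \<in> smooth_functions A then dd w f p else 0)
      (\<lambda>f. if f \<in> smooth_functions A then dd w f p else 0) = h.G p w w" for p w
      using gh[of p w w] unfolding tvec_def h.G_def .
    show "connected (UNIV :: 'a set)" by (rule conn)
  qed
qed

text \<open>The global inverse \<open>\<tau>\<close> transports a derivation to Euclidean space,
  where Hadamard's expansion identifies it by its components.\<close>

lemma tangent_tvec:
  assumes \<tau>: "is_section \<tau> UNIV" "\<And>p. \<tau> (\<iota> p) = p" and v: "v \<in> tangent_space A p"
  shows "v = tvec (\<chi> i. v (\<lambda>p. \<iota> p $ i)) p"
proof
  fix f
  have comp: "f \<circ> \<iota> \<in> smooth_functions A" if "smooth_on UNIV f" for f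
    unfolding smooth_functions_iff smooth_fun_def
  proof (intro allI impI)
    fix \<sigma> W assume s: "is_section \<sigma> W"
    have "open W" using s by (simp add: is_section_def)
    from smooth_on_cong[OF this _ smooth_on_subset[OF that subset_UNIV], of "f \<circ> \<iota> \<circ> \<sigma>"]
    show "smooth_on W (f \<circ> \<iota> \<circ> \<sigma>)" using section_right_inverse[OF s] by simp
  qed
  have t: "pushforward std_atlas \<iota> v \<in> std_tangent (\<iota> p)"
  proof (rule std_tangentI)
    note V = v[unfolded tangent_space_def mem_Collect_eq]
    fix f h :: "real^'n \<Rightarrow> real" and c :: real
    show "pushforward std_atlas \<iota> v f = 0" if "\<not> smooth_on UNIV f"
      using that by (simp add: pushforward_def smooth_functions_std)
    assume f: "smooth_on UNIV f"
    show "pushforward std_atlas \<iota> v (\<lambda>q. c * f q) = c * pushforward std_atlas \<iota> v f"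
      using f smooth_on_mult[OF open_UNIV smooth_on_const f, of c] V comp[OF f]
      by (simp add: pushforward_def smooth_functions_std comp_def)
    assume h: "smooth_on UNIV h"
    show "pushforward std_atlas \<iota> v (\<lambda>q. f q + h q) = pushforward std_atlas \<iota> v f + pushforward std_atlas \<iota> v h"
      using f h smooth_on_add[OF open_UNIV f h] V comp[OF f] comp[OF h]
      by (simp add: pushforward_def smooth_functions_std comp_def)
    show "pushforward std_atlas \<iota> v (\<lambda>q. f q * h q) =
        f (\<iota> p) * pushforward std_atlas \<iota> v h + h (\<iota> p) * pushforward std_atlas \<iota> v f"
      using f h smooth_on_mult[OF open_UNIV f h] V comp[OF f] comp[OF h]
      by (simp add: pushforward_def smooth_functions_std comp_def)
  qed
  show "v f = tvec (\<chi> i. v (\<lambda>p. \<iota> p $ i)) p f"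
  proof (cases "smooth_fun f")
    case True
    have sf: "smooth_on UNIV (f \<circ> \<tau>)" using True \<tau>(1) unfolding smooth_fun_def by blast
    have "v f = pushforward std_atlas \<iota> v (f \<circ> \<tau>)"
      using sf by (simp add: pushforward_def smooth_functions_std comp_def \<tau>(2))
    also have "\<dots> = (\<Sum>i\<in>UNIV. v (\<lambda>p. \<iota> p $ i) * frechet_derivative (f \<circ> \<tau>) (at (\<iota> p)) (axis i 1))"
      unfolding std_tangent_rep[OF t sf] by (simp add: pushforward_def smooth_functions_std smooth_coord comp_def)
    also have "\<dots> = dd (\<chi> i. v (\<lambda>p. \<iota> p $ i)) f p"
    proof -
      have "dd w f p = frechet_derivative (f \<circ> \<tau>) (at (\<iota> p)) w" for w
        using dd_section[OF \<tau>(1) UNIV_I, of w f "\<iota> p"] by (simp only: \<tau>(2))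
      then show ?thesis using dd_expand[OF True, of "\<chi> i. v (\<lambda>p. \<iota> p $ i)" p] by simp
    qed
    finally show ?thesis using True by (simp add: tvec_def smooth_functions_iff)
  next
    case False
    then show ?thesis using v by (simp add: tvec_def tangent_space_def smooth_functions_iff)
  qed
qed

end

lemma (in hessian_potential_locale) G_expand:
  "G p x y = (\<Sum>i\<in>UNIV. \<Sum>j\<in>UNIV. G p (axis i 1) (axis j 1) * (x $ i * y $ j))"
proof -
  have "G p x y = G p (\<Sum>i\<in>UNIV. x $ i *\<^sub>R axis i 1) (\<Sum>j\<in>UNIV. y $ j *\<^sub>R axis j 1)"
    using basis_expansion[of x] basis_expansion[of y] by (simp add: scalar_mult_eq_scaleR)
  also have "\<dots> = (\<Sum>(i, j)\<in>UNIV \<times> UNIV. G p (x $ i *\<^sub>R axis i 1) (y $ j *\<^sub>R axis j 1))"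
    by (rule bilinear_sum[OF bilinear_G])
  also have "\<dots> = (\<Sum>i\<in>UNIV. \<Sum>j\<in>UNIV. G p (axis i 1) (axis j 1) * (x $ i * y $ j))"
    unfolding sum.cartesian_product[symmetric]
    by (simp add: bilinear_lmul[OF bilinear_G] bilinear_rmul[OF bilinear_G] mult_ac)
  finally show ?thesis .
qed

section \<open>Euclidean space in its own coordinates, and the conclusion\<close>

lemma dev_map_id: "dev_map (\<lambda>x :: real^'n. x)"
proof
  fix p :: "real^'n"
  show "\<exists>U. open U \<and> p \<in> U \<and> open ((\<lambda>x. x) ` U) \<and> inj_on (\<lambda>x. x) U \<and> continuous_on U (\<lambda>x. x) \<and>
      continuous_on ((\<lambda>x. x) ` U) (inv_into U (\<lambda>x. x))"
    by (rule exI[of _ UNIV]) simp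
qed

lemma partial_deriv_id: "partial_deriv (\<lambda>x :: real^'n. x) i f p = frechet_derivative f (at p) (axis i 1)"
proof -
  interpret S: dev_map "\<lambda>x :: real^'n. x" by (rule dev_map_id)
  have "S.is_section (\<lambda>x. x) UNIV" by (simp add: S.is_section_def)
  from S.dd_section[OF this UNIV_I, of "axis i 1" f p] show ?thesis
    by (simp add: S.partial_deriv_dd comp_def)
qed

lemma hessian_potential_std:
  fixes a :: "real^'n^'n" and w :: "real^'n \<Rightarrow> real"
  assumes w: "smooth_on UNIV w"
    and a: "\<And>x i j. frechet_derivative (\<lambda>y. frechet_derivative w (at y) (axis i 1)) (at x) (axis j 1) = a $ i $ j"
  shows "hessian_potential std_atlas (\<lambda>x. x) (const_metric a) w"
  unfolding hessian_potential_def
proof (intro conjI allI)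
  show "w \<in> smooth_functions std_atlas" using w by (simp add: smooth_functions_std)
  fix p :: "real^'n" and i j
  have pd: "partial_deriv (\<lambda>x. x) i w = (\<lambda>y. frechet_derivative w (at y) (axis i 1))" for i
    by (rule ext) (rule partial_deriv_id)
  have cf: "coord_field std_atlas (\<lambda>x. x) k p = std_coord_field k p" for k
    unfolding coord_field_def std_coord_field_def partial_deriv_id ..
  have "const_metric a p (std_coord_field i p) (std_coord_field j p) = a $ i $ j"
  proof -
    have "const_metric a p (std_coord_field i p) (std_coord_field j p) =
        (\<Sum>k\<in>UNIV. \<Sum>l\<in>UNIV. if k = i then (if l = j then a $ k $ l else 0) else 0)"
      unfolding const_metric_def std_coord_field_coord by (intro sum.cong refl) auto
    moreover have "(\<Sum>l\<in>UNIV. if k = i then (if l = j then a $ k $ l else 0) else 0) = (if k = i then a $ k $ j else 0)" for k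
      by simp
    ultimately show ?thesis by simp
  qed
  then show "const_metric a p (coord_field std_atlas (\<lambda>x. x) i p) (coord_field std_atlas (\<lambda>x. x) j p) =
      hessian_matrix (\<lambda>x. x) w p $ i $ j"
    unfolding cf hessian_matrix_def pd by (simp add: partial_deriv_id a)
qed

text \<open>Any two loops are freely homotopic here; for two constant loops such a homotopy traces a
  path between their points.\<close>

lemma simply_connected_space_connected:
  assumes "simply_connected (UNIV :: 'a::topological_space set)" shows "connected (UNIV :: 'a set)"
proof -
  have "path_component UNIV x y" for x y :: 'a
  proof -
    have "homotopic_loops UNIV (\<lambda>_. x) (\<lambda>_. y)"
      using assms by (simp add: simply_connected_def path_def pathstart_def pathfinish_def)
    from homotopic_loops_imp_path_component_value[OF this, of 0] show ?thesis by simp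
  qed
  then have "path_connected (UNIV :: 'a set)" by (simp add: path_connected_component)
  then show ?thesis by (rule path_connected_imp_connected)
qed

theorem theorem4p8:
  fixes A :: "('a::{t2_space,second_countable_topology}, real^'n) chart set"
    and D :: "'a conn"
    and \<iota> :: "'a \<Rightarrow> real^'n"
    and g :: "'a metric_tensor"
    and u :: "'a \<Rightarrow> real"
    and \<xi> v :: "real^'n"
    and c :: real
  assumes "affine_manifold A D"
    and "simply_connected (UNIV :: 'a set)"
    and "development_map A D \<iota>"
    and "riemannian_metric A g"
    and "hessian_potential A \<iota> g u"
    and "\<And>p. ln (det (hessian_matrix \<iota> u p)) =
           - (\<Sum>j\<in>UNIV. v $ j * \<iota> p $ j) + (\<Sum>i\<in>UNIV. partial_deriv \<iota> i u p * \<xi> $ i) + c"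
    and "riemannian_complete A g"
  shows "diffeomorphism A std_atlas \<iota> \<and>
    (\<exists>(a :: real^'n^'n) (b :: real^'n) (k :: real). \<forall>p.
       u p = (\<Sum>i\<in>UNIV. \<Sum>j\<in>UNIV. a $ i $ j * \<iota> p $ i * \<iota> p $ j)
             + (\<Sum>i\<in>UNIV. b $ i * \<iota> p $ i) + k) \<and>
    (\<exists>(h :: (real^'n) metric_tensor) F.
       riemannian_metric std_atlas h \<and> flat_metric std_atlas h \<and>
       (\<exists>w. hessian_potential std_atlas (\<lambda>x. x) h w) \<and>
       hessian_equivalence A D g std_atlas std_connection h F)"
proof -
  interpret developed_atlas A \<iota>
    using assms(1,3) by (intro developed_atlas.intro) (simp_all add: affine_manifold_def development_map_def)
  have conn: "connected (UNIV :: 'a set)" using assms(2) by (rule simply_connected_space_connected)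
  note gh = metric_is_hessian[OF assms(4,5)]
  interpret M: hessian_manifold \<iota> u A g by (rule hessian_manifold_of_metric[OF assms(4,5) conn])
  \<comment> \<open>\<open>hessian_matrix\<close> and \<open>G\<close> take the two derivatives in
    opposite orders, hence the use of symmetry.\<close>
  have hm: "hessian_matrix \<iota> u p = (\<chi> i j. M.G p (axis i 1) (axis j 1))" for p
    unfolding hessian_matrix_def partial_deriv_dd M.G_def[symmetric] by (subst M.G_sym) (rule refl)
  have ma: "ln (det (\<chi> i j. M.G p (axis i 1) (axis j 1))) = - (v \<bullet> \<iota> p) + dd \<xi> u p + c" for p
    using assms(6)[of p] dd_expand[OF M.smooth_u, of \<xi> p]
    by (simp add: hm inner_vec_def partial_deriv_dd mult.commute)
  have "complete_hessian \<iota> u (riemannian_dist A g)" by (rule M.complete_hessian_riemannian_dist[OF assms(7)])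
  moreover have "monge_ampere \<iota> u \<xi> v c"
    by (intro monge_ampere.intro monge_ampere_axioms.intro M.hessian_potential_locale_axioms ma)
  ultimately interpret K: complete_monge_ampere \<iota> u \<xi> v c "riemannian_dist A g"
    by (intro complete_monge_ampere.intro)
  obtain \<tau> where "is_section \<tau> UNIV \<and> (\<forall>p. \<tau> (\<iota> p) = p)"
    using K.global_section_of_lam_zero[OF K.lam_zero conn] by (rule exE)
  then have \<tau>: "is_section \<tau> UNIV" "\<And>p. \<tau> (\<iota> p) = p" by (rule conjunct1, rule conjunct2[THEN spec])
  note quad = K.quadratic_of_lam_zero[OF K.lam_zero \<tau>]
  \<comment> \<open>The constant Hessian, read at the point over the origin. The polynomial for
    \<open>u\<close> has \<open>a / 2\<close> as its quadratic part, while the flat metric on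
    Euclidean space uses \<open>a\<close> itself.\<close>
  define a :: "real^'n^'n" where "a = (\<chi> i j. M.G (\<tau> 0) (axis i 1) (axis j 1))"
  have aG: "M.G p x y = (\<Sum>i\<in>UNIV. \<Sum>j\<in>UNIV. a $ i $ j * (x $ i * y $ j))" for p x y
    using M.G_expand[of "\<tau> 0" x y] quad(1)[of p x y] by (simp add: a_def)
  have diff: "diffeomorphism A std_atlas \<iota>" by (rule bijective_dev_diffeomorphism[OF \<tau>])
  have u_eq: "u p = (\<Sum>i\<in>UNIV. \<Sum>j\<in>UNIV. (a $ i $ j / 2) * \<iota> p $ i * \<iota> p $ j)
      + (\<Sum>i\<in>UNIV. dd (axis i 1) u (\<tau> 0) * \<iota> p $ i) + u (\<tau> 0)" for p
    unfolding quad(2)[of p] aG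
    by (simp add: dd_expand[OF M.smooth_u, of "\<iota> p"] sum_divide_distrib mult_ac)
  have "\<exists>(a :: real^'n^'n) (b :: real^'n) (k :: real). \<forall>p.
      u p = (\<Sum>i\<in>UNIV. \<Sum>j\<in>UNIV. a $ i $ j * \<iota> p $ i * \<iota> p $ j) + (\<Sum>i\<in>UNIV. b $ i * \<iota> p $ i) + k"
    by (intro exI[of _ "\<chi> i j. a $ i $ j / 2"] exI[of _ "\<chi> i. dd (axis i 1) u (\<tau> 0)"] exI[of _ "u (\<tau> 0)"] allI)
      (simp only: vec_lambda_beta, rule u_eq)
  moreover have "riemannian_metric std_atlas (const_metric a)"
  proof (rule const_metric_riemannian)
    show "a $ i $ j = a $ j $ i" for i j unfolding a_def vec_lambda_beta by (rule M.G_sym)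
    show "(\<Sum>i\<in>UNIV. \<Sum>j\<in>UNIV. a $ i $ j * (x $ i * x $ j)) > 0" if "x \<noteq> 0" for x :: "real^'n"
      using M.G_pos[OF that, of "\<tau> 0"] unfolding aG .
  qed
  \<comment> \<open>The potential of the flat metric is \<open>u\<close> transported to the global
    coordinates.\<close>
  moreover have "hessian_potential std_atlas (\<lambda>x. x) (const_metric a) (u \<circ> \<tau>)"
  proof (rule hessian_potential_std)
    show "smooth_on UNIV (u \<circ> \<tau>)" using M.smooth_u \<tau>(1) unfolding smooth_fun_def by blast
    fix x :: "real^'n" and i j
    have fd: "frechet_derivative (f \<circ> \<tau>) (at y) b = dd b f (\<tau> y)" for f y b
      by (rule dd_section[OF \<tau>(1) UNIV_I, symmetric])
    have "(\<lambda>y. frechet_derivative (u \<circ> \<tau>) (at y) (axis i 1)) = dd (axis i 1) u \<circ> \<tau>"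
      by (rule ext) (simp only: fd comp_def[of "dd (axis i 1) u"])
    then have "frechet_derivative (\<lambda>y. frechet_derivative (u \<circ> \<tau>) (at y) (axis i 1)) (at x) (axis j 1) =
        M.G (\<tau> x) (axis j 1) (axis i 1)" by (simp only: fd M.G_def)
    also have "\<dots> = a $ i $ j" unfolding M.G_sym[of _ "axis j 1"] using quad(1)[of "\<tau> x"] by (simp add: a_def)
    finally show "frechet_derivative (\<lambda>y. frechet_derivative (u \<circ> \<tau>) (at y) (axis i 1)) (at x) (axis j 1) = a $ i $ j" .
  qed
  \<comment> \<open>The equivalence is \<open>\<iota>\<close> itself. Preservation of the connection
    is part of being a development map, and for the metrics both sides are the form \<open>a\<close>
    on the affine components of the two vectors.\<close>
  moreover have "hessian_equivalence A D g std_atlas std_connection (const_metric a) \<iota>"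
    unfolding hessian_equivalence_def
  proof (intro conjI allI ballI diff)
    show "is_pullback_connection A std_atlas \<iota> D std_connection" using assms(3) by (simp add: development_map_def)
    fix p x y assume x: "x \<in> tangent_space A p" and y: "y \<in> tangent_space A p"
    define X Y :: "real^'n" where "X = (\<chi> i. x (\<lambda>p. \<iota> p $ i))" and "Y = (\<chi> i. y (\<lambda>p. \<iota> p $ i))"
    have "g p x y = M.G p X Y"
      using gh[of p X Y] tangent_tvec[OF \<tau> x] tangent_tvec[OF \<tau> y] by (simp only: X_def Y_def M.G_def)
    also have "\<dots> = const_metric a (\<iota> p) (pushforward std_atlas \<iota> x) (pushforward std_atlas \<iota> y)"
      unfolding aG const_metric_def X_def Y_def
      by (simp add: pushforward_def smooth_functions_std smooth_coord comp_def)
    finally show "g p x y = const_metric a (\<iota> p) (pushforward std_atlas \<iota> x) (pushforward std_atlas \<iota> y)" .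
  qed
  ultimately show ?thesis using diff const_metric_flat[of a] by blast
qed

end
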